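(* Every subcubic graph has slope parameter at most five. Moreover, this can be realized by a straight-line drawing in which no three vertices are collinear and every edge has one of the five basic slopes $i\pi/5$, $0\le i\le 4$; i.e., there is a set $P$ of points, no three collinear, such that $G$ is isomorphic to $G(P,\{i\pi/5:0\le i\le 4\})$.
   Context: A graph is cubic if every vertex has degree at most three, and subcubic if it is cubic and each of its connected components has a vertex of degree less than three. The slope of a line is the angle mod $\pi$ by which a counterclockwise rotation takes the $x$-axis parallel to it. For a point set $P$ and a set $\Sigma$ of slopes, $G(P,\Sigma)$ is the graph on $P$ in which $p,q$ are adjacent iff the slope of line $pq$ lies in $\Sigma$. The slope parameter of $G$ is the minimum $|\Sigma|$ over all $\Sigma$ and $P$ with $G\cong G(P,\Sigma)$. *)

theory Defs
  imports
    "HOL-Analysis.Analysis"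
    "HOL-Library.Extended_Nat"
    "Graph_Theory.Graph_Theory"
begin

(* A finite simple undirected graph is a pair_graph: a finite, loop-free, symmetric digraph
   without parallel arcs.  Each edge is a pair of opposite arcs, so the degree of a vertex is
   its out-degree, and the connected components are the strongly connected ones. *)

definition cubic :: "'a pair_pre_digraph \<Rightarrow> bool" where
  "cubic G \<longleftrightarrow> pair_graph G \<and> (\<forall>v \<in> pverts G. out_degree G v \<le> 3)"

definition subcubic :: "'a pair_pre_digraph \<Rightarrow> bool" where
  "subcubic G \<longleftrightarrow> cubic G \<and>
     (\<forall>C \<in> pre_digraph.sccs (with_proj G). \<exists>v \<in> verts C. out_degree G v < 3)"

(* The plane is the complex plane: the real line is the x-axis, and multiplication by cis t is
   the counterclockwise rotation by t.  Angles mod pi are represented in {0..<pi}. *)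
definition slope :: "complex set \<Rightarrow> real" where
  "slope L = (THE t. t \<in> {0..<pi} \<and> affine_parallel ((\<lambda>z. cis t * z) ` \<real>) L)"

definition slope_graph :: "complex set \<Rightarrow> real set \<Rightarrow> complex pair_pre_digraph" where
  "slope_graph P S =
     \<lparr> pverts = P,
       parcs = {(p, q). p \<in> P \<and> q \<in> P \<and> p \<noteq> q \<and> slope (affine hull {p, q}) \<in> S} \<rparr>"

(* An infimum in enat is attained unless the set is empty, in which case it is infinity. *)
definition slope_parameter :: "'a pair_pre_digraph \<Rightarrow> enat" where
  "slope_parameter G =
     Inf {enat (card S) | S. finite S \<and> S \<subseteq> {0..<pi} \<and> (\<exists>P. digraph_iso G (slope_graph P S))}"

definition no_three_collinear :: "complex set \<Rightarrow> bool" where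
  "no_three_collinear P \<longleftrightarrow>
     (\<forall>p \<in> P. \<forall>q \<in> P. \<forall>r \<in> P. distinct [p, q, r] \<longrightarrow> \<not> collinear {p, q, r})"

end

(* The drawing is built by induction on the number of vertices, keeping the coordinates as
   independent over the ring of numbers a + b phi (phi the golden ratio) as the edges allow.  The
   ratios of the basic directions lie in that ring, so accidental incidences become linear relations
   over it, and a generic real parameter avoids the relations that are not forced by the graph.
   If at most one edge joins two parts, they are drawn separately and put together with generic scale
   and shift.  Otherwise a shortest path between two vertices of degree two is removed, the rest is
   drawn, and the path is inserted as a polygon with one degree of freedom; the slopes are chosen so
   that the velocities of its vertices are phi^k times basic directions, and comparing their sizes
   rules out all incidences.  If only one vertex of degree two is left, a minimal set with two
   outgoing edges is drawn with both edges extended to a common point, and is then glued there. *)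
theory Submission
  imports Defs
begin

text \<open>The inserted path has n + 1 new vertices and 2n + 1 edges, so a single real parameter X
  remains, and every unwanted incidence is a polynomial in X of degree at most two, harmless unless
  it vanishes identically. The velocities grow by the factor phi along the path; for incidences of
  several new vertices a comparison of sizes shows that the leading coefficient vanishes only if
  their velocities are parallel, and then their indices differ by at least three. For a collinear
  triple the next coefficient is a relation over Z[phi] between three heights of the smaller
  drawing. So the induction has to carry the absence of these relations (\<open>separated\<close>),
  and this property has to reproduce itself. The relation is not symmetric in its first two
  vertices; it is therefore asked only for the pairs of a set R that on vertices of degree two never
  contains a pair in both orders, and each path is run in the direction that R permits. The
  coordinates cannot stay fully independent, since three heights of one point are always dependent.
  What survives is that a relation must fill every slot of a whole union of components
  (\<open>indep\<close>).\<close>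

definition phi :: real where "phi = 2 * cos (pi/5)"

lemma sin_pi5_pos: "sin (pi/5) > 0"
  by (rule sin_gt_zero) auto

lemma phi_pos: "phi > 0"
  unfolding phi_def by (simp add: cos_gt_zero)

text \<open>For x = \<pi>/5 the angles 3x and 2x add up to \<pi>, so their sines agree; dividing by
  sin x leaves the quadratic equation for 2 cos x.\<close>

lemma phi_sq: "phi * phi = phi + 1"
proof -
  define c s where "c = cos (pi/5)" and "s = sin (pi/5)"
  have s: "s > 0" and c: "c > 0" using sin_pi5_pos phi_pos by (auto simp: s_def c_def phi_def)
  have "sin (3 * (pi/5)) = sin (2 * (pi/5))"
    using sin_pi_minus[of "2*(pi/5)"] by (simp add: field_simps)
  moreover have "sin (3 * (pi/5)) = s * (4 * c^2 - 1)"
  proof -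
    have "sin (3 * (pi/5)) = sin (2 * (pi/5) + pi/5)" by (simp add: field_simps)
    also have "\<dots> = 2 * s * c * c + (2 * c^2 - 1) * s"
      by (simp only: sin_add sin_double cos_double_cos s_def c_def)
    finally show ?thesis by (simp add: algebra_simps power2_eq_square)
  qed
  moreover have "sin (2 * (pi/5)) = s * (2 * c)"
    by (simp only: sin_double s_def c_def)
  ultimately have "4 * c^2 - 1 = 2 * c" using s by auto
  then show ?thesis by (simp add: phi_def c_def power2_eq_square algebra_simps)
qed

lemma phi_lower: "phi > 1.618" and phi_upper: "phi < 1.6181"
proof -
  have "(phi - 1.618) * (phi + 0.618) > 0" using phi_sq by (simp add: algebra_simps)
  then show "phi > 1.618" using phi_pos by (simp add: zero_less_mult_iff)
  show "phi < 1.6181"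
  proof (rule ccontr)
    assume "\<not> phi < 1.6181"
    then have "phi * phi \<ge> 1.6181 * phi" by simp
    then have "0.6181 * phi \<le> 1" using phi_sq by (simp add: algebra_simps)
    then show False using \<open>\<not> phi < 1.6181\<close> by simp
  qed
qed

section \<open>Heights in the five basic directions\<close>

definition sn :: "int \<Rightarrow> real" where "sn k = sin (real_of_int k * pi / 5) / sin (pi/5)"
definition dir :: "int \<Rightarrow> complex" where "dir k = cis (real_of_int k * pi / 5)"
text \<open>Signed distance of z from the line through 0 in direction k, in units of sin (\<pi>/5).
  Two points span a line of slope k \<pi>/5 iff these heights agree. In this unit the basic
  directions have heights 0, 1, phi up to sign only.\<close>

definition ht :: "int \<Rightarrow> complex \<Rightarrow> real" where
  "ht k z = Im (z * cis (- (real_of_int k * pi / 5))) / sin (pi/5)"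

lemma ht_add: "ht k (z + w) = ht k z + ht k w"
  and ht_diff: "ht k (z - w) = ht k z - ht k w"
  and ht_scale: "ht k (of_real r * z) = r * ht k z"
  and ht_minus: "ht k (- z) = - ht k z"
  and ht_0: "ht k 0 = 0"
  using sin_pi5_pos
  by (auto simp: ht_def algebra_simps add_divide_distrib diff_divide_distrib)

lemmas ht_linear = ht_add ht_diff ht_scale ht_minus ht_0

lemma ht_dir: "ht k (dir j) = sn (j - k)"
  by (simp add: ht_def dir_def sn_def sin_diff ring_distribs diff_divide_distrib)

text \<open>Three linear functionals on the plane are dependent; for three heights the coefficients
  are the sines of the differences of the other two angles, as in a Pluecker relation.\<close>

lemma sn_plucker: "sn (b - a) * ht k z = sn (b - k) * ht a z + sn (k - a) * ht b z"
proof -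
  define A B K where "A = real_of_int a * pi / 5" and "B = real_of_int b * pi / 5" and "K = real_of_int k * pi / 5"
  have e: "sn (b - a) = sin (B - A) / sin (pi/5)" "sn (b - k) = sin (B - K) / sin (pi/5)"
      "sn (k - a) = sin (K - A) / sin (pi/5)"
    by (simp_all add: sn_def A_def B_def K_def ring_distribs diff_divide_distrib)
  have e2: "ht k z = (Im z * cos K - Re z * sin K) / sin (pi/5)"
     "ht a z = (Im z * cos A - Re z * sin A) / sin (pi/5)"
     "ht b z = (Im z * cos B - Re z * sin B) / sin (pi/5)"
    by (simp_all add: ht_def A_def B_def K_def algebra_simps)
  have "sin (B - A) * (Im z * cos K - Re z * sin K)
      = sin (B - K) * (Im z * cos A - Re z * sin A) + sin (K - A) * (Im z * cos B - Re z * sin B)"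
  proof -
    have "sin (B - A) * cos K = sin (B - K) * cos A + sin (K - A) * cos B"
      by (simp add: sin_diff algebra_simps)
    moreover have "sin (B - A) * sin K = sin (B - K) * sin A + sin (K - A) * sin B"
      by (simp add: sin_diff algebra_simps)
    ultimately show ?thesis by algebra
  qed
  then show ?thesis unfolding e e2 by (simp only: times_divide_times_eq add_divide_distrib[symmetric])
qed

lemma sn_minus: "sn (- k) = - sn k" by (simp add: sn_def)
lemma sn_0: "sn 0 = 0" by (simp add: sn_def)
lemma sn_1: "sn 1 = 1" using sin_pi5_pos by (simp add: sn_def)
lemma sn_2: "sn 2 = phi"
  using sin_pi5_pos sin_double[of "pi/5"] by (simp add: sn_def phi_def)
lemma sn_add5: "sn (k + 5) = - sn k"
proof -
  have "real_of_int (k + 5) * pi / 5 = real_of_int k * pi / 5 + pi" by (simp add: field_simps)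
  then show ?thesis unfolding sn_def by (simp only: sin_periodic_pi minus_divide_left)
qed
lemma sn_3: "sn 3 = phi" using sn_add5[of "-2"] by (simp add: sn_minus sn_2)
lemma sn_4: "sn 4 = 1" using sn_add5[of "-1"] by (simp add: sn_minus sn_1)

lemma abs_sn_mod: "\<bar>sn k\<bar> = \<bar>sn (k mod 5)\<bar>"
proof -
  have "\<bar>sn (k + 5 * int n)\<bar> = \<bar>sn k\<bar>" for k n
  proof (induction n)
    case (Suc n)
    have "k + 5 * int (Suc n) = (k + 5 * int n) + 5" by simp
    then show ?case using Suc by (simp only: sn_add5 abs_minus_cancel)
  qed simp
  note A = this
  show ?thesis
  proof (cases "k div 5 \<ge> 0")
    case True
    then have "k = k mod 5 + 5 * int (nat (k div 5))" by simp
    then show ?thesis using A by metis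
  next
    case False
    then have "k mod 5 = k + 5 * int (nat (- (k div 5)))"
      using mult_div_mod_eq[of 5 k] by linarith
    then show ?thesis using A by metis
  qed
qed

text \<open>Here five slopes meet the golden ratio: the sines of the multiples of \<pi>/5 have two
  nonzero absolute values, with quotient phi.\<close>

lemma abs_sn: "\<bar>sn k\<bar> = (if 5 dvd k then 0 else if k mod 5 = 1 \<or> k mod 5 = 4 then 1 else phi)"
proof -
  have "k mod 5 \<in> {0,1,2,3,4}"
    using pos_mod_bound[of 5 k] pos_mod_sign[of 5 k] by auto
  then show ?thesis unfolding abs_sn_mod[of k]
    using phi_pos by (auto simp: sn_0 sn_1 sn_2 sn_3 sn_4 dvd_eq_mod_eq_0)
qed

lemma sn_eq_0_iff: "sn k = 0 \<longleftrightarrow> 5 dvd k"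
  using abs_sn[of k] phi_pos by (auto split: if_splits)

lemma abs_sn_ge_1: "\<not> 5 dvd k \<Longrightarrow> \<bar>sn k\<bar> \<ge> 1"
  and abs_sn_le_phi: "\<bar>sn k\<bar> \<le> phi"
  using abs_sn[of k] phi_lower by (auto split: if_splits)

lemma ht_basis: "ht k z = - sn (k - 1) * ht 0 z + sn k * ht 1 z"
  using sn_plucker[of 1 0 k z] sn_minus[of "k - 1"] by (simp add: sn_1)

lemma ht_cong: 
  assumes "5 dvd (a - b)"
  shows "ht a z = ht b z \<or> ht a z = - ht b z"
proof -
  have s: "sn (a - b) = 0" using assms sn_eq_0_iff by simp
  have "sn (b + 1 - b) * ht a z = sn (b + 1 - a) * ht b z + sn (a - b) * ht (b + 1) z"
    by (rule sn_plucker)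
  then have 1: "ht a z = sn (b + 1 - a) * ht b z" using s by (simp add: sn_1)
  have "(b + 1 - a) mod 5 = 1" using assms by presburger
  then have "\<bar>sn (b + 1 - a)\<bar> = 1" using abs_sn[of "b + 1 - a"] by (simp add: dvd_eq_mod_eq_0)
  then show ?thesis using 1 by (auto simp: abs_if split: if_splits)
qed

lemma ht_cong_eq: 
  assumes "5 dvd (a - b)"
  shows "ht a z = ht a w \<longleftrightarrow> ht b z = ht b w"
  using ht_cong[OF assms, of "z - w"] by (auto simp: ht_linear)

lemma ht_inj:
  assumes "\<not> 5 dvd (a - b)" "ht a z = ht a w" "ht b z = ht b w"
  shows "z = w"
proof -
  have nz: "sn (b - a) \<noteq> 0" using assms(1) sn_eq_0_iff by (metis dvd_minus_iff minus_diff_eq)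
  have "ht k (z - w) = 0" for k
    using sn_plucker[of b a k "z - w"] assms(2,3) nz by (simp add: ht_linear)
  from this[of 0] have "Im (z - w) = 0" using sin_pi5_pos by (simp add: ht_def)
  moreover from \<open>\<And>k. ht k (z - w) = 0\<close>[of 1] have "Re (z - w) * sin (pi/5) = 0"
    using \<open>Im (z - w) = 0\<close> sin_pi5_pos by (simp add: ht_def)
  ultimately show ?thesis using sin_pi5_pos by (simp add: complex_eq_iff)
qed

lemma ht_surj:
  assumes "\<not> 5 dvd (a - b)"
  obtains z where "ht a z = x" "ht b z = y"
proof
  have nz: "sn (b - a) \<noteq> 0" "sn (a - b) \<noteq> 0" using assms sn_eq_0_iff
    by (metis dvd_minus_iff minus_diff_eq)+
  let ?z = "of_real (x / sn (b - a)) * dir b + of_real (y / sn (a - b)) * dir a"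
  show "ht a ?z = x" "ht b ?z = y"
    using nz by (simp_all only: ht_add ht_scale ht_dir) (simp_all add: sn_0)
qed

text \<open>The determinant of two plane vectors: zero iff they are parallel, so collinearity of p,
  q, r is its vanishing on q - p and r - p.\<close>

definition cr :: "complex \<Rightarrow> complex \<Rightarrow> real" where "cr z w = Im (cnj z * w)"

lemma cr_linear: "cr z (v + w) = cr z v + cr z w" "cr (v + w) z = cr v z + cr w z"
  "cr z (v - w) = cr z v - cr z w" "cr (v - w) z = cr v z - cr w z"
  "cr (of_real r * z) w = r * cr z w" "cr z (of_real r * w) = r * cr z w"
  "cr z 0 = 0" "cr 0 z = 0" "cr z z = 0"
  by (auto simp: cr_def algebra_simps)

lemma cr_commute: "cr z w = - cr w z" by (simp add: cr_def algebra_simps)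

lemma cr_dir: "cr (dir k) z = sin (pi/5) * ht k z"
  using sin_pi5_pos by (simp add: cr_def dir_def ht_def cis_cnj)

section \<open>The ring Z[phi] and linear functionals over it\<close>

definition Zphi :: "real set" where
  "Zphi = range (\<lambda>(a::int, b::int). of_int a + of_int b * phi)"

lemma ZphiI: "x = of_int a + of_int b * phi \<Longrightarrow> x \<in> Zphi"
  by (auto simp: Zphi_def)

lemma countable_Zphi: "countable Zphi" by (simp add: Zphi_def)

lemma Zphi_add: "x \<in> Zphi \<Longrightarrow> y \<in> Zphi \<Longrightarrow> x + y \<in> Zphi"
proof -
  assume "x \<in> Zphi" "y \<in> Zphi"
  then obtain a b c d where "x = of_int a + of_int b * phi" "y = of_int c + of_int d * phi"
    by (auto simp: Zphi_def)
  then show ?thesis by (intro ZphiI[of _ "a + c" "b + d"]) (simp add: algebra_simps)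
qed

lemma Zphi_minus: "x \<in> Zphi \<Longrightarrow> - x \<in> Zphi"
proof -
  assume "x \<in> Zphi"
  then obtain a b where "x = of_int a + of_int b * phi" by (auto simp: Zphi_def)
  then show ?thesis by (intro ZphiI[of _ "- a" "- b"]) simp
qed

lemma Zphi_diff: "x \<in> Zphi \<Longrightarrow> y \<in> Zphi \<Longrightarrow> x - y \<in> Zphi"
  unfolding diff_conv_add_uminus by (intro Zphi_add Zphi_minus)

lemma Zphi_mult: "x \<in> Zphi \<Longrightarrow> y \<in> Zphi \<Longrightarrow> x * y \<in> Zphi"
proof -
  assume "x \<in> Zphi" "y \<in> Zphi"
  then obtain a b c d where e: "x = of_int a + of_int b * phi" "y = of_int c + of_int d * phi"
    by (auto simp: Zphi_def)
  have "x * y = of_int a * of_int c + (of_int a * of_int d + of_int b * of_int c) * phi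
      + of_int b * of_int d * (phi * phi)" unfolding e by (simp add: algebra_simps)
  then show ?thesis unfolding phi_sq
    by (intro ZphiI[of _ "a * c + b * d" "a * d + b * c + b * d"]) (simp add: algebra_simps)
qed

lemma Zphi_of_int: "of_int k \<in> Zphi" by (rule ZphiI[of _ k 0]) simp
lemma Zphi_0: "0 \<in> Zphi" and Zphi_1: "1 \<in> Zphi"
  using Zphi_of_int[of 0] Zphi_of_int[of 1] by simp_all
lemma Zphi_phi: "phi \<in> Zphi" by (rule ZphiI[of _ 0 1]) simp
lemma Zphi_inverse_phi: "1 / phi \<in> Zphi"
proof -
  have "1 / phi = (of_int (-1) + of_int 1 * phi)" using phi_sq phi_pos
    by (simp add: divide_eq_eq left_diff_distrib)
  then show ?thesis by (rule ZphiI)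
qed
lemma Zphi_power: "x \<in> Zphi \<Longrightarrow> x ^ n \<in> Zphi"
  by (induction n) (auto intro: Zphi_1 Zphi_mult)
lemma Zphi_sum: "(\<And>i. i \<in> I \<Longrightarrow> f i \<in> Zphi) \<Longrightarrow> sum f I \<in> Zphi"
  by (induction I rule: infinite_finite_induct) (auto intro: Zphi_0 Zphi_add)

lemma sn_cases: "sn k \<in> {0, 1, -1, phi, - phi}"
  using abs_sn[of k] by (auto split: if_splits)

lemma Zphi_sn: "sn k \<in> Zphi"
  using sn_cases[of k] by (elim insertE emptyE, simp_all add: Zphi_0 Zphi_1 Zphi_phi Zphi_minus)

text \<open>phi is a unit with inverse phi - 1, so every nonzero \<open>sn k\<close> is a unit and
  changing between pairs of heights never introduces denominators.\<close>

lemma Zphi_divide_sn: 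
  assumes "x \<in> Zphi" "\<not> 5 dvd k"
  shows "x / sn k \<in> Zphi"
proof -
  have m: "x * (1 / phi) \<in> Zphi" by (rule Zphi_mult[OF assms(1) Zphi_inverse_phi])
  have "sn k \<noteq> 0" using assms(2) sn_eq_0_iff by simp
  then consider "sn k = 1" | "sn k = - 1" | "sn k = phi" | "sn k = - phi"
    using sn_cases[of k] by blast
  then show ?thesis
    by cases (use assms(1) m Zphi_minus[OF assms(1)] Zphi_minus[OF m] in simp_all)
qed

lemmas Zphi_intros = Zphi_0 Zphi_1 Zphi_phi Zphi_add Zphi_diff Zphi_minus Zphi_mult Zphi_power
  Zphi_sum Zphi_sn

text \<open>Heights 0 and 1 serve as coordinates, in which every height has coefficients in
  \<open>Zphi\<close> (\<open>htc\<close>). The pairs c in \<open>Zphi \<times> Zphi\<close> are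
  thus a countable family of functionals that contains all heights.\<close>

definition lin :: "real \<times> real \<Rightarrow> complex \<Rightarrow> real" where
  "lin c z = fst c * ht 0 z + snd c * ht 1 z"

definition htc :: "int \<Rightarrow> real \<times> real" where "htc k = (- sn (k - 1), sn k)"

lemma lin_htc: "lin (htc k) z = ht k z"
  by (simp add: lin_def htc_def ht_basis[of k z])

lemma lin_linear: "lin c (z + w) = lin c z + lin c w" "lin c (z - w) = lin c z - lin c w"
  "lin c (of_real r * z) = r * lin c z" "lin c 0 = 0" "lin c (- z) = - lin c z"
  by (simp_all add: lin_def ht_linear ring_distribs mult.left_commute)

lemma lin_coeff: "lin (c + c') z = lin c z + lin c' z" "lin (r *\<^sub>R c) z = r * lin c z"
  "lin (- c) z = - lin c z" "lin 0 z = 0" "lin (c - c') z = lin c z - lin c' z"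
  by (simp_all add: lin_def algebra_simps)

lemma lin_sum: "lin (\<Sum>i\<in>I. f i) z = (\<Sum>i\<in>I. lin (f i) z)"
  by (induction I rule: infinite_finite_induct) (auto simp: lin_coeff)

lemma htc_Zphi: "htc k \<in> Zphi \<times> Zphi" by (auto simp: htc_def intro: Zphi_intros)

lemma lin_dir_Zphi: "c \<in> Zphi \<times> Zphi \<Longrightarrow> lin c (dir k) \<in> Zphi"
  by (auto simp: lin_def ht_dir intro!: Zphi_intros)

text \<open>Direction b has height 0 in slope b, so evaluating at the directions b and a isolates
  the coefficients of the heights a and b.\<close>

lemma lin_expand:
  assumes "\<not> 5 dvd (a - b)"
  shows "lin c z = lin c (dir b) / sn (b - a) * ht a z + lin c (dir a) / sn (a - b) * ht b z"
proof -
  have nz: "sn (b - a) \<noteq> 0" "sn (a - b) \<noteq> 0" using assms sn_eq_0_iff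
    by (metis dvd_minus_iff minus_diff_eq)+
  have "z = of_real (ht a z / sn (b - a)) * dir b + of_real (ht b z / sn (a - b)) * dir a" (is "_ = ?w")
    by (rule ht_inj[OF assms]) (use nz in \<open>simp_all only: ht_add ht_scale ht_dir\<close>, simp_all add: sn_0)
  then have "lin c z = lin c ?w" by simp
  also have "\<dots> = lin c (dir b) / sn (b - a) * ht a z + lin c (dir a) / sn (a - b) * ht b z"
    unfolding lin_linear by (simp add: mult_ac)
  finally show ?thesis .
qed

lemma lin_parallel:
  assumes "c \<in> Zphi \<times> Zphi" "lin c (dir e) = 0"
  obtains t where "t \<in> Zphi" "\<And>z. lin c z = t * ht e z"
proof
  have nd: "\<not> 5 dvd (e - (e + 1))" by simp
  show "lin c z = (lin c (dir (e + 1)) / sn (e + 1 - e)) * ht e z" for z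
    using lin_expand[OF nd, of c z] assms(2) by simp
  show "lin c (dir (e + 1)) / sn (e + 1 - e) \<in> Zphi"
    using lin_dir_Zphi[OF assms(1)] by (simp add: sn_1)
qed

lemma lin_eq_0: "(\<And>z. lin c z = 0) \<Longrightarrow> c = 0"
proof -
  assume *: "\<And>z. lin c z = 0"
  have "fst c * sn 1 = 0" using *[of "dir 1"] by (simp add: lin_def ht_dir sn_0)
  moreover have "snd c * sn (-1) = 0" using *[of "dir 0"] by (simp add: lin_def ht_dir sn_0)
  ultimately show "c = 0" using sn_minus[of 1] by (simp add: sn_1 prod_eq_iff)
qed

section \<open>Generic real parameters\<close>

text \<open>Genericity is cocountability: it survives countable conjunctions, which is enough as all
  relations have coefficients in a countable ring, and it implies existence because the reals are
  uncountable.\<close>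

definition generic :: "(real \<Rightarrow> bool) \<Rightarrow> bool" where "generic P \<longleftrightarrow> countable {x. \<not> P x}"

lemma generic_mono: "generic P \<Longrightarrow> (\<And>x. P x \<Longrightarrow> Q x) \<Longrightarrow> generic Q"
  unfolding generic_def by (rule countable_subset[of _ "{x. \<not> P x}"]) auto

lemma generic_conj: "generic P \<Longrightarrow> generic Q \<Longrightarrow> generic (\<lambda>x. P x \<and> Q x)"
proof -
  assume "generic P" "generic Q"
  then have "countable ({x. \<not> P x} \<union> {x. \<not> Q x})" by (simp add: generic_def)
  then show ?thesis unfolding generic_def by (rule countable_subset[rotated]) auto
qed

lemma genericI: "(\<And>x. P x) \<Longrightarrow> generic P" by (simp add: generic_def)

lemma generic_const: "P \<Longrightarrow> generic (\<lambda>x. P)" by (simp add: generic_def)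

lemma generic_ball:
  assumes "countable I" "\<And>i. i \<in> I \<Longrightarrow> generic (P i)"
  shows "generic (\<lambda>x. \<forall>i\<in>I. P i x)"
proof -
  have "countable (\<Union>i\<in>I. {x. \<not> P i x})"
    by (rule countable_UN[OF assms(1)]) (rule assms(2)[unfolded generic_def])
  moreover have "{x. \<not> (\<forall>i\<in>I. P i x)} = (\<Union>i\<in>I. {x. \<not> P i x})" by blast
  ultimately show ?thesis unfolding generic_def by simp
qed

lemma generic_all: "(\<And>i::'i::countable. generic (P i)) \<Longrightarrow> generic (\<lambda>x. \<forall>i. P i x)"
  using generic_ball[of UNIV P] by simp

lemma generic_ex: "generic P \<Longrightarrow> \<exists>x. P x"
proof (rule ccontr)
  assume "generic P" "\<not> (\<exists>x. P x)"
  then have "countable (UNIV :: real set)" by (simp add: generic_def)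
  then show False using uncountable_UNIV_real by simp
qed

lemma generic_quadratic:
  assumes "a \<noteq> 0 \<or> b \<noteq> 0 \<or> c \<noteq> 0"
  shows "generic (\<lambda>x. a + b * x + c * x\<^sup>2 \<noteq> 0)"
proof -
  have "{x. a + b * x + c * x\<^sup>2 = 0} = {x. poly [:a, b, c:] x = 0}"
    by (auto simp: algebra_simps power2_eq_square)
  also have "finite \<dots>" by (rule poly_roots_finite) (use assms in auto)
  finally show ?thesis by (simp add: generic_def countable_finite)
qed

lemma generic_affine: "a \<noteq> 0 \<or> b \<noteq> 0 \<Longrightarrow> generic (\<lambda>x. a + b * x \<noteq> 0)"
  using generic_quadratic[of a b 0] by simp

text \<open>On the line dir 0 + x dir 1, each nonzero functional over \<open>Zphi\<close> and each w
  in W excludes at most one x.\<close>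

lemma irrational_vector:
  assumes "finite W" "0 \<notin> W"
  obtains d where "\<And>c. c \<in> Zphi \<times> Zphi \<Longrightarrow> lin c d = 0 \<Longrightarrow> c = 0"
    "\<And>w. w \<in> W \<Longrightarrow> cr d w \<noteq> 0"
proof -
  let ?d = "\<lambda>x. dir 0 + of_real x * dir 1"
  have "generic (\<lambda>x. \<forall>c\<in>Zphi \<times> Zphi. lin c (?d x) = 0 \<longrightarrow> c = 0)"
  proof (rule generic_ball)
    show "countable (Zphi \<times> Zphi)" by (simp add: countable_Zphi)
    fix c assume "c \<in> Zphi \<times> Zphi"
    show "generic (\<lambda>x. lin c (?d x) = 0 \<longrightarrow> c = 0)"
    proof (cases "c = 0")
      case False
      have "lin c (dir 0) \<noteq> 0 \<or> lin c (dir 1) \<noteq> 0"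
      proof (rule ccontr)
        assume "\<not> (lin c (dir 0) \<noteq> 0 \<or> lin c (dir 1) \<noteq> 0)"
        then have "lin c z = 0" for z by (subst lin_expand[of 0 1 c z]) auto
        then show False using lin_eq_0 False by blast
      qed
      then have "generic (\<lambda>x. lin c (dir 0) + lin c (dir 1) * x \<noteq> 0)" by (rule generic_affine)
      then show ?thesis by (rule generic_mono) (auto simp: lin_linear algebra_simps)
    qed (simp add: generic_def)
  qed
  moreover have "generic (\<lambda>x. \<forall>w\<in>W. cr (?d x) w \<noteq> 0)"
  proof (rule generic_ball)
    show "countable W" using assms(1) by (rule countable_finite)
    fix w assume "w \<in> W"
    then have "w \<noteq> 0" using assms by auto
    then have "cr (dir 0) w \<noteq> 0 \<or> cr (dir 1) w \<noteq> 0"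
      using ht_inj[of 0 1 w 0] sin_pi5_pos by (auto simp: cr_dir ht_0)
    then have "generic (\<lambda>x. cr (dir 0) w + cr (dir 1) w * x \<noteq> 0)" by (rule generic_affine)
    then show "generic (\<lambda>x. cr (?d x) w \<noteq> 0)"
      by (rule generic_mono) (auto simp: cr_linear algebra_simps)
  qed
  ultimately obtain x where "\<forall>c\<in>Zphi \<times> Zphi. lin c (?d x) = 0 \<longrightarrow> c = 0" "\<forall>w\<in>W. cr (?d x) w \<noteq> 0"
    using generic_ex[OF generic_conj] by blast
  then show ?thesis by (intro that[of "?d x"]) auto
qed

section \<open>Drawings\<close>

definition deg :: "'a set \<Rightarrow> ('a \<Rightarrow> 'a \<Rightarrow> bool) \<Rightarrow> 'a \<Rightarrow> nat" where
  "deg V E u = card {w \<in> V. E u w}"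

text \<open>If the vertices of X have degree three in the whole graph, this is the number of edges
  that leave X.\<close>

definition defect :: "('a \<Rightarrow> 'a \<Rightarrow> bool) \<Rightarrow> 'a set \<Rightarrow> nat" where
  "defect E X = (\<Sum>x\<in>X. 3 - deg X E x)"

definition free :: "'a set \<Rightarrow> ('a \<Rightarrow> complex) \<Rightarrow> 'a \<Rightarrow> int \<Rightarrow> bool" where
  "free V D u s \<longleftrightarrow> (\<forall>w\<in>V. w \<noteq> u \<longrightarrow> ht s (D u) \<noteq> ht s (D w))"

definition faithful :: "'a set \<Rightarrow> ('a \<Rightarrow> 'a \<Rightarrow> bool) \<Rightarrow> ('a \<Rightarrow> complex) \<Rightarrow> bool" where
  "faithful V E D \<longleftrightarrow>
     (\<forall>p\<in>V. \<forall>q\<in>V. p \<noteq> q \<longrightarrow> D p \<noteq> D q \<and> (E p q \<longleftrightarrow> (\<exists>s. ht s (D p) = ht s (D q)))) \<and>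
     (\<forall>p\<in>V. \<forall>q\<in>V. \<forall>r\<in>V. p \<noteq> q \<longrightarrow> p \<noteq> r \<longrightarrow> q \<noteq> r \<longrightarrow> cr (D q - D p) (D r - D p) \<noteq> 0)"

text \<open>In \<open>generic_vvV\<close> two path vertices i < j have parallel velocities; there B
  is phi^i and A is phi^j up to sign, with j - i \<ge> 3.\<close>

definition bad_ratio :: "real \<Rightarrow> real \<Rightarrow> bool" where
  "bad_ratio A B \<longleftrightarrow> A \<in> Zphi \<and> B \<in> Zphi \<and> A \<noteq> 0 \<and> (\<exists>m\<ge>3. \<bar>B\<bar> * phi ^ m = \<bar>A\<bar>)"

text \<open>In \<open>generic_vvv\<close> three path vertices i < j < l have parallel velocities,
  and A, B are the velocity of l minus those of j and i. The window is wide enough for all such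
  quotients; its upper end stays below phi, and inside it 1 - B/A is smaller in size than
  B/A.\<close>

definition near_ratio :: "real \<Rightarrow> real \<Rightarrow> bool" where
  "near_ratio A B \<longleftrightarrow> A \<in> Zphi \<and> B \<in> Zphi \<and> A \<noteq> 0 \<and> B \<noteq> A \<and> 0.6 < B / A \<and> B / A < 1.6"

text \<open>With h the height s, the forbidden equation says that h p - h r and h q - h r are in the
  ratio B : A. For a near ratio all three vertices are attachment vertices of a path, so r may be
  assumed deficient and free as well; for a bad ratio r is an arbitrary vertex.\<close>

definition separated :: "'a set \<Rightarrow> ('a \<Rightarrow> 'a \<Rightarrow> bool) \<Rightarrow> ('a \<times> 'a) set \<Rightarrow> ('a \<Rightarrow> complex) \<Rightarrow> bool" where
  "separated V E R D \<longleftrightarrow> (\<forall>p\<in>V. \<forall>q\<in>V. \<forall>r\<in>V. \<forall>s A B. p \<noteq> q \<longrightarrow> p \<noteq> r \<longrightarrow> q \<noteq> r \<longrightarrow> (p, q) \<in> R \<longrightarrow>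
     deg V E p < 3 \<longrightarrow> deg V E q < 3 \<longrightarrow> free V D p s \<longrightarrow> free V D q s \<longrightarrow>
     (bad_ratio A B \<or> near_ratio A B \<and> (p, r) \<in> R \<and> (q, r) \<in> R \<and> deg V E r < 3 \<and> free V D r s) \<longrightarrow>
     - A * ht s (D p) + B * ht s (D q) + (A - B) * ht s (D r) \<noteq> 0)"

definition supp :: "('a \<Rightarrow> int \<Rightarrow> real) \<Rightarrow> 'a \<Rightarrow> int set" where
  "supp \<kappa> u = {s \<in> {0..<5}. \<kappa> u s \<noteq> 0}"

text \<open>\<kappa> holds the coefficients of a relation between heights. It may use at a vertex
  only slopes in which another edge could leave, and no more of them than the degree leaves room for
  up to three.\<close>

definition slots :: "'a set \<Rightarrow> ('a \<Rightarrow> 'a \<Rightarrow> bool) \<Rightarrow> ('a \<Rightarrow> complex) \<Rightarrow> ('a \<Rightarrow> int \<Rightarrow> real) \<Rightarrow> bool" where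
  "slots V E D \<kappa> \<longleftrightarrow> (\<forall>u\<in>V. (\<forall>s. \<kappa> u s \<in> Zphi) \<and> (\<forall>s\<in>supp \<kappa> u. free V D u s) \<and>
     card (supp \<kappa> u) + deg V E u \<le> 3)"

definition closed_in :: "'a set \<Rightarrow> ('a \<Rightarrow> 'a \<Rightarrow> bool) \<Rightarrow> 'a set \<Rightarrow> bool" where
  "closed_in V E Y \<longleftrightarrow> Y \<subseteq> V \<and> (\<forall>x\<in>Y. \<forall>y\<in>V. E x y \<longrightarrow> y \<in> Y)"

text \<open>Plain linear independence is too much: an isolated point with three slots always
  satisfies a relation (\<open>sn_plucker\<close>), and edges spread such relations over a
  component. The exceptional relations are those that fill all slots of a union Y of components and
  use none elsewhere.\<close>

definition indep :: "'a set \<Rightarrow> ('a \<Rightarrow> 'a \<Rightarrow> bool) \<Rightarrow> ('a \<Rightarrow> complex) \<Rightarrow> bool" where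
  "indep V E D \<longleftrightarrow> (\<forall>\<kappa>. slots V E D \<kappa> \<longrightarrow> (\<Sum>u\<in>V. \<Sum>s\<in>{0..<5}. \<kappa> u s * ht s (D u)) = 0 \<longrightarrow>
     (\<exists>Y. closed_in V E Y \<and> (\<forall>u\<in>Y. card (supp \<kappa> u) + deg V E u = 3) \<and> (\<forall>u\<in>V - Y. supp \<kappa> u = {})))"

text \<open>The cap point of \<open>path_cap\<close> moves along a fixed vector over
  \<open>Zphi\<close>, and it stays collinear with two old vertices only if their difference is
  parallel to that vector, so that they satisfy such a relation. In the application every proper
  nonempty subset has defect at least three.\<close>

definition nonrigid :: "'a set \<Rightarrow> ('a \<Rightarrow> 'a \<Rightarrow> bool) \<Rightarrow> ('a \<Rightarrow> complex) \<Rightarrow> bool" where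
  "nonrigid V E D \<longleftrightarrow> (\<forall>p\<in>V. \<forall>q\<in>V. \<forall>c\<in>Zphi \<times> Zphi. p \<noteq> q \<longrightarrow> \<not> E p q \<longrightarrow> c \<noteq> 0 \<longrightarrow>
     lin c (D p) = lin c (D q) \<longrightarrow> (\<exists>X\<subseteq>V. p \<in> X \<and> q \<in> X \<and> defect E X \<le> 2))"

definition good :: "'a set \<Rightarrow> ('a \<Rightarrow> 'a \<Rightarrow> bool) \<Rightarrow> ('a \<times> 'a) set \<Rightarrow> ('a \<Rightarrow> complex) \<Rightarrow> bool" where
  "good V E R D \<longleftrightarrow> faithful V E D \<and> separated V E R D \<and> indep V E D \<and> nonrigid V E D"

text \<open>Degree two is the case that counts: at the time when a path is run, every vertex of
  degree below three has degree exactly two.\<close>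

definition oriented :: "'a set \<Rightarrow> ('a \<Rightarrow> 'a \<Rightarrow> bool) \<Rightarrow> ('a \<times> 'a) set \<Rightarrow> bool" where
  "oriented V E R \<longleftrightarrow> (\<forall>p\<in>V. \<forall>q\<in>V. deg V E p = 2 \<longrightarrow> deg V E q = 2 \<longrightarrow> (p, q) \<in> R \<longrightarrow> (q, p) \<notin> R)"

lemma cr_rotate: "cr (q - p) (r - p) = cr (r - q) (p - q)"
  and cr_swap: "cr (q - p) (r - p) = - cr (r - p) (q - p)"
  by (simp_all add: cr_def algebra_simps)

lemma ht_parallel:
  assumes "ht e v = 0" "v \<noteq> 0" "cr v w = 0"
  shows "ht e w = 0"
proof -
  define k where "k = - ht (e + 1) v"
  have "v = of_real k * dir e"
    by (rule ht_inj[of e "e + 1"]) (use assms(1) in \<open>simp_all only: ht_scale ht_dir\<close>, simp_all add: k_def sn_0 sn_minus sn_1)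
  then have "k \<noteq> 0" "cr v w = k * (sin (pi/5) * ht e w)"
    using assms(2) by (auto simp: cr_linear cr_dir)
  then show ?thesis using assms(3) sin_pi5_pos by auto
qed

lemma sum_three:
  fixes x :: "'a \<Rightarrow> real"
  assumes "finite S" "p \<noteq> q" "p \<noteq> r" "q \<noteq> r"
  shows "(\<Sum>u\<in>S. (if u = p then P else if u = q then Q else if u = r then W else 0) * x u) =
     (if p \<in> S then P * x p else 0) + (if q \<in> S then Q * x q else 0) + (if r \<in> S then W * x r else 0)"
proof -
  have "(\<Sum>u\<in>S. (if u = p then P else if u = q then Q else if u = r then W else 0) * x u) =
    (\<Sum>u\<in>S. (if u = p then P * x u else 0) + (if u = q then Q * x u else 0) + (if u = r then W * x u else 0))"
    using assms by (intro sum.cong) auto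
  also have "\<dots> = (if p \<in> S then P * x p else 0) + (if q \<in> S then Q * x q else 0) + (if r \<in> S then W * x r else 0)"
    using assms(1) by (simp add: sum.distrib)
  finally show ?thesis .
qed

lemma sum_two:
  fixes x :: "'a \<Rightarrow> real"
  assumes "finite S" "p \<noteq> q"
  shows "(\<Sum>u\<in>S. (if u = p then P else if u = q then Q else 0) * x u) =
     (if p \<in> S then P * x p else 0) + (if q \<in> S then Q * x q else 0)"
proof -
  have "(\<Sum>u\<in>S. (if u = p then P else if u = q then Q else 0) * x u) =
    (\<Sum>u\<in>S. (if u = p then P * x u else 0) + (if u = q then Q * x u else 0))"
    using assms by (intro sum.cong) auto
  also have "\<dots> = (if p \<in> S then P * x p else 0) + (if q \<in> S then Q * x q else 0)"
    using assms(1) by (simp add: sum.distrib)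
  finally show ?thesis .
qed

lemma bad_ratio_nz: "bad_ratio A B \<Longrightarrow> A \<noteq> 0 \<and> B \<noteq> 0 \<and> A \<noteq> B"
proof -
  assume "bad_ratio A B"
  then obtain m :: nat where m: "m \<ge> 3" "\<bar>B\<bar> * phi ^ m = \<bar>A\<bar>" and A: "A \<noteq> 0" by (auto simp: bad_ratio_def)
  have "phi ^ m > 1" using phi_lower m(1) by (intro one_less_power) auto
  moreover have "B \<noteq> 0" using m A by auto
  ultimately have "\<bar>B\<bar> < \<bar>A\<bar>" using m(2) by (metis mult.right_neutral mult_less_cancel_left_pos zero_less_abs_iff)
  then show ?thesis using A \<open>B \<noteq> 0\<close> by auto
qed

lemma near_ratio_nz: "near_ratio A B \<Longrightarrow> A \<noteq> 0 \<and> B \<noteq> 0 \<and> A \<noteq> B"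
  by (auto simp: near_ratio_def)

lemma faithfulD: 
  assumes "faithful V E D" "p \<in> V" "q \<in> V" "p \<noteq> q"
  shows "D p \<noteq> D q" "E p q \<longleftrightarrow> (\<exists>s. ht s (D p) = ht s (D q))"
    "r \<in> V \<Longrightarrow> p \<noteq> r \<Longrightarrow> q \<noteq> r \<Longrightarrow> cr (D q - D p) (D r - D p) \<noteq> 0"
  using assms by (auto simp: faithful_def)

lemma free_mono:
  assumes "free V D u s" "U \<subseteq> V" "\<And>w. w \<in> insert u U \<Longrightarrow> D w = D' w"
  shows "free U D' u s"
  unfolding free_def
proof (intro ballI impI)
  fix w assume w: "w \<in> U" "w \<noteq> u"
  then have "w \<in> V" using assms(2) by blast
  then have "ht s (D u) \<noteq> ht s (D w)" using assms(1) w(2) unfolding free_def by blast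
  moreover have "D w = D' w" "D u = D' u" by (rule assms(3), use w in simp)+
  ultimately show "ht s (D' u) \<noteq> ht s (D' w)" by simp
qed

lemma Zphi_pair_sum:
  assumes "\<And>u. u \<in> S \<Longrightarrow> f u \<in> Zphi \<times> Zphi"
  shows "sum f S \<in> Zphi \<times> Zphi"
  unfolding mem_Times_iff fst_sum snd_sum
  using assms by (intro conjI Zphi_sum) (auto simp: mem_Times_iff)

section \<open>Joining two parts by at most one edge\<close>

locale glue =
  fixes A B :: "'a set" and E :: "'a \<Rightarrow> 'a \<Rightarrow> bool" and a b :: 'a and e :: int and d :: complex
    and DA DB :: "'a \<Rightarrow> complex"
  assumes finite: "finite A" "finite B" and disjoint: "A \<inter> B = {}" and a: "a \<in> A" and b: "b \<in> B"
    and sym: "\<And>x y. E x y \<Longrightarrow> E y x"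
    and cross: "\<And>x y. x \<in> A \<Longrightarrow> y \<in> B \<Longrightarrow> E x y \<Longrightarrow> x = a \<and> y = b"
    and fA: "faithful A E DA" and fB: "faithful B E DB"
    and d_lin: "\<And>c. c \<in> Zphi \<times> Zphi \<Longrightarrow> lin c d = 0 \<Longrightarrow>
        \<exists>t\<in>Zphi. (t \<noteq> 0 \<longrightarrow> E a b) \<and> (\<forall>z. lin c z = t * ht e z)"
    and e: "E a b \<Longrightarrow> ht e d = 0" "E a b \<Longrightarrow> free A DA a e" "E a b \<Longrightarrow> free B DB b e" "e \<in> {0..<5}"
    and d_A: "\<And>u w. u \<in> A \<Longrightarrow> w \<in> A \<Longrightarrow> u \<noteq> w \<Longrightarrow> cr d (DA u - DA w) = 0 \<Longrightarrow>
        E a b \<and> ht e (DA u) = ht e (DA w)"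
    and d_B: "\<And>u w. u \<in> B \<Longrightarrow> w \<in> B \<Longrightarrow> u \<noteq> w \<Longrightarrow> cr d (DB u - DB w) = 0 \<Longrightarrow>
        E a b \<and> ht e (DB u) = ht e (DB w)"
begin

text \<open>A stays fixed, B is scaled by l about b, and b is put at distance y from a in direction
  d. If there is an edge, d is its direction and y slides B along it; otherwise d satisfies no
  nontrivial relation over \<open>Zphi\<close>.\<close>

definition pos :: "real \<Rightarrow> real \<Rightarrow> 'a \<Rightarrow> complex" where
  "pos l y u = (if u \<in> A then DA u else DA a + of_real y * d + of_real l * (DB u - DB b))"

lemma pos_A: "u \<in> A \<Longrightarrow> pos l y u = DA u"
  and pos_B: "u \<in> B \<Longrightarrow> pos l y u = DA a + of_real y * d + of_real l * (DB u - DB b)"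
  using disjoint by (auto simp: pos_def)

text \<open>The coefficients on B add up to t times height e. Attaching this multiple to a and, with
  the opposite sign, to b turns one relation on the union into a relation on each part; without the
  edge t is 0.\<close>

definition splits :: "('a \<Rightarrow> real \<times> real) \<Rightarrow> bool" where
  "splits f \<longleftrightarrow> (\<exists>t\<in>Zphi. (t \<noteq> 0 \<longrightarrow> E a b) \<and> (\<forall>z. lin (sum f B) z = t * ht e z) \<and>
     (\<Sum>u\<in>A. lin (f u) (DA u)) + t * ht e (DA a) = 0 \<and> (\<Sum>u\<in>B. lin (f u) (DB u)) = t * ht e (DB b))"

lemma sum_pos: "(\<Sum>u\<in>A \<union> B. lin (f u) (pos l y u)) =
   ((\<Sum>u\<in>A. lin (f u) (DA u)) + lin (sum f B) (DA a)) + lin (sum f B) d * y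
   + l * ((\<Sum>u\<in>B. lin (f u) (DB u)) - lin (sum f B) (DB b))"
proof -
  have "(\<Sum>u\<in>A \<union> B. lin (f u) (pos l y u)) = (\<Sum>u\<in>A. lin (f u) (DA u)) +
     (\<Sum>u\<in>B. lin (f u) (DA a + of_real y * d + of_real l * (DB u - DB b)))"
    using finite disjoint by (simp add: sum.union_disjoint pos_A pos_B)
  also have "(\<Sum>u\<in>B. lin (f u) (DA a + of_real y * d + of_real l * (DB u - DB b))) =
     lin (sum f B) (DA a) + y * lin (sum f B) d + l * ((\<Sum>u\<in>B. lin (f u) (DB u)) - lin (sum f B) (DB b))"
    unfolding lin_sum by (simp add: lin_linear sum.distrib sum_distrib_left sum_subtractf right_diff_distrib)
  finally show ?thesis by (simp add: algebra_simps)
qed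

text \<open>The value of a relation is affine in y, with slope the sum over B evaluated at d. If
  that slope vanishes, \<open>d_lin\<close> supplies t, and the value is affine in l; it can then
  vanish for generic l only if the parts of A and B vanish separately. Hence the nesting: l is
  chosen before y.\<close>

lemma generic_splits:
  "generic (\<lambda>l. generic (\<lambda>y. \<forall>f. (\<forall>u\<in>A \<union> B. f u \<in> Zphi \<times> Zphi) \<longrightarrow>
      (\<Sum>u\<in>A \<union> B. lin (f u) (pos l y u)) = 0 \<longrightarrow> splits f))"
proof -
  \<comment> \<open>Only the values on the finite vertex set matter; taking functions undefined
    elsewhere makes the family of relations countable.\<close>
  let ?F = "PiE (A \<union> B) (\<lambda>_. Zphi \<times> Zphi)"
  have cF: "countable ?F" by (rule countable_PiE) (auto simp: finite countable_Zphi)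
  have one: "generic (\<lambda>l. generic (\<lambda>y. (\<Sum>u\<in>A \<union> B. lin (f u) (pos l y u)) = 0 \<longrightarrow> splits f))"
    if "f \<in> ?F" for f
  proof -
    have fZ: "sum f B \<in> Zphi \<times> Zphi" by (rule Zphi_pair_sum) (use that in auto)
    let ?VB = "(\<Sum>u\<in>B. lin (f u) (DB u)) - lin (sum f B) (DB b)"
    let ?VA = "(\<Sum>u\<in>A. lin (f u) (DA u)) + lin (sum f B) (DA a)"
    show ?thesis
    proof (cases "lin (sum f B) d = 0")
      case False
      have "generic (\<lambda>y. (\<Sum>u\<in>A \<union> B. lin (f u) (pos l y u)) \<noteq> 0)" for l
      proof -
        have "generic (\<lambda>y. (?VA + l * ?VB) + lin (sum f B) d * y \<noteq> 0)"
          by (rule generic_affine) (use False in simp)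
        then show ?thesis by (rule generic_mono) (simp add: sum_pos algebra_simps)
      qed
      then have "generic (\<lambda>y. (\<Sum>u\<in>A \<union> B. lin (f u) (pos l y u)) = 0 \<longrightarrow> splits f)" for l
        by (rule generic_mono) auto
      then show ?thesis by (rule genericI)
    next
      case True
      then obtain t where t: "t \<in> Zphi" "t \<noteq> 0 \<longrightarrow> E a b" "\<And>z. lin (sum f B) z = t * ht e z"
        using d_lin[OF fZ] by auto
      show ?thesis
      proof (cases "?VA = 0 \<and> ?VB = 0")
        case True
        then have "splits f" unfolding splits_def using t by (intro bexI[of _ t]) auto
        then show ?thesis by (simp add: generic_const)
      next
        case False
        then have "generic (\<lambda>l. ?VA + ?VB * l \<noteq> 0)" by (intro generic_affine) auto
        then show ?thesis
        proof (rule generic_mono)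
          fix l assume "?VA + ?VB * l \<noteq> 0"
          then show "generic (\<lambda>y. (\<Sum>u\<in>A \<union> B. lin (f u) (pos l y u)) = 0 \<longrightarrow> splits f)"
            using True by (intro genericI) (simp add: sum_pos algebra_simps)
        qed
      qed
    qed
  qed
  have "generic (\<lambda>l. \<forall>f\<in>?F. generic (\<lambda>y. (\<Sum>u\<in>A \<union> B. lin (f u) (pos l y u)) = 0 \<longrightarrow> splits f))"
    by (rule generic_ball[OF cF one])
  then show ?thesis
  proof (rule generic_mono)
    fix l assume "\<forall>f\<in>?F. generic (\<lambda>y. (\<Sum>u\<in>A \<union> B. lin (f u) (pos l y u)) = 0 \<longrightarrow> splits f)"
    then have "generic (\<lambda>y. \<forall>f\<in>?F. (\<Sum>u\<in>A \<union> B. lin (f u) (pos l y u)) = 0 \<longrightarrow> splits f)"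
      by (intro generic_ball[OF cF]) auto
    then show "generic (\<lambda>y. \<forall>f. (\<forall>u\<in>A \<union> B. f u \<in> Zphi \<times> Zphi) \<longrightarrow>
      (\<Sum>u\<in>A \<union> B. lin (f u) (pos l y u)) = 0 \<longrightarrow> splits f)"
    proof (rule generic_mono, intro allI impI)
      fix y f
      assume H: "\<forall>f\<in>?F. (\<Sum>u\<in>A \<union> B. lin (f u) (pos l y u)) = 0 \<longrightarrow> splits f"
        and f: "\<forall>u\<in>A \<union> B. f u \<in> Zphi \<times> Zphi" "(\<Sum>u\<in>A \<union> B. lin (f u) (pos l y u)) = 0"
      let ?g = "restrict f (A \<union> B)"
      have "?g \<in> ?F" using f by (intro PiE_I) auto
      moreover have "(\<Sum>u\<in>A \<union> B. lin (?g u) (pos l y u)) = 0"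
        using f(2) by (subst sum.cong[OF refl]) auto
      ultimately have "splits ?g" using H by blast
      moreover have "sum ?g B = sum f B" "(\<Sum>u\<in>A. lin (?g u) (DA u)) = (\<Sum>u\<in>A. lin (f u) (DA u))"
         "(\<Sum>u\<in>B. lin (?g u) (DB u)) = (\<Sum>u\<in>B. lin (f u) (DB u))"
        by (auto intro!: sum.cong)
      ultimately show "splits f" unfolding splits_def by simp
    qed
  qed
qed

text \<open>For two vertices on one side the determinant is affine in y, with slope the determinant
  of their difference and d. It is constant only if the two lie on a line parallel to the edge; by
  freeness of e this is not the line of the edge, and a generic l keeps the third vertex off
  it.\<close>

lemma generic_noncollinear:
  "generic (\<lambda>l. generic (\<lambda>y. l \<noteq> 0 \<and>
     (\<forall>p\<in>A. \<forall>q\<in>A. \<forall>r\<in>B. p \<noteq> q \<longrightarrow> cr (pos l y q - pos l y p) (pos l y r - pos l y p) \<noteq> 0) \<and>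
     (\<forall>p\<in>A. \<forall>q\<in>B. \<forall>r\<in>B. q \<noteq> r \<longrightarrow> cr (pos l y r - pos l y q) (pos l y p - pos l y q) \<noteq> 0)))"
proof -
  have 0: "generic (\<lambda>l. l \<noteq> 0)" using generic_affine[of 0 1] by simp
  have 1: "generic (\<lambda>l. \<forall>p\<in>A. \<forall>q\<in>A. \<forall>r\<in>B. p \<noteq> q \<longrightarrow> generic (\<lambda>y. cr (pos l y q - pos l y p) (pos l y r - pos l y p) \<noteq> 0))"
  proof (intro generic_ball countable_finite finite)
    fix p q r assume p: "p \<in> A" and q: "q \<in> A" and r: "r \<in> B"
    show "generic (\<lambda>l. p \<noteq> q \<longrightarrow> generic (\<lambda>y. cr (pos l y q - pos l y p) (pos l y r - pos l y p) \<noteq> 0))"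
    proof (cases "p = q")
      case False
      let ?v = "DA q - DA p"
      have eq: "cr (pos l y q - pos l y p) (pos l y r - pos l y p) =
        cr ?v (DA a - DA p + of_real l * (DB r - DB b)) + cr ?v d * y" for l y
      proof -
        have "pos l y r - pos l y p = (DA a - DA p + of_real l * (DB r - DB b)) + of_real y * d"
          using p r by (simp add: pos_A pos_B)
        then show ?thesis using p q by (simp only: cr_linear pos_A) (simp add: algebra_simps)
      qed
      show ?thesis
      proof (cases "cr ?v d = 0")
        case True
        then have ab: "E a b" and h: "ht e (DA q) = ht e (DA p)"
          using d_A[OF q p] False cr_commute[of ?v d] by auto
        have pa: "p \<noteq> a" using e(2)[OF ab] q h False by (auto simp: free_def)
        then have "ht e (DA a) \<noteq> ht e (DA p)" using e(2)[OF ab] p by (auto simp: free_def)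
        then have "generic (\<lambda>l. ht e (DA a - DA p) + ht e (DB r - DB b) * l \<noteq> 0)"
          by (intro generic_affine) (simp add: ht_linear)
        then show ?thesis
        proof (rule generic_mono, intro impI genericI)
          fix l y assume "ht e (DA a - DA p) + ht e (DB r - DB b) * l \<noteq> 0"
          then have "ht e (DA a - DA p + of_real l * (DB r - DB b)) \<noteq> 0" 
            by (simp only: ht_add ht_scale) (simp add: mult.commute)
          moreover have "?v \<noteq> 0" "ht e ?v = 0" using faithfulD(1)[OF fA q p] False h by (auto simp: ht_diff)
          ultimately have "cr ?v (DA a - DA p + of_real l * (DB r - DB b)) \<noteq> 0"
            using ht_parallel by blast
          then show "cr (pos l y q - pos l y p) (pos l y r - pos l y p) \<noteq> 0"
            unfolding eq True by simp
        qed
      next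
        case nz: False
        show ?thesis by (rule genericI, rule impI) (unfold eq, rule generic_affine, use nz in simp)
      qed
    qed (simp add: genericI)
  qed
  have 2: "generic (\<lambda>l. \<forall>p\<in>A. \<forall>q\<in>B. \<forall>r\<in>B. q \<noteq> r \<longrightarrow> generic (\<lambda>y. cr (pos l y r - pos l y q) (pos l y p - pos l y q) \<noteq> 0))"
  proof (intro generic_ball countable_finite finite)
    fix p q r assume p: "p \<in> A" and q: "q \<in> B" and r: "r \<in> B"
    show "generic (\<lambda>l. q \<noteq> r \<longrightarrow> generic (\<lambda>y. cr (pos l y r - pos l y q) (pos l y p - pos l y q) \<noteq> 0))"
    proof (cases "q = r")
      case False
      let ?v = "DB r - DB q"
      have eq: "cr (pos l y r - pos l y q) (pos l y p - pos l y q) =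
        l * (cr ?v (DA p - DA a - of_real l * (DB q - DB b)) + (- cr ?v d) * y)" for l y
      proof -
        have "pos l y r - pos l y q = of_real l * ?v" using q r by (simp add: pos_B algebra_simps)
        moreover have "pos l y p - pos l y q = (DA p - DA a - of_real l * (DB q - DB b)) - of_real y * d"
          using p q by (simp add: pos_A pos_B)
        ultimately show ?thesis by (simp only: cr_linear) (simp add: algebra_simps)
      qed
      show ?thesis
      proof (cases "cr ?v d = 0")
        case True
        then have ab: "E a b" and h: "ht e (DB r) = ht e (DB q)"
          using d_B[OF r q] False cr_commute[of ?v d] by auto
        have "q \<noteq> b" using e(3)[OF ab] r h False by (auto simp: free_def)
        then have "ht e (DB q) \<noteq> ht e (DB b)" using e(3)[OF ab] q by (auto simp: free_def)
        then have "generic (\<lambda>l. ht e (DA p - DA a) + (- ht e (DB q - DB b)) * l \<noteq> 0)"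
          by (intro generic_affine) (simp add: ht_linear)
        then show ?thesis
        proof (rule generic_mono[OF generic_conj[OF _ 0]], intro impI genericI)
          fix l y assume *: "ht e (DA p - DA a) + (- ht e (DB q - DB b)) * l \<noteq> 0 \<and> l \<noteq> 0"
          then have "ht e (DA p - DA a - of_real l * (DB q - DB b)) \<noteq> 0"
            by (simp only: ht_diff ht_scale) (simp add: algebra_simps)
          moreover have "?v \<noteq> 0" "ht e ?v = 0" using faithfulD(1)[OF fB r q] False h by (auto simp: ht_diff)
          ultimately have "cr ?v (DA p - DA a - of_real l * (DB q - DB b)) \<noteq> 0"
            using ht_parallel by blast
          then show "cr (pos l y r - pos l y q) (pos l y p - pos l y q) \<noteq> 0"
            unfolding eq True using * by simp
        qed
      next
        case nz: False
        show ?thesis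
        proof (rule generic_mono[OF 0], intro impI)
          fix l :: real assume "l \<noteq> 0"
          have "generic (\<lambda>y. cr ?v (DA p - DA a - of_real l * (DB q - DB b)) + (- cr ?v d) * y \<noteq> 0)"
            by (rule generic_affine) (use nz in simp)
          then show "generic (\<lambda>y. cr (pos l y r - pos l y q) (pos l y p - pos l y q) \<noteq> 0)"
            by (rule generic_mono) (use \<open>l \<noteq> 0\<close> in \<open>simp add: eq\<close>)
        qed
      qed
    qed (simp add: genericI)
  qed
  show ?thesis
  proof (rule generic_mono[OF generic_conj[OF 0 generic_conj[OF 1 2]]])
    fix l
    assume *: "l \<noteq> 0 \<and> (\<forall>p\<in>A. \<forall>q\<in>A. \<forall>r\<in>B. p \<noteq> q \<longrightarrow> generic (\<lambda>y. cr (pos l y q - pos l y p) (pos l y r - pos l y p) \<noteq> 0)) \<and>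
      (\<forall>p\<in>A. \<forall>q\<in>B. \<forall>r\<in>B. q \<noteq> r \<longrightarrow> generic (\<lambda>y. cr (pos l y r - pos l y q) (pos l y p - pos l y q) \<noteq> 0))"
    show "generic (\<lambda>y. l \<noteq> 0 \<and>
     (\<forall>p\<in>A. \<forall>q\<in>A. \<forall>r\<in>B. p \<noteq> q \<longrightarrow> cr (pos l y q - pos l y p) (pos l y r - pos l y p) \<noteq> 0) \<and>
     (\<forall>p\<in>A. \<forall>q\<in>B. \<forall>r\<in>B. q \<noteq> r \<longrightarrow> cr (pos l y r - pos l y q) (pos l y p - pos l y q) \<noteq> 0))"
    proof (intro generic_conj generic_ball countable_finite finite)
      show "generic (\<lambda>y. l \<noteq> 0)" using * by (simp add: generic_const)
      fix p q r assume "p \<in> A" "q \<in> A" "r \<in> B"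
      then show "generic (\<lambda>y. p \<noteq> q \<longrightarrow> cr (pos l y q - pos l y p) (pos l y r - pos l y p) \<noteq> 0)"
        using * by (cases "p = q") (auto simp: genericI)
    next
      fix p q r assume "p \<in> A" "q \<in> B" "r \<in> B"
      then show "generic (\<lambda>y. q \<noteq> r \<longrightarrow> cr (pos l y r - pos l y q) (pos l y p - pos l y q) \<noteq> 0)"
        using * by (cases "q = r") (auto simp: genericI)
    qed
  qed
qed

end

lemma separatedD:
  assumes "separated V E R D" "p \<in> V" "q \<in> V" "r \<in> V" "p \<noteq> q" "p \<noteq> r" "q \<noteq> r" "(p, q) \<in> R"
    "deg V E p < 3" "deg V E q < 3" "free V D p s" "free V D q s"
    "bad_ratio A B \<or> near_ratio A B \<and> (p, r) \<in> R \<and> (q, r) \<in> R \<and> deg V E r < 3 \<and> free V D r s"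
  shows "- A * ht s (D p) + B * ht s (D q) + (A - B) * ht s (D r) \<noteq> 0"
  using assms unfolding separated_def by blast

lemma nonrigidD:
  assumes "nonrigid V E D" "p \<in> V" "q \<in> V" "c \<in> Zphi \<times> Zphi" "p \<noteq> q" "\<not> E p q" "c \<noteq> 0"
    "lin c (D p) = lin c (D q)"
  obtains X where "X \<subseteq> V" "p \<in> X" "q \<in> X" "defect E X \<le> 2"
  using assms(1)[unfolded nonrigid_def, rule_format, OF assms(2-8)] that by auto

lemma htc_ht: 
  assumes "\<And>z. k * ht s z = t * ht e z" "k \<noteq> 0"
  shows "t \<noteq> 0" "ht s z = ht s w \<longleftrightarrow> ht e z = ht e w"
proof -
  show "t \<noteq> 0" using assms(1)[of "dir (s + 1)"] assms(2) by (auto simp: ht_dir sn_1)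
  then show "ht s z = ht s w \<longleftrightarrow> ht e z = ht e w" using assms(1)[of z] assms(1)[of w] assms(2)
    by (metis mult_left_cancel)
qed

context glue
begin

definition glued :: "real \<Rightarrow> real \<Rightarrow> bool" where
  "glued l y \<longleftrightarrow> (\<forall>f. (\<forall>u\<in>A \<union> B. f u \<in> Zphi \<times> Zphi) \<longrightarrow>
      (\<Sum>u\<in>A \<union> B. lin (f u) (pos l y u)) = 0 \<longrightarrow> splits f) \<and> l \<noteq> 0 \<and>
     (\<forall>p\<in>A. \<forall>q\<in>A. \<forall>r\<in>B. p \<noteq> q \<longrightarrow> cr (pos l y q - pos l y p) (pos l y r - pos l y p) \<noteq> 0) \<and>
     (\<forall>p\<in>A. \<forall>q\<in>B. \<forall>r\<in>B. q \<noteq> r \<longrightarrow> cr (pos l y r - pos l y q) (pos l y p - pos l y q) \<noteq> 0)"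

lemma glued_ex: "\<exists>l y. glued l y"
proof -
  have "generic (\<lambda>l. generic (\<lambda>y. glued l y))"
    by (rule generic_mono[OF generic_conj[OF generic_splits generic_noncollinear]], elim conjE)
      (simp add: glued_def generic_conj)
  then show ?thesis using generic_ex by blast
qed

context
  fixes l y :: real
  assumes glued: "glued l y"
begin

lemma l_nz: "l \<noteq> 0" using glued by (simp add: glued_def)

lemma ht_pos_eq_B: "u \<in> B \<Longrightarrow> w \<in> B \<Longrightarrow> ht s (pos l y u) = ht s (pos l y w) \<longleftrightarrow> ht s (DB u) = ht s (DB w)"
  using l_nz by (simp add: pos_B ht_add ht_scale ht_diff)

lemma ht_pos_a_b: "E a b \<Longrightarrow> ht e (pos l y a) = ht e (pos l y b)"
proof -
  assume ab: "E a b"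
  have "ht e (pos l y b) = ht e (DA a + of_real y * d)" by (simp add: pos_B[OF b])
  then show ?thesis by (simp add: pos_A[OF a] ht_add ht_scale e(1)[OF ab])
qed

text \<open>Take the coefficients c at p and -c at q. The split puts p on the edge line through a
  and q on the one through b, where freeness leaves only a and b themselves.\<close>

lemma two_points:
  assumes p: "p \<in> A" and q: "q \<in> B" and c: "c \<in> Zphi \<times> Zphi" "c \<noteq> 0"
    and eq: "lin c (pos l y p) = lin c (pos l y q)"
  obtains t where "t \<noteq> 0" "E a b" "p = a" "q = b" "\<And>z. lin c z = t * ht e z"
proof -
  have pq: "p \<noteq> q" "p \<notin> B" "q \<notin> A" using p q disjoint by auto
  define f where "f u = (if u = p then c else if u = q then - c else 0)" for u
  have "f u \<in> Zphi \<times> Zphi" for u using c(1) by (auto simp: f_def mem_Times_iff intro!: Zphi_intros)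
  moreover have s: "(\<Sum>u\<in>S. lin (f u) (g u)) = (if p \<in> S then lin c (g p) else 0) - (if q \<in> S then lin c (g q) else 0)"
    if "Finite_Set.finite S" for S g
  proof -
    have "(\<Sum>u\<in>S. lin (f u) (g u)) = (\<Sum>u\<in>S. (if u = p then 1 else if u = q then -1 else 0) * lin c (g u))"
      by (intro sum.cong) (auto simp: f_def lin_coeff)
    then show ?thesis using sum_two[OF that pq(1)] by simp
  qed
  ultimately have "splits f"
    using glued eq p q pq finite by (auto simp: glued_def)
  then obtain t where t: "t \<noteq> 0 \<longrightarrow> E a b" "\<And>z. lin (sum f B) z = t * ht e z"
     "lin c (DA p) + t * ht e (DA a) = 0" "- lin c (DB q) = t * ht e (DB b)"
    unfolding splits_def s[OF finite(1)] s[OF finite(2)] using p q pq by auto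
  have "sum f B = (\<Sum>u\<in>B. if u = q then - c else 0)" using pq by (intro sum.cong) (auto simp: f_def)
  then have sf: "sum f B = - c" using finite q by simp
  then have tc: "lin c z = (- t) * ht e z" for z using t(2)[of z] by (simp add: lin_coeff)
  have "t \<noteq> 0" using tc lin_eq_0[of c] c(2) by auto
  then have ab: "E a b" using t by simp
  have "ht e (DA p) = ht e (DA a)" using t(3) tc[of "DA p"] \<open>t \<noteq> 0\<close> by simp
  then have "p = a" using e(2)[OF ab] p by (auto simp: free_def)
  have "ht e (DB q) = ht e (DB b)" using t(4) tc[of "DB q"] \<open>t \<noteq> 0\<close> by simp
  then have "q = b" using e(3)[OF ab] q by (auto simp: free_def)
  show ?thesis by (rule that[of "- t"]) (use \<open>t \<noteq> 0\<close> ab \<open>p = a\<close> \<open>q = b\<close> tc in auto)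
qed

lemma cross_adj:
  assumes "p \<in> A" "q \<in> B"
  shows "pos l y p \<noteq> pos l y q" "E p q \<longleftrightarrow> (\<exists>s. ht s (pos l y p) = ht s (pos l y q))"
proof -
  have imp: "E p q \<and> 5 dvd (s - e)" if "ht s (pos l y p) = ht s (pos l y q)" for s
  proof -
    have "htc s \<noteq> 0"
    proof
      assume "htc s = 0"
      then have "ht s (dir (s + 1)) = 0" using lin_htc[of s] by (simp add: lin_coeff)
      then show False by (simp add: ht_dir sn_1)
    qed
    moreover have "lin (htc s) (pos l y p) = lin (htc s) (pos l y q)" using that by (simp add: lin_htc)
    ultimately obtain t where t: "t \<noteq> 0" "E a b" "p = a" "q = b" "\<And>z. lin (htc s) z = t * ht e z"
      by (rule two_points[OF assms htc_Zphi]) blast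
    have "ht s (dir e) = 0" using t(5)[of "dir e"] by (simp add: lin_htc ht_dir sn_0)
    then have "5 dvd (e - s)" by (simp add: ht_dir sn_eq_0_iff)
    then have "5 dvd (s - e)" by presburger
    then show ?thesis using t(2-4) by simp
  qed
  show "E p q \<longleftrightarrow> (\<exists>s. ht s (pos l y p) = ht s (pos l y q))"
  proof
    assume ab: "E p q"
    then have "p = a" "q = b" using cross[OF assms] by auto
    then show "\<exists>s. ht s (pos l y p) = ht s (pos l y q)" using ht_pos_a_b ab by blast
  next
    assume "\<exists>s. ht s (pos l y p) = ht s (pos l y q)"
    then show "E p q" using imp by blast
  qed
  show "pos l y p \<noteq> pos l y q"
  proof
    assume "pos l y p = pos l y q"
    then have "5 dvd (e + 1 - e)" using imp[of "e + 1"] by simp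
    then show False by simp
  qed
qed

lemma faithful_pos: "faithful (A \<union> B) E (pos l y)"
proof -
  have 1: "pos l y p \<noteq> pos l y q \<and> (E p q \<longleftrightarrow> (\<exists>s. ht s (pos l y p) = ht s (pos l y q)))"
    if V: "p \<in> A \<union> B" "q \<in> A \<union> B" and ne: "p \<noteq> q" for p q
  proof -
    consider "p \<in> A" "q \<in> A" | "p \<in> B" "q \<in> B" | "p \<in> A" "q \<in> B" | "q \<in> A" "p \<in> B" using V by blast
    then show ?thesis
    proof cases
      case 1
      then show ?thesis using faithfulD(1,2)[OF fA 1 ne] by (simp add: pos_A)
    next
      case 2
      have "pos l y p - pos l y q = of_real l * (DB p - DB q)" using 2 by (simp add: pos_B algebra_simps)
      then have "pos l y p \<noteq> pos l y q" using faithfulD(1)[OF fB 2 ne] l_nz by auto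
      then show ?thesis using faithfulD(2)[OF fB 2 ne] ht_pos_eq_B[OF 2] by simp
    next
      case 3
      then show ?thesis using cross_adj by simp
    next
      case 4
      have "E p q \<longleftrightarrow> E q p" using sym by blast
      moreover have "(\<exists>s. ht s (pos l y p) = ht s (pos l y q)) \<longleftrightarrow> (\<exists>s. ht s (pos l y q) = ht s (pos l y p))"
        by (simp add: eq_commute)
      ultimately show ?thesis using cross_adj[OF 4] by simp
    qed
  qed
  have c1: "cr (pos l y q - pos l y p) (pos l y r - pos l y p) \<noteq> 0" if "p \<in> A" "q \<in> A" "r \<in> B" "p \<noteq> q" for p q r
    using glued that by (simp add: glued_def)
  have c2: "cr (pos l y r - pos l y q) (pos l y p - pos l y q) \<noteq> 0" if "p \<in> A" "q \<in> B" "r \<in> B" "q \<noteq> r" for p q r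
    using glued that by (simp add: glued_def)
  have 2: "cr (pos l y q - pos l y p) (pos l y r - pos l y p) \<noteq> 0"
    if V: "p \<in> A \<union> B" "q \<in> A \<union> B" "r \<in> A \<union> B" and ne: "p \<noteq> q" "p \<noteq> r" "q \<noteq> r" for p q r
  proof -
    consider "p \<in> A" "q \<in> A" "r \<in> A" | "p \<in> B" "q \<in> B" "r \<in> B"
      | "p \<in> A" "q \<in> A" "r \<in> B" | "p \<in> A" "q \<in> B" "r \<in> A" | "p \<in> B" "q \<in> A" "r \<in> A"
      | "p \<in> A" "q \<in> B" "r \<in> B" | "p \<in> B" "q \<in> A" "r \<in> B" | "p \<in> B" "q \<in> B" "r \<in> A" using V by blast
    then show ?thesis
    proof cases
      case 1
      then show ?thesis using faithfulD(3)[OF fA 1(1,2) ne(1) 1(3) ne(2,3)] by (simp add: pos_A)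
    next
      case 2
      have e1: "pos l y q - pos l y p = of_real l * (DB q - DB p)"
        and e2: "pos l y r - pos l y p = of_real l * (DB r - DB p)" using 2 by (simp_all add: pos_B algebra_simps)
      show ?thesis using faithfulD(3)[OF fB 2(1,2) ne(1) 2(3) ne(2,3)] l_nz
        unfolding e1 e2 by (simp only: cr_linear(5,6)) simp
    next
      case 3 then show ?thesis using c1[OF 3] ne by simp
    next
      case 4 then show ?thesis using c1[OF 4(1,3,2)] ne cr_swap[of "pos l y q" "pos l y p" "pos l y r"] by simp
    next
      case 5 then show ?thesis using c1[OF 5(2,3,1)] ne cr_rotate[of "pos l y q" "pos l y p" "pos l y r"] by simp
    next
      case 6 then show ?thesis using c2[OF 6] ne cr_rotate[of "pos l y q" "pos l y p" "pos l y r"] by simp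
    next
      case 7 then show ?thesis using c2[OF 7(2,1,3)] ne cr_swap[of "pos l y q" "pos l y p" "pos l y r"] by simp
    next
      case 8 then show ?thesis using c2[OF 8(3,1,2)] ne by simp
    qed
  qed
  show ?thesis unfolding faithful_def using 1 2 by blast
qed

lemma free_A: "u \<in> A \<Longrightarrow> free (A \<union> B) (pos l y) u s \<Longrightarrow> free A DA u s"
  by (rule free_mono[where V="A \<union> B" and D="pos l y"]) (auto simp: pos_A)
lemma free_B:
  assumes "u \<in> B" "free (A \<union> B) (pos l y) u s"
  shows "free B DB u s"
  unfolding free_def
proof (intro ballI impI)
  fix w assume w: "w \<in> B" "w \<noteq> u"
  then have "ht s (pos l y u) \<noteq> ht s (pos l y w)" using assms(2) by (simp add: free_def)
  then show "ht s (DB u) \<noteq> ht s (DB w)" using ht_pos_eq_B[OF assms(1) w(1)] by simp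
qed

lemma deg_A: 
  assumes u: "u \<in> A"
  shows "deg (A \<union> B) E u = deg A E u + (if E a b \<and> u = a then 1 else 0)"
proof -
  have "b \<notin> A" using b disjoint by auto
  moreover have "E u w \<longleftrightarrow> E a b \<and> u = a \<and> w = b" if "w \<in> B" for w
    using cross[OF u that] by blast
  then have "{w \<in> A \<union> B. E u w} = (if E a b \<and> u = a then insert b {w \<in> A. E u w} else {w \<in> A. E u w})"
    using b by (auto split: if_split)
  ultimately show ?thesis unfolding deg_def using finite(1) by simp
qed

lemma deg_B:
  assumes u: "u \<in> B"
  shows "deg (A \<union> B) E u = deg B E u + (if E a b \<and> u = b then 1 else 0)"
proof -
  have "a \<notin> B" using a disjoint by auto
  moreover have "E u w \<longleftrightarrow> E a b \<and> u = b \<and> w = a" if "w \<in> A" for w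
    using cross[OF that u] sym[of u w] sym[of w u] by blast
  then have "{w \<in> A \<union> B. E u w} = (if E a b \<and> u = b then insert a {w \<in> B. E u w} else {w \<in> B. E u w})"
    using a by (auto split: if_split)
  ultimately show ?thesis unfolding deg_def using finite(2) by simp
qed

text \<open>Let k be the total coefficient on B. Since A, B and A - B are nonzero, k = 0 means that
  all three vertices lie in one part. If k is not 0, the slope is that of the edge, so a and b are
  not free and can occur only as r; then r is exchanged for the other end of the edge, and the part
  containing p and q gives the contradiction.\<close>

lemma separated_pos:
  assumes sA: "separated A E (R \<inter> {(p, q). deg (A \<union> B) E p < 3 \<and> deg (A \<union> B) E q < 3}) DA"
    and sB: "separated B E (R \<inter> {(p, q). deg (A \<union> B) E p < 3 \<and> deg (A \<union> B) E q < 3}) DB"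
  shows "separated (A \<union> B) E R (pos l y)"
  unfolding separated_def
proof (intro ballI allI impI notI)
  fix p q r s \<alpha> \<beta>
  assume in_V: "p \<in> A \<union> B" "q \<in> A \<union> B" "r \<in> A \<union> B" and ne: "p \<noteq> q" "p \<noteq> r" "q \<noteq> r"
    and R: "(p, q) \<in> R" "deg (A \<union> B) E p < 3" "deg (A \<union> B) E q < 3"
    and fr: "free (A \<union> B) (pos l y) p s" "free (A \<union> B) (pos l y) q s"
    and ratio: "bad_ratio \<alpha> \<beta> \<or> near_ratio \<alpha> \<beta> \<and> (p, r) \<in> R \<and> (q, r) \<in> R \<and>
       deg (A \<union> B) E r < 3 \<and> free (A \<union> B) (pos l y) r s"
    and eq: "- \<alpha> * ht s (pos l y p) + \<beta> * ht s (pos l y q) + (\<alpha> - \<beta>) * ht s (pos l y r) = 0"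
  have nz: "\<alpha> \<noteq> 0" "\<beta> \<noteq> 0" "\<alpha> \<noteq> \<beta>"
    using ratio bad_ratio_nz[of \<alpha> \<beta>] near_ratio_nz[of \<alpha> \<beta>] by blast+
  have Z: "\<alpha> \<in> Zphi" "\<beta> \<in> Zphi" using ratio by (auto simp: bad_ratio_def near_ratio_def)
  define g where "g u = (if u = p then - \<alpha> else if u = q then \<beta> else if u = r then \<alpha> - \<beta> else 0)" for u
  have gs: "(\<Sum>u\<in>S. g u * x u) = (if p \<in> S then - \<alpha> * x p else 0) + (if q \<in> S then \<beta> * x q else 0)
      + (if r \<in> S then (\<alpha> - \<beta>) * x r else 0)" if "Finite_Set.finite S" for S x
    unfolding g_def by (rule sum_three[OF that ne])
  define f where "f u = g u *\<^sub>R htc s" for u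
  have "g u \<in> Zphi" for u using Z by (auto simp: g_def intro!: Zphi_intros)
  then have "f u \<in> Zphi \<times> Zphi" for u using htc_Zphi[of s]
    by (auto simp: f_def mem_Times_iff intro!: Zphi_intros)
  moreover have lf: "lin (f u) z = g u * ht s z" for u z by (simp add: f_def lin_coeff lin_htc)
  moreover have "(\<Sum>u\<in>A \<union> B. g u * ht s (pos l y u)) = 0"
    using eq in_V by (subst gs) (use finite in auto)
  ultimately have "splits f" using glued by (simp add: glued_def)
  define k where "k = (\<Sum>u\<in>B. g u)"
  have "lin (sum f B) z = k * ht s z" for z unfolding lin_sum lf k_def by (simp add: sum_distrib_right)
  then obtain t where t: "t \<noteq> 0 \<longrightarrow> E a b" "\<And>z. k * ht s z = t * ht e z"
     "(\<Sum>u\<in>A. g u * ht s (DA u)) + k * ht s (DA a) = 0" "(\<Sum>u\<in>B. g u * ht s (DB u)) = k * ht s (DB b)"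
    using \<open>splits f\<close> unfolding splits_def lf by auto
  have k: "k = (if p \<in> B then - \<alpha> else 0) + (if q \<in> B then \<beta> else 0) + (if r \<in> B then \<alpha> - \<beta> else 0)"
    unfolding k_def using gs[OF finite(2), of "\<lambda>_. 1"] by simp
  note EA = t(3)[unfolded gs[OF finite(1)]] and EB = t(4)[unfolded gs[OF finite(2)]]
  have dj: "\<And>x. x \<in> A \<Longrightarrow> x \<notin> B" "\<And>x. x \<in> B \<Longrightarrow> x \<notin> A" using disjoint by auto
  have dm: "deg A E u \<le> deg (A \<union> B) E u" if "u \<in> A" for u using deg_A[OF that] by simp
  have dmB: "deg B E u \<le> deg (A \<union> B) E u" if "u \<in> B" for u using deg_B[OF that] by simp
  show False
  proof (cases "k = 0")
    case True
    then consider "p \<in> A" "q \<in> A" "r \<in> A" | "p \<in> B" "q \<in> B" "r \<in> B"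
    proof (cases "p \<in> A"; cases "q \<in> A"; cases "r \<in> A")
    qed (use in_V nz dj k in \<open>simp_all\<close>)
    then show False
    proof cases
      case 1
      have "- \<alpha> * ht s (DA p) + \<beta> * ht s (DA q) + (\<alpha> - \<beta>) * ht s (DA r) = 0" using EA True 1 by simp
      moreover have "- \<alpha> * ht s (DA p) + \<beta> * ht s (DA q) + (\<alpha> - \<beta>) * ht s (DA r) \<noteq> 0"
      proof (rule separatedD[OF sA 1 ne])
        show "deg A E p < 3" "deg A E q < 3" using R dm[OF 1(1)] dm[OF 1(2)] by simp_all
        show "bad_ratio \<alpha> \<beta> \<or> near_ratio \<alpha> \<beta> \<and> (p, r) \<in> R \<inter> {(p, q). deg (A \<union> B) E p < 3 \<and> deg (A \<union> B) E q < 3} \<and> (q, r) \<in> R \<inter> {(p, q). deg (A \<union> B) E p < 3 \<and> deg (A \<union> B) E q < 3} \<and> deg A E r < 3 \<and> free A DA r s"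
          using ratio R dm[OF 1(3)] free_A[OF 1(3)] by auto
      qed (use R free_A[OF 1(1) fr(1)] free_A[OF 1(2) fr(2)] in simp_all)
      ultimately show False by simp
    next
      case 2
      have "- \<alpha> * ht s (DB p) + \<beta> * ht s (DB q) + (\<alpha> - \<beta>) * ht s (DB r) = 0" using EB True 2 by simp
      moreover have "- \<alpha> * ht s (DB p) + \<beta> * ht s (DB q) + (\<alpha> - \<beta>) * ht s (DB r) \<noteq> 0"
      proof (rule separatedD[OF sB 2 ne])
        show "deg B E p < 3" "deg B E q < 3" using R dmB[OF 2(1)] dmB[OF 2(2)] by simp_all
        show "bad_ratio \<alpha> \<beta> \<or> near_ratio \<alpha> \<beta> \<and> (p, r) \<in> R \<inter> {(p, q). deg (A \<union> B) E p < 3 \<and> deg (A \<union> B) E q < 3} \<and> (q, r) \<in> R \<inter> {(p, q). deg (A \<union> B) E p < 3 \<and> deg (A \<union> B) E q < 3} \<and> deg B E r < 3 \<and> free B DB r s"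
          using ratio R dmB[OF 2(3)] free_B[OF 2(3)] by auto
      qed (use R free_B[OF 2(1) fr(1)] free_B[OF 2(2) fr(2)] in simp_all)
      ultimately show False by simp
    qed
  next
    case False
    note se = htc_ht[OF t(2) False]
    have ab: "E a b" using t(1) se(1) by simp
    have fa: "free A DA a s" and fb: "free B DB b s"
      using e(2,3)[OF ab] se(2) by (auto simp: free_def)
    have Dab: "ht s (pos l y a) = ht s (pos l y b)" using ht_pos_a_b[OF ab] se(2) by simp
    have ab_ne: "a \<noteq> b" using a b disjoint by auto
    have nfree: "\<not> free (A \<union> B) (pos l y) a s" "\<not> free (A \<union> B) (pos l y) b s"
      using Dab a b ab_ne by (auto simp: free_def)
    then have pq: "p \<noteq> a" "p \<noteq> b" "q \<noteq> a" "q \<noteq> b" using fr by auto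
    have A1: "ht s (DA u) \<noteq> ht s (DA a)" if "u \<in> A" "u \<noteq> a" for u using fa that by (auto simp: free_def)
    have B1: "ht s (DB u) \<noteq> ht s (DB b)" if "u \<in> B" "u \<noteq> b" for u using fb that by (auto simp: free_def)
    have bad: "bad_ratio \<alpha> \<beta>" if "r = a \<or> r = b" using ratio that nfree by auto
    have key1: False if h: "r = a" "p \<in> B" "q \<in> B"
    proof -
      have kk: "k = - \<alpha> + \<beta>" using k h a dj by simp
      have "- \<alpha> * ht s (DB p) + \<beta> * ht s (DB q) + (\<alpha> - \<beta>) * ht s (DB b) = 0"
        using EB h a dj by (simp add: kk algebra_simps)
      then show False using sB[unfolded separated_def, rule_format, of p q b s \<alpha> \<beta>] h b ne(1) pq R bad
          dmB[OF h(2)] dmB[OF h(3)] free_B[OF h(2) fr(1)] free_B[OF h(3) fr(2)] by simp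
    qed
    have key2: False if h: "r = b" "p \<in> A" "q \<in> A"
    proof -
      have kk: "k = \<alpha> - \<beta>" using k h b dj by simp
      have "- \<alpha> * ht s (DA p) + \<beta> * ht s (DA q) + (\<alpha> - \<beta>) * ht s (DA a) = 0"
        using EA h b dj by (simp add: kk algebra_simps)
      then show False using sA[unfolded separated_def, rule_format, of p q a s \<alpha> \<beta>] h a ne(1) pq R bad
          dm[OF h(2)] dm[OF h(3)] free_A[OF h(2) fr(1)] free_A[OF h(3) fr(2)] by simp
    qed
    consider "p \<in> A" "q \<in> A" "r \<in> A" | "p \<in> B" "q \<in> B" "r \<in> B"
      | "p \<in> A" "q \<in> A" "r \<in> B" | "p \<in> A" "q \<in> B" "r \<in> A" | "p \<in> B" "q \<in> A" "r \<in> A"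
      | "p \<in> A" "q \<in> B" "r \<in> B" | "p \<in> B" "q \<in> A" "r \<in> B" | "p \<in> B" "q \<in> B" "r \<in> A" using in_V by blast
    then show False
    proof cases
      case 1 then show False using False k dj by simp
    next
      case 2 then show False using False k by simp
    next
      case 3
      have kk: "k = \<alpha> - \<beta>" using k 3 dj by simp
      have "(\<alpha> - \<beta>) * ht s (DB r) = (\<alpha> - \<beta>) * ht s (DB b)" using EB 3 dj by (auto simp: kk algebra_simps)
      then have "ht s (DB r) = ht s (DB b)" using nz by simp
      then have "r = b" using B1[OF 3(3)] by blast
      then show False using key2 3 by blast
    next
      case 4
      have kk: "k = \<beta>" using k 4 dj by simp
      have "(\<beta>) * ht s (DB q) = (\<beta>) * ht s (DB b)" using EB 4 dj by (auto simp: kk algebra_simps)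
      then have "ht s (DB q) = ht s (DB b)" using nz by simp
      then have "q = b" using B1[OF 4(2)] by blast
      then show False using pq by blast
    next
      case 5
      have kk: "k = - \<alpha>" using k 5 dj by simp
      have "(- \<alpha>) * ht s (DB p) = (- \<alpha>) * ht s (DB b)" using EB 5 dj by (auto simp: kk algebra_simps)
      then have "ht s (DB p) = ht s (DB b)" using nz by simp
      then have "p = b" using B1[OF 5(1)] by blast
      then show False using pq by blast
    next
      case 6
      have kk: "k = - (- \<alpha>)" using k 6 dj by simp
      have "(- \<alpha>) * ht s (DA p) = (- \<alpha>) * ht s (DA a)" using EA 6 dj by (auto simp: kk algebra_simps)
      then have "ht s (DA p) = ht s (DA a)" using nz by simp
      then have "p = a" using A1[OF 6(1)] by blast
      then show False using pq by blast
    next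
      case 7
      have kk: "k = - (\<beta>)" using k 7 dj by simp
      have "(\<beta>) * ht s (DA q) = (\<beta>) * ht s (DA a)" using EA 7 dj by (auto simp: kk algebra_simps)
      then have "ht s (DA q) = ht s (DA a)" using nz by simp
      then have "q = a" using A1[OF 7(2)] by blast
      then show False using pq by blast
    next
      case 8
      have kk: "k = - (\<alpha> - \<beta>)" using k 8 dj by simp
      have "(\<alpha> - \<beta>) * ht s (DA r) = (\<alpha> - \<beta>) * ht s (DA a)" using EA 8 dj by (auto simp: kk algebra_simps)
      then have "ht s (DA r) = ht s (DA a)" using nz by simp
      then have "r = a" using A1[OF 8(3)] by blast
      then show False using key1 8 by blast
    qed
  qed
qed

lemma nonrigid_pos:
  assumes nA: "nonrigid A E DA" and nB: "nonrigid B E DB"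
  shows "nonrigid (A \<union> B) E (pos l y)"
  unfolding nonrigid_def
proof (intro ballI impI)
  fix p q c
  assume in_V: "p \<in> A \<union> B" "q \<in> A \<union> B" and c: "c \<in> Zphi \<times> Zphi" "c \<noteq> 0" and pq: "p \<noteq> q" "\<not> E p q"
    and eq: "lin c (pos l y p) = lin c (pos l y q)"
  consider "p \<in> A" "q \<in> A" | "p \<in> B" "q \<in> B" | "p \<in> A" "q \<in> B" | "q \<in> A" "p \<in> B" using in_V by blast
  then show "\<exists>X\<subseteq>A \<union> B. p \<in> X \<and> q \<in> X \<and> defect E X \<le> 2"
  proof cases
    case 1
    then have "lin c (DA p) = lin c (DA q)" using eq by (simp add: pos_A)
    then obtain X where "X \<subseteq> A" "p \<in> X" "q \<in> X" "defect E X \<le> 2"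
      by (rule nonrigidD[OF nA 1 c(1) pq c(2)])
    then show ?thesis by (intro exI[of _ X]) auto
  next
    case 2
    then have "lin c (DB p) = lin c (DB q)" using eq l_nz by (simp add: pos_B lin_linear)
    then obtain X where "X \<subseteq> B" "p \<in> X" "q \<in> X" "defect E X \<le> 2"
      by (rule nonrigidD[OF nB 2 c(1) pq c(2)])
    then show ?thesis by (intro exI[of _ X]) auto
  next
    case 3
    obtain t where "t \<noteq> 0" "E a b" "p = a" "q = b" "\<And>z. lin c z = t * ht e z"
      by (rule two_points[OF 3 c eq]) blast
    then show ?thesis using pq by simp
  next
    case 4
    obtain t where "t \<noteq> 0" "E a b" "q = a" "p = b" "\<And>z. lin c z = t * ht e z"
      by (rule two_points[OF 4 c eq[symmetric]]) blast
    then show ?thesis using pq sym[of a b] by simp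
  qed
qed

end
end

lemma indepD:
  assumes "indep V E D" "slots V E D \<kappa>" "(\<Sum>u\<in>V. \<Sum>s\<in>{0..<5}. \<kappa> u s * ht s (D u)) = 0"
  obtains Y where "closed_in V E Y" "\<And>u. u \<in> Y \<Longrightarrow> card (supp \<kappa> u) + deg V E u = 3"
    "\<And>u. u \<in> V \<Longrightarrow> u \<notin> Y \<Longrightarrow> supp \<kappa> u = {}"
proof -
  obtain Y where Y: "closed_in V E Y" "\<forall>u\<in>Y. card (supp \<kappa> u) + deg V E u = 3" "\<forall>u\<in>V - Y. supp \<kappa> u = {}"
    using assms unfolding indep_def by blast
  show thesis by (rule that[OF Y(1)]) (use Y in auto)
qed

lemma not_dvd_slopes:
  fixes s s' :: int
  assumes "s \<in> {0..<5}" "s' \<in> {0..<5}" "s \<noteq> s'"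
  shows "\<not> 5 dvd (s - s')"
  using assms unfolding atLeastLessThan_iff by presburger

lemma finite_supp: "finite (supp \<kappa> u)"
  by (rule finite_subset[of _ "{0..<5}"]) (auto simp: supp_def)

context glue
begin
context
  fixes l y :: real
  assumes glued: "glued l y"
begin

text \<open>The multiple t of the split becomes a coefficient at slope e: t at a, -t at b. In the
  union that slot is taken by the edge, so in each part the new slot just replaces the edge in the
  count. If t = 0 and there is an edge, a and b have room left and lie outside the exceptional sets
  of the parts; if t is not 0, both lie inside. Either way the union of these sets is closed across
  the edge.\<close>

lemma indep_pos:
  assumes iA: "indep A E DA" and iB: "indep B E DB"
  shows "indep (A \<union> B) E (pos l y)"
  unfolding indep_def
proof (intro allI impI)
  fix \<kappa>
  assume sl: "slots (A \<union> B) E (pos l y) \<kappa>"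
    and eq: "(\<Sum>u\<in>A \<union> B. \<Sum>s\<in>{0..<5}. \<kappa> u s * ht s (pos l y u)) = 0"
  have slD: "\<And>s. \<kappa> u s \<in> Zphi" "\<And>s. s \<in> supp \<kappa> u \<Longrightarrow> free (A \<union> B) (pos l y) u s"
     "card (supp \<kappa> u) + deg (A \<union> B) E u \<le> 3" if "u \<in> A \<union> B" for u
    using sl that by (simp_all add: slots_def)
  define f where "f u = (\<Sum>s\<in>{0..<5}. \<kappa> u s *\<^sub>R htc s)" for u
  have lf: "lin (f u) z = (\<Sum>s\<in>{0..<5}. \<kappa> u s * ht s z)" for u z
    by (simp add: f_def lin_sum lin_coeff lin_htc)
  have "f u \<in> Zphi \<times> Zphi" if "u \<in> A \<union> B" for u
    unfolding f_def
  proof (rule Zphi_pair_sum)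
    fix s show "\<kappa> u s *\<^sub>R htc s \<in> Zphi \<times> Zphi" using slD(1)[OF that, of s] htc_Zphi[of s]
      by (auto simp: mem_Times_iff intro!: Zphi_intros)
  qed
  moreover have "(\<Sum>u\<in>A \<union> B. lin (f u) (pos l y u)) = 0" using eq by (simp add: lf)
  ultimately have "splits f" using glued by (simp add: glued_def)
  then obtain t where t: "t \<in> Zphi" "t \<noteq> 0 \<longrightarrow> E a b"
      "(\<Sum>u\<in>A. \<Sum>s\<in>{0..<5}. \<kappa> u s * ht s (DA u)) + t * ht e (DA a) = 0"
      "(\<Sum>u\<in>B. \<Sum>s\<in>{0..<5}. \<kappa> u s * ht s (DB u)) = t * ht e (DB b)"
    by (auto simp: splits_def lf)
  have ab: "a \<noteq> b" "a \<notin> B" "b \<notin> A" using a b disjoint by auto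
  have nf: "\<not> free (A \<union> B) (pos l y) a e" "\<not> free (A \<union> B) (pos l y) b e" if "E a b"
    using ht_pos_a_b[OF glued that] a b ab by (auto simp: free_def)
  have \<kappa>e: "\<kappa> a e = 0" "\<kappa> b e = 0" if "E a b"
    using nf[OF that] slD(2)[of a e] slD(2)[of b e] a b e(4) by (auto simp: supp_def)
  define \<kappa>A where "\<kappa>A u s = \<kappa> u s + (if u = a then if s = e then t else 0 else 0)" for u s
  define \<kappa>B where "\<kappa>B u s = \<kappa> u s + (if u = b then if s = e then - t else 0 else 0)" for u s
  have sA: "supp \<kappa>A u = (if u = a \<and> t \<noteq> 0 then insert e (supp \<kappa> u) else supp \<kappa> u)" for u
    using \<kappa>e t(2) e(4) by (auto simp: supp_def \<kappa>A_def)
  have sB: "supp \<kappa>B u = (if u = b \<and> t \<noteq> 0 then insert e (supp \<kappa> u) else supp \<kappa> u)" for u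
    using \<kappa>e t(2) e(4) by (auto simp: supp_def \<kappa>B_def)
  have en: "e \<notin> supp \<kappa> a" "e \<notin> supp \<kappa> b" if "t \<noteq> 0" using \<kappa>e t(2) that by (auto simp: supp_def)
  have cA: "card (supp \<kappa>A u) + deg A E u + (if E a b \<and> u = a \<and> t = 0 then 1 else 0)
      = card (supp \<kappa> u) + deg (A \<union> B) E u" if "u \<in> A" for u
    unfolding sA deg_A[OF glued that] using en t(2) by (auto simp: finite_supp)
  have cB: "card (supp \<kappa>B u) + deg B E u + (if E a b \<and> u = b \<and> t = 0 then 1 else 0)
      = card (supp \<kappa> u) + deg (A \<union> B) E u" if "u \<in> B" for u
    unfolding sB deg_B[OF glued that] using en t(2) by (auto simp: finite_supp)
  have slA: "slots A E DA \<kappa>A" unfolding slots_def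
  proof (intro ballI conjI allI)
    fix u s assume u: "u \<in> A"
    show "\<kappa>A u s \<in> Zphi" using slD(1)[of u s] u t(1) by (auto simp: \<kappa>A_def intro!: Zphi_intros)
    show "card (supp \<kappa>A u) + deg A E u \<le> 3" using cA[OF u] slD(3)[of u] u by simp
  next
    fix u s assume u: "u \<in> A" and s: "s \<in> supp \<kappa>A u"
    show "free A DA u s"
    proof (cases "s \<in> supp \<kappa> u")
      case True
      then show ?thesis using free_A[OF glued u slD(2)] u by blast
    next
      case False
      then have "u = a" "t \<noteq> 0" "s = e" using s unfolding sA by (auto split: if_splits)
      then show ?thesis using e(2) t(2) by simp
    qed
  qed
  have slB: "slots B E DB \<kappa>B" unfolding slots_def
  proof (intro ballI conjI allI)
    fix u s assume u: "u \<in> B"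
    show "\<kappa>B u s \<in> Zphi" using slD(1)[of u s] u t(1) by (auto simp: \<kappa>B_def intro!: Zphi_intros)
    show "card (supp \<kappa>B u) + deg B E u \<le> 3" using cB[OF u] slD(3)[of u] u by simp
  next
    fix u s assume u: "u \<in> B" and s: "s \<in> supp \<kappa>B u"
    show "free B DB u s"
    proof (cases "s \<in> supp \<kappa> u")
      case True
      then show ?thesis using free_B[OF glued u slD(2)] u by blast
    next
      case False
      then have "u = b" "t \<noteq> 0" "s = e" using s unfolding sB by (auto split: if_splits)
      then show ?thesis using e(3) t(2) by simp
    qed
  qed
  have d: "(\<Sum>s\<in>{0..<5}. (if u = v then if s = e then c else 0 else 0) * x s) = (if u = v then c * x e else 0)"
    for u v :: 'a and c and x :: "int \<Rightarrow> real"
  proof (cases "u = v")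
    case True
    have "(\<Sum>s\<in>{0..<5}. (if s = e then c else 0) * x s) = (\<Sum>s\<in>{0..<5}. if s = e then c * x s else 0)"
      by (rule sum.cong) auto
    then show ?thesis using True e(4) by simp
  qed simp
  have zA: "(\<Sum>u\<in>A. \<Sum>s\<in>{0..<5}. \<kappa>A u s * ht s (DA u)) = 0"
  proof -
    have "(\<Sum>u\<in>A. \<Sum>s\<in>{0..<5}. \<kappa>A u s * ht s (DA u)) =
       (\<Sum>u\<in>A. (\<Sum>s\<in>{0..<5}. \<kappa> u s * ht s (DA u)) + (if u = a then t * ht e (DA u) else 0))"
      unfolding \<kappa>A_def distrib_right sum.distrib[where A="{0..<5}"] d ..
    also have "\<dots> = 0" using t(3) finite(1) a by (simp add: sum.distrib)
    finally show ?thesis .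
  qed
  have zB: "(\<Sum>u\<in>B. \<Sum>s\<in>{0..<5}. \<kappa>B u s * ht s (DB u)) = 0"
  proof -
    have "(\<Sum>u\<in>B. \<Sum>s\<in>{0..<5}. \<kappa>B u s * ht s (DB u)) =
       (\<Sum>u\<in>B. (\<Sum>s\<in>{0..<5}. \<kappa> u s * ht s (DB u)) + (if u = b then - t * ht e (DB u) else 0))"
      unfolding \<kappa>B_def distrib_right sum.distrib[where A="{0..<5}"] d ..
    also have "\<dots> = 0" using t(4) finite(2) b by (simp add: sum.distrib)
    finally show ?thesis .
  qed
  obtain YA where YA: "closed_in A E YA" "\<And>u. u \<in> YA \<Longrightarrow> card (supp \<kappa>A u) + deg A E u = 3"
    "\<And>u. u \<in> A \<Longrightarrow> u \<notin> YA \<Longrightarrow> supp \<kappa>A u = {}" by (rule indepD[OF iA slA zA]) blast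
  obtain YB where YB: "closed_in B E YB" "\<And>u. u \<in> YB \<Longrightarrow> card (supp \<kappa>B u) + deg B E u = 3"
    "\<And>u. u \<in> B \<Longrightarrow> u \<notin> YB \<Longrightarrow> supp \<kappa>B u = {}" by (rule indepD[OF iB slB zB]) blast
  have sub: "YA \<subseteq> A" "YB \<subseteq> B" using YA(1) YB(1) by (auto simp: closed_in_def)
  have t0: "a \<notin> YA" "b \<notin> YB" if "E a b" "t = 0"
  proof -
    show "a \<notin> YA"
    proof
      assume "a \<in> YA"
      then show False using YA(2)[of a] cA[OF a] slD(3)[of a] a that by simp
    qed
    show "b \<notin> YB"
    proof
      assume "b \<in> YB"
      then show False using YB(2)[of b] cB[OF b] slD(3)[of b] b that by simp
    qed
  qed
  have t1: "a \<in> YA" "b \<in> YB" if "t \<noteq> 0"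
    using YA(3)[OF a] YB(3)[OF b] sA[of a] sB[of b] that by auto
  have cl: "closed_in (A \<union> B) E (YA \<union> YB)" unfolding closed_in_def
  proof (intro conjI ballI impI)
    show "YA \<union> YB \<subseteq> A \<union> B" using sub by blast
    fix x z assume x: "x \<in> YA \<union> YB" and z: "z \<in> A \<union> B" and E: "E x z"
    consider "x \<in> YA" "z \<in> A" | "x \<in> YB" "z \<in> B" | "x \<in> YA" "z \<in> B" | "x \<in> YB" "z \<in> A" using x z by blast
    then show "z \<in> YA \<union> YB"
    proof cases
      case 1 then show ?thesis using YA(1) E unfolding closed_in_def by blast
    next
      case 2 then show ?thesis using YB(1) E unfolding closed_in_def by blast
    next
      case 3
      then have "x = a" "z = b" using cross[of x z] sub E by blast+
      then show ?thesis using t0 t1 3 E by blast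
    next
      case 4
      then have "z = a" "x = b" using cross[of z x] sub sym[OF E] by blast+
      then show ?thesis using t0 t1 4 sym[OF E] by blast
    qed
  qed
  have full: "card (supp \<kappa> u) + deg (A \<union> B) E u = 3" if uY: "u \<in> YA \<union> YB" for u
  proof -
    consider "u \<in> YA" "u \<in> A" | "u \<in> YB" "u \<in> B" using uY sub by blast
    then show ?thesis
    proof cases
      case 1
      then have n: "\<not> (E a b \<and> u = a \<and> t = 0)" using t0 by blast
      then show ?thesis using YA(2)[OF 1(1)] cA[OF 1(2), unfolded if_not_P[OF n]] by simp
    next
      case 2
      then have n: "\<not> (E a b \<and> u = b \<and> t = 0)" using t0 by blast
      then show ?thesis using YB(2)[OF 2(1)] cB[OF 2(2), unfolded if_not_P[OF n]] by simp
    qed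
  qed
  have emp: "supp \<kappa> u = {}" if "u \<in> (A \<union> B) - (YA \<union> YB)" for u
    using that YA(3)[of u] YB(3)[of u] sA[of u] sB[of u] by (auto split: if_splits)
  show "\<exists>Y. closed_in (A \<union> B) E Y \<and> (\<forall>u\<in>Y. card (supp \<kappa> u) + deg (A \<union> B) E u = 3) \<and>
      (\<forall>u\<in>(A \<union> B) - Y. supp \<kappa> u = {})"
    by (intro exI[of _ "YA \<union> YB"] conjI ballI cl full emp)
qed

end
end

text \<open>An occupied slope is occupied by a neighbour, and two slopes never by the same one, as
  two equal heights determine the point.\<close>

lemma card_not_free:
  assumes "finite V" "faithful V E D" "u \<in> V"
  shows "card {s \<in> {0..<5}. \<not> free V D u s} \<le> deg V E u"
proof -
  define g where "g s = (SOME w. w \<in> V \<and> w \<noteq> u \<and> ht s (D u) = ht s (D w))" for s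
  have P: "g s \<in> V \<and> g s \<noteq> u \<and> ht s (D u) = ht s (D (g s))" if nf: "\<not> free V D u s" for s
    unfolding g_def
    by (rule someI_ex[of "\<lambda>w. w \<in> V \<and> w \<noteq> u \<and> ht s (D u) = ht s (D w)"])
      (use nf in \<open>auto simp: free_def\<close>)
  have g: "g s \<in> V" "g s \<noteq> u" "ht s (D u) = ht s (D (g s))" if "\<not> free V D u s" for s
    using P[OF that] by simp_all
  have "g ` {s \<in> {0..<5}. \<not> free V D u s} \<subseteq> {w \<in> V. E u w}"
  proof (rule image_subsetI)
    fix s assume "s \<in> {s \<in> {0..<5}. \<not> free V D u s}"
    then have nf: "\<not> free V D u s" by simp
    show "g s \<in> {w \<in> V. E u w}"
      using g[OF nf] faithfulD(2)[OF assms(2,3) g(1)[OF nf]] by auto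
  qed
  moreover have "inj_on g {s \<in> {0..<5}. \<not> free V D u s}"
  proof (rule inj_onI, rule ccontr)
    fix s s' assume s: "s \<in> {s \<in> {0..<5}. \<not> free V D u s}" "s' \<in> {s \<in> {0..<5}. \<not> free V D u s}"
      and eq: "g s = g s'" "s \<noteq> s'"
    have "\<not> 5 dvd (s - s')" using s eq(2) by (intro not_dvd_slopes) auto
    then have "D u = D (g s)" using ht_inj[of s s' "D u" "D (g s)"] g[of s] g[of s'] s eq by auto
    then show False using faithfulD(1)[OF assms(2,3)] g[of s] s by auto
  qed
  ultimately show ?thesis unfolding deg_def using assms(1) by (intro card_inj_on_le[of g]) auto
qed

lemma deg_less:
  assumes "finite V" "U \<subseteq> V" "w \<in> V" "w \<notin> U" "E u w"
  shows "deg U E u < deg V E u"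
  unfolding deg_def
proof (rule psubset_card_mono)
  have "w \<in> {w \<in> V. E u w}" "w \<notin> {w \<in> U. E u w}" using assms by simp_all
  then show "{w \<in> U. E u w} \<subset> {w \<in> V. E u w}" using assms(2) by blast
qed (use assms in simp)

text \<open>If there is an edge, a and b have degree at most two in their parts and so block at most
  four slopes together; a fifth is left for the edge.\<close>

theorem good_glue:
  assumes fin: "finite A" "finite B" and disj: "A \<inter> B = {}" and ab: "a \<in> A" "b \<in> B"
    and sym: "\<And>x y. E x y \<Longrightarrow> E y x"
    and cross: "\<And>x y. x \<in> A \<Longrightarrow> y \<in> B \<Longrightarrow> E x y \<Longrightarrow> x = a \<and> y = b"
    and deg: "\<And>u. u \<in> A \<union> B \<Longrightarrow> deg (A \<union> B) E u \<le> 3"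
    and gA: "good A E (R \<inter> {(p, q). deg (A \<union> B) E p < 3 \<and> deg (A \<union> B) E q < 3}) DA"
    and gB: "good B E (R \<inter> {(p, q). deg (A \<union> B) E p < 3 \<and> deg (A \<union> B) E q < 3}) DB"
  shows "\<exists>D. good (A \<union> B) E R D"
proof -
  have fA: "faithful A E DA" and fB: "faithful B E DB" using gA gB by (simp_all add: good_def)
  obtain e d where "glue A B E a b e d DA DB"
  proof (cases "E a b")
    case True
    have dA: "deg A E a \<le> 2"
      using deg_less[of "A \<union> B" A b E a] deg[of a] fin ab True disj by fastforce
    have dB: "deg B E b \<le> 2"
      using deg_less[of "A \<union> B" B a E b] deg[of b] fin ab sym[OF True] disj by fastforce
    let ?FA = "{s \<in> {0..<5}. \<not> free A DA a s}" and ?FB = "{s \<in> {0..<5}. \<not> free B DB b s}"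
    have "card (?FA \<union> ?FB) \<le> card ?FA + card ?FB" by (rule card_Un_le)
    also have "\<dots> \<le> 4"
      using card_not_free[OF fin(1) fA ab(1)] card_not_free[OF fin(2) fB ab(2)] dA dB by linarith
    finally have c4: "card (?FA \<union> ?FB) \<le> 4" .
    have "\<not> {0..<5::int} \<subseteq> ?FA \<union> ?FB"
    proof
      assume sub: "{0..<5::int} \<subseteq> ?FA \<union> ?FB"
      have "finite (?FA \<union> ?FB)" by (rule finite_subset[of _ "{0..<5}"]) auto
      from card_mono[OF this sub] c4 show False by simp
    qed
    then obtain e where e: "e \<in> {0..<5}" "free A DA a e" "free B DB b e" by blast
    have "glue A B E a b e (dir e) DA DB"
    proof
      fix c assume c: "c \<in> Zphi \<times> Zphi" "lin c (dir e) = 0"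
      obtain t where "t \<in> Zphi" "\<And>z. lin c z = t * ht e z" by (rule lin_parallel[OF c]) blast
      then show "\<exists>t\<in>Zphi. (t \<noteq> 0 \<longrightarrow> E a b) \<and> (\<forall>z. lin c z = t * ht e z)" using True by blast
    next
      fix u w assume "cr (dir e) (DA u - DA w) = 0"
      then show "E a b \<and> ht e (DA u) = ht e (DA w)" using True sin_pi5_pos by (simp add: cr_dir ht_diff)
    next
      fix u w assume "cr (dir e) (DB u - DB w) = 0"
      then show "E a b \<and> ht e (DB u) = ht e (DB w)" using True sin_pi5_pos by (simp add: cr_dir ht_diff)
    qed (fact fin disj ab sym cross fA fB | simp add: ht_dir sn_0 e del: atLeastLessThan_iff)+
    then show ?thesis by (rule that)
  next
    case False
    let ?W = "(\<lambda>(u, w). DA u - DA w) ` (A \<times> A) \<union> (\<lambda>(u, w). DB u - DB w) ` (B \<times> B) - {0}"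
    obtain d where d: "\<And>c. c \<in> Zphi \<times> Zphi \<Longrightarrow> lin c d = 0 \<Longrightarrow> c = 0" "\<And>w. w \<in> ?W \<Longrightarrow> cr d w \<noteq> 0"
      by (rule irrational_vector[of ?W]) (use fin in auto)
    \<comment> \<open>The slope 0 is a placeholder: without an edge every t is 0.\<close>
    have "glue A B E a b 0 d DA DB"
    proof
      fix c assume c: "c \<in> Zphi \<times> Zphi" "lin c d = 0"
      then have "c = 0" by (rule d(1))
      then show "\<exists>t\<in>Zphi. (t \<noteq> 0 \<longrightarrow> E a b) \<and> (\<forall>z. lin c z = t * ht 0 z)"
        by (intro bexI[of _ 0]) (auto simp: lin_coeff Zphi_0)
    next
      fix u w assume "u \<in> A" "w \<in> A" "u \<noteq> w" "cr d (DA u - DA w) = 0"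
      then show "E a b \<and> ht 0 (DA u) = ht 0 (DA w)"
        using d(2)[of "DA u - DA w"] faithfulD(1)[OF fA, of u w] by fastforce
    next
      fix u w assume "u \<in> B" "w \<in> B" "u \<noteq> w" "cr d (DB u - DB w) = 0"
      then show "E a b \<and> ht 0 (DB u) = ht 0 (DB w)"
        using d(2)[of "DB u - DB w"] faithfulD(1)[OF fB, of u w] by fastforce
    qed (fact fin disj ab sym cross fA fB | simp add: False)+
    then show ?thesis by (rule that)
  qed
  then interpret glue A B E a b e d DA DB .
  obtain l y where g: "glued l y" using glued_ex by blast
  have "good (A \<union> B) E R (pos l y)"
    unfolding good_def
    by (intro conjI faithful_pos[OF g] separated_pos[OF g] nonrigid_pos[OF g] indep_pos[OF g])
      (use gA gB in \<open>simp_all add: good_def\<close>)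
  then show ?thesis by blast
qed

text \<open>The point is chosen so that a functional over \<open>Zphi\<close> vanishing there
  vanishes identically. A combination of one or two heights with nonzero coefficients never does, so
  a relation fills all three slots of the vertex, as \<open>indep\<close> permits.\<close>

theorem good_single:
  assumes "\<not> E u u"
  shows "\<exists>D. good {u} E R D"
proof -
  obtain d where d: "\<And>c. c \<in> Zphi \<times> Zphi \<Longrightarrow> lin c d = 0 \<Longrightarrow> c = 0"
    by (rule irrational_vector[of "{}"]) auto
  have dg: "deg {u} E u = 0" using assms by (auto simp: deg_def)
  have "indep {u} E (\<lambda>_. d)" unfolding indep_def
  proof (intro allI impI)
    fix \<kappa> assume sl: "slots {u} E (\<lambda>_. d) \<kappa>"
      and eq: "(\<Sum>u\<in>{u}. \<Sum>s\<in>{0..<5}. \<kappa> u s * ht s d) = 0"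
    define c where "c = (\<Sum>s\<in>{0..<5}. \<kappa> u s *\<^sub>R htc s)"
    have lc: "lin c z = (\<Sum>s\<in>{0..<5}. \<kappa> u s * ht s z)" for z
      by (simp add: c_def lin_sum lin_coeff lin_htc)
    have "c \<in> Zphi \<times> Zphi" unfolding c_def
    proof (rule Zphi_pair_sum)
      fix s show "\<kappa> u s *\<^sub>R htc s \<in> Zphi \<times> Zphi" using sl htc_Zphi[of s]
        by (auto simp: slots_def mem_Times_iff intro!: Zphi_intros)
    qed
    then have "c = 0" using d eq by (simp add: lc)
    then have z: "(\<Sum>s\<in>supp \<kappa> u. \<kappa> u s * ht s z) = 0" for z
    proof -
      have "(\<Sum>s\<in>supp \<kappa> u. \<kappa> u s * ht s z) = (\<Sum>s\<in>{0..<5}. \<kappa> u s * ht s z)"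
        by (rule sum.mono_neutral_left) (auto simp: supp_def)
      then show ?thesis using lc[of z] \<open>c = 0\<close> by (simp add: lin_coeff)
    qed
    have k3: "card (supp \<kappa> u) \<le> 3" using sl dg by (simp add: slots_def)
    have n1: "card (supp \<kappa> u) \<noteq> 1"
    proof
      assume "card (supp \<kappa> u) = 1"
      then obtain s where s: "supp \<kappa> u = {s}" by (auto simp: card_1_singleton_iff)
      then have "\<kappa> u s \<noteq> 0" by (auto simp: supp_def)
      then show False using z[of "dir (s + 1)"] s by (simp add: ht_dir sn_1)
    qed
    have n2: "card (supp \<kappa> u) \<noteq> 2"
    proof
      assume "card (supp \<kappa> u) = 2"
      then obtain s s' where s: "supp \<kappa> u = {s, s'}" "s \<noteq> s'" by (auto simp: card_2_iff)
      then have "\<kappa> u s' \<noteq> 0" "s \<in> {0..<5}" "s' \<in> {0..<5}" by (auto simp: supp_def)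
      then have "\<not> 5 dvd (s - s')" using s(2) by (intro not_dvd_slopes)
      then show False using z[of "dir s"] s \<open>\<kappa> u s' \<noteq> 0\<close> by (simp add: ht_dir sn_0 sn_eq_0_iff)
    qed
    have "card (supp \<kappa> u) = 3" if "supp \<kappa> u \<noteq> {}"
    proof -
      have "card (supp \<kappa> u) \<noteq> 0" using that by (simp add: finite_supp)
      then show ?thesis using k3 n1 n2 by linarith
    qed
    then show "\<exists>Y. closed_in {u} E Y \<and> (\<forall>v\<in>Y. card (supp \<kappa> v) + deg {u} E v = 3) \<and> (\<forall>v\<in>{u} - Y. supp \<kappa> v = {})"
      by (intro exI[of _ "if supp \<kappa> u = {} then {} else {u}"]) (simp add: closed_in_def dg)
  qed
  then have "good {u} E R (\<lambda>_. d)"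
    by (auto simp: good_def faithful_def separated_def nonrigid_def)
  then show ?thesis by blast
qed

text \<open>Slopes repeat mod \<pi> but directions only mod 2\<pi>, so indices congruent mod 5 agree
  up to a sign.\<close>

lemma ht_sign:
  assumes "5 dvd (a - b)"
  obtains \<epsilon> :: real where "\<epsilon> = 1 \<or> \<epsilon> = - 1" "\<And>z. ht a z = \<epsilon> * ht b z" "dir a = of_real \<epsilon> * dir b"
proof -
  have s: "sn (a - b) = 0" using assms sn_eq_0_iff by simp
  have 1: "ht a z = sn (b + 1 - a) * ht b z" for z
    using sn_plucker[of "b + 1" b a z] s by (simp add: sn_1)
  have "(b + 1 - a) mod 5 = 1" using assms by presburger
  then have "\<bar>sn (b + 1 - a)\<bar> = 1" using abs_sn[of "b + 1 - a"] by (simp add: dvd_eq_mod_eq_0)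
  then have e: "sn (b + 1 - a) = 1 \<or> sn (b + 1 - a) = - 1" by (auto simp: abs_if split: if_splits)
  have "dir a = of_real (sn (b + 1 - a)) * dir b"
  proof (rule ht_inj[of b "b + 1"])
    show "ht b (dir a) = ht b (of_real (sn (b + 1 - a)) * dir b)"
      using s by (simp only: ht_scale ht_dir) (simp add: sn_0)
    have "sn (a - (b + 1)) = - sn (b + 1 - a)" using sn_minus[of "b + 1 - a"] by simp
    then show "ht (b + 1) (dir a) = ht (b + 1) (of_real (sn (b + 1 - a)) * dir b)"
      by (simp only: ht_scale ht_dir) (simp add: sn_minus sn_1)
  qed simp
  then show thesis using that[OF e 1] by simp
qed

lemma cr_dir_dir: "cr (dir a) (dir b) = sin (pi/5) * sn (b - a)"
  by (simp add: cr_dir ht_dir)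

lemma phi_powers: "phi ^ 2 = phi + 1" "phi ^ 3 = 2 * phi + 1" "phi ^ 4 = 3 * phi + 2" "phi ^ 5 = 5 * phi + 3"
  "phi ^ 6 = 8 * phi + 5"
  using phi_sq by (simp_all add: eval_nat_numeral distrib_left mult.assoc[symmetric] mult.left_commute algebra_simps)

lemma phi_gt_1: "1 < phi" using phi_lower by simp

section \<open>Inserting a path\<close>

text \<open>An induced path v 0, ..., v n outside V', where u k is the only neighbour of v k in V'
  and \<theta> k the slope planned for this edge. The \<theta> k are integers and not residues,
  because the signs of the steps decide the slopes of the path edges. R' contains the u k in their
  order along the path.\<close>

locale path_core =
  fixes V' :: "'a set" and E :: "'a \<Rightarrow> 'a \<Rightarrow> bool" and D' :: "'a \<Rightarrow> complex" and R' :: "('a \<times> 'a) set"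
    and n :: nat and v u :: "nat \<Rightarrow> 'a" and \<theta> :: "nat \<Rightarrow> int"
  assumes fin: "finite V'" and sym: "\<And>x y. E x y \<Longrightarrow> E y x"
    and faithful': "faithful V' E D'" and separated': "separated V' E R' D'"
    and v_notin: "\<And>k. k \<le> n \<Longrightarrow> v k \<notin> V'" and v_inj: "inj_on v {..n}"
    and u_in: "\<And>k. k \<le> n \<Longrightarrow> u k \<in> V'"
    and ext: "\<And>k w. k \<le> n \<Longrightarrow> w \<in> V' \<Longrightarrow> E (v k) w \<longleftrightarrow> w = u k"
    and adj: "\<And>i j. i < j \<Longrightarrow> j \<le> n \<Longrightarrow> E (v i) (v j) \<longleftrightarrow> j = Suc i"
    and step: "\<And>k. k < n \<Longrightarrow> \<theta> (Suc k) - \<theta> k \<in> {1, -1, 2, -2}"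
    and step2: "\<And>k. Suc k < n \<Longrightarrow> \<not> 5 dvd (\<theta> (Suc (Suc k)) - \<theta> k)"
    and free_u: "\<And>k. k \<le> n \<Longrightarrow> free V' D' (u k) (\<theta> k)"
    and same: "\<And>i j. i < j \<Longrightarrow> j \<le> n \<Longrightarrow> u i = u j \<Longrightarrow> \<not> 5 dvd (\<theta> i - \<theta> j)"
    and u_R: "\<And>i j. i < j \<Longrightarrow> j \<le> n \<Longrightarrow> (u i, u j) \<in> R'"
    and u_deg: "\<And>k. k \<le> n \<Longrightarrow> deg V' E (u k) < 3"
begin

text \<open>Slope of the edge from v k to v (k + 1), chosen so that its height of direction \<theta>
  k is phi times that of direction \<theta> (k + 1), sign included (\<open>t_theta\<close>). Hence
  the velocities phi^k dir (\<theta> k) preserve all path edges.\<close>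

definition t :: "nat \<Rightarrow> int" where
  "t k = (if \<theta> (Suc k) - \<theta> k \<in> {1, -2} then \<theta> k + 2 else \<theta> k - 2)"

definition c :: "nat \<Rightarrow> complex" where "c k = of_real (phi ^ k) * dir (\<theta> k)"

text \<open>The position at X = 0. The start v 0 = u 0 is an arbitrary point of its line; every
  further vertex is where its line through u k meets the path edge from its predecessor.\<close>

primrec base :: "nat \<Rightarrow> complex" where
  "base 0 = D' (u 0)"
| "base (Suc k) = (SOME z. ht (\<theta> (Suc k)) z = ht (\<theta> (Suc k)) (D' (u (Suc k))) \<and> ht (t k) z = ht (t k) (base k))"

definition pos :: "real \<Rightarrow> 'a \<Rightarrow> complex" where
  "pos X x = (if x \<in> V' then D' x
     else base (the_inv_into {..n} v x) + of_real X * c (the_inv_into {..n} v x))"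

lemma pos_V: "x \<in> V' \<Longrightarrow> pos X x = D' x" by (simp add: pos_def)
lemma pos_v: "k \<le> n \<Longrightarrow> pos X (v k) = base k + of_real X * c k"
  using v_notin[of k] the_inv_into_f_f[OF v_inj, of k] by (simp add: pos_def)

lemma ht_c: "ht s (c k) = phi ^ k * sn (\<theta> k - s)"
  by (simp only: c_def ht_scale ht_dir)

lemma step_cases:
  assumes "k < n"
  obtains "\<theta> (Suc k) = \<theta> k + 1" "t k = \<theta> k + 2" | "\<theta> (Suc k) = \<theta> k - 1" "t k = \<theta> k - 2"
    | "\<theta> (Suc k) = \<theta> k + 2" "t k = \<theta> k - 2" | "\<theta> (Suc k) = \<theta> k - 2" "t k = \<theta> k + 2"
proof -
  consider "\<theta> (Suc k) - \<theta> k = 1" | "\<theta> (Suc k) - \<theta> k = -1" | "\<theta> (Suc k) - \<theta> k = 2" | "\<theta> (Suc k) - \<theta> k = -2"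
    using step[OF assms] by blast
  then show thesis
  proof cases
    case 1 then show ?thesis using that(1) by (simp add: t_def)
  next
    case 2 then show ?thesis using that(2) by (simp add: t_def)
  next
    case 3 then show ?thesis using that(3) by (simp add: t_def)
  next
    case 4 then show ?thesis using that(4) by (simp add: t_def)
  qed
qed

lemma t_theta:
  assumes "k < n"
  shows "\<not> 5 dvd (\<theta> k - t k)" "\<not> 5 dvd (\<theta> (Suc k) - t k)" "\<not> 5 dvd (\<theta> (Suc k) - \<theta> k)"
    "\<bar>sn (\<theta> k - t k)\<bar> = phi" "\<bar>sn (\<theta> (Suc k) - t k)\<bar> = 1"
    "phi * sn (\<theta> (Suc k) - t k) = sn (\<theta> k - t k)"
  using phi_pos by (cases rule: step_cases[OF assms]; simp add: sn_minus sn_1 sn_2 sn_4)+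

lemma t_t:
  assumes "Suc k < n"
  shows "\<not> 5 dvd (t (Suc k) - t k)"
proof -
  have "k < n" using assms by simp
  then show ?thesis
    by (cases rule: step_cases[OF \<open>k < n\<close>]; cases rule: step_cases[OF assms]; simp)
qed

lemma ht_t_c: "k < n \<Longrightarrow> ht (t k) (c (Suc k)) = ht (t k) (c k)"
  using t_theta(6)[of k] by (simp add: ht_c)

lemma base_Suc:
  assumes "k < n"
  shows "ht (\<theta> (Suc k)) (base (Suc k)) = ht (\<theta> (Suc k)) (D' (u (Suc k)))"
    "ht (t k) (base (Suc k)) = ht (t k) (base k)"
proof -
  obtain z where "ht (\<theta> (Suc k)) z = ht (\<theta> (Suc k)) (D' (u (Suc k)))" "ht (t k) z = ht (t k) (base k)"
    by (rule ht_surj[OF t_theta(2)[OF assms]])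
  then have "\<exists>z. ht (\<theta> (Suc k)) z = ht (\<theta> (Suc k)) (D' (u (Suc k))) \<and> ht (t k) z = ht (t k) (base k)" by blast
  note s = someI_ex[where P="\<lambda>z. ht (\<theta> (Suc k)) z = ht (\<theta> (Suc k)) (D' (u (Suc k))) \<and> ht (t k) z = ht (t k) (base k)", OF this]
  show "ht (\<theta> (Suc k)) (base (Suc k)) = ht (\<theta> (Suc k)) (D' (u (Suc k)))"
    "ht (t k) (base (Suc k)) = ht (t k) (base k)"
    using s by simp_all
qed

lemma ht_base: "k \<le> n \<Longrightarrow> ht (\<theta> k) (base k) = ht (\<theta> k) (D' (u k))"
proof (cases k)
  case (Suc i)
  assume "k \<le> n"
  then show ?thesis using base_Suc(1)[of i] Suc by simp
qed simp

lemma c_eq_0_iff: "ht s (c k) = 0 \<longleftrightarrow> 5 dvd (\<theta> k - s)"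
  using phi_pos by (simp add: ht_c sn_eq_0_iff)

text \<open>\<open>step\<close> and \<open>step2\<close> exclude the distances one and two. Parallel
  velocities therefore differ by a factor of at least phi^3, the origin of the exponent in
  \<open>bad_ratio\<close>.\<close>

lemma gap3:
  assumes "i < j" "j \<le> n" "5 dvd (\<theta> i - \<theta> j)"
  shows "i + 3 \<le> j"
proof (rule ccontr)
  assume "\<not> i + 3 \<le> j"
  then consider "j = Suc i" | "j = Suc (Suc i)" using assms(1) by linarith
  then show False
  proof cases
    case 1
    then show ?thesis using t_theta(3)[of i] assms by (simp add: dvd_diff_commute)
  next
    case 2
    then show ?thesis using step2[of i] assms by (simp add: dvd_diff_commute)
  qed
qed

text \<open>A nonzero height of c k has size between phi^k and phi^(k+1), so at index distance at
  least two equal heights can only be zero.\<close>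

lemma c_pair:
  assumes "i + 2 \<le> j" "ht s (c i) = ht s (c j)"
  shows "5 dvd (\<theta> i - s)" "5 dvd (\<theta> j - s)"
proof -
  have eq: "phi ^ i * \<bar>sn (\<theta> i - s)\<bar> = phi ^ j * \<bar>sn (\<theta> j - s)\<bar>"
    using assms(2) phi_pos unfolding ht_c
    by (metis abs_mult abs_of_pos zero_less_power)
  have "sn (\<theta> j - s) = 0"
  proof (rule ccontr)
    assume "sn (\<theta> j - s) \<noteq> 0"
    then have "phi ^ j * 1 \<le> phi ^ j * \<bar>sn (\<theta> j - s)\<bar>"
      using phi_pos by (intro mult_left_mono abs_sn_ge_1) (auto simp: sn_eq_0_iff)
    also have "\<dots> \<le> phi ^ i * phi" unfolding eq[symmetric] 
      using phi_pos by (intro mult_left_mono abs_sn_le_phi) auto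
    also have "\<dots> < phi ^ (i + 2)" using phi_gt_1 phi_pos by (simp add: power2_eq_square)
    also have "\<dots> \<le> phi ^ j" using assms(1) phi_gt_1 by (intro power_increasing) auto
    finally show False by simp
  qed
  then show "5 dvd (\<theta> j - s)" by (simp add: sn_eq_0_iff)
  have "sn (\<theta> i - s) = 0" using eq \<open>sn (\<theta> j - s) = 0\<close> phi_pos by simp
  then show "5 dvd (\<theta> i - s)" by (simp add: sn_eq_0_iff)
qed

lemma c_ne: "k < n \<Longrightarrow> ht (\<theta> k) (c (Suc k)) \<noteq> ht (\<theta> k) (c k)"
  using t_theta(3)[of k] phi_pos by (simp add: ht_c sn_eq_0_iff sn_0)

lemma cr_c_c: "cr (c i) (c j) = sin (pi/5) * (phi ^ (i + j) * sn (\<theta> j - \<theta> i))"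
  by (simp only: c_def cr_linear cr_dir_dir) (simp add: power_add)

text \<open>Consecutive indices share a path edge, which reduces the claim to \<open>c_pair\<close>.
  Otherwise the determinant of the two fastest velocities, if nonzero, is at least phi^(j+l), while
  the other two add up to at most phi^(j+l-1) + phi^(j+l-3). So it is zero, and the two remaining
  terms have different powers of phi.\<close>

lemma c_triple:
  assumes "i < j" "j < l" "l \<le> n" "cr (c j - c i) (c l - c i) = 0"
  shows "5 dvd (\<theta> i - \<theta> j)" "5 dvd (\<theta> i - \<theta> l)"
proof -
  have *: "5 dvd (\<theta> i - \<theta> j) \<and> 5 dvd (\<theta> i - \<theta> l)"
  proof (cases "j = Suc i")
    case True
    then have i: "i < n" using assms by simp
    have "ht (t i) (c j - c i) = 0" using ht_t_c[OF i] True by (simp add: ht_diff)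
    moreover have "c j - c i \<noteq> 0" using c_ne[OF i] True by auto
    ultimately have "ht (t i) (c l - c i) = 0" using assms(4) ht_parallel by blast
    then have "5 dvd (\<theta> i - t i)" using c_pair(1)[of i l "t i"] assms True by (simp add: ht_diff)
    then show ?thesis using t_theta(1)[OF i] by simp
  next
    case nij: False
    show ?thesis
    proof (cases "l = Suc j")
      case True
      then have j: "j < n" using assms by simp
      have "ht (t j) (c l - c j) = 0" using ht_t_c[OF j] True by (simp add: ht_diff)
      moreover have "c l - c j \<noteq> 0" using c_ne[OF j] True by auto
      moreover have "cr (c l - c j) (c i - c j) = 0" using assms(4) cr_rotate[of "c j" "c i" "c l"] by simp
      ultimately have "ht (t j) (c i - c j) = 0" using ht_parallel by blast
      then have "5 dvd (\<theta> j - t j)" using c_pair(2)[of i j "t j"] assms nij by (simp add: ht_diff)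
      then show ?thesis using t_theta(1)[OF j] by simp
    next
      case False
      have ij: "i + 2 \<le> j" and jl: "j + 2 \<le> l" using assms nij False by auto
      define P where "P = phi ^ (j + l - 3)"
      have P: "P > 0" using phi_pos by (simp add: P_def)
      have eq: "phi ^ (j + l) * sn (\<theta> l - \<theta> j) = phi ^ (i + l) * sn (\<theta> l - \<theta> i) - phi ^ (i + j) * sn (\<theta> j - \<theta> i)"
      proof -
        have "cr (c j - c i) (c l - c i) = cr (c j) (c l) - cr (c i) (c l) - cr (c j) (c i)"
          by (simp add: cr_linear)
        also have "cr (c j) (c i) = - cr (c i) (c j)" by (rule cr_commute)
        finally have "0 = sin (pi/5) * (phi ^ (j + l) * sn (\<theta> l - \<theta> j) - phi ^ (i + l) * sn (\<theta> l - \<theta> i) + phi ^ (i + j) * sn (\<theta> j - \<theta> i))"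
          using assms(4) by (simp add: cr_c_c algebra_simps)
        then show ?thesis using sin_pi5_pos by simp
      qed
      have z: "sn (\<theta> l - \<theta> j) = 0"
      proof (rule ccontr)
        assume "sn (\<theta> l - \<theta> j) \<noteq> 0"
        then have "phi ^ (j + l) * 1 \<le> phi ^ (j + l) * \<bar>sn (\<theta> l - \<theta> j)\<bar>"
          using phi_pos by (intro mult_left_mono abs_sn_ge_1) (auto simp: sn_eq_0_iff)
        also have "\<dots> = \<bar>phi ^ (i + l) * sn (\<theta> l - \<theta> i) - phi ^ (i + j) * sn (\<theta> j - \<theta> i)\<bar>"
          using phi_pos by (simp add: eq[symmetric] abs_mult)
        also have "\<dots> \<le> phi ^ (i + l) * \<bar>sn (\<theta> l - \<theta> i)\<bar> + phi ^ (i + j) * \<bar>sn (\<theta> j - \<theta> i)\<bar>"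
          using phi_pos by (intro order_trans[OF abs_triangle_ineq4]) (simp add: abs_mult)
        also have "\<dots> \<le> phi ^ (i + l) * phi + phi ^ (i + j) * phi"
          using phi_pos by (intro add_mono mult_left_mono abs_sn_le_phi) auto
        also have "\<dots> = phi ^ (i + l + 1) + phi ^ (i + j + 1)" by simp
        also have "\<dots> \<le> phi ^ ((j + l - 3) + 2) + phi ^ (j + l - 3)"
        proof (rule add_mono)
          show "phi ^ (i + l + 1) \<le> phi ^ ((j + l - 3) + 2)"
            by (rule power_increasing) (use ij jl phi_gt_1 in linarith)+
          show "phi ^ (i + j + 1) \<le> phi ^ (j + l - 3)"
            by (rule power_increasing) (use ij jl phi_gt_1 in linarith)+
        qed
        finally have "phi ^ ((j + l - 3) + 3) \<le> phi ^ ((j + l - 3) + 2) + phi ^ (j + l - 3)"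
          using ij jl by simp
        then have "P * phi ^ 3 \<le> P * (phi ^ 2 + 1)" by (simp only: power_add P_def distrib_left mult_1_right)
        then show False using P phi_lower by (simp add: phi_powers)
      qed
      obtain \<epsilon> :: real where e: "\<epsilon> = 1 \<or> \<epsilon> = -1" "\<And>z. ht (\<theta> l) z = \<epsilon> * ht (\<theta> j) z"
        by (rule ht_sign[OF z[unfolded sn_eq_0_iff]]) blast
      have "sn (\<theta> i - \<theta> l) = \<epsilon> * sn (\<theta> i - \<theta> j)" using e(2)[of "dir (\<theta> i)"] by (simp add: ht_dir)
      then have es: "sn (\<theta> l - \<theta> i) = \<epsilon> * sn (\<theta> j - \<theta> i)"
        using sn_minus[of "\<theta> i - \<theta> l"] sn_minus[of "\<theta> i - \<theta> j"] by simp
      have "sn (\<theta> j - \<theta> i) = 0"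
      proof (rule ccontr)
        assume nz: "sn (\<theta> j - \<theta> i) \<noteq> 0"
        have "phi ^ (i + l) * (\<epsilon> * sn (\<theta> j - \<theta> i)) = phi ^ (i + j) * sn (\<theta> j - \<theta> i)"
          using eq z es by simp
        then have "(phi ^ (i + l) * \<epsilon>) * sn (\<theta> j - \<theta> i) = phi ^ (i + j) * sn (\<theta> j - \<theta> i)"
          by (simp only: mult.assoc)
        then have "phi ^ (i + l) * \<epsilon> = phi ^ (i + j)" using nz by simp
        then have "\<bar>phi ^ (i + l)\<bar> * \<bar>\<epsilon>\<bar> = \<bar>phi ^ (i + j)\<bar>" by (simp only: abs_mult[symmetric])
        then have "\<bar>phi ^ (i + l)\<bar> = \<bar>phi ^ (i + j)\<bar>" using e(1) by auto
        moreover have "phi ^ (i + j) < phi ^ (i + l)" using jl phi_gt_1 by (intro power_strict_increasing) auto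
        ultimately show False using phi_pos by simp
      qed
      then have "5 dvd (\<theta> j - \<theta> i)" "5 dvd (\<theta> l - \<theta> i)" using es by (simp_all add: sn_eq_0_iff[symmetric])
      then show ?thesis by (simp add: dvd_diff_commute)
    qed
  qed
  then show "5 dvd (\<theta> i - \<theta> j)" "5 dvd (\<theta> i - \<theta> l)" by simp_all
qed

end

lemma generic_imp: "(P \<Longrightarrow> generic Q) \<Longrightarrow> generic (\<lambda>X. P \<longrightarrow> Q X)"
  by (cases P) (simp_all add: genericI)

lemma quadratic_generic:
  assumes "\<And>X. f X = p + q * X + r * X\<^sup>2" "p \<noteq> 0 \<or> q \<noteq> 0 \<or> r \<noteq> 0"
  shows "generic (\<lambda>X. f X \<noteq> 0)"
  unfolding assms(1) by (rule generic_quadratic[OF assms(2)])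

lemma affine_generic:
  assumes "\<And>X. f X = p + q * X" "p \<noteq> 0 \<or> q \<noteq> 0"
  shows "generic (\<lambda>X. f X \<noteq> 0)"
  unfolding assms(1) by (rule generic_affine[OF assms(2)])

text \<open>Since phi^3 \<ge> 4.2, aj and ai are at most L/4.2 and L/17.6 in size, so whatever the
  signs both differences are close to al.\<close>

lemma near_ratio_sizes:
  assumes L: "L > 0" and a: "\<bar>al\<bar> = L" and b: "\<bar>aj\<bar> * phi ^ 3 \<le> L" and c: "\<bar>ai\<bar> * phi ^ 3 \<le> \<bar>aj\<bar>"
    and ne: "ai \<noteq> aj" and Z: "al - aj \<in> Zphi" "al - ai \<in> Zphi"
  shows "near_ratio (al - aj) (al - ai)"
proof -
  have p3: "phi ^ 3 \<ge> 4.2" using phi_lower by (simp add: phi_powers)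
  have "\<bar>aj\<bar> * 4.2 \<le> \<bar>aj\<bar> * phi ^ 3" by (intro mult_left_mono p3) simp
  then have bj: "\<bar>aj\<bar> * 4.2 \<le> L" using b by linarith
  have "\<bar>ai\<bar> * 4.2 \<le> \<bar>ai\<bar> * phi ^ 3" by (intro mult_left_mono p3) simp
  then have bi: "\<bar>ai\<bar> * 4.2 \<le> \<bar>aj\<bar>" using c by linarith
  have "aj \<le> \<bar>aj\<bar>" "- aj \<le> \<bar>aj\<bar>" "ai \<le> \<bar>ai\<bar>" "- ai \<le> \<bar>ai\<bar>" by simp_all
  note ab = this bj bi L
  have al: "al = (if al > 0 then L else - L)" using a by auto
  have A0: "al - aj \<noteq> 0" using bj a L by linarith
  have "0.6 < (al - ai) / (al - aj) \<and> (al - ai) / (al - aj) < 1.6"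
  proof (cases "al > 0")
    case True
    then have "al - aj > 0" "0.6 * (al - aj) < al - ai" "al - ai < 1.6 * (al - aj)"
      using ab al True by (auto split: if_splits)
    then show ?thesis by (simp add: pos_less_divide_eq pos_divide_less_eq)
  next
    case False
    then have "al - aj < 0" "0.6 * (al - aj) > al - ai" "al - ai > 1.6 * (al - aj)"
      using ab al False by (auto split: if_splits)
    then show ?thesis by (simp add: neg_less_divide_eq neg_divide_less_eq)
  qed
  then show ?thesis using A0 ne Z by (simp add: near_ratio_def)
qed

context path_core
begin

definition points :: "'a set" where "points = V' \<union> v ` {..n}"

lemma c_sign:
  assumes "5 dvd (\<theta> j - \<theta> i)"
  obtains a where "\<bar>a\<bar> = phi ^ j" "a \<in> Zphi" "c j = of_real a * dir (\<theta> i)" "\<And>z. cr (c j) z = sin (pi/5) * (a * ht (\<theta> i) z)"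
    "\<And>z w. ht (\<theta> j) z = ht (\<theta> j) w \<longleftrightarrow> ht (\<theta> i) z = ht (\<theta> i) w"
proof -
  obtain \<epsilon> :: real where e: "\<epsilon> = 1 \<or> \<epsilon> = - 1" "\<And>z. ht (\<theta> j) z = \<epsilon> * ht (\<theta> i) z" "dir (\<theta> j) = of_real \<epsilon> * dir (\<theta> i)"
    by (rule ht_sign[OF assms]) blast
  have 3: "c j = of_real (phi ^ j * \<epsilon>) * dir (\<theta> i)" unfolding c_def e(3) by simp
  show thesis
  proof (rule that[OF _ _ 3])
    show "\<bar>phi ^ j * \<epsilon>\<bar> = phi ^ j" using e(1) phi_pos by (auto simp: abs_mult)
    show "phi ^ j * \<epsilon> \<in> Zphi" using e(1) by (auto intro!: Zphi_intros)
    show "cr (c j) z = sin (pi/5) * (phi ^ j * \<epsilon> * ht (\<theta> i) z)" for z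
      unfolding 3 cr_linear cr_dir by simp
    show "ht (\<theta> j) z = ht (\<theta> j) w \<longleftrightarrow> ht (\<theta> i) z = ht (\<theta> i) w" for z w
      unfolding e(2) using e(1) by auto
  qed
qed

text \<open>If s is not the slope \<theta> k, height s of v k moves and leaves that of w. Otherwise
  v k stays on its line through u k, and freeness says that no other old vertex lies there.\<close>

lemma generic_v_V:
  assumes k: "k \<le> n" and w: "w \<in> V'"
  shows "generic (\<lambda>X. \<forall>s. ht s (pos X (v k)) = ht s (pos X w) \<longrightarrow> w = u k \<and> 5 dvd (\<theta> k - s))"
proof (rule generic_all)
  fix s
  show "generic (\<lambda>X. ht s (pos X (v k)) = ht s (pos X w) \<longrightarrow> w = u k \<and> 5 dvd (\<theta> k - s))"
  proof (cases "5 dvd (\<theta> k - s)")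
    case False
    have "generic (\<lambda>X. ht s (pos X (v k)) - ht s (pos X w) \<noteq> 0)"
      by (rule affine_generic[of _ "ht s (base k) - ht s (D' w)" "ht s (c k)"])
        (use k w False in \<open>simp_all add: pos_v pos_V ht_add ht_scale c_eq_0_iff\<close>)
    then show ?thesis by (rule generic_mono) auto
  next
    case True
    have "ht s (pos X (v k)) = ht s (pos X w) \<longrightarrow> w = u k" for X
    proof
      assume "ht s (pos X (v k)) = ht s (pos X w)"
      then have "ht s (base k) = ht s (D' w)" using True c_eq_0_iff[of s k]
        by (simp add: pos_v[OF k] pos_V[OF w] ht_add ht_scale)
      then have "ht (\<theta> k) (base k) = ht (\<theta> k) (D' w)" using ht_cong_eq[OF True] by blast
      then have "ht (\<theta> k) (D' (u k)) = ht (\<theta> k) (D' w)" using ht_base[OF k] by simp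
      then show "w = u k" using free_u[OF k] w unfolding free_def by blast
    qed
    then show ?thesis using True by (simp add: genericI)
  qed
qed

lemma ht_u_ne:
  assumes "i < j" "j \<le> n" "5 dvd (\<theta> i - \<theta> j)"
  shows "u i \<noteq> u j" "ht (\<theta> i) (D' (u i)) \<noteq> ht (\<theta> i) (D' (u j))"
proof -
  show "u i \<noteq> u j" using same[OF assms(1,2)] assms(3) by blast
  then show "ht (\<theta> i) (D' (u i)) \<noteq> ht (\<theta> i) (D' (u j))"
    using free_u[of i] u_in[of j] assms(1,2) unfolding free_def by auto
qed

lemma ht_base_other:
  assumes "j \<le> n" "5 dvd (\<theta> i - \<theta> j)"
  shows "ht (\<theta> i) (base j) = ht (\<theta> i) (D' (u j))"
  using ht_base[OF assms(1)] ht_cong_eq[OF assms(2)] by blast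

text \<open>At distance at least two, \<open>c_pair\<close> leaves only the case that both vertices
  move along parallel lines of slope s; these lines pass through u i and u j, and freeness makes
  them different.\<close>

lemma generic_v_v:
  assumes ij: "i < j" "j \<le> n"
  shows "generic (\<lambda>X. pos X (v i) \<noteq> pos X (v j) \<and>
     (\<forall>s. ht s (pos X (v i)) = ht s (pos X (v j)) \<longrightarrow> j = Suc i))"
proof (cases "j = Suc i")
  case True
  have "generic (\<lambda>X. ht (\<theta> i) (pos X (v j)) - ht (\<theta> i) (pos X (v i)) \<noteq> 0)"
    by (rule affine_generic[of _ "ht (\<theta> i) (base j) - ht (\<theta> i) (base i)" "ht (\<theta> i) (c j) - ht (\<theta> i) (c i)"])
      (use ij True c_ne[of i] in \<open>simp_all add: pos_v ht_add ht_scale algebra_simps\<close>)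
  then show ?thesis by (rule generic_mono) (use True in auto)
next
  case False
  have nn: "i + 2 \<le> j" using ij False by simp
  have one: "generic (\<lambda>X. ht s (pos X (v i)) \<noteq> ht s (pos X (v j)))" for s
  proof -
    have "generic (\<lambda>X. ht s (pos X (v i)) - ht s (pos X (v j)) \<noteq> 0)"
    proof (rule affine_generic[of _ "ht s (base i) - ht s (base j)" "ht s (c i) - ht s (c j)"])
      show "ht s (pos X (v i)) - ht s (pos X (v j)) =
         ht s (base i) - ht s (base j) + (ht s (c i) - ht s (c j)) * X" for X
        using ij by (simp add: pos_v ht_add ht_scale algebra_simps)
      show "ht s (base i) - ht s (base j) \<noteq> 0 \<or> ht s (c i) - ht s (c j) \<noteq> 0"
      proof (rule ccontr)
        assume "\<not> ?thesis"
        then have b: "ht s (base i) = ht s (base j)" and "ht s (c i) = ht s (c j)" by auto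
        then have d: "5 dvd (\<theta> i - s)" "5 dvd (\<theta> j - s)" using c_pair[OF nn] by blast+
        then have d2: "5 dvd (\<theta> i - \<theta> j)" by presburger
        have "ht (\<theta> i) (base i) = ht (\<theta> i) (base j)" using b ht_cong_eq[OF d(1)] by blast
        then have "ht (\<theta> i) (D' (u i)) = ht (\<theta> i) (D' (u j))"
          using ht_base[of i] ht_base_other[OF ij(2) d2] ij by simp
        then show False using ht_u_ne(2)[OF ij d2] by simp
      qed
    qed
    then show ?thesis by (rule generic_mono) auto
  qed
  have "generic (\<lambda>X. \<forall>s. ht s (pos X (v i)) \<noteq> ht s (pos X (v j)))" by (rule generic_all[OF one])
  then show ?thesis by (rule generic_mono) auto
qed

text \<open>If the line through w and w' does not have slope \<theta> k, v k moves off it. If it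
  has, v k could be on it only if it is the line through u k, and freeness allows just one old
  vertex there.\<close>

lemma generic_vVV:
  assumes k: "k \<le> n" and w: "w \<in> V'" "w' \<in> V'" "w \<noteq> w'"
  shows "generic (\<lambda>X. cr (pos X w' - pos X w) (pos X (v k) - pos X w) \<noteq> 0)"
proof (rule affine_generic[of _ "cr (D' w' - D' w) (base k - D' w)" "cr (D' w' - D' w) (c k)"])
  let ?d = "D' w' - D' w"
  have d0: "?d \<noteq> 0" using faithfulD(1)[OF faithful' w(2,1)] w(3) by auto
  show "cr (pos X w' - pos X w) (pos X (v k) - pos X w) = cr ?d (base k - D' w) + cr ?d (c k) * X" for X
  proof -
    have "pos X (v k) - pos X w = (base k - D' w) + of_real X * c k" by (simp add: pos_v[OF k] pos_V w)
    then show ?thesis using w by (simp only: pos_V cr_linear) (simp add: algebra_simps)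
  qed
  show "cr ?d (base k - D' w) \<noteq> 0 \<or> cr ?d (c k) \<noteq> 0"
  proof (rule ccontr)
    assume "\<not> ?thesis"
    then have z: "cr ?d (base k - D' w) = 0" "cr ?d (c k) = 0" by auto
    have "cr (dir (\<theta> k)) ?d = 0"
      using z(2)[unfolded c_def cr_linear(6)] phi_pos cr_commute[of ?d "dir (\<theta> k)"] by simp
    then have hd: "ht (\<theta> k) ?d = 0" using sin_pi5_pos by (simp add: cr_dir)
    then have "ht (\<theta> k) (base k - D' w) = 0" using ht_parallel d0 z(1) by blast
    then have "ht (\<theta> k) (D' (u k)) = ht (\<theta> k) (D' w)" using ht_base[OF k] by (simp add: ht_diff)
    moreover from this hd have "ht (\<theta> k) (D' (u k)) = ht (\<theta> k) (D' w')" by (simp add: ht_diff)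
    ultimately have "w = u k" "w' = u k" using free_u[OF k] w unfolding free_def by blast+
    then show False using w(3) by simp
  qed
qed

text \<open>The quadratic coefficient is the determinant of the two velocities. When they are
  parallel, the linear coefficient is the relation of \<open>separated\<close> for u i, u j and w
  with a bad ratio; if w is one of u i, u j, it is a nonzero multiple of the distance of their
  lines.\<close>

lemma generic_vvV:
  assumes ij: "i < j" "j \<le> n" and w: "w \<in> V'"
  shows "generic (\<lambda>X. cr (pos X (v i) - pos X w) (pos X (v j) - pos X w) \<noteq> 0)"
proof (rule quadratic_generic[of _ "cr (base i - D' w) (base j - D' w)"
        "cr (c i) (base j - D' w) + cr (base i - D' w) (c j)" "cr (c i) (c j)"])
  show "cr (pos X (v i) - pos X w) (pos X (v j) - pos X w) =
     cr (base i - D' w) (base j - D' w) + (cr (c i) (base j - D' w) + cr (base i - D' w) (c j)) * X + cr (c i) (c j) * X\<^sup>2" for X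
  proof -
    have "pos X (v i) - pos X w = (base i - D' w) + of_real X * c i"
      "pos X (v j) - pos X w = (base j - D' w) + of_real X * c j" using ij by (simp_all add: pos_v pos_V w)
    then show ?thesis by (simp only: cr_linear(1,2,5,6)) (simp add: algebra_simps power2_eq_square)
  qed
  show "cr (base i - D' w) (base j - D' w) \<noteq> 0 \<or> cr (c i) (base j - D' w) + cr (base i - D' w) (c j) \<noteq> 0 \<or> cr (c i) (c j) \<noteq> 0"
  proof (rule ccontr)
    assume "\<not> ?thesis"
    then have z: "cr (c i) (base j - D' w) + cr (base i - D' w) (c j) = 0" "cr (c i) (c j) = 0" by auto
    have i: "i \<le> n" using ij by simp
    have dj: "5 dvd (\<theta> j - \<theta> i)" using z(2) sin_pi5_pos phi_pos by (simp add: cr_c_c sn_eq_0_iff)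
    then have di: "5 dvd (\<theta> i - \<theta> j)" by presburger
    obtain A where A: "\<bar>A\<bar> = phi ^ j" "A \<in> Zphi" "\<And>z. cr (c j) z = sin (pi/5) * (A * ht (\<theta> i) z)"
        "\<And>z w. ht (\<theta> j) z = ht (\<theta> j) w \<longleftrightarrow> ht (\<theta> i) z = ht (\<theta> i) w"
      by (rule c_sign[OF dj]) blast
    let ?h = "\<lambda>x. ht (\<theta> i) (D' x)"
    have "cr (c i) (base j - D' w) = sin (pi/5) * (phi ^ i * (?h (u j) - ?h w))"
      unfolding c_def cr_linear(5) cr_dir ht_diff ht_base_other[OF ij(2) di] by (simp add: algebra_simps)
    moreover have "cr (base i - D' w) (c j) = - (sin (pi/5) * (A * (?h (u i) - ?h w)))"
      unfolding cr_commute[of "base i - D' w"] A(3) ht_diff ht_base[OF i] by (simp add: algebra_simps)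
    ultimately have "sin (pi/5) * (- A * ?h (u i) + phi ^ i * ?h (u j) + (A - phi ^ i) * ?h w) = 0"
      using z(1) by (simp add: algebra_simps)
    then have eq: "- A * ?h (u i) + phi ^ i * ?h (u j) + (A - phi ^ i) * ?h w = 0" using sin_pi5_pos by simp
    note ne = ht_u_ne[OF ij di]
    have A0: "A \<noteq> 0" using A(1) phi_pos by auto
    show False
    proof (cases "w = u i \<or> w = u j")
      case True
      then show False using eq ne A0 phi_pos by (auto simp: algebra_simps)
    next
      case False
      have "j = i + (j - i)" "3 \<le> j - i" using gap3[OF ij di] by auto
      then have "bad_ratio A (phi ^ i)" unfolding bad_ratio_def using A(1,2) A0 phi_pos
        by (auto intro!: Zphi_intros exI[of _ "j - i"] simp: power_add[symmetric])
      moreover have "free V' D' (u j) (\<theta> i)"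
        using free_u[OF ij(2)] A(4) unfolding free_def by blast
      ultimately show False
        using separatedD[OF separated' u_in[OF i] u_in[OF ij(2)] w, of "\<theta> i" A "phi ^ i"] ne False
          u_R[OF ij] u_deg[OF i] u_deg[OF ij(2)] free_u[OF i] eq by auto
    qed
  qed
qed

text \<open>By \<open>c_triple\<close> the quadratic coefficient vanishes only for three parallel
  velocities; the linear one is then the relation of \<open>separated\<close> for u i, u j and u l
  with a near ratio.\<close>

lemma generic_vvv:
  assumes ij: "i < j" and jl: "j < l" and l: "l \<le> n"
  shows "generic (\<lambda>X. cr (pos X (v j) - pos X (v i)) (pos X (v l) - pos X (v i)) \<noteq> 0)"
proof (rule quadratic_generic[of _ "cr (base j - base i) (base l - base i)"
        "cr (c j - c i) (base l - base i) + cr (base j - base i) (c l - c i)" "cr (c j - c i) (c l - c i)"])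
  have i: "i \<le> n" and j: "j \<le> n" and il: "i < l" using assms by auto
  show "cr (pos X (v j) - pos X (v i)) (pos X (v l) - pos X (v i)) = cr (base j - base i) (base l - base i)
     + (cr (c j - c i) (base l - base i) + cr (base j - base i) (c l - c i)) * X + cr (c j - c i) (c l - c i) * X\<^sup>2" for X
  proof -
    have "pos X (v j) - pos X (v i) = (base j - base i) + of_real X * (c j - c i)"
      "pos X (v l) - pos X (v i) = (base l - base i) + of_real X * (c l - c i)"
      using i j l by (simp_all add: pos_v algebra_simps)
    then show ?thesis by (simp only: cr_linear(1,2,5,6)) (simp add: algebra_simps power2_eq_square)
  qed
  show "cr (base j - base i) (base l - base i) \<noteq> 0 \<or>
    cr (c j - c i) (base l - base i) + cr (base j - base i) (c l - c i) \<noteq> 0 \<or> cr (c j - c i) (c l - c i) \<noteq> 0"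
  proof (rule ccontr)
    assume "\<not> ?thesis"
    then have z: "cr (c j - c i) (base l - base i) + cr (base j - base i) (c l - c i) = 0"
       "cr (c j - c i) (c l - c i) = 0" by auto
    note d = c_triple[OF ij jl l z(2)]
    have dj: "5 dvd (\<theta> j - \<theta> i)" and dl: "5 dvd (\<theta> l - \<theta> i)" and djl: "5 dvd (\<theta> j - \<theta> l)" using d by presburger+
    obtain aj where aj: "\<bar>aj\<bar> = phi ^ j" "aj \<in> Zphi" "c j = of_real aj * dir (\<theta> i)"
        "\<And>z w. ht (\<theta> j) z = ht (\<theta> j) w \<longleftrightarrow> ht (\<theta> i) z = ht (\<theta> i) w"
      by (rule c_sign[OF dj]) blast
    obtain al where al: "\<bar>al\<bar> = phi ^ l" "al \<in> Zphi" "c l = of_real al * dir (\<theta> i)"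
        "\<And>z w. ht (\<theta> l) z = ht (\<theta> l) w \<longleftrightarrow> ht (\<theta> i) z = ht (\<theta> i) w"
      by (rule c_sign[OF dl]) blast
    define ai where "ai = phi ^ i"
    let ?h = "\<lambda>x. ht (\<theta> i) (D' x)"
    have ci: "c i = of_real ai * dir (\<theta> i)" by (simp add: c_def ai_def)
    have e1: "c j - c i = of_real (aj - ai) * dir (\<theta> i)" and e2: "c l - c i = of_real (al - ai) * dir (\<theta> i)"
      unfolding ci aj(3) al(3) by (simp_all add: algebra_simps)
    have "cr (c j - c i) (base l - base i) = sin (pi/5) * ((aj - ai) * (?h (u l) - ?h (u i)))"
      unfolding e1 cr_linear(5) cr_dir ht_diff ht_base[OF i] ht_base_other[OF l d(2)] by (simp add: algebra_simps)
    moreover have "cr (base j - base i) (c l - c i) = - (sin (pi/5) * ((al - ai) * (?h (u j) - ?h (u i))))"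
      unfolding cr_commute[of "base j - base i"] e2 cr_linear(5) cr_dir ht_diff ht_base[OF i] ht_base_other[OF j d(1)] by (simp add: algebra_simps)
    ultimately have "sin (pi/5) * (- (al - aj) * ?h (u i) + (al - ai) * ?h (u j) + ((al - aj) - (al - ai)) * ?h (u l)) = 0"
      using z(1) by (simp add: algebra_simps)
    then have eq: "- (al - aj) * ?h (u i) + (al - ai) * ?h (u j) + ((al - aj) - (al - ai)) * ?h (u l) = 0"
      using sin_pi5_pos by simp
    have g: "i + 3 \<le> j" "j + 3 \<le> l" using gap3[OF ij j d(1)] gap3[OF jl l djl] by auto
    have "near_ratio (al - aj) (al - ai)"
    proof (rule near_ratio_sizes[of "phi ^ l"])
      show "0 < phi ^ l" using phi_pos by simp
      show "\<bar>aj\<bar> * phi ^ 3 \<le> phi ^ l" unfolding aj(1) power_add[symmetric]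
        by (rule power_increasing) (use g phi_gt_1 in linarith)+
      have "phi ^ i * phi ^ 3 \<le> phi ^ j" unfolding power_add[symmetric]
        by (rule power_increasing) (use g phi_gt_1 in linarith)+
      then show "\<bar>ai\<bar> * phi ^ 3 \<le> \<bar>aj\<bar>" unfolding aj(1) ai_def using phi_pos by simp
      have "phi ^ i < phi ^ j" using ij phi_gt_1 by (intro power_strict_increasing) auto
      then show "ai \<noteq> aj" using aj(1) phi_pos unfolding ai_def by auto
    qed (use al aj in \<open>auto simp: ai_def intro!: Zphi_intros\<close>)
    moreover have "free V' D' (u j) (\<theta> i)" "free V' D' (u l) (\<theta> i)"
      using free_u[OF j] free_u[OF l] aj(4) al(4) unfolding free_def by blast+
    ultimately have "- (al - aj) * ?h (u i) + (al - ai) * ?h (u j) + ((al - aj) - (al - ai)) * ?h (u l) \<noteq> 0"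
      using u_R[OF ij j] u_R[OF jl l] u_R[OF il l] u_deg[OF l]
      by (intro separatedD[OF separated' u_in[OF i] u_in[OF j] u_in[OF l]])
        (simp_all add: ht_u_ne(1)[OF ij j d(1)] ht_u_ne(1)[OF il l d(2)] ht_u_ne(1)[OF jl l djl]
          u_deg[OF i] u_deg[OF j] free_u[OF i])
    then show False using eq by simp
  qed
qed

definition placed :: "real \<Rightarrow> bool" where
  "placed X \<longleftrightarrow>
    (\<forall>k\<in>{..n}. \<forall>w\<in>V'. \<forall>s. ht s (pos X (v k)) = ht s (pos X w) \<longrightarrow> w = u k \<and> 5 dvd (\<theta> k - s)) \<and>
    (\<forall>i\<in>{..n}. \<forall>j\<in>{..n}. i < j \<longrightarrow> pos X (v i) \<noteq> pos X (v j) \<and>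
       (\<forall>s. ht s (pos X (v i)) = ht s (pos X (v j)) \<longrightarrow> j = Suc i)) \<and>
    (\<forall>k\<in>{..n}. \<forall>w\<in>V'. \<forall>w'\<in>V'. w \<noteq> w' \<longrightarrow> cr (pos X w' - pos X w) (pos X (v k) - pos X w) \<noteq> 0) \<and>
    (\<forall>i\<in>{..n}. \<forall>j\<in>{..n}. \<forall>w\<in>V'. i < j \<longrightarrow> cr (pos X (v i) - pos X w) (pos X (v j) - pos X w) \<noteq> 0) \<and>
    (\<forall>i\<in>{..n}. \<forall>j\<in>{..n}. \<forall>l\<in>{..n}. i < j \<longrightarrow> j < l \<longrightarrow>
       cr (pos X (v j) - pos X (v i)) (pos X (v l) - pos X (v i)) \<noteq> 0)"

lemma generic_placed: "generic placed"
  unfolding placed_def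
  by (intro generic_conj generic_ball countable_finite fin finite_atMost generic_imp)
    (auto intro: generic_v_V generic_vVV generic_vvV generic_vvv generic_mono[OF generic_v_v])

text \<open>Every relation is affine in X, and one with nonzero slope holds for at most one X. So at
  a generic parameter the relations between positions may be differentiated along the motion of the
  path.\<close>

lemma linear_generic:
  "generic (\<lambda>X. \<forall>f. (\<forall>x\<in>points. f x \<in> Zphi \<times> Zphi) \<longrightarrow> (\<Sum>x\<in>points. lin (f x) (pos X x)) = 0 \<longrightarrow>
     (\<Sum>k\<le>n. lin (f (v k)) (c k)) = 0)"
proof -
  let ?F = "PiE points (\<lambda>_. Zphi \<times> Zphi)"
  have fp: "finite points" by (simp add: points_def fin)
  have cF: "countable ?F" by (rule countable_PiE) (auto simp: fp countable_Zphi)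
  have dj: "V' \<inter> v ` {..n} = {}" using v_notin by auto
  have sum: "(\<Sum>x\<in>points. lin (f x) (pos X x)) =
     ((\<Sum>x\<in>V'. lin (f x) (D' x)) + (\<Sum>k\<le>n. lin (f (v k)) (base k))) + (\<Sum>k\<le>n. lin (f (v k)) (c k)) * X" for f X
  proof -
    have "(\<Sum>x\<in>points. lin (f x) (pos X x)) = (\<Sum>x\<in>V'. lin (f x) (D' x)) + (\<Sum>k\<le>n. lin (f (v k)) (pos X (v k)))"
      unfolding points_def using dj fin by (simp add: sum.union_disjoint pos_V sum.reindex[OF v_inj])
    also have "(\<Sum>k\<le>n. lin (f (v k)) (pos X (v k))) = (\<Sum>k\<le>n. lin (f (v k)) (base k) + lin (f (v k)) (c k) * X)"
      by (rule sum.cong) (simp_all add: pos_v lin_linear)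
    finally show ?thesis by (simp add: sum.distrib sum_distrib_right)
  qed
  have "generic (\<lambda>X. \<forall>f\<in>?F. (\<Sum>x\<in>points. lin (f x) (pos X x)) = 0 \<longrightarrow> (\<Sum>k\<le>n. lin (f (v k)) (c k)) = 0)"
  proof (rule generic_ball[OF cF])
    fix f
    show "generic (\<lambda>X. (\<Sum>x\<in>points. lin (f x) (pos X x)) = 0 \<longrightarrow> (\<Sum>k\<le>n. lin (f (v k)) (c k)) = 0)"
    proof (cases "(\<Sum>k\<le>n. lin (f (v k)) (c k)) = 0")
      case False
      have "generic (\<lambda>X. (\<Sum>x\<in>points. lin (f x) (pos X x)) \<noteq> 0)"
        by (rule affine_generic[OF sum]) (use False in simp)
      then show ?thesis by (rule generic_mono) simp
    qed (simp add: genericI)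
  qed
  then show ?thesis
  proof (rule generic_mono, intro allI impI)
    fix X f
    assume H: "\<forall>f\<in>?F. (\<Sum>x\<in>points. lin (f x) (pos X x)) = 0 \<longrightarrow> (\<Sum>k\<le>n. lin (f (v k)) (c k)) = 0"
      and f: "\<forall>x\<in>points. f x \<in> Zphi \<times> Zphi" "(\<Sum>x\<in>points. lin (f x) (pos X x)) = 0"
    let ?g = "restrict f points"
    have "?g \<in> ?F" using f by (intro PiE_I) auto
    moreover have "(\<Sum>x\<in>points. lin (?g x) (pos X x)) = 0"
      using f(2) by (subst sum.cong[OF refl]) auto
    ultimately have "(\<Sum>k\<le>n. lin (?g (v k)) (c k)) = 0" using H by blast
    moreover have "(\<Sum>k\<le>n. lin (?g (v k)) (c k)) = (\<Sum>k\<le>n. lin (f (v k)) (c k))"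
      by (rule sum.cong) (auto simp: points_def)
    ultimately show "(\<Sum>k\<le>n. lin (f (v k)) (c k)) = 0" by simp
  qed
qed

end

context path_core
begin

declare base.simps [simp del]

lemma v_u_adj: "k \<le> n \<Longrightarrow> E (v k) (u k)" using ext u_in by blast

context
  fixes X :: real
  assumes placed: "placed X"
begin

lemma placedD:
  "k \<le> n \<Longrightarrow> w \<in> V' \<Longrightarrow> ht s (pos X (v k)) = ht s (pos X w) \<Longrightarrow> w = u k \<and> 5 dvd (\<theta> k - s)"
  "i < j \<Longrightarrow> j \<le> n \<Longrightarrow> pos X (v i) \<noteq> pos X (v j)"
  "i < j \<Longrightarrow> j \<le> n \<Longrightarrow> ht s (pos X (v i)) = ht s (pos X (v j)) \<Longrightarrow> j = Suc i"
  "k \<le> n \<Longrightarrow> w \<in> V' \<Longrightarrow> w' \<in> V' \<Longrightarrow> w \<noteq> w' \<Longrightarrow> cr (pos X w' - pos X w) (pos X (v k) - pos X w) \<noteq> 0"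
  "i < j \<Longrightarrow> j \<le> n \<Longrightarrow> w \<in> V' \<Longrightarrow> cr (pos X (v i) - pos X w) (pos X (v j) - pos X w) \<noteq> 0"
  "i < j \<Longrightarrow> j < l \<Longrightarrow> l \<le> n \<Longrightarrow> cr (pos X (v j) - pos X (v i)) (pos X (v l) - pos X (v i)) \<noteq> 0"
proof -
  note P = placed[unfolded placed_def]
  show "k \<le> n \<Longrightarrow> w \<in> V' \<Longrightarrow> ht s (pos X (v k)) = ht s (pos X w) \<Longrightarrow> w = u k \<and> 5 dvd (\<theta> k - s)"
    using P by simp
  show "i < j \<Longrightarrow> j \<le> n \<Longrightarrow> pos X (v i) \<noteq> pos X (v j)"
    using P by simp
  show "j = Suc i" if "i < j" "j \<le> n" "ht s (pos X (v i)) = ht s (pos X (v j))"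
  proof -
    have "i \<in> {..n}" "j \<in> {..n}" using that by simp_all
    then show ?thesis using conjunct1[OF conjunct2[OF P]] that by blast
  qed
  show "k \<le> n \<Longrightarrow> w \<in> V' \<Longrightarrow> w' \<in> V' \<Longrightarrow> w \<noteq> w' \<Longrightarrow> cr (pos X w' - pos X w) (pos X (v k) - pos X w) \<noteq> 0"
    using P by simp
  show "i < j \<Longrightarrow> j \<le> n \<Longrightarrow> w \<in> V' \<Longrightarrow> cr (pos X (v i) - pos X w) (pos X (v j) - pos X w) \<noteq> 0"
    using P by simp
  show "i < j \<Longrightarrow> j < l \<Longrightarrow> l \<le> n \<Longrightarrow> cr (pos X (v j) - pos X (v i)) (pos X (v l) - pos X (v i)) \<noteq> 0"
    using P by simp
qed

lemma ht_edge: "k < n \<Longrightarrow> ht (t k) (pos X (v (Suc k))) = ht (t k) (pos X (v k))"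
  by (simp add: pos_v ht_add ht_scale ht_t_c base_Suc(2))

lemma ht_ext: "k \<le> n \<Longrightarrow> ht (\<theta> k) (pos X (v k)) = ht (\<theta> k) (pos X (u k))"
  using ht_base u_in by (simp add: pos_v pos_V ht_add ht_scale ht_c sn_0)

lemma pair_v_V:
  assumes "k \<le> n" "w \<in> V'"
  shows "pos X (v k) \<noteq> pos X w" "E (v k) w \<longleftrightarrow> (\<exists>s. ht s (pos X (v k)) = ht s (pos X w))"
proof -
  show "pos X (v k) \<noteq> pos X w"
  proof
    assume "pos X (v k) = pos X w"
    then have "5 dvd (\<theta> k - (\<theta> k + 1))" using placedD(1)[OF assms, of "\<theta> k + 1"] by simp
    then show False by simp
  qed
  show "E (v k) w \<longleftrightarrow> (\<exists>s. ht s (pos X (v k)) = ht s (pos X w))"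
  proof
    assume "E (v k) w"
    then have "w = u k" using ext[OF assms] by simp
    then show "\<exists>s. ht s (pos X (v k)) = ht s (pos X w)" using ht_ext[OF assms(1)] by blast
  next
    assume "\<exists>s. ht s (pos X (v k)) = ht s (pos X w)"
    then show "E (v k) w" using placedD(1)[OF assms] ext[OF assms] by blast
  qed
qed

lemma pair_v_v:
  assumes "i < j" "j \<le> n"
  shows "pos X (v i) \<noteq> pos X (v j)" "E (v i) (v j) \<longleftrightarrow> (\<exists>s. ht s (pos X (v i)) = ht s (pos X (v j)))"
proof -
  show "pos X (v i) \<noteq> pos X (v j)" by (rule placedD(2)[OF assms])
  show "E (v i) (v j) \<longleftrightarrow> (\<exists>s. ht s (pos X (v i)) = ht s (pos X (v j)))"
  proof
    assume "E (v i) (v j)"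
    then have "j = Suc i" using adj[OF assms] by simp
    then have "ht (t i) (pos X (v i)) = ht (t i) (pos X (v j))" using ht_edge[of i] assms by simp
    then show "\<exists>s. ht s (pos X (v i)) = ht s (pos X (v j))" by blast
  next
    assume "\<exists>s. ht s (pos X (v i)) = ht s (pos X (v j))"
    then show "E (v i) (v j)" using placedD(3)[OF assms] adj[OF assms] by blast
  qed
qed

lemma faithful_placed: "faithful points E (pos X)"
proof -
  define ok where "ok p q \<longleftrightarrow> pos X p \<noteq> pos X q \<and> (E p q \<longleftrightarrow> (\<exists>s. ht s (pos X p) = ht s (pos X q)))" for p q
  have ok_sym: "ok q p" if "ok p q" for p q
  proof -
    have "E p q \<longleftrightarrow> E q p" using sym by blast
    moreover have "(\<exists>s. ht s (pos X p) = ht s (pos X q)) \<longleftrightarrow> (\<exists>s. ht s (pos X q) = ht s (pos X p))"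
      by (simp add: eq_commute)
    ultimately show ?thesis using that by (auto simp: ok_def)
  qed
  define nc where "nc p q r \<longleftrightarrow> cr (pos X q - pos X p) (pos X r - pos X p) \<noteq> 0" for p q r
  \<comment> \<open>A cyclic shift and a transposition generate all orders of a triple, so each
    triple can be sorted into one of the placed forms.\<close>
  have nc1: "nc q r p" if "nc p q r" for p q r
    using that cr_rotate[of "pos X q" "pos X p" "pos X r"] unfolding nc_def by simp
  have nc2: "nc p r q" if "nc p q r" for p q r
    using that cr_swap[of "pos X q" "pos X p" "pos X r"] unfolding nc_def by simp
  have VV: "ok p q" if "p \<in> V'" "q \<in> V'" "p \<noteq> q" for p q
    using faithfulD(1,2)[OF faithful' that] that by (simp add: ok_def pos_V)
  have vV: "ok (v k) w" if "k \<le> n" "w \<in> V'" for k w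
    using pair_v_V[OF that] by (simp add: ok_def)
  have vv: "ok (v i) (v j)" if "i \<le> n" "j \<le> n" "i \<noteq> j" for i j
  proof (cases "i < j")
    case True
    then show ?thesis using pair_v_v[OF True that(2)] by (simp add: ok_def)
  next
    case False
    then have "j < i" using that by simp
    then have "ok (v j) (v i)" using pair_v_v[OF _ that(1)] by (simp add: ok_def)
    then show ?thesis by (rule ok_sym)
  qed
  have P: "p \<in> V' \<or> (\<exists>k\<le>n. p = v k)" if "p \<in> points" for p using that by (auto simp: points_def)
  have 1: "ok p q" if pq: "p \<in> points" "q \<in> points" and ne: "p \<noteq> q" for p q
  proof -
    consider "p \<in> V'" "q \<in> V'" | k where "k \<le> n" "p = v k" "q \<in> V'" | k where "k \<le> n" "q = v k" "p \<in> V'"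
      | i j where "i \<le> n" "j \<le> n" "p = v i" "q = v j" using P[OF pq(1)] P[OF pq(2)] by blast
    then show ?thesis
    proof cases
      case 1 then show ?thesis using VV ne by simp
    next
      case (2 k) then show ?thesis using vV by simp
    next
      case (3 k) then show ?thesis using ok_sym[OF vV[of k p]] by simp
    next
      case (4 i j) then have "i \<noteq> j" using ne by blast
      then show ?thesis using vv[OF 4(1,2)] 4 by simp
    qed
  qed
  have VVV: "nc p q r" if "p \<in> V'" "q \<in> V'" "r \<in> V'" "p \<noteq> q" "p \<noteq> r" "q \<noteq> r" for p q r
    using faithfulD(3)[OF faithful' that(1,2,4,3,5,6)] that by (simp add: nc_def pos_V)
  have vVV: "nc w w' (v k)" if "k \<le> n" "w \<in> V'" "w' \<in> V'" "w \<noteq> w'" for k w w'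
    using placedD(4)[OF that] by (simp add: nc_def)
  have vvV: "nc w (v i) (v j)" if "i \<le> n" "j \<le> n" "i \<noteq> j" "w \<in> V'" for i j w
  proof (cases "i < j")
    case True then show ?thesis using placedD(5)[OF True that(2,4)] by (simp add: nc_def)
  next
    case False
    then have "j < i" using that by simp
    then have "nc w (v j) (v i)" using placedD(5)[OF _ that(1,4)] by (simp add: nc_def)
    then show ?thesis by (rule nc2)
  qed
  have vvv0: "nc (v i) (v j) (v l)" if "i < j" "j < l" "l \<le> n" for i j l
    using placedD(6)[OF that] by (simp add: nc_def)
  have vvv: "nc (v i) (v j) (v l)" if le: "i \<le> n" "j \<le> n" "l \<le> n" and ne: "i \<noteq> j" "i \<noteq> l" "j \<noteq> l" for i j l
  proof -
    consider "i < j" "j < l" | "i < l" "l < j" | "j < i" "i < l" | "j < l" "l < i" | "l < i" "i < j" | "l < j" "j < i"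
      using ne by linarith
    then show ?thesis
    proof cases
      case 1 then show ?thesis using vvv0[OF 1 le(3)] by simp
    next
      case 2 then show ?thesis using nc2[OF vvv0[OF 2 le(2)]] by simp
    next
      case 3 then show ?thesis using nc2[OF nc1[OF vvv0[OF 3 le(3)]]] by simp
    next
      case 4 then show ?thesis using nc1[OF nc1[OF vvv0[OF 4 le(1)]]] by simp
    next
      case 5 then show ?thesis using nc1[OF vvv0[OF 5 le(2)]] by simp
    next
      case 6 then show ?thesis using nc2[OF nc1[OF nc1[OF vvv0[OF 6 le(1)]]]] by simp
    qed
  qed
  have 2: "nc p q r" if pqr: "p \<in> points" "q \<in> points" "r \<in> points" and ne: "p \<noteq> q" "p \<noteq> r" "q \<noteq> r" for p q r
  proof -
    show ?thesis
    proof (cases "p \<in> V'")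
      case pT: True
      show ?thesis
      proof (cases "q \<in> V'")
        case qT: True
        show ?thesis
        proof (cases "r \<in> V'")
          case rT: True
          show ?thesis using VVV[OF pT qT rT ne] .
        next
          case rF: False
          obtain ri where rk: "ri \<le> n" "r = v ri" using P[OF pqr(3)] rF by blast
          show ?thesis using vVV[OF rk(1) pT qT ne(1)] rk(2) by simp
        qed
      next
        case qF: False
        obtain qi where qk: "qi \<le> n" "q = v qi" using P[OF pqr(2)] qF by blast
        show ?thesis
        proof (cases "r \<in> V'")
          case rT: True
          show ?thesis using nc2[OF vVV[OF qk(1) pT rT ne(2)]] qk(2) by simp
        next
          case rF: False
          obtain ri where rk: "ri \<le> n" "r = v ri" using P[OF pqr(3)] rF by blast
          show ?thesis using vvV[OF qk(1) rk(1) _ pT] ne(3) qk(2) rk(2) by blast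
        qed
      qed
    next
      case pF: False
      obtain pi where pk: "pi \<le> n" "p = v pi" using P[OF pqr(1)] pF by blast
      show ?thesis
      proof (cases "q \<in> V'")
        case qT: True
        show ?thesis
        proof (cases "r \<in> V'")
          case rT: True
          show ?thesis using nc1[OF nc1[OF vVV[OF pk(1) qT rT ne(3)]]] pk(2) by simp
        next
          case rF: False
          obtain ri where rk: "ri \<le> n" "r = v ri" using P[OF pqr(3)] rF by blast
          show ?thesis using nc2[OF nc1[OF vvV[OF pk(1) rk(1) _ qT]]] ne(2) pk(2) rk(2) by blast
        qed
      next
        case qF: False
        obtain qi where qk: "qi \<le> n" "q = v qi" using P[OF pqr(2)] qF by blast
        show ?thesis
        proof (cases "r \<in> V'")
          case rT: True
          show ?thesis using nc1[OF vvV[OF pk(1) qk(1) _ rT]] ne(1) pk(2) qk(2) by blast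
        next
          case rF: False
          obtain ri where rk: "ri \<le> n" "r = v ri" using P[OF pqr(3)] rF by blast
          show ?thesis using vvv[OF pk(1) qk(1) rk(1)] ne pk(2) qk(2) rk(2) by blast
        qed
      qed
    qed
  qed
  show ?thesis unfolding faithful_def
    by (intro conjI ballI impI) (use 1 2 in \<open>auto simp: ok_def nc_def\<close>)
qed

end
end

section \<open>Powers of phi and the separation property of the new drawing\<close>

lemma phi_bound: "phi > 809/500" using phi_lower by simp

text \<open>The powers of phi with integer exponent, up to sign; two natural exponents stand for one
  integer.\<close>

definition pure :: "real \<Rightarrow> bool" where "pure y \<longleftrightarrow> (\<exists>a b::nat. \<bar>y\<bar> * phi ^ b = phi ^ a)"

lemma pure_nz: "pure y \<Longrightarrow> y \<noteq> 0"
  using phi_pos by (auto simp: pure_def)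

lemma pure_mult: 
  assumes "pure x" "pure y"
  shows "pure (x * y)"
proof -
  obtain a b c d :: nat where "\<bar>x\<bar> * phi ^ b = phi ^ a" "\<bar>y\<bar> * phi ^ d = phi ^ c"
    using assms by (auto simp: pure_def)
  then have "(\<bar>x\<bar> * phi ^ b) * (\<bar>y\<bar> * phi ^ d) = phi ^ a * phi ^ c" by simp
  then have "\<bar>x * y\<bar> * phi ^ (b + d) = phi ^ (a + c)" by (simp add: abs_mult power_add mult_ac)
  then show ?thesis unfolding pure_def by blast
qed

lemma pure_inverse:
  assumes "pure x"
  shows "pure (1 / x)"
proof -
  obtain a b :: nat where "\<bar>x\<bar> * phi ^ b = phi ^ a" using assms by (auto simp: pure_def)
  then have "\<bar>1 / x\<bar> * phi ^ a = phi ^ b" using pure_nz[OF assms] by (simp add: field_simps)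
  then show ?thesis unfolding pure_def by blast
qed

lemma pure_divide: "pure x \<Longrightarrow> pure y \<Longrightarrow> pure (x / y)"
  using pure_mult[OF _ pure_inverse, of x y] by simp

lemma pure_cases:
  assumes "pure y"
  shows "\<bar>y\<bar> = 1 \<or> \<bar>y\<bar> \<ge> phi \<or> \<bar>y\<bar> \<le> 31/50"
proof -
  obtain a b :: nat where e: "\<bar>y\<bar> * phi ^ b = phi ^ a" using assms by (auto simp: pure_def)
  have pb: "phi ^ b > 0" using phi_pos by simp
  consider "a = b" | "a \<ge> b + 1" | "b \<ge> a + 1" by linarith
  then show ?thesis
  proof cases
    case 1
    then have "\<bar>y\<bar> * phi ^ b = 1 * phi ^ b" using e by simp
    then have "\<bar>y\<bar> = 1" using pb by (metis less_irrefl mult_cancel_right)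
    then show ?thesis by simp
  next
    case 2
    then have "phi * phi ^ b \<le> \<bar>y\<bar> * phi ^ b" unfolding e using phi_gt_1 power_increasing[of "b + 1" a phi] by simp
    then show ?thesis using pb by simp
  next
    case 3
    then have "phi ^ a * phi \<le> phi ^ b" using phi_gt_1 power_increasing[of "a + 1" b phi] by (simp add: mult.commute)
    then have "(\<bar>y\<bar> * phi) * phi ^ b \<le> 1 * phi ^ b" unfolding e[symmetric] by (simp add: mult_ac)
    then have "\<bar>y\<bar> * phi \<le> 1" using pb by (simp only: mult_le_cancel_right_pos)
    moreover have "\<bar>y\<bar> * (809/500) \<le> \<bar>y\<bar> * phi" using phi_bound by (intro mult_left_mono) auto
    ultimately have "\<bar>y\<bar> \<le> 31/50" by simp
    then show ?thesis by blast
  qed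
qed

text \<open>The neighbours of 1 among the powers of phi are 0.618... and 1.618..., both just outside
  the bounds.\<close>

lemma pure_near_1: "pure y \<Longrightarrow> 13/20 < y \<Longrightarrow> y < 1.6 \<Longrightarrow> y = 1"
  using pure_cases[of y] phi_bound by auto

lemma bad_ratioD:
  assumes "bad_ratio A B"
  shows "pure (B / A)" "\<bar>B / A\<bar> \<le> 6/25" "B \<noteq> 0" "A \<noteq> 0"
proof -
  obtain m :: nat where m: "m \<ge> 3" "\<bar>B\<bar> * phi ^ m = \<bar>A\<bar>" and A: "A \<noteq> 0" using assms by (auto simp: bad_ratio_def)
  show "A \<noteq> 0" "B \<noteq> 0" using bad_ratio_nz[OF assms] by auto
  have AA: "\<bar>A\<bar> \<noteq> 0" using \<open>A \<noteq> 0\<close> by simp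
  have "\<bar>B / A\<bar> * phi ^ m = (\<bar>B\<bar> * phi ^ m) / \<bar>A\<bar>" unfolding abs_divide by (rule times_divide_eq_left)
  also have "\<dots> = \<bar>A\<bar> / \<bar>A\<bar>" by (simp only: m(2))
  also have "\<dots> = 1" by (rule divide_self[OF AA])
  finally have e: "\<bar>B / A\<bar> * phi ^ m = 1" .
  then have "\<bar>B / A\<bar> * phi ^ m = phi ^ 0" by (simp only: power_0)
  then show "pure (B / A)" unfolding pure_def by blast
  have "phi ^ 3 \<le> phi ^ m" using m(1) phi_gt_1 by (intro power_increasing) auto
  then have "4.2 \<le> phi ^ m" using phi_bound by (simp add: phi_powers)
  then have "\<bar>B / A\<bar> * 4.2 \<le> 1" unfolding e[symmetric] by (intro mult_left_mono) auto
  moreover have "x \<le> 6/25" if "x * 4.2 \<le> 1" for x :: real using that by simp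
  ultimately show "\<bar>B / A\<bar> \<le> 6/25" by blast
qed

lemma ratio_facts:
  assumes "bad_ratio A B \<or> near_ratio A B"
  shows "A \<in> Zphi" "B \<in> Zphi" "A \<noteq> 0" "B \<noteq> 0" "A \<noteq> B"
proof -
  have "A \<in> Zphi \<and> B \<in> Zphi" using assms unfolding bad_ratio_def near_ratio_def by argo
  then show "A \<in> Zphi" "B \<in> Zphi" by simp_all
  show "A \<noteq> 0" "B \<noteq> 0" "A \<noteq> B" using assms bad_ratio_nz[of A B] near_ratio_nz[of A B] by argo+
qed

text \<open>With \<rho> = B/A either equation makes 1 - \<rho> a power of phi up to sign. But 0 <
  |\<rho>| \<le> 0.24, and so close to 1 there is no power except 1 itself.\<close>

lemma bad_ratio_one_new:
  assumes "bad_ratio A B" "pure x" "pure z"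
  shows "(A - B) * z \<noteq> A * x" "(A - B) * z \<noteq> - B * x"
proof -
  note b = bad_ratioD[OF assms(1)]
  define \<rho> where "\<rho> = B / A"
  have r: "\<bar>\<rho>\<bar> \<le> 6/25" "\<rho> \<noteq> 0" "pure \<rho>" and B: "B = \<rho> * A" using b by (auto simp: \<rho>_def)
  have z: "z \<noteq> 0" using assms(3) by (rule pure_nz)
  have np: "\<not> pure (1 - \<rho>)"
  proof
    assume "pure (1 - \<rho>)"
    moreover have "13/20 < 1 - \<rho>" "1 - \<rho> < 1.6" using r(1) by linarith+
    ultimately have "1 - \<rho> = 1" by (rule pure_near_1)
    then show False using r(2) by simp
  qed
  show "(A - B) * z \<noteq> A * x"
  proof
    assume "(A - B) * z = A * x"
    then have "A * ((1 - \<rho>) * z) = A * x" unfolding B by (simp add: algebra_simps)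
    then have "(1 - \<rho>) * z = x" by (rule mult_left_cancel[OF b(4), THEN iffD1])
    then have "1 - \<rho> = x / z" using z by (simp add: eq_divide_eq)
    then show False using np pure_divide[OF assms(2,3)] by simp
  qed
  show "(A - B) * z \<noteq> - B * x"
  proof
    assume "(A - B) * z = - B * x"
    then have "A * ((1 - \<rho>) * z) = A * (- \<rho> * x)" unfolding B by (simp add: algebra_simps)
    then have "(1 - \<rho>) * z = - \<rho> * x" by (rule mult_left_cancel[OF b(4), THEN iffD1])
    then have "1 - \<rho> = (- \<rho> * x) / z" using z by (simp only: eq_divide_eq) simp
    moreover have "pure ((- \<rho> * x) / z)" using pure_divide[OF pure_mult[OF r(3) assms(2)] assms(3)] by (simp add: pure_def)
    ultimately show False using np by simp
  qed
qed

text \<open>With \<rho> = B/A, |1 - \<rho>| < 0.6 < \<rho>, and z is not larger than x, so the left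
  side is smaller than either right side.\<close>

lemma near_ratio_one_new:
  assumes "near_ratio A B" "\<bar>x\<bar> \<ge> \<bar>z\<bar>" "z \<noteq> 0"
  shows "(A - B) * z \<noteq> A * x" "(A - B) * z \<noteq> - B * x"
proof -
  define \<rho> where "\<rho> = B / A"
  have A: "A \<noteq> 0" and r: "0.6 < \<rho>" "\<rho> < 1.6" and B: "B = \<rho> * A"
    using assms(1) by (auto simp: near_ratio_def \<rho>_def)
  have x: "\<bar>x\<bar> > 0" using assms by linarith
  have "\<bar>1 - \<rho>\<bar> < 0.6" using r by linarith
  then have "\<bar>1 - \<rho>\<bar> * \<bar>x\<bar> < 0.6 * \<bar>x\<bar>" using x by (intro mult_strict_right_mono)
  moreover have "\<bar>1 - \<rho>\<bar> * \<bar>z\<bar> \<le> \<bar>1 - \<rho>\<bar> * \<bar>x\<bar>" using assms(2) by (intro mult_left_mono) auto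
  ultimately have lt: "\<bar>1 - \<rho>\<bar> * \<bar>z\<bar> < 0.6 * \<bar>x\<bar>" by linarith
  show "(A - B) * z \<noteq> A * x"
  proof
    assume "(A - B) * z = A * x"
    then have "A * ((1 - \<rho>) * z) = A * x" unfolding B by (simp add: algebra_simps)
    then have e: "(1 - \<rho>) * z = x" by (rule mult_left_cancel[OF A, THEN iffD1])
    have "\<bar>1 - \<rho>\<bar> * \<bar>z\<bar> = \<bar>x\<bar>" unfolding e[symmetric] by (simp only: abs_mult)
    then show False using lt x by linarith
  qed
  show "(A - B) * z \<noteq> - B * x"
  proof
    assume "(A - B) * z = - B * x"
    then have "A * ((1 - \<rho>) * z) = A * (- (\<rho> * x))" unfolding B by (simp add: algebra_simps)
    then have e: "(1 - \<rho>) * z = - (\<rho> * x)" by (rule mult_left_cancel[OF A, THEN iffD1])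
    have "\<bar>(1 - \<rho>) * z\<bar> = \<bar>\<rho> * x\<bar>" unfolding e by (rule abs_minus_cancel)
    then have "\<bar>1 - \<rho>\<bar> * \<bar>z\<bar> = \<bar>\<rho>\<bar> * \<bar>x\<bar>" by (simp only: abs_mult)
    moreover have "0.6 * \<bar>x\<bar> \<le> \<bar>\<rho>\<bar> * \<bar>x\<bar>" using r by (intro mult_right_mono) auto
    ultimately show False using lt by linarith
  qed
qed

text \<open>B/A would be a power of phi, up to sign, of size at least 1. A bad ratio is too small,
  and a near ratio is different from 1 and below phi.\<close>

lemma two_new:
  assumes "bad_ratio A B \<or> near_ratio A B" "\<bar>x\<bar> \<ge> \<bar>y\<bar>" "pure x" "pure y"
  shows "A * x \<noteq> B * y"
proof
  assume e: "A * x = B * y"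
  define \<rho> where "\<rho> = B / A"
  have A: "A \<noteq> 0" using assms(1) by (auto simp: near_ratio_def bad_ratio_def)
  have y: "\<bar>y\<bar> > 0" using pure_nz[OF assms(4)] by simp
  have xy: "x / y = \<rho>" using e A y by (simp add: \<rho>_def field_simps)
  then have "\<bar>\<rho>\<bar> = \<bar>x\<bar> / \<bar>y\<bar>" by (auto simp: abs_divide)
  then have "\<bar>\<rho>\<bar> \<ge> 1" using assms(2) y by (simp add: le_divide_eq)
  moreover have "near_ratio A B"
  proof (rule ccontr)
    assume "\<not> near_ratio A B"
    then have "\<bar>B / A\<bar> \<le> 6/25" using assms(1) bad_ratioD(2)[of A B] by blast
    then have "\<bar>\<rho>\<bar> \<le> 6/25" unfolding \<rho>_def .
    then show False using \<open>\<bar>\<rho>\<bar> \<ge> 1\<close> by linarith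
  qed
  ultimately have r0: "\<bar>\<rho>\<bar> \<ge> 1" "0.6 < \<rho>" "\<rho> < 1.6" "\<rho> \<noteq> 1"
    using A by (simp_all add: near_ratio_def \<rho>_def)
  then have r: "1 \<le> \<rho>" "\<rho> < 1.6" "\<rho> \<noteq> 1" by simp_all
  moreover have "pure \<rho>" unfolding xy[symmetric] by (rule pure_divide[OF assms(3,4)])
  ultimately show False using pure_near_1[of \<rho>] by linarith
qed

text \<open>With \<rho> = B/A the equation gives x/z = 1 - \<rho> + \<rho> y/z, which is within 0.48
  of 1. A power of phi of size at least 1 in this range is 1, and then y = z = x, against |y| <
  |x|.\<close>

lemma three_new:
  assumes "bad_ratio A B" "\<bar>y\<bar> \<le> \<bar>z\<bar>" "\<bar>y\<bar> < \<bar>x\<bar>" "pure x" "pure y" "pure z" "\<bar>z\<bar> \<le> \<bar>x\<bar>"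
  shows "(A - B) * z \<noteq> A * x - B * y"
proof
  assume e: "(A - B) * z = A * x - B * y"
  note b = bad_ratioD[OF assms(1)]
  define \<rho> where "\<rho> = B / A"
  have r: "\<bar>\<rho>\<bar> \<le> 6/25" "\<rho> \<noteq> 0" and B: "B = \<rho> * A" using b by (auto simp: \<rho>_def)
  have z: "z \<noteq> 0" using assms(6) by (rule pure_nz)
  have "A * ((1 - \<rho>) * z) = A * (x - \<rho> * y)" using e unfolding B by (simp add: algebra_simps)
  then have "(1 - \<rho>) * z = x - \<rho> * y" by (rule mult_left_cancel[OF b(4), THEN iffD1])
  then have "x = (1 - \<rho>) * z + \<rho> * y" by simp
  then have xz: "x / z = 1 - \<rho> + \<rho> * (y / z)" using z by (simp add: add_divide_distrib)
  have "\<bar>y / z\<bar> \<le> 1" using assms(2) z by (simp add: abs_divide divide_le_eq)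
  then have "\<bar>\<rho>\<bar> * \<bar>y / z\<bar> \<le> \<bar>\<rho>\<bar> * 1" by (intro mult_left_mono) auto
  then have "\<bar>\<rho> * (y / z)\<bar> \<le> \<bar>\<rho>\<bar>" by (simp only: abs_mult mult_1_right)
  then have "\<bar>x / z - 1\<bar> \<le> 12/25" unfolding xz using r(1) by linarith
  then have x1: "x / z > 0.5" "x / z < 1.6" by linarith+
  have px: "pure (x / z)" by (rule pure_divide[OF assms(4,6)])
  have "\<bar>x / z\<bar> \<ge> 1" using assms(7) z by (simp add: abs_divide)
  then have "x / z = 1" using pure_near_1[OF px] x1 by linarith
  then have "\<rho> * (y / z - 1) = 0" using xz by (simp add: algebra_simps)
  then have "y = z" "x = z" using r(2) z \<open>x / z = 1\<close> by auto
  then show False using assms(3) by simp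
qed

context path_core
begin

text \<open>The derivative in X of height s of the vertex x.\<close>

definition first_order :: "int \<Rightarrow> 'a \<Rightarrow> real" where
  "first_order s x = (if x \<in> V' then 0 else ht s (c (the_inv_into {..n} v x)))"

lemma first_order_V: "x \<in> V' \<Longrightarrow> first_order s x = 0"
  and first_order_v: "k \<le> n \<Longrightarrow> first_order s (v k) = ht s (c k)"
  using v_notin[of k] the_inv_into_f_f[OF v_inj, of k] by (simp_all add: first_order_def)

definition linear :: "real \<Rightarrow> bool" where
  "linear X \<longleftrightarrow> (\<forall>f. (\<forall>x\<in>points. f x \<in> Zphi \<times> Zphi) \<longrightarrow> (\<Sum>x\<in>points. lin (f x) (pos X x)) = 0 \<longrightarrow>
     (\<Sum>k\<le>n. lin (f (v k)) (c k)) = 0)"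

lemma generic_linear: "generic linear" unfolding linear_def by (rule linear_generic)

lemma finite_points: "finite points" by (simp add: points_def fin)

lemma v_points: "k \<le> n \<Longrightarrow> v k \<in> points" and V_points: "x \<in> V' \<Longrightarrow> x \<in> points"
  by (auto simp: points_def)

lemma points_cases:
  assumes "x \<in> points"
  obtains "x \<in> V'" | k where "k \<le> n" "x = v k"
  using assms by (auto simp: points_def)

lemma ht_c_size:
  assumes "\<not> 5 dvd (\<theta> k - s)"
  shows "pure (ht s (c k))" "phi ^ k \<le> \<bar>ht s (c k)\<bar>" "\<bar>ht s (c k)\<bar> \<le> phi ^ Suc k"
proof -
  have a: "\<bar>ht s (c k)\<bar> = phi ^ k * \<bar>sn (\<theta> k - s)\<bar>" using phi_pos by (simp add: ht_c abs_mult)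
  have "phi ^ k * 1 \<le> phi ^ k * \<bar>sn (\<theta> k - s)\<bar>"
    using phi_pos assms by (intro mult_left_mono abs_sn_ge_1) auto
  then show "phi ^ k \<le> \<bar>ht s (c k)\<bar>" using a by simp
  have "phi ^ k * \<bar>sn (\<theta> k - s)\<bar> \<le> phi ^ k * phi"
    using phi_pos by (intro mult_left_mono abs_sn_le_phi) auto
  then show "\<bar>ht s (c k)\<bar> \<le> phi ^ Suc k" using a by (simp add: mult.commute)
  have "\<bar>sn (\<theta> k - s)\<bar> = 1 \<or> \<bar>sn (\<theta> k - s)\<bar> = phi" using abs_sn[of "\<theta> k - s"] assms by auto
  then have "\<bar>ht s (c k)\<bar> * phi ^ 0 = phi ^ k \<or> \<bar>ht s (c k)\<bar> * phi ^ 0 = phi ^ Suc k"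
    using a by auto
  then show "pure (ht s (c k))" unfolding pure_def by blast
qed

context
  fixes X :: real
  assumes placed: "placed X" and linear: "linear X"
begin

lemma free_v:
  assumes "k \<le> n" "free points (pos X) (v k) s"
  shows "\<not> 5 dvd (\<theta> k - s)" "\<not> 5 dvd (s - \<theta> k)"
proof -
  show "\<not> 5 dvd (\<theta> k - s)"
  proof
    assume "5 dvd (\<theta> k - s)"
    then have "ht s (pos X (v k)) = ht s (pos X (u k))" using ht_ext[OF placed assms(1)] ht_cong_eq by blast
    moreover have "u k \<noteq> v k" "u k \<in> points" using u_in[OF assms(1)] v_notin[OF assms(1)] V_points by auto
    ultimately show False using assms(2) unfolding free_def by blast
  qed
  then show "\<not> 5 dvd (s - \<theta> k)" by presburger
qed

lemma free_u_points:
  assumes "k \<le> n" "free points (pos X) (u k) s"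
  shows "\<not> 5 dvd (\<theta> k - s)"
proof
  assume "5 dvd (\<theta> k - s)"
  then have "ht s (pos X (u k)) = ht s (pos X (v k))" using ht_ext[OF placed assms(1)] ht_cong_eq by metis
  moreover have "v k \<noteq> u k" "v k \<in> points" using u_in[OF assms(1)] v_notin[OF assms(1)] v_points[OF assms(1)] by auto
  ultimately show False using assms(2) unfolding free_def by blast
qed

lemma free_V': "x \<in> V' \<Longrightarrow> free points (pos X) x s \<Longrightarrow> free V' D' x s"
  by (rule free_mono[where V=points and D="pos X"]) (auto simp: pos_V points_def)

lemma deg_points_V:
  assumes "x \<in> V'"
  shows "deg points E x = deg V' E x + card {k. k \<le> n \<and> u k = x}"
proof -
  have "{w \<in> points. E x w} = {w \<in> V'. E x w} \<union> v ` {k. k \<le> n \<and> u k = x}"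
  proof (intro equalityI subsetI)
    fix w assume w: "w \<in> {w \<in> points. E x w}"
    then have wp: "w \<in> points" and ww: "E x w" by auto
    show "w \<in> {w \<in> V'. E x w} \<union> v ` {k. k \<le> n \<and> u k = x}"
    proof (cases rule: points_cases[OF wp])
      case 1 then show ?thesis using ww by simp
    next
      case (2 k)
      then have "x = u k" using ext[OF 2(1) assms] sym[OF ww] by simp
      then show ?thesis using 2 by simp
    qed
  next
    fix w assume "w \<in> {w \<in> V'. E x w} \<union> v ` {k. k \<le> n \<and> u k = x}"
    then consider "w \<in> V'" "E x w" | k where "k \<le> n" "u k = x" "w = v k" by auto
    then show "w \<in> {w \<in> points. E x w}"
    proof cases
      case 1 then show ?thesis by (simp add: V_points)
    next
      case (2 k) then show ?thesis using v_points[OF 2(1)] sym[OF v_u_adj[OF 2(1)]] by simp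
    qed
  qed
  moreover have "{w \<in> V'. E x w} \<inter> v ` {k. k \<le> n \<and> u k = x} = {}" using v_notin by auto
  moreover have "card (v ` {k. k \<le> n \<and> u k = x}) = card {k. k \<le> n \<and> u k = x}"
    by (rule card_image) (rule inj_on_subset[OF v_inj], auto)
  ultimately show ?thesis unfolding deg_def using fin by (simp add: card_Un_disjoint)
qed

lemma interior_full:
  assumes "0 < k" "k < n"
  shows "3 \<le> deg points E (v k)"
proof -
  have k: "k \<le> n" "k - 1 \<le> n" "k + 1 \<le> n" using assms by simp_all
  have ne: "v (k - 1) \<noteq> u k" "v (k + 1) \<noteq> u k" using v_notin[OF k(2)] v_notin[OF k(3)] u_in[OF k(1)] by metis+
  have "v (k - 1) \<noteq> v (k + 1)"
  proof
    assume "v (k - 1) = v (k + 1)"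
    then have "k - 1 = k + 1" by (rule inj_onD[OF v_inj]) (use k in auto)
    then show False by simp
  qed
  then have c3: "card {u k, v (k - 1), v (k + 1)} = 3" using ne by simp
  have "E (v (k - 1)) (v k)" "E (v k) (v (k + 1))"
    using adj[of "k - 1" k] adj[of k "k + 1"] assms by simp_all
  then have "{u k, v (k - 1), v (k + 1)} \<subseteq> {w \<in> points. E (v k) w}"
    using v_u_adj[OF k(1)] V_points[OF u_in[OF k(1)]] v_points[OF k(2)] v_points[OF k(3)] sym[of "v (k - 1)" "v k"] by simp
  from card_mono[OF _ this] show ?thesis using finite_points c3 unfolding deg_def by simp
qed

lemma deficient_cases:
  assumes "p \<in> points" "deg points E p < 3"
  obtains "p \<in> V'" | "p = v 0" | "p = v n" "n \<noteq> 0"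
proof (cases rule: points_cases[OF assms(1)])
  case 1 then show ?thesis by (rule that(1))
next
  case (2 k)
  have "\<not> (0 < k \<and> k < n)"
  proof
    assume "0 < k \<and> k < n"
    then have "3 \<le> deg points E (v k)" using interior_full[of k] by blast
    then show False using assms(2) 2(2) by simp
  qed
  then have "k = 0 \<or> k = n \<and> n \<noteq> 0" using 2(1) by arith
  then show ?thesis using that(2,3) 2(2) by auto
qed

lemma first_order_relation:
  assumes pqr: "p \<in> points" "q \<in> points" "r \<in> points" "p \<noteq> q" "p \<noteq> r" "q \<noteq> r"
    and Z: "A \<in> Zphi" "B \<in> Zphi" "C \<in> Zphi"
    and eq: "A * ht s (pos X p) + B * ht s (pos X q) + C * ht s (pos X r) = 0"
  shows "A * first_order s p + B * first_order s q + C * first_order s r = 0"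
proof -
  define g where "g x = (if x = p then A else if x = q then B else if x = r then C else 0)" for x
  define f where "f x = g x *\<^sub>R htc s" for x
  have lf: "lin (f x) z = g x * ht s z" for x z by (simp add: f_def lin_coeff lin_htc)
  have gZ: "g x \<in> Zphi" for x using Z Zphi_0 by (simp add: g_def)
  have "f x \<in> Zphi \<times> Zphi" for x using gZ[of x] htc_Zphi[of s] by (simp add: f_def mem_Times_iff Zphi_mult)
  moreover have "(\<Sum>x\<in>points. lin (f x) (pos X x)) = 0"
    unfolding lf g_def using eq pqr by (subst sum_three[OF finite_points pqr(4-6)]) simp
  ultimately have "(\<Sum>k\<le>n. lin (f (v k)) (c k)) = 0" using linear unfolding linear_def by simp
  also have "(\<Sum>k\<le>n. lin (f (v k)) (c k)) = (\<Sum>k\<le>n. g (v k) * first_order s (v k))"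
    by (rule sum.cong) (simp_all add: lf first_order_v)
  also have "\<dots> = (\<Sum>x\<in>v ` {..n}. g x * first_order s x)" by (simp add: sum.reindex[OF v_inj])
  also have "\<dots> = (\<Sum>x\<in>points. g x * first_order s x)"
    by (rule sum.mono_neutral_left[OF finite_points]) (auto simp: points_def first_order_V)
  also have "\<dots> = A * first_order s p + B * first_order s q + C * first_order s r"
    unfolding g_def using pqr by (subst sum_three[OF finite_points pqr(4-6)]) simp
  finally show ?thesis .
qed

text \<open>The forbidden relation is differentiated. A deficient vertex is old, with derivative 0,
  or an end of the path, with a power of phi up to sign; an interior vertex can occur only as r in a
  bad ratio. The size lemmas exclude one, two or three moving vertices; the condition on (v 0, v n)
  ensures that the faster end v n stands in front of v 0. If nothing moves, the relation is one of
  the smaller drawing.\<close>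

lemma separated_placed:
  assumes R: "R \<inter> {(p, q). p \<in> V' \<and> q \<in> V' \<and> deg points E p < 3 \<and> deg points E q < 3} \<subseteq> R'"
    and orient: "(v 0, v n) \<notin> R"
  shows "separated points E R (pos X)"
  unfolding separated_def
proof (intro ballI allI impI notI)
  fix p q r s A B
  assume pt: "p \<in> points" "q \<in> points" "r \<in> points" and ne: "p \<noteq> q" "p \<noteq> r" "q \<noteq> r"
    and pqR: "(p, q) \<in> R" and dp: "deg points E p < 3" and dq: "deg points E q < 3"
    and fp: "free points (pos X) p s" and fq: "free points (pos X) q s"
    and ratio: "bad_ratio A B \<or> near_ratio A B \<and> (p, r) \<in> R \<and> (q, r) \<in> R \<and> deg points E r < 3 \<and> free points (pos X) r s"
    and eq: "- A * ht s (pos X p) + B * ht s (pos X q) + (A - B) * ht s (pos X r) = 0"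
  have bn: "bad_ratio A B \<or> near_ratio A B" using ratio by argo
  note Z = ratio_facts(1,2)[OF bn] and nz = ratio_facts(3-5)[OF bn]
  have fo: "- A * first_order s p + B * first_order s q + (A - B) * first_order s r = 0"
    by (rule first_order_relation[OF pt ne _ _ _ eq]) (use Z in \<open>auto intro: Zphi_intros\<close>)
  have dV: "deg V' E x \<le> deg points E x" if "x \<in> V'" for x using deg_points_V[OF that] by simp
  have R'I: "(x, y) \<in> R'" if "(x, y) \<in> R" "x \<in> V'" "y \<in> V'" "deg points E x < 3" "deg points E y < 3" for x y
    using R that by blast
  have big: "\<bar>ht s (c 0)\<bar> \<le> \<bar>ht s (c n)\<bar>" if "n \<noteq> 0" "\<not> 5 dvd (\<theta> 0 - s)" "\<not> 5 dvd (\<theta> n - s)"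
  proof -
    have "phi ^ Suc 0 \<le> phi ^ n" using that(1) phi_gt_1 by (intro power_increasing) auto
    then show ?thesis using ht_c_size(3)[OF that(2)] ht_c_size(2)[OF that(3)] by linarith
  qed
  have r_first: "r \<in> V' \<or> (\<exists>l\<le>n. r = v l)" using pt(3) by (auto simp: points_def)
  have r_zero: "r \<in> V' \<or> (\<exists>l\<le>n. r = v l \<and> 5 dvd (\<theta> l - s))" if "first_order s r = 0"
    using r_first that by (auto simp: first_order_v c_eq_0_iff)
  have r_pure: "\<exists>l\<le>n. r = v l \<and> \<not> 5 dvd (\<theta> l - s)" if "first_order s r \<noteq> 0"
    using r_first that by (auto simp: first_order_v first_order_V c_eq_0_iff)
  have ends: "first_order s x = ht s (c k) \<and> \<not> 5 dvd (\<theta> k - s)" if "x = v k" "k \<le> n" "free points (pos X) x s" for x k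
    using free_v(1)[OF that(2)] that by (simp add: first_order_v)
  have both: False if pn: "p = v n" and q0: "q = v 0"
  proof -
    have n0: "n \<noteq> 0" using pn q0 ne(1) by (cases "n = 0") auto
    note pp = ends[OF pn order_refl fp] and qq = ends[OF q0 le0 fq]
    have x: "pure (first_order s p)" and y: "pure (first_order s q)" using pp qq ht_c_size(1) by simp_all
    have yx: "\<bar>first_order s q\<bar> \<le> \<bar>first_order s p\<bar>" using big[OF n0] pp qq by simp
    show False
    proof (cases "first_order s r = 0")
      case True
      then have "A * first_order s p = B * first_order s q" using fo by simp
      then show False using two_new[OF bn yx x y] by simp
    next
      case False
      then obtain l where l: "l \<le> n" "r = v l" "\<not> 5 dvd (\<theta> l - s)" using r_pure by blast
      have "l \<noteq> 0" using l(2) q0 ne(3) by (cases "l = 0") auto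
      moreover have "l \<noteq> n" using l(2) pn ne(2) by (cases "l = n") auto
      ultimately have ll: "0 < l" "l < n" using l(1) by simp_all
      then have bad: "bad_ratio A B" using ratio interior_full[of l] l(2) by auto
      have r: "first_order s r = ht s (c l)" using l by (simp add: first_order_v)
      note sl = ht_c_size[OF l(3)]
      have s0: "\<bar>first_order s q\<bar> \<le> phi ^ Suc 0" using ht_c_size(3)[of 0 s] qq by simp
      have sn: "phi ^ n \<le> \<bar>first_order s p\<bar>" using ht_c_size(2)[of n s] pp by simp
      have i1: "phi ^ Suc 0 \<le> phi ^ l" by (rule power_increasing) (use ll phi_gt_1 in auto)
      have i2: "phi ^ Suc l \<le> phi ^ n" by (rule power_increasing) (use ll phi_gt_1 in auto)
      have i3: "phi ^ Suc 0 < phi ^ n" by (rule power_strict_increasing) (use ll phi_gt_1 in auto)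
      have "(A - B) * first_order s r \<noteq> A * first_order s p - B * first_order s q"
      proof (rule three_new[OF bad _ _ x y])
        show "\<bar>first_order s q\<bar> \<le> \<bar>first_order s r\<bar>" unfolding r using s0 i1 sl(2) by linarith
        show "\<bar>first_order s q\<bar> < \<bar>first_order s p\<bar>" using s0 i3 sn by linarith
        show "pure (first_order s r)" unfolding r by (rule sl(1))
        show "\<bar>first_order s r\<bar> \<le> \<bar>first_order s p\<bar>" unfolding r using sl(3) i2 sn by linarith
      qed
      then show False using fo by simp
    qed
  qed
  have ordered: "\<bar>first_order s x\<bar> \<le> \<bar>first_order s y\<bar>"
    if "x = v 0" "y = v n" "x \<noteq> y" "x = v l" "l \<le> n" "\<not> 5 dvd (\<theta> l - s)" "y = v k" "k \<le> n" "\<not> 5 dvd (\<theta> k - s)" for x y l k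
  proof -
    have "l = 0" by (rule inj_onD[OF v_inj]) (use that in auto)
    moreover have "k = n" by (rule inj_onD[OF v_inj]) (use that in auto)
    moreover have "n \<noteq> 0" using that(1-3) by (cases "n = 0") auto
    ultimately show ?thesis using big that by (simp add: first_order_v)
  qed
  have rest: False if pk: "p = v 0 \<or> p = v n"
  proof -
    obtain h where h: "h \<le> n" "p = v h" "h = 0 \<or> h = n" using pk by auto
    note pp = ends[OF h(2,1) fp]
    have x: "pure (first_order s p)" using pp ht_c_size(1) by simp
    show False
    proof (cases rule: deficient_cases[OF pt(2) dq])
      case qV: 1
      have eq1: "(A - B) * first_order s r = A * first_order s p" using fo by (simp add: first_order_V qV)
      have r1: "first_order s r \<noteq> 0" using eq1 nz pure_nz[OF x] by auto
      then obtain l where l: "l \<le> n" "r = v l" "\<not> 5 dvd (\<theta> l - s)" using r_pure by blast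
      have z: "pure (first_order s r)" using l ht_c_size(1)[OF l(3)] by (simp add: first_order_v)
      have "near_ratio A B" "(p, r) \<in> R" "deg points E r < 3" using ratio bad_ratio_one_new(1)[OF _ x z] eq1 by blast+
      note nr = this
      have "r = v 0 \<and> p = v n"
      proof (cases rule: deficient_cases[OF pt(3) nr(3)])
        case 1 then show ?thesis using first_order_V r1 by simp
      next
        case 2 then show ?thesis using h(2,3) ne by auto
      next
        case 3 then have "p = v 0" using h(2,3) ne by auto
        then show ?thesis using nr(2) orient 3 by simp
      qed
      then have le: "\<bar>first_order s r\<bar> \<le> \<bar>first_order s p\<bar>" using ordered[of r p l h] l h pp ne by auto
      show False using near_ratio_one_new(1)[OF nr(1) le r1] eq1 by simp
    next
      case q0: 2
      then have pn: "p = v n" using pk ne(1) by auto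
      then show False using both q0 by blast
    next
      case qn: 3
      then have "p = v 0" using pk ne(1) by auto
      then show False using pqR orient qn by simp
    qed
  qed
  show False
  proof (cases rule: deficient_cases[OF pt(1) dp])
    case pV: 1
    show False
    proof (cases "q \<in> V'")
      case qV: True
      have r0: "first_order s r = 0" using fo nz(3) by (simp add: first_order_V pV qV)
      have fp': "free V' D' p s" and fq': "free V' D' q s" using free_V' pV qV fp fq by blast+
      consider "r \<in> V'" | l where "l \<le> n" "r = v l" "5 dvd (\<theta> l - s)" using r_zero[OF r0] by blast
      then show False
      proof cases
        case 1
        have "- A * ht s (D' p) + B * ht s (D' q) + (A - B) * ht s (D' r) \<noteq> 0"
        proof (rule separatedD[OF separated' pV qV 1 ne])
          show "(p, q) \<in> R'" by (rule R'I[OF pqR pV qV dp dq])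
          show "deg V' E p < 3" "deg V' E q < 3" using dV[OF pV] dV[OF qV] dp dq by simp_all
          show "bad_ratio A B \<or> near_ratio A B \<and> (p, r) \<in> R' \<and> (q, r) \<in> R' \<and> deg V' E r < 3 \<and> free V' D' r s"
          proof (cases "bad_ratio A B")
            case False
            then have "near_ratio A B" "(p, r) \<in> R" "(q, r) \<in> R" "deg points E r < 3" "free points (pos X) r s"
              using ratio by blast+
            then show ?thesis using R'I[OF _ pV 1 dp] R'I[OF _ qV 1 dq] dV[OF 1] free_V'[OF 1] by simp
          qed simp
        qed (rule fp', rule fq')
        then show False using eq by (simp add: pos_V pV qV 1)
      next
        case (2 l)
        \<comment> \<open>Slope s at r is occupied by the edge to u l, so r is not free and the
          ratio is bad. Both ends of this edge have the same height, so u l may take the place of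
          r.\<close>
        have bad: "bad_ratio A B" using ratio free_v(1)[OF 2(1)] 2(2,3) by blast
        have rl: "ht s (pos X r) = ht s (D' (u l))"
        proof -
          have "ht (\<theta> l) (pos X (v l)) = ht (\<theta> l) (pos X (u l))" by (rule ht_ext[OF placed 2(1)])
          then have "ht s (pos X (v l)) = ht s (pos X (u l))" using ht_cong_eq[OF 2(3)] by blast
          then show ?thesis using 2(2) u_in[OF 2(1)] by (simp add: pos_V)
        qed
        have "u l \<noteq> p" "u l \<noteq> q" using free_u_points[OF 2(1)] fp fq 2(3) by blast+
        then have "- A * ht s (D' p) + B * ht s (D' q) + (A - B) * ht s (D' (u l)) \<noteq> 0"
          using R'I[OF pqR pV qV dp dq] dV[OF pV] dV[OF qV] dp dq fp' fq' bad
          by (intro separatedD[OF separated' pV qV u_in[OF 2(1)] ne(1)]) auto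
        then show False using eq rl by (simp add: pos_V pV qV)
      qed
    next
      case False
      then obtain k where k: "k \<le> n" "q = v k" "k = 0 \<or> k = n"
        by (cases rule: deficient_cases[OF pt(2) dq]) auto
      note q = ends[OF k(2,1) fq]
      have y: "pure (first_order s q)" using q ht_c_size(1) by simp
      have eq1: "(A - B) * first_order s r = - B * first_order s q" using fo by (simp add: first_order_V pV)
      have r1: "first_order s r \<noteq> 0" using eq1 nz pure_nz[OF y] by auto
      then obtain l where l: "l \<le> n" "r = v l" "\<not> 5 dvd (\<theta> l - s)" using r_pure by blast
      have z: "pure (first_order s r)" using l ht_c_size(1)[OF l(3)] by (simp add: first_order_v)
      have "near_ratio A B" "(q, r) \<in> R" "deg points E r < 3" using ratio bad_ratio_one_new(2)[OF _ y z] eq1 by blast+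
      note nr = this
      have "r = v 0 \<and> q = v n"
      proof (cases rule: deficient_cases[OF pt(3) nr(3)])
        case 1 then show ?thesis using first_order_V r1 by simp
      next
        case 2 then show ?thesis using k(2,3) ne by auto
      next
        case 3 then have "q = v 0" using k(2,3) ne by auto
        then show ?thesis using nr(2) orient 3 by simp
      qed
      then have le: "\<bar>first_order s r\<bar> \<le> \<bar>first_order s q\<bar>" using ordered[of r q l k] l k q ne by auto
      show False using near_ratio_one_new(2)[OF nr(1) le r1] eq1 by simp
    qed
  next
    case pP: 2
    note pQ = this
    have "p = v 0 \<or> p = v n" using pP by simp
    then show False by (rule rest)
  next
    case pP: 3
    then have "p = v 0 \<or> p = v n" by simp
    then show False by (rule rest)
  qed
qed

end
end

section \<open>Independence and rigidity after inserting a path\<close>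

context path_core
begin

lemma lower_deg:
  assumes "k \<le> n" "S \<subseteq> X" "finite X" "\<And>w. w \<in> S \<Longrightarrow> E (v k) w"
  shows "card S \<le> deg X E (v k)"
  unfolding deg_def by (rule card_mono) (use assms in auto)

text \<open>Height t k agrees at both ends of a path edge. Expressing height t (k + 1) by the
  heights t k and \<theta> (k + 1) carries it along the path at the price of one height \<theta> at
  each vertex passed; no coefficient vanishes because the three slopes are pairwise different. The
  points z are arbitrary so that positions and velocities are both covered.\<close>

lemma chain:
  assumes "m \<le> l" "l < n"
  shows "\<exists>a C. a \<in> Zphi \<and> a \<noteq> 0 \<and> (\<forall>k. C k \<in> Zphi) \<and> (\<forall>k. C k \<noteq> 0 \<longleftrightarrow> m < k \<and> k \<le> l) \<and>
    (\<forall>z. (\<forall>k. m \<le> k \<and> k < l \<longrightarrow> ht (t k) (z (Suc k)) = ht (t k) (z k)) \<longrightarrow>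
       ht (t l) (z l) = a * ht (t m) (z m) + (\<Sum>k\<le>n. C k * ht (\<theta> k) (z k)))"
  using assms
proof (induction l rule: dec_induct)
  case base
  show ?case by (rule exI[of _ 1], rule exI[of _ "\<lambda>_. 0"]) (simp add: Zphi_0 Zphi_1)
next
  case (step l)
  have l: "l < n" "Suc l < n" using step.prems by simp_all
  obtain a C where aC: "a \<in> Zphi" "a \<noteq> 0" "\<And>k. C k \<in> Zphi" "\<And>k. C k \<noteq> 0 \<longleftrightarrow> m < k \<and> k \<le> l"
    and exp: "\<And>z. (\<forall>k. m \<le> k \<and> k < l \<longrightarrow> ht (t k) (z (Suc k)) = ht (t k) (z k)) \<Longrightarrow>
       ht (t l) (z l) = a * ht (t m) (z m) + (\<Sum>k\<le>n. C k * ht (\<theta> k) (z k))"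
    using step.IH l(1) by blast
  have nd: "\<not> 5 dvd (t l - \<theta> (Suc l))" "\<not> 5 dvd (\<theta> (Suc l) - t l)" using t_theta(2)[OF l(1)] by presburger+
  define P where "P = ht (t (Suc l)) (dir (\<theta> (Suc l))) / sn (\<theta> (Suc l) - t l)"
  define Q where "Q = ht (t (Suc l)) (dir (t l)) / sn (t l - \<theta> (Suc l))"
  have PQ: "ht (t (Suc l)) z = P * ht (t l) z + Q * ht (\<theta> (Suc l)) z" for z
    using lin_expand[OF nd(1), of "htc (t (Suc l))" z] by (simp add: lin_htc P_def Q_def)
  have "P \<in> Zphi" "Q \<in> Zphi" unfolding P_def Q_def ht_dir using nd by (auto intro!: Zphi_divide_sn Zphi_sn)
  have "\<not> 5 dvd (t l - t (Suc l))" using t_t[OF l(2)] by presburger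
  then have nz: "P \<noteq> 0" "Q \<noteq> 0" unfolding P_def Q_def ht_dir using nd t_theta(1)[OF l(2)] by (simp_all add: sn_eq_0_iff)
  define C' where "C' k = (if k = Suc l then Q else P * C k)" for k
  show ?case
  proof (rule exI[of _ "P * a"], rule exI[of _ C'], intro conjI allI impI)
    show "P * a \<in> Zphi" using \<open>P \<in> Zphi\<close> aC(1) by (rule Zphi_mult)
    show "P * a \<noteq> 0" using nz aC(2) by simp
    show "C' k \<in> Zphi" for k using \<open>P \<in> Zphi\<close> \<open>Q \<in> Zphi\<close> aC(3)[of k] by (simp add: C'_def Zphi_mult)
    show "C' k \<noteq> 0 \<longleftrightarrow> m < k \<and> k \<le> Suc l" for k
      using nz aC(4)[of k] step.hyps by (auto simp: C'_def)
    fix z assume z: "\<forall>k. m \<le> k \<and> k < Suc l \<longrightarrow> ht (t k) (z (Suc k)) = ht (t k) (z k)"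
    have Cl: "C (Suc l) = 0" using aC(4)[of "Suc l"] by auto
    have "(\<Sum>k\<le>n. C' k * ht (\<theta> k) (z k)) = (\<Sum>k\<le>n. P * (C k * ht (\<theta> k) (z k)) + (if k = Suc l then Q * ht (\<theta> k) (z k) else 0))"
      by (rule sum.cong) (auto simp: C'_def Cl)
    also have "\<dots> = P * (\<Sum>k\<le>n. C k * ht (\<theta> k) (z k)) + Q * ht (\<theta> (Suc l)) (z (Suc l))"
      using l by (simp add: sum.distrib sum_distrib_left)
    finally have s: "(\<Sum>k\<le>n. C' k * ht (\<theta> k) (z k)) = P * (\<Sum>k\<le>n. C k * ht (\<theta> k) (z k)) + Q * ht (\<theta> (Suc l)) (z (Suc l))" .
    have "ht (t l) (z (Suc l)) = a * ht (t m) (z m) + (\<Sum>k\<le>n. C k * ht (\<theta> k) (z k))"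
      using exp[of z] z step.hyps by simp
    then show "ht (t (Suc l)) (z (Suc l)) = P * a * ht (t m) (z m) + (\<Sum>k\<le>n. C' k * ht (\<theta> k) (z k))"
      unfolding s PQ[of "z (Suc l)"] by (simp add: algebra_simps)
  qed
qed

context
  fixes X :: real
  assumes placed: "placed X" and linear: "linear X"
begin

text \<open>Both functionals are transported to v m, which leaves one multiple of height t m and the
  heights \<theta> k. On the velocities the heights \<theta> k are zero, so the condition
  \<open>first\<close> kills that multiple. Height \<theta> k of v k is that of u k, so the relation
  now lives on the old drawing; \<open>nz\<close> keeps the coefficients at both ends of the segment
  from vanishing.\<close>

lemma expand_two:
  assumes ml: "m < l" "l \<le> n" and Z: "c1 \<in> Zphi \<times> Zphi" "c2 \<in> Zphi \<times> Zphi"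
    and nz: "lin c1 (dir (t m)) \<noteq> 0" "lin c2 (dir (\<theta> l)) \<noteq> 0" "lin c2 (dir (t (l - 1))) \<noteq> 0"
    and first: "lin c1 (c m) + lin c2 (c l) = 0"
  obtains C where "\<And>k. C k \<in> Zphi" "\<And>k. C k \<noteq> 0 \<longleftrightarrow> m \<le> k \<and> k \<le> l"
    "lin c1 (pos X (v m)) + lin c2 (pos X (v l)) = (\<Sum>k\<le>n. C k * ht (\<theta> k) (D' (u k)))"
proof -
  define j where "j = l - 1"
  have j: "m \<le> j" "j < n" "l = Suc j" using ml by (simp_all add: j_def)
  have m: "m < n" using ml by simp
  obtain a C0 where aC: "a \<in> Zphi" "a \<noteq> 0" "\<And>k. C0 k \<in> Zphi" "\<And>k. C0 k \<noteq> 0 \<longleftrightarrow> m < k \<and> k \<le> j"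
    and exp: "\<And>z. (\<forall>k. m \<le> k \<and> k < j \<longrightarrow> ht (t k) (z (Suc k)) = ht (t k) (z k)) \<Longrightarrow>
       ht (t j) (z j) = a * ht (t m) (z m) + (\<Sum>k\<le>n. C0 k * ht (\<theta> k) (z k))"
    using chain[OF j(1,2)] by blast
  have nd: "\<not> 5 dvd (t m - \<theta> m)" "\<not> 5 dvd (\<theta> m - t m)" "\<not> 5 dvd (t j - \<theta> l)" "\<not> 5 dvd (\<theta> l - t j)"
    using t_theta(1)[OF m] t_theta(2)[OF j(2)] unfolding j(3) by presburger+
  define P1 Q1 where "P1 = lin c1 (dir (\<theta> m)) / sn (\<theta> m - t m)" and "Q1 = lin c1 (dir (t m)) / sn (t m - \<theta> m)"
  define P2 Q2 where "P2 = lin c2 (dir (\<theta> l)) / sn (\<theta> l - t j)" and "Q2 = lin c2 (dir (t j)) / sn (t j - \<theta> l)"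
  have e1: "lin c1 z = P1 * ht (t m) z + Q1 * ht (\<theta> m) z" for z
    using lin_expand[OF nd(1), of c1 z] by (simp add: P1_def Q1_def)
  have e2: "lin c2 z = P2 * ht (t j) z + Q2 * ht (\<theta> l) z" for z
    using lin_expand[OF nd(3), of c2 z] by (simp add: P2_def Q2_def)
  have Zs: "Q1 \<in> Zphi" "P2 \<in> Zphi" "Q2 \<in> Zphi"
    unfolding Q1_def P2_def Q2_def using nd lin_dir_Zphi[OF Z(1)] lin_dir_Zphi[OF Z(2)] by (simp_all add: Zphi_divide_sn)
  have nzs: "Q1 \<noteq> 0" "P2 \<noteq> 0" "Q2 \<noteq> 0"
    unfolding Q1_def P2_def Q2_def using nd nz by (simp_all add: sn_eq_0_iff j_def)
  define C where "C k = (if k = m then Q1 else if k = l then Q2 else P2 * C0 k)" for k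
  have C0: "C0 m = 0" "C0 l = 0" using aC(4)[of m] aC(4)[of l] j by auto
  have total: "lin c1 (z m) + lin c2 (z l) = (P1 + P2 * a) * ht (t m) (z m) + (\<Sum>k\<le>n. C k * ht (\<theta> k) (z k))"
    if z: "\<And>k. k < n \<Longrightarrow> ht (t k) (z (Suc k)) = ht (t k) (z k)" for z
  proof -
    have "(\<Sum>k\<le>n. C k * ht (\<theta> k) (z k)) = (\<Sum>k\<le>n. P2 * (C0 k * ht (\<theta> k) (z k)) +
        (if k = m then Q1 * ht (\<theta> k) (z k) else 0) + (if k = l then Q2 * ht (\<theta> k) (z k) else 0))"
      using ml(1) by (intro sum.cong) (auto simp: C_def C0)
    also have "\<dots> = P2 * (\<Sum>k\<le>n. C0 k * ht (\<theta> k) (z k)) + Q1 * ht (\<theta> m) (z m) + Q2 * ht (\<theta> l) (z l)"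
      using ml by (simp add: sum.distrib sum_distrib_left)
    finally have s: "(\<Sum>k\<le>n. C k * ht (\<theta> k) (z k)) =
      P2 * (\<Sum>k\<le>n. C0 k * ht (\<theta> k) (z k)) + Q1 * ht (\<theta> m) (z m) + Q2 * ht (\<theta> l) (z l)" .
    have "ht (t j) (z l) = a * ht (t m) (z m) + (\<Sum>k\<le>n. C0 k * ht (\<theta> k) (z k))"
      using exp[of z] z j by simp
    then show ?thesis unfolding s e1 e2 by (simp add: algebra_simps)
  qed
  have "(P1 + P2 * a) * ht (t m) (c m) = 0"
    using total[of c] ht_t_c first by (simp add: ht_c sn_0)
  moreover have "ht (t m) (c m) \<noteq> 0" using nd(2) by (simp add: c_eq_0_iff)
  ultimately have z0: "P1 + P2 * a = 0" by simp
  have hu: "ht (\<theta> k) (pos X (v k)) = ht (\<theta> k) (D' (u k))" if "k \<le> n" for k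
    using ht_ext[OF placed that] u_in[OF that] by (simp add: pos_V)
  show thesis
  proof (rule that[of C])
    show "C k \<in> Zphi" for k using Zs aC(3)[of k] by (simp add: C_def Zphi_mult)
    show "C k \<noteq> 0 \<longleftrightarrow> m \<le> k \<and> k \<le> l" for k using nzs aC(4)[of k] j by (auto simp: C_def)
    show "lin c1 (pos X (v m)) + lin c2 (pos X (v l)) = (\<Sum>k\<le>n. C k * ht (\<theta> k) (D' (u k)))"
      using total[of "\<lambda>k. pos X (v k)"] ht_edge[OF placed] z0 hu by simp
  qed
qed

text \<open>A term at u k in slope \<theta> k is turned into a slot of u k in V'. This slope is free
  in V', and \<kappa> does not use it because the edge to v k occupies it in the new drawing.
  Vertices v k attached to the same u have different slopes, and each lost edge makes room for one
  slot, so \<open>indep\<close> of the smaller drawing applies.\<close>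

lemma attached:
  assumes iV: "indep V' E D'"
    and \<kappa>: "\<And>x s. x \<in> V' \<Longrightarrow> \<kappa> x s \<in> Zphi" "\<And>x s. x \<in> V' \<Longrightarrow> s \<in> supp \<kappa> x \<Longrightarrow> free points (pos X) x s"
      "\<And>x. x \<in> V' \<Longrightarrow> card (supp \<kappa> x) + deg points E x \<le> 3"
    and C: "\<And>k. C k \<in> Zphi" "\<And>k. k \<le> n \<Longrightarrow> C k \<noteq> 0 \<longleftrightarrow> k \<in> I" "I \<subseteq> {..n}"
    and eq: "(\<Sum>x\<in>V'. \<Sum>s\<in>{0..<5}. \<kappa> x s * ht s (D' x)) + (\<Sum>k\<le>n. C k * ht (\<theta> k) (D' (u k))) = 0"
  obtains Y where "closed_in V' E Y"
    "\<And>x. x \<in> Y \<Longrightarrow> card (supp \<kappa> x) + card {k \<in> I. u k = x} + deg V' E x = 3"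
    "\<And>x. x \<in> V' \<Longrightarrow> x \<notin> Y \<Longrightarrow> supp \<kappa> x = {} \<and> (\<forall>k\<in>I. u k \<noteq> x)"
proof -
  \<comment> \<open>\<open>supp\<close> is indexed by the residues 0, ..., 4, so the slopes are
    reduced mod 5; \<epsilon> is the sign by which the height changes.\<close>
  define \<sigma> where "\<sigma> k = \<theta> k mod 5" for k
  have \<sigma>5: "\<sigma> k \<in> {0..<5}" for k by (simp add: \<sigma>_def)
  have dvd: "5 dvd (\<theta> k - \<sigma> k)" for k unfolding \<sigma>_def by presburger
  have "\<forall>k. \<exists>e::real. (e = 1 \<or> e = -1) \<and> (\<forall>z. ht (\<theta> k) z = e * ht (\<sigma> k) z)"
  proof
    fix k
    obtain e :: real where e: "e = 1 \<or> e = -1" "\<And>z. ht (\<theta> k) z = e * ht (\<sigma> k) z"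
      by (rule ht_sign[OF dvd[of k]]) blast
    show "\<exists>e::real. (e = 1 \<or> e = -1) \<and> (\<forall>z. ht (\<theta> k) z = e * ht (\<sigma> k) z)"
      by (intro exI[of _ e] conjI e(1) allI e(2))
  qed
  from choice[OF this] obtain \<epsilon> :: "nat \<Rightarrow> real" where
    \<epsilon>: "\<And>k. \<epsilon> k = 1 \<or> \<epsilon> k = -1" "\<And>k z. ht (\<theta> k) z = \<epsilon> k * ht (\<sigma> k) z" by blast
  have inj: "k = k'" if "k \<le> n" "k' \<le> n" "u k = u k'" "\<sigma> k = \<sigma> k'" for k k'
  proof (rule ccontr)
    assume "k \<noteq> k'"
    moreover have "5 dvd (\<theta> k - \<theta> k')" "5 dvd (\<theta> k' - \<theta> k)"
      using dvd[of k] dvd[of k'] that(4) by presburger+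
    ultimately show False using same[of k k'] same[of k' k] that by (cases "k < k'") auto
  qed
  define K where "K x s = (\<Sum>k\<le>n. if u k = x then if \<sigma> k = s then \<epsilon> k * C k else 0 else 0)" for x s
  have K1: "K (u k) (\<sigma> k) = \<epsilon> k * C k" if "k \<le> n" for k
  proof -
    have "K (u k) (\<sigma> k) = (\<Sum>i\<le>n. if i = k then \<epsilon> k * C k else 0)"
      unfolding K_def by (rule sum.cong) (use inj that in auto)
    then show ?thesis using that by simp
  qed
  have K0: "K x s = 0" if "\<And>k. k \<le> n \<Longrightarrow> u k = x \<Longrightarrow> \<sigma> k \<noteq> s" for x s
    unfolding K_def by (rule sum.neutral) (use that in auto)
  have \<kappa>0: "\<kappa> (u k) (\<sigma> k) = 0" if "k \<le> n" for k
  proof (rule ccontr)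
    assume "\<kappa> (u k) (\<sigma> k) \<noteq> 0"
    then have "\<sigma> k \<in> supp \<kappa> (u k)" using \<sigma>5 by (simp add: supp_def)
    then show False using free_u_points[OF placed linear that] \<kappa>(2)[OF u_in[OF that]] dvd by blast
  qed
  define \<kappa>' where "\<kappa>' x s = \<kappa> x s + K x s" for x s
  have I: "k \<le> n" "C k \<noteq> 0" if "k \<in> I" for k using C that by auto
  have supp': "supp \<kappa>' x = supp \<kappa> x \<union> \<sigma> ` {k \<in> I. u k = x}" for x
  proof (intro equalityI subsetI)
    fix s assume s: "s \<in> supp \<kappa>' x"
    show "s \<in> supp \<kappa> x \<union> \<sigma> ` {k \<in> I. u k = x}"
    proof (cases "\<exists>k\<le>n. u k = x \<and> \<sigma> k = s")
      case True
      then obtain k where k: "k \<le> n" "u k = x" "\<sigma> k = s" by blast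
      then have "C k \<noteq> 0" using s K1[OF k(1)] \<kappa>0[OF k(1)] by (auto simp: supp_def \<kappa>'_def)
      then show ?thesis using k C(2) by blast
    next
      case False
      then have "K x s = 0" by (intro K0) blast
      then show ?thesis using s by (simp add: supp_def \<kappa>'_def)
    qed
  next
    fix s assume "s \<in> supp \<kappa> x \<union> \<sigma> ` {k \<in> I. u k = x}"
    then consider "s \<in> supp \<kappa> x" | k where "k \<in> I" "u k = x" "s = \<sigma> k" by blast
    then show "s \<in> supp \<kappa>' x"
    proof cases
      case 1
      then have nz: "\<kappa> x s \<noteq> 0" by (simp add: supp_def)
      then have "K x s = 0" using \<kappa>0 by (intro K0) auto
      then show ?thesis using 1 by (simp add: supp_def \<kappa>'_def)
    next
      case (2 k)
      then show ?thesis using K1[OF I(1)[OF 2(1)]] \<kappa>0[OF I(1)[OF 2(1)]] I(2)[OF 2(1)] \<epsilon>(1)[of k] \<sigma>5[of k]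
        by (auto simp: supp_def \<kappa>'_def)
    qed
  qed
  have disj: "supp \<kappa> x \<inter> \<sigma> ` {k \<in> I. u k = x} = {}" for x
    using \<kappa>0 I(1) by (auto simp: supp_def)
  have card_image: "card (\<sigma> ` {k \<in> I. u k = x}) = card {k \<in> I. u k = x}" for x
    by (rule card_image) (auto intro!: inj_onI inj dest: I(1))
  have finI: "finite I" using C(3) finite_subset by blast
  have card': "card (supp \<kappa>' x) = card (supp \<kappa> x) + card {k \<in> I. u k = x}" for x
    unfolding supp' using card_Un_disjoint[OF finite_supp _ disj] finI card_image by simp
  have cI: "card {k \<in> I. u k = x} \<le> card {k. k \<le> n \<and> u k = x}" for x
    by (rule card_mono) (use I in auto)
  have sl: "slots V' E D' \<kappa>'" unfolding slots_def
  proof (intro ballI conjI allI)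
    fix x s assume x: "x \<in> V'"
    show "\<kappa>' x s \<in> Zphi" unfolding \<kappa>'_def K_def
    proof (intro Zphi_add Zphi_sum \<kappa>(1)[OF x])
      fix k show "(if u k = x then if \<sigma> k = s then \<epsilon> k * C k else 0 else 0) \<in> Zphi"
        using \<epsilon>(1)[of k] C(1)[of k] by (auto intro: Zphi_intros)
    qed
    show "card (supp \<kappa>' x) + deg V' E x \<le> 3"
      unfolding card' using \<kappa>(3)[OF x] deg_points_V[OF placed linear x] cI[of x] by linarith
  next
    fix x s assume x: "x \<in> V'" and "s \<in> supp \<kappa>' x"
    then consider "s \<in> supp \<kappa> x" | k where "k \<in> I" "u k = x" "s = \<sigma> k" unfolding supp' by blast
    then show "free V' D' x s"
    proof cases
      case 1 then show ?thesis using free_V'[OF placed linear x] \<kappa>(2)[OF x] by blast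
    next
      case (2 k)
      then show ?thesis using free_u[OF I(1)[OF 2(1)]] ht_cong_eq[OF dvd[of k]] unfolding free_def by blast
    qed
  qed
  have one: "(\<Sum>x\<in>V'. \<Sum>s\<in>{0..<5}. (if u k = x then if \<sigma> k = s then b else 0 else 0) * ht s (D' x)) = b * ht (\<sigma> k) (D' (u k))"
    if "k \<le> n" for k b
  proof -
    have "(\<Sum>s\<in>{0..<5}. (if u k = x then if \<sigma> k = s then b else 0 else 0) * ht s (D' x)) =
       (if u k = x then b * ht (\<sigma> k) (D' x) else 0)" for x
    proof (cases "u k = x")
      case True
      have "(\<Sum>s\<in>{0..<5}. (if \<sigma> k = s then b else 0) * ht s (D' x)) = (\<Sum>s\<in>{0..<5}. if \<sigma> k = s then b * ht s (D' x) else 0)"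
        by (rule sum.cong) auto
      then show ?thesis using True \<sigma>5[of k] by simp
    qed simp
    then show ?thesis using fin u_in[OF that] by simp
  qed
  have "(\<Sum>x\<in>V'. \<Sum>s\<in>{0..<5}. K x s * ht s (D' x)) =
     (\<Sum>x\<in>V'. \<Sum>s\<in>{0..<5}. \<Sum>k\<le>n. (if u k = x then if \<sigma> k = s then \<epsilon> k * C k else 0 else 0) * ht s (D' x))"
    unfolding K_def by (simp only: sum_distrib_right)
  also have "\<dots> = (\<Sum>x\<in>V'. \<Sum>k\<le>n. \<Sum>s\<in>{0..<5}. (if u k = x then if \<sigma> k = s then \<epsilon> k * C k else 0 else 0) * ht s (D' x))"
    by (rule sum.cong[OF refl], rule sum.swap)
  also have "\<dots> = (\<Sum>k\<le>n. \<Sum>x\<in>V'. \<Sum>s\<in>{0..<5}. (if u k = x then if \<sigma> k = s then \<epsilon> k * C k else 0 else 0) * ht s (D' x))"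
    by (rule sum.swap)
  also have "\<dots> = (\<Sum>k\<le>n. C k * ht (\<theta> k) (D' (u k)))"
  proof (rule sum.cong[OF refl])
    fix k assume "k \<in> {..n}"
    then have k: "k \<le> n" by simp
    show "(\<Sum>x\<in>V'. \<Sum>s\<in>{0..<5}. (if u k = x then if \<sigma> k = s then \<epsilon> k * C k else 0 else 0) * ht s (D' x)) =
       C k * ht (\<theta> k) (D' (u k))" unfolding one[OF k] \<epsilon>(2)[of k] by simp
  qed
  finally have "(\<Sum>x\<in>V'. \<Sum>s\<in>{0..<5}. \<kappa>' x s * ht s (D' x)) = 0"
    using eq unfolding \<kappa>'_def by (simp only: distrib_right sum.distrib)
  from indepD[OF iV sl this] obtain Y where Y: "closed_in V' E Y"
    "\<And>x. x \<in> Y \<Longrightarrow> card (supp \<kappa>' x) + deg V' E x = 3" "\<And>x. x \<in> V' \<Longrightarrow> x \<notin> Y \<Longrightarrow> supp \<kappa>' x = {}" by blast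
  show thesis
  proof (rule that[OF Y(1)])
    show "card (supp \<kappa> x) + card {k \<in> I. u k = x} + deg V' E x = 3" if "x \<in> Y" for x
      using Y(2)[OF that] unfolding card' .
    show "supp \<kappa> x = {} \<and> (\<forall>k\<in>I. u k \<noteq> x)" if "x \<in> V'" "x \<notin> Y" for x
      using Y(3)[OF that] unfolding supp' by auto
  qed
qed

end
end

context path_core
begin

lemma path_adj: "k < n \<Longrightarrow> E (v k) (v (Suc k))" "k < n \<Longrightarrow> E (v (Suc k)) (v k)"
  using adj[of k "Suc k"] sym by auto

lemma v_ne: "i \<le> n \<Longrightarrow> j \<le> n \<Longrightarrow> i \<noteq> j \<Longrightarrow> v i \<noteq> v j"
  using inj_onD[OF v_inj, of i j] by auto

lemma v_ne_u: "i \<le> n \<Longrightarrow> j \<le> n \<Longrightarrow> v i \<noteq> u j" "i \<le> n \<Longrightarrow> j \<le> n \<Longrightarrow> u j \<noteq> v i"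
  using v_notin[of i] u_in[of j] by auto

lemma end_deg:
  assumes "k \<le> n" "n \<noteq> 0" "finite X" "u k \<in> X" "k < n \<Longrightarrow> v (Suc k) \<in> X" "0 < k \<Longrightarrow> k = n \<Longrightarrow> v (k - 1) \<in> X"
  shows "2 \<le> deg X E (v k)"
proof -
  define w where "w = (if k < n then v (Suc k) else v (k - 1))"
  have "E (v k) w"
  proof (cases "k < n")
    case True then show ?thesis using path_adj(1) by (simp add: w_def)
  next
    case False
    then have "E (v (Suc (k - 1))) (v (k - 1))" by (intro path_adj(2)) (use assms in simp)
    then show ?thesis using False assms(1,2) by (simp add: w_def)
  qed
  moreover have "w \<in> X" "w \<noteq> u k" using assms v_ne_u by (auto simp: w_def)
  ultimately have "card {u k, w} \<le> deg X E (v k)"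
    by (intro lower_deg) (use assms v_u_adj[OF assms(1)] in auto)
  then show ?thesis using \<open>w \<noteq> u k\<close> by auto
qed

lemma interior_deg:
  assumes "0 < k" "k < n" "finite X" "u k \<in> X" "v (Suc k) \<in> X" "v (k - 1) \<in> X"
  shows "3 \<le> deg X E (v k)"
proof -
  have "E (v (Suc (k - 1))) (v (k - 1))" by (intro path_adj(2)) (use assms in simp)
  then have "E (v k) (v (k - 1))" using assms by simp
  then have "card {u k, v (k - 1), v (Suc k)} \<le> deg X E (v k)"
    by (intro lower_deg) (use assms v_u_adj[of k] path_adj(1)[of k] in auto)
  moreover have "u k \<noteq> v (k - 1)" "u k \<noteq> v (Suc k)" "v (k - 1) \<noteq> v (Suc k)"
    using assms v_ne_u(2)[of _ k] v_ne[of "k - 1" "Suc k"] by simp_all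
  ultimately show ?thesis by simp
qed

lemma sum_v:
  assumes "k \<le> n"
  shows "(\<Sum>i\<le>n. if v i = v k then g i else (0::real)) = g k"
proof -
  have "(\<Sum>i\<le>n. if v i = v k then g i else 0) = (\<Sum>i\<le>n. if i = k then g i else 0)"
    by (rule sum.cong) (use v_ne assms in auto)
  then show ?thesis using assms by simp
qed

lemma sum_V: "x \<in> V' \<Longrightarrow> (\<Sum>i\<le>n. if v i = x then g i else (0::real)) = 0"
  by (rule sum.neutral) (use v_notin in auto)

context
  fixes X :: real
  assumes placed: "placed X" and linear: "linear X"
begin

lemma two_first_order:
  assumes pq: "p \<in> points" "q \<in> points" "p \<noteq> q" and Z: "\<alpha> \<in> Zphi \<times> Zphi" "\<beta> \<in> Zphi \<times> Zphi"
    and eq: "lin \<alpha> (pos X p) + lin \<beta> (pos X q) = 0"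
  shows "(\<Sum>k\<le>n. if v k = p then lin \<alpha> (c k) else 0) + (\<Sum>k\<le>n. if v k = q then lin \<beta> (c k) else 0) = 0"
proof -
  define f where "f x = (if x = p then \<alpha> else if x = q then \<beta> else 0)" for x
  have "0 \<in> Zphi \<times> Zphi" by (simp add: zero_prod_def Zphi_0)
  then have "\<forall>x\<in>points. f x \<in> Zphi \<times> Zphi" using Z by (auto simp: f_def)
  moreover have "(\<Sum>x\<in>points. lin (f x) (pos X x)) = 0"
  proof -
    have "(\<Sum>x\<in>points. lin (f x) (pos X x)) =
       (\<Sum>x\<in>points. (if x = p then lin \<alpha> (pos X p) else 0) + (if x = q then lin \<beta> (pos X q) else 0))"
      using pq(3) by (intro sum.cong) (auto simp: f_def lin_coeff)
    then show ?thesis using pq eq finite_points by (simp add: sum.distrib)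
  qed
  ultimately have 0: "(\<Sum>k\<le>n. lin (f (v k)) (c k)) = 0" using linear unfolding linear_def by blast
  have "(\<Sum>k\<le>n. lin (f (v k)) (c k)) =
     (\<Sum>k\<le>n. (if v k = p then lin \<alpha> (c k) else 0) + (if v k = q then lin \<beta> (c k) else 0))"
    using pq(3) by (intro sum.cong) (auto simp: f_def lin_coeff)
  then show ?thesis using 0 by (simp add: sum.distrib)
qed

text \<open>Nonadjacency makes c nonzero on all basic directions, hence on all velocities, so
  differentiation rules out one old and one new vertex. For v m and v l the relation expands into
  slots at u m, ..., u l. The exceptional set Y together with the path segment from v m to v l then
  has all its edges, except for at most one at each end of the segment.\<close>

lemma nonrigid_placed:
  assumes iV: "indep V' E D'" and nV: "nonrigid V' E D'"
    and deg3: "\<And>x. x \<in> V' \<Longrightarrow> deg points E x \<le> 3"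
  shows "nonrigid points E (pos X)"
  unfolding nonrigid_def
proof (intro ballI impI)
  fix p q c0 assume p: "p \<in> points" and q: "q \<in> points" and c0: "c0 \<in> Zphi \<times> Zphi" and ne: "p \<noteq> q"
    and nE: "\<not> E p q" and nz: "c0 \<noteq> 0" and eq: "lin c0 (pos X p) = lin c0 (pos X q)"
  have dirs: "lin c0 (dir k) \<noteq> 0" for k
  proof
    assume "lin c0 (dir k) = 0"
    then obtain \<tau> where \<tau>: "\<And>z. lin c0 z = \<tau> * ht k z" using lin_parallel[OF c0] by blast
    have "\<tau> \<noteq> 0" using nz lin_eq_0[of c0] \<tau> by auto
    then have "ht k (pos X p) = ht k (pos X q)" using eq \<tau> by simp
    then show False using faithfulD(2)[OF faithful_placed[OF placed] p q ne] nE by blast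
  qed
  have cs: "lin c0 (c k) \<noteq> 0" for k using dirs[of "\<theta> k"] phi_pos unfolding c_def lin_linear by simp
  have mc: "- c0 \<in> Zphi \<times> Zphi" using c0 by (auto simp: mem_Times_iff intro: Zphi_intros)
  have fo: "(\<Sum>k\<le>n. if v k = x then lin c0 (c k) else 0) + (\<Sum>k\<le>n. if v k = y then lin (- c0) (c k) else 0) = 0"
    if "x \<in> points" "y \<in> points" "x \<noteq> y" "lin c0 (pos X x) = lin c0 (pos X y)" for x y
    using two_first_order[OF that(1-3) c0 mc] that(4) by (simp add: lin_coeff)
  have mixed: False if "x \<in> V'" "k \<le> n" "lin c0 (pos X x) = lin c0 (pos X (v k))" for x k
  proof -
    have "x \<noteq> v k" using v_notin[OF that(2)] that(1) by auto
    then have "lin (- c0) (c k) = 0"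
      using fo[OF V_points[OF that(1)] v_points[OF that(2)] _ that(3)] by (simp add: sum_v[OF that(2)] sum_V[OF that(1)])
    then show False using cs by (simp add: lin_coeff)
  qed
  have path: "\<exists>Z\<subseteq>points. v m \<in> Z \<and> v l \<in> Z \<and> defect E Z \<le> 2"
    if ml: "m < l" "l \<le> n" and eq: "lin c0 (pos X (v m)) = lin c0 (pos X (v l))" for m l
  proof -
    have m: "m \<le> n" using ml by simp
    have first: "lin c0 (c m) + lin (- c0) (c l) = 0"
      using fo[OF v_points[OF m] v_points[OF ml(2)] v_ne[OF m ml(2)] eq] ml by (simp add: sum_v[OF m] sum_v[OF ml(2)])
    obtain C where C: "\<And>k. C k \<in> Zphi" "\<And>k. C k \<noteq> 0 \<longleftrightarrow> m \<le> k \<and> k \<le> l"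
      "lin c0 (pos X (v m)) + lin (- c0) (pos X (v l)) = (\<Sum>k\<le>n. C k * ht (\<theta> k) (D' (u k)))"
      by (rule expand_two[OF placed linear ml c0 mc _ _ _ first]) (use dirs in \<open>auto simp: lin_coeff\<close>)
    have C': "C k \<noteq> 0 \<longleftrightarrow> k \<in> {m..l}" if "k \<le> n" for k using C(2)[of k] by simp
    have I: "{m..l} \<subseteq> {..n}" using ml by auto
    \<comment> \<open>With \<kappa> = 0 all slots come from the segment, so being full means for a
      vertex of Y that it has three edges, each going to Y or to the segment.\<close>
    obtain Y where Y: "closed_in V' E Y"
      "\<And>x. x \<in> Y \<Longrightarrow> card (supp (\<lambda>_ _. 0) x) + card {k \<in> {m..l}. u k = x} + deg V' E x = 3"
      "\<And>x. x \<in> V' \<Longrightarrow> x \<notin> Y \<Longrightarrow> supp (\<lambda>_ _. 0) x = {} \<and> (\<forall>k\<in>{m..l}. u k \<noteq> x)"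
      by (rule attached[OF placed linear iV, of "\<lambda>_ _. 0" C "{m..l}"])
        (use Zphi_0 deg3 C(1) C' I C(3) eq in \<open>auto simp: supp_def lin_coeff\<close>)
    define Z where "Z = Y \<union> v ` {m..l}"
    have YV: "Y \<subseteq> V'" using Y(1) by (simp add: closed_in_def)
    have finY: "finite Y" using YV fin finite_subset by blast
    have finZ: "finite Z" using finY by (simp add: Z_def)
    have vZ: "v k \<in> Z" if "m \<le> k" "k \<le> l" for k using that by (simp add: Z_def)
    have uZ: "u k \<in> Z" if "m \<le> k" "k \<le> l" for k
    proof -
      have "u k \<in> Y"
      proof (rule ccontr)
        assume "u k \<notin> Y"
        then have "\<forall>i\<in>{m..l}. u i \<noteq> u k" using Y(3)[of "u k"] u_in[of k] that ml by simp
        then show False using that by auto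
      qed
      then show ?thesis by (simp add: Z_def)
    qed
    have dY: "3 \<le> deg Z E x" if x: "x \<in> Y" for x
    proof -
      have xV: "x \<in> V'" using x YV by blast
      have "{w \<in> V'. E x w} \<union> v ` {k \<in> {m..l}. u k = x} \<subseteq> {w \<in> Z. E x w}"
      proof (intro Un_least subsetI)
        fix w assume "w \<in> {w \<in> V'. E x w}"
        then show "w \<in> {w \<in> Z. E x w}" using Y(1) x by (auto simp: Z_def closed_in_def)
      next
        fix w assume "w \<in> v ` {k \<in> {m..l}. u k = x}"
        then obtain k where k: "m \<le> k" "k \<le> l" "u k = x" "w = v k" by auto
        then have "E (v k) (u k)" using ml by (intro v_u_adj) simp
        then show "w \<in> {w \<in> Z. E x w}" using k sym vZ by auto
      qed
      from card_mono[OF _ this] have "card ({w \<in> V'. E x w} \<union> v ` {k \<in> {m..l}. u k = x}) \<le> deg Z E x"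
        using finZ by (simp add: deg_def)
      moreover have "card ({w \<in> V'. E x w} \<union> v ` {k \<in> {m..l}. u k = x}) =
          card {w \<in> V'. E x w} + card (v ` {k \<in> {m..l}. u k = x})"
        by (rule card_Un_disjoint) (use fin v_notin ml in auto)
      moreover have "card (v ` {k \<in> {m..l}. u k = x}) = card {k \<in> {m..l}. u k = x}"
        by (rule card_image) (rule inj_on_subset[OF v_inj], use ml in auto)
      ultimately show ?thesis using Y(2)[OF x] by (simp add: deg_def supp_def)
    qed
    have di: "3 \<le> deg Z E (v k)" if "m < k" "k < l" for k
      by (rule interior_deg) (use that ml finZ vZ uZ in auto)
    have de: "2 \<le> deg Z E (v k)" if "k = m \<or> k = l" for k
    proof (cases "k = m")
      case True
      have "v (Suc m) \<in> Z" "u m \<in> Z" using ml vZ[of "Suc m"] uZ by simp_all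
      then have "card {u m, v (Suc m)} \<le> deg Z E (v m)"
        by (intro lower_deg) (use ml finZ v_u_adj[of m] path_adj(1)[of m] in auto)
      moreover have "u m \<noteq> v (Suc m)" using v_ne_u(2)[of "Suc m" m] ml by simp
      ultimately show ?thesis using True by simp
    next
      case False
      then have kl: "k = l" using that by simp
      have "E (v (Suc (l - 1))) (v (l - 1))" by (rule path_adj(2)) (use ml in simp)
      then have "E (v l) (v (l - 1))" using ml by simp
      moreover have "v (l - 1) \<in> Z" "u l \<in> Z" using ml vZ[of "l - 1"] uZ by simp_all
      ultimately have "card {u l, v (l - 1)} \<le> deg Z E (v l)"
        by (intro lower_deg) (use ml finZ v_u_adj[of l] in auto)
      moreover have "u l \<noteq> v (l - 1)" using v_ne_u(2)[of "l - 1" l] ml by simp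
      ultimately show ?thesis using kl by simp
    qed
    have split: "sum g Z = sum g Y + sum g (v ` {m..l})" for g :: "'a \<Rightarrow> nat"
      unfolding Z_def by (rule sum.union_disjoint) (use finY YV v_notin ml in auto)
    have "defect E Z = (\<Sum>x\<in>Y. 3 - deg Z E x) + (\<Sum>x\<in>v ` {m..l}. 3 - deg Z E x)"
      unfolding defect_def by (rule split)
    also have "(\<Sum>x\<in>Y. 3 - deg Z E x) = 0" by (rule sum.neutral) (use dY in auto)
    also have "(\<Sum>x\<in>v ` {m..l}. 3 - deg Z E x) = (\<Sum>k\<in>{m..l}. 3 - deg Z E (v k))"
      by (rule sum.reindex_cong[of v "{m..l}"]) (use inj_on_subset[OF v_inj I] in auto)
    also have "\<dots> \<le> (\<Sum>k\<in>{m..l}. (if k = m then 1 else 0) + (if k = l then 1 else 0))"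
    proof (rule sum_mono)
      fix k assume k: "k \<in> {m..l}"
      show "3 - deg Z E (v k) \<le> (if k = m then 1 else 0) + (if k = l then 1 else 0)"
      proof (cases "k = m \<or> k = l")
        case True then show ?thesis using de[OF True] by auto
      next
        case False then show ?thesis using di[of k] k by simp
      qed
    qed
    also have "\<dots> = 2" using ml by (simp add: sum.distrib)
    finally have "defect E Z \<le> 2" by simp
    moreover have "Z \<subseteq> points" using YV I by (auto simp: Z_def points_def)
    moreover have "v m \<in> Z" "v l \<in> Z" using vZ ml by simp_all
    ultimately show ?thesis by blast
  qed
  show "\<exists>Z\<subseteq>points. p \<in> Z \<and> q \<in> Z \<and> defect E Z \<le> 2"
  proof (cases rule: points_cases[OF p])
    case pV: 1
    show ?thesis
    proof (cases rule: points_cases[OF q])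
      case qV: 1
      obtain Z where "Z \<subseteq> V'" "p \<in> Z" "q \<in> Z" "defect E Z \<le> 2"
        by (rule nonrigidD[OF nV pV qV c0 ne nE nz]) (use eq in \<open>simp_all add: pos_V pV qV\<close>)
      then show ?thesis using V_points by blast
    next
      case (2 k) then show ?thesis using mixed[OF pV 2(1)] eq by blast
    qed
  next
    case pm: (2 m)
    show ?thesis
    proof (cases rule: points_cases[OF q])
      case qV: 1 then show ?thesis using mixed[OF qV pm(1)] eq pm by simp
    next
      case (2 l)
      have "m \<noteq> l" using 2 pm ne by auto
      then consider "m < l" | "l < m" by linarith
      then show ?thesis
      proof cases
        case 1 then show ?thesis using path[OF 1 2(1)] eq 2 pm by simp
      next
        case b: 2
        have "lin c0 (pos X (v l)) = lin c0 (pos X (v m))" using eq 2 pm by simp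
        from path[OF b pm(1) this] show ?thesis using 2 pm by blast
      qed
    qed
  qed
qed

end
end

context path_core
begin

context
  fixes X :: real
  assumes placed: "placed X" and linear: "linear X"
begin

text \<open>Interior path vertices have no slot and each end at most one. Differentiation shows that
  both ends use their slot or neither does. If both do, the relation moves to all the u k with
  nonzero coefficients, and Y together with the whole path is the exceptional set. If neither does,
  Y contains no u k, for the edge to v k would push the count above three.\<close>

lemma indep_placed:
  assumes iV: "indep V' E D'" and n0: "n \<noteq> 0"
  shows "indep points E (pos X)"
  unfolding indep_def
proof (intro allI impI)
  fix \<kappa> assume sl: "slots points E (pos X) \<kappa>"
    and eq: "(\<Sum>x\<in>points. \<Sum>s\<in>{0..<5}. \<kappa> x s * ht s (pos X x)) = 0"
  have K: "\<kappa> x s \<in> Zphi" "s \<in> supp \<kappa> x \<Longrightarrow> free points (pos X) x s" "card (supp \<kappa> x) + deg points E x \<le> 3"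
    if "x \<in> points" for x s using sl that unfolding slots_def by auto
  have vp: "v k \<in> points" "u k \<in> points" if "k \<le> n" for k using v_points[OF that] V_points[OF u_in[OF that]] .
  have inner: "supp \<kappa> (v k) = {}" if "0 < k" "k < n" for k
  proof -
    have "card (supp \<kappa> (v k)) = 0"
      using K(3)[of "v k"] vp[of k] interior_full[OF placed linear that] that by linarith
    then show ?thesis using finite_supp[of \<kappa> "v k"] by simp
  qed
  have ends: "card (supp \<kappa> (v k)) \<le> 1 \<and> 2 \<le> deg points E (v k)" if k: "k = 0 \<or> k = n" for k
  proof -
    have kn: "k \<le> n" using k by auto
    have "2 \<le> deg points E (v k)"
      by (rule end_deg) (use kn n0 finite_points vp[OF kn] vp[of "Suc k"] vp[of "k - 1"] in auto)
    moreover have "card (supp \<kappa> (v k)) + deg points E (v k) \<le> 3" by (rule K(3)[OF vp(1)[OF kn]])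
    ultimately show ?thesis by linarith
  qed
  define f where "f x = (\<Sum>s\<in>{0..<5}. \<kappa> x s *\<^sub>R htc s)" for x
  have lf: "lin (f x) z = (\<Sum>s\<in>{0..<5}. \<kappa> x s * ht s z)" for x z
    by (simp add: f_def lin_sum lin_coeff lin_htc)
  have fZ: "f x \<in> Zphi \<times> Zphi" if "x \<in> points" for x
  proof -
    have "fst (f x) \<in> Zphi" "snd (f x) \<in> Zphi"
      unfolding f_def fst_sum snd_sum using K(1)[OF that] htc_Zphi
      by (auto intro!: Zphi_sum Zphi_mult simp: mem_Times_iff)
    then show ?thesis by (simp add: mem_Times_iff)
  qed
  have f0: "lin (f x) z = 0" if "supp \<kappa> x = {}" for x z
    unfolding lf by (rule sum.neutral) (use that in \<open>auto simp: supp_def\<close>)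
  have f1: "f x = \<kappa> x \<sigma> *\<^sub>R htc \<sigma> \<and> \<kappa> x \<sigma> \<noteq> 0" if "supp \<kappa> x = {\<sigma>}" for x \<sigma>
  proof -
    have s: "\<sigma> \<in> {0..<5}" "\<kappa> x \<sigma> \<noteq> 0" using that by (auto simp: supp_def)
    have "f x = (\<Sum>s\<in>{0..<5}. if s = \<sigma> then \<kappa> x \<sigma> *\<^sub>R htc \<sigma> else 0)"
      unfolding f_def by (rule sum.cong) (use that in \<open>auto simp: supp_def\<close>)
    then show ?thesis using s by simp
  qed
  have point_sum: "sum g points = sum g V' + (\<Sum>k\<le>n. g (v k))" for g :: "'a \<Rightarrow> real"
  proof -
    have "sum g points = sum g V' + sum g (v ` {..n})"
      unfolding points_def by (rule sum.union_disjoint) (use fin v_notin in auto)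
    then show ?thesis by (simp add: sum.reindex[OF v_inj])
  qed
  have two_ends: "(\<Sum>k\<le>n. lin (f (v k)) (z k)) = lin (f (v 0)) (z 0) + lin (f (v n)) (z n)" for z
  proof -
    have "(\<Sum>k\<le>n. lin (f (v k)) (z k)) =
      (\<Sum>k\<le>n. (if k = 0 then lin (f (v k)) (z k) else 0) + (if k = n then lin (f (v k)) (z k) else 0))"
      by (rule sum.cong) (use n0 inner f0 in auto)
    then show ?thesis by (simp add: sum.distrib)
  qed
  have total: "(\<Sum>x\<in>V'. \<Sum>s\<in>{0..<5}. \<kappa> x s * ht s (D' x)) + (lin (f (v 0)) (pos X (v 0)) + lin (f (v n)) (pos X (v n))) = 0"
  proof -
    have "(\<Sum>x\<in>V'. \<Sum>s\<in>{0..<5}. \<kappa> x s * ht s (pos X x)) = (\<Sum>x\<in>V'. \<Sum>s\<in>{0..<5}. \<kappa> x s * ht s (D' x))"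
      by (simp add: pos_V)
    then show ?thesis using eq point_sum[of "\<lambda>x. \<Sum>s\<in>{0..<5}. \<kappa> x s * ht s (pos X x)"] two_ends[of "\<lambda>k. pos X (v k)"]
      by (simp add: lf)
  qed
  have "(\<Sum>x\<in>points. lin (f x) (pos X x)) = 0" using eq by (simp add: lf)
  then have "(\<Sum>k\<le>n. lin (f (v k)) (c k)) = 0" using linear fZ unfolding linear_def by blast
  then have first: "lin (f (v 0)) (c 0) + lin (f (v n)) (c n) = 0" by (simp only: two_ends)
  have c_nz: "lin (f (v k)) (c k) \<noteq> 0" if k: "k = 0 \<or> k = n" and ne: "supp \<kappa> (v k) \<noteq> {}" for k
  proof -
    obtain \<sigma> where s: "supp \<kappa> (v k) = {\<sigma>}"
    proof -
      have "card (supp \<kappa> (v k)) \<noteq> 0" using ne finite_supp[of \<kappa> "v k"] by simp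
      then have "card (supp \<kappa> (v k)) = 1" using ends[OF k] by linarith
      then show thesis by (rule card_1_singletonE) (rule that)
    qed
    have kn: "k \<le> n" using k by auto
    have "free points (pos X) (v k) \<sigma>" using K(2)[OF vp(1)[OF kn]] s by simp
    then have "\<not> 5 dvd (\<theta> k - \<sigma>)" by (rule free_v(1)[OF placed linear kn])
    then show ?thesis using f1[OF s] by (simp add: lin_coeff lin_htc c_eq_0_iff)
  qed
  have split: "deg points E x = deg V' E x + card {k. k \<le> n \<and> u k = x}" if "x \<in> V'" for x
    by (rule deg_points_V[OF placed linear that])
  show "\<exists>Y. closed_in points E Y \<and> (\<forall>x\<in>Y. card (supp \<kappa> x) + deg points E x = 3) \<and> (\<forall>x\<in>points - Y. supp \<kappa> x = {})"
  proof (cases "supp \<kappa> (v 0) = {} \<and> supp \<kappa> (v n) = {}")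
    case True
    then have none: "supp \<kappa> (v k) = {}" if "k \<le> n" for k using inner[of k] that by (cases "k = 0 \<or> k = n") auto
    have 0: "(\<Sum>x\<in>V'. \<Sum>s\<in>{0..<5}. \<kappa> x s * ht s (D' x)) + (\<Sum>k\<le>n. 0 * ht (\<theta> k) (D' (u k))) = 0"
      using total True by (simp add: f0)
    obtain Y where Y: "closed_in V' E Y"
      "\<And>x. x \<in> Y \<Longrightarrow> card (supp \<kappa> x) + card {k \<in> {}. u k = x} + deg V' E x = 3"
      "\<And>x. x \<in> V' \<Longrightarrow> x \<notin> Y \<Longrightarrow> supp \<kappa> x = {} \<and> (\<forall>k\<in>{}. u k \<noteq> x)"
      by (rule attached[OF placed linear iV _ _ _ _ _ _ 0, of "{}"])
        (use K V_points Zphi_0 in auto)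
    have YV: "x \<in> V'" if "x \<in> Y" for x using Y(1) that by (auto simp: closed_in_def)
    have c0: "card {k. k \<le> n \<and> u k = x} = 0 \<and> card (supp \<kappa> x) + deg points E x = 3" if x: "x \<in> Y" for x
    proof -
      have "card {k \<in> {}. u k = x} = 0" by simp
      then show ?thesis using Y(2)[OF x] split[OF YV[OF x]] K(3)[OF V_points[OF YV[OF x]]] by linarith
    qed
    have "closed_in points E Y" unfolding closed_in_def
    proof (intro conjI ballI impI subsetI)
      show "x \<in> points" if "x \<in> Y" for x using YV[OF that] by (rule V_points)
      fix x y assume x: "x \<in> Y" and y: "y \<in> points" and E: "E x y"
      show "y \<in> Y"
      proof (cases rule: points_cases[OF y])
        case 1 then show ?thesis using Y(1) x E by (auto simp: closed_in_def)
      next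
        case (2 k)
        then have "x = u k" using ext[OF 2(1) YV[OF x]] sym[OF E] by simp
        then have *: "k \<in> {k. k \<le> n \<and> u k = x}" using 2 by simp
        have "finite {k. k \<le> n \<and> u k = x}" by simp
      then have "{k. k \<le> n \<and> u k = x} = {}" using c0[OF x] by (simp only: card_0_eq)
        with * show ?thesis by blast
      qed
    qed
    moreover have "\<forall>x\<in>Y. card (supp \<kappa> x) + deg points E x = 3" using c0 by blast
    moreover have "\<forall>x\<in>points - Y. supp \<kappa> x = {}"
    proof
      fix x assume x: "x \<in> points - Y"
      then have "x \<in> points" by simp
      then show "supp \<kappa> x = {}" by (cases rule: points_cases) (use none Y(3) x in auto)
    qed
    ultimately show ?thesis by blast
  next
    case False
    then have "supp \<kappa> (v 0) \<noteq> {} \<and> supp \<kappa> (v n) \<noteq> {}"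
    proof (cases "supp \<kappa> (v 0) = {}")
      case True
      then have "lin (f (v n)) (c n) = 0" using first f0[OF True] by simp
      then show ?thesis using c_nz[of n] False True by blast
    next
      case F: False
      have "supp \<kappa> (v n) \<noteq> {}"
      proof
        assume "supp \<kappa> (v n) = {}"
        then have "lin (f (v 0)) (c 0) = 0" using first f0[of "v n"] by simp
        then show False using c_nz[of 0] F by blast
      qed
      then show ?thesis using F by blast
    qed
    then have ne: "supp \<kappa> (v k) \<noteq> {}" if "k = 0 \<or> k = n" for k using that by blast
    have single: "\<exists>\<sigma>. supp \<kappa> (v k) = {\<sigma>}" if k: "k = 0 \<or> k = n" for k
    proof -
      have "card (supp \<kappa> (v k)) \<noteq> 0" using ne[OF k] finite_supp[of \<kappa> "v k"] by simp
      then have "card (supp \<kappa> (v k)) = 1" using ends[OF k] by linarith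
      then show ?thesis by (rule card_1_singletonE) blast
    qed
    obtain \<sigma> where s: "supp \<kappa> (v 0) = {\<sigma>}" using single[of 0] by auto
    obtain \<tau> where t': "supp \<kappa> (v n) = {\<tau>}" using single[of n] by auto
    have fs: "free points (pos X) (v 0) \<sigma>" "free points (pos X) (v n) \<tau>"
      using K(2)[OF vp(1)[of 0]] K(2)[OF vp(1)[of n]] s t' by simp_all
    have edge: "ht (t 0) (pos X (v (Suc 0))) = ht (t 0) (pos X (v 0))"
      "ht (t (n - 1)) (pos X (v n)) = ht (t (n - 1)) (pos X (v (n - 1)))"
      using ht_edge[OF placed, of 0] ht_edge[OF placed, of "n - 1"] n0 by simp_all
    have nfree: "\<not> 5 dvd (t 0 - \<sigma>)" "\<not> 5 dvd (t (n - 1) - \<tau>)"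
    proof -
      show "\<not> 5 dvd (t 0 - \<sigma>)"
      proof
        assume "5 dvd (t 0 - \<sigma>)"
        then have "ht \<sigma> (pos X (v (Suc 0))) = ht \<sigma> (pos X (v 0))" using edge(1) ht_cong_eq by blast
        moreover have "v (Suc 0) \<noteq> v 0" "v (Suc 0) \<in> points" using v_ne[of "Suc 0" 0] vp[of "Suc 0"] n0 by simp_all
        ultimately show False using fs(1) unfolding free_def by metis
      qed
      show "\<not> 5 dvd (t (n - 1) - \<tau>)"
      proof
        assume "5 dvd (t (n - 1) - \<tau>)"
        then have "ht \<tau> (pos X (v n)) = ht \<tau> (pos X (v (n - 1)))" using edge(2) ht_cong_eq by blast
        moreover have "v (n - 1) \<noteq> v n" "v (n - 1) \<in> points" using v_ne[of "n - 1" n] vp[of "n - 1"] n0 by simp_all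
        ultimately show False using fs(2) unfolding free_def by blast
      qed
    qed
    have nz: "lin (f (v 0)) (dir (t 0)) \<noteq> 0" "lin (f (v n)) (dir (\<theta> n)) \<noteq> 0" "lin (f (v n)) (dir (t (n - 1))) \<noteq> 0"
      using f1[OF s] f1[OF t'] nfree free_v(1)[OF placed linear order_refl fs(2)]
      by (simp_all add: lin_coeff lin_htc ht_dir sn_eq_0_iff)
    have n: "0 < n" using n0 by simp
    obtain C where C: "\<And>k. C k \<in> Zphi" "\<And>k. C k \<noteq> 0 \<longleftrightarrow> 0 \<le> k \<and> k \<le> n"
      "lin (f (v 0)) (pos X (v 0)) + lin (f (v n)) (pos X (v n)) = (\<Sum>k\<le>n. C k * ht (\<theta> k) (D' (u k)))"
      by (rule expand_two[OF placed linear n order_refl fZ[OF vp(1)[of 0]] fZ[OF vp(1)[of n]] nz first]) blast+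
    have 0: "(\<Sum>x\<in>V'. \<Sum>s\<in>{0..<5}. \<kappa> x s * ht s (D' x)) + (\<Sum>k\<le>n. C k * ht (\<theta> k) (D' (u k))) = 0"
      using total C(3) by simp
    obtain Y where Y: "closed_in V' E Y"
      "\<And>x. x \<in> Y \<Longrightarrow> card (supp \<kappa> x) + card {k \<in> {..n}. u k = x} + deg V' E x = 3"
      "\<And>x. x \<in> V' \<Longrightarrow> x \<notin> Y \<Longrightarrow> supp \<kappa> x = {} \<and> (\<forall>k\<in>{..n}. u k \<noteq> x)"
      by (rule attached[OF placed linear iV _ _ _ _ _ _ 0, of "{..n}"])
        (use K V_points C in auto)
    have YV: "x \<in> V'" if "x \<in> Y" for x using Y(1) that by (auto simp: closed_in_def)
    have uY: "u k \<in> Y" if "k \<le> n" for k using Y(3)[OF u_in[OF that]] that by auto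
    have "closed_in points E (Y \<union> v ` {..n})" unfolding closed_in_def
    proof (intro conjI ballI impI subsetI)
      show "x \<in> points" if "x \<in> Y \<union> v ` {..n}" for x using that YV vp by (auto simp: points_def)
      fix x y assume x: "x \<in> Y \<union> v ` {..n}" and y: "y \<in> points" and E: "E x y"
      show "y \<in> Y \<union> v ` {..n}"
      proof (cases rule: points_cases[OF y])
        case yV: 1
        show ?thesis
        proof (cases "x \<in> Y")
          case True then show ?thesis using Y(1) yV E by (auto simp: closed_in_def)
        next
          case False
          then obtain k where "k \<le> n" "x = v k" using x by auto
          then show ?thesis using ext[of k y] yV E uY by auto
        qed
      next
        case (2 k) then show ?thesis by simp
      qed
    qed
    moreover have "card (supp \<kappa> x) + deg points E x = 3" if x: "x \<in> Y \<union> v ` {..n}" for x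
    proof (cases "x \<in> Y")
      case True
      then show ?thesis using Y(2)[OF True] split[OF YV[OF True]] by simp
    next
      case False
      then obtain k where k: "k \<le> n" "x = v k" using x by auto
      have le: "card (supp \<kappa> x) + deg points E x \<le> 3" using K(3)[OF vp(1)[OF k(1)]] k by simp
      show ?thesis
      proof (cases "k = 0 \<or> k = n")
        case True
        have "card (supp \<kappa> x) = 1" using True s t' k by auto
        then show ?thesis using ends[OF True] le k by simp
      next
        case False
        then have "3 \<le> deg points E x" using interior_full[OF placed linear, of k] k by simp
        then show ?thesis using le by simp
      qed
    qed
    moreover have "supp \<kappa> x = {}" if x: "x \<in> points - (Y \<union> v ` {..n})" for x
      using Y(3)[of x] x by (auto simp: points_def)
    ultimately show ?thesis by blast
  qed
qed

end

lemma ex_placed: "\<exists>X. placed X \<and> linear X"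
  using generic_ex[OF generic_conj[OF generic_placed generic_linear]] .

lemma good_placed:
  assumes "indep V' E D'" "nonrigid V' E D'" "n \<noteq> 0" "(v 0, v n) \<notin> R"
    and "\<And>x. x \<in> V' \<Longrightarrow> deg points E x \<le> 3"
    and "R \<inter> {(p, q). p \<in> V' \<and> q \<in> V' \<and> deg points E p < 3 \<and> deg points E q < 3} \<subseteq> R'"
  shows "\<exists>X. placed X \<and> good points E R (pos X)"
proof -
  obtain X where X: "placed X" "linear X" using ex_placed by blast
  have "good points E R (pos X)" unfolding good_def
    using faithful_placed[OF X(1)] separated_placed[OF X assms(6,4)] indep_placed[OF X assms(1,3)]
      nonrigid_placed[OF X assms(1,2,5)] by blast
  then show ?thesis using X by blast
qed

end

section \<open>Extending two edges at the ends of a path to a common point\<close>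

lemma phi_bounds: "1618 / 1000 < phi" "phi < 16181 / 10000"
  using phi_lower phi_upper by simp_all

lemma phi_more_powers: "phi ^ 7 = 13 * phi + 8" "phi ^ 8 = 21 * phi + 13" "phi ^ 9 = 34 * phi + 21"
proof -
  have "phi ^ 7 = phi ^ 6 * phi" "phi ^ 8 = phi ^ 6 * (phi * phi)" "phi ^ 9 = phi ^ 6 * (phi * phi * phi)"
    by (simp_all add: eval_nat_numeral)
  then show "phi ^ 7 = 13 * phi + 8" "phi ^ 8 = 21 * phi + 13" "phi ^ 9 = 34 * phi + 21"
    by (simp_all add: phi_powers phi_sq ring_distribs mult.assoc)
qed

lemma sn_56: "sn 5 = 0" "sn 6 = - 1" using sn_add5[of 0] sn_add5[of 1] by (simp_all add: sn_0 sn_1)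

lemmas sn_values = sn_minus sn_0 sn_1 sn_2 sn_3 sn_4 sn_56

lemma phi_times: "phi ^ 8 * phi = 34 * phi + 21" "phi ^ 6 * phi = 13 * phi + 8" "phi ^ 4 * phi = 5 * phi + 3"
   "phi ^ 3 * phi = 3 * phi + 2"
  by (simp_all add: phi_more_powers phi_powers phi_sq ring_distribs mult.assoc)

text \<open>The one configuration of \<open>triple_step\<close> that estimates do not settle, n = 4
  with i = 1 and j = 3. Here a and b are the slopes \<theta> i and \<theta> j relative to \<tau>,
  and p, q, w collect the signs. Powers of phi are linear in phi, so each case is decided by the
  numerical bounds.\<close>

lemma four_steps:
  fixes a b \<eta> :: int and p q w :: real
  assumes "a \<in> {0,1,2,3,4}" "b \<in> {1,2,3,4}" "a \<noteq> b" "\<eta> \<in> {1,-1}" "p \<in> {1,-1}" "q \<in> {1,-1}" "w \<in> {1,-1}"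
  shows "phi ^ 8 * (p * sn b) + phi ^ 3 * (q * sn (b - \<eta>)) \<noteq>
    phi ^ 4 * sn (b - a) + phi ^ 6 * (p * w * sn a) + phi * (q * w * sn (a - \<eta>))"
proof
  assume eq: "phi ^ 8 * (p * sn b) + phi ^ 3 * (q * sn (b - \<eta>)) =
    phi ^ 4 * sn (b - a) + phi ^ 6 * (p * w * sn a) + phi * (q * w * sn (a - \<eta>))"
  have eq: "p * (phi ^ 8 * sn b) + q * (phi ^ 3 * sn (b - \<eta>)) =
    phi ^ 4 * sn (b - a) + (p * w) * (phi ^ 6 * sn a) + (q * w) * (phi * sn (a - \<eta>))"
    using eq by (simp only: mult_ac)
  have *: "p * A + q * B = C + (p * w) * G + (q * w) * H \<Longrightarrow>
    (A + B = C + G + H \<or> A + B = C - G - H) \<or> (A - B = C + G - H \<or> A - B = C - G + H) \<or>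
    (- A + B = C - G + H \<or> - A + B = C + G - H) \<or> (- A - B = C - G - H \<or> - A - B = C + G + H)" for A B C G H :: real
    using assms(5-7) by (elim insertE emptyE) simp_all
  show False using assms(1-4) *[OF eq] phi_bounds
    by (elim insertE emptyE; hypsubst; (simp (no_asm_use) only: sn_values)?; simp add: sn_values phi_times; simp add: phi_more_powers phi_powers phi_sq)
qed

text \<open>The numerical core of \<open>cs_n2\<close>: d and d' are the two steps of \<theta>, and
  e is \<tau> - \<theta> 0.\<close>

lemma two_steps:
  fixes d d' e \<eta> :: int
  assumes "d \<in> {1,-1,2,-2}" "d' \<in> {1,-1,2,-2}" "\<not> 5 dvd (d + d')" "e \<in> {1,-1}" "\<eta> \<in> {1,-1}"
    "\<bar>sn (d + d' - e - \<eta>)\<bar> = phi"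
  shows "phi * sn (- e) - phi ^ 2 * sn (d + d' - e - \<eta>) \<noteq> phi * sn (d - e + \<eta>)"
  using assms phi_bounds
  by (elim insertE emptyE; hypsubst; simp add: sn_values phi_powers phi_sq algebra_simps)

lemma sn_sign:
  assumes "5 dvd (a - b)"
  obtains e :: real where "e \<in> {1, -1}" "\<And>k. sn (a - k) = e * sn (b - k)"
proof -
  obtain e :: real where e: "e = 1 \<or> e = - 1" "dir a = of_real e * dir b"
    by (rule ht_sign[OF assms]) blast
  have "sn (a - k) = e * sn (b - k)" for k
  proof -
    have "ht k (dir a) = ht k (of_real e * dir b)" using e(2) by simp
    then show ?thesis by (simp only: ht_scale ht_dir)
  qed
  then show thesis using that e(1) by blast
qed

text \<open>The cap is the point where the line of slope \<tau> through v 0 meets the line of slope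
  \<tau> + \<eta> through v n. The conditions \<open>near\<close> and \<open>far\<close> make its
  velocity as unbalanced as possible: size phi^(n+1) along \<tau> and 1 along \<tau> +
  \<eta>.\<close>

locale path_cap = path_core +
  fixes \<tau> \<eta> :: int
  assumes eta: "\<eta> \<in> {1, -1}" and near: "\<theta> 0 - \<tau> \<in> {1, -1}" and far: "\<bar>sn (\<theta> n - \<tau> - \<eta>)\<bar> = phi" and n2: "2 \<le> n"
begin

text \<open>\<alpha> and \<beta> solve the two conditions that the cap keeps height \<tau> in common
  with v 0 and height \<tau> + \<eta> in common with v n (\<open>cs_first\<close>,
  \<open>cs_last\<close>); the factor \<eta> is the inverse of \<open>sn \<eta>\<close>.\<close>

definition \<alpha> :: real where "\<alpha> = - of_int \<eta> * (phi ^ n * sn (\<theta> n - \<tau> - \<eta>))"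
definition \<beta> :: real where "\<beta> = of_int \<eta> * sn (\<theta> 0 - \<tau>)"
definition cs :: complex where "cs = of_real \<alpha> * dir \<tau> + of_real \<beta> * dir (\<tau> + \<eta>)"

lemma eta_real: "real_of_int \<eta> = 1 \<or> real_of_int \<eta> = - 1" "real_of_int \<eta> * sn \<eta> = 1"
  using eta by (auto simp: sn_1 sn_minus)

lemma abs_\<alpha>: "\<bar>\<alpha>\<bar> = phi ^ Suc n"
  using eta_real(1) phi_pos by (auto simp: \<alpha>_def abs_mult far)
lemma abs_\<beta>: "\<bar>\<beta>\<bar> = 1"
  using near eta_real(1) by (auto simp: \<beta>_def abs_mult sn_1 sn_minus)

lemma coeff_Zphi: "\<alpha> \<in> Zphi" "\<beta> \<in> Zphi"
proof -
  have "real_of_int \<eta> \<in> Zphi" using eta_real(1) by (auto simp: Zphi_1 Zphi_minus)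
  then show "\<alpha> \<in> Zphi" "\<beta> \<in> Zphi" unfolding \<alpha>_def \<beta>_def by (auto intro!: Zphi_intros)
qed

lemma ht_cs: "ht k cs = \<alpha> * sn (\<tau> - k) + \<beta> * sn (\<tau> + \<eta> - k)"
  by (simp only: cs_def ht_add ht_scale ht_dir)

lemma cs_first: "ht \<tau> cs = ht \<tau> (c 0)"
proof -
  have "ht \<tau> cs = (real_of_int \<eta> * sn \<eta>) * sn (\<theta> 0 - \<tau>)" by (simp add: ht_cs sn_0 \<beta>_def)
  then show ?thesis by (simp add: eta_real(2) ht_c)
qed

lemma cs_last: "ht (\<tau> + \<eta>) cs = ht (\<tau> + \<eta>) (c n)"
proof -
  have "ht (\<tau> + \<eta>) cs = (real_of_int \<eta> * sn \<eta>) * (phi ^ n * sn (\<theta> n - \<tau> - \<eta>))"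
    by (simp add: ht_cs sn_0 sn_minus \<alpha>_def)
  then show ?thesis by (simp add: eta_real(2) ht_c algebra_simps)
qed

lemma slopes_differ: "\<not> 5 dvd (\<tau> - (\<tau> + \<eta>))" using eta by auto

lemma sn_at_\<tau>: "5 dvd (\<tau> - k) \<Longrightarrow> \<bar>sn (\<tau> + \<eta> - k)\<bar> = 1"
proof -
  assume "5 dvd (\<tau> - k)"
  then have "(\<tau> + \<eta> - k) mod 5 = 1 \<or> (\<tau> + \<eta> - k) mod 5 = 4" using eta by (elim insertE emptyE; presburger)
  then show ?thesis using abs_sn[of "\<tau> + \<eta> - k"] by (auto simp: dvd_eq_mod_eq_0)
qed

lemma \<alpha>_large: "\<not> 5 dvd (\<tau> - k) \<Longrightarrow> phi ^ Suc n \<le> \<bar>\<alpha> * sn (\<tau> - k)\<bar>"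
proof -
  assume "\<not> 5 dvd (\<tau> - k)"
  then have "phi ^ Suc n * 1 \<le> phi ^ Suc n * \<bar>sn (\<tau> - k)\<bar>"
    using phi_pos by (intro mult_left_mono abs_sn_ge_1) auto
  then show ?thesis by (simp add: abs_mult abs_\<alpha>)
qed

lemma \<beta>_small: "\<bar>\<beta> * sn k\<bar> \<le> phi" using abs_sn_le_phi by (simp add: abs_mult abs_\<beta>)

lemma ht_c_le: "\<bar>ht k (c i)\<bar> \<le> phi ^ Suc i"
proof -
  have "phi ^ i * \<bar>sn (\<theta> i - k)\<bar> \<le> phi ^ i * phi" using phi_pos by (intro mult_left_mono abs_sn_le_phi) auto
  then show ?thesis using phi_pos by (simp add: ht_c abs_mult mult.commute)
qed

lemma phi_pow_mono: "i \<le> j \<Longrightarrow> phi ^ i \<le> phi ^ j"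
  using phi_gt_1 by (intro power_increasing) auto

lemma phi_add: "phi ^ Suc (Suc k) = phi ^ Suc k + phi ^ k"
proof -
  have "phi ^ Suc (Suc k) = phi ^ k * (phi * phi)" by simp
  then show ?thesis unfolding phi_sq by (simp add: algebra_simps)
qed

lemma phi_add': "a = d + 2 \<Longrightarrow> b = d + 1 \<Longrightarrow> phi ^ a = phi ^ b + phi ^ d"
  using phi_add[of d] by simp

text \<open>In slope \<tau> only the \<beta> part remains, of size 1. In every other slope the
  \<alpha> part is at least phi^(n+1) and the \<beta> part at most phi.\<close>

lemma nonbasic: "ht k cs \<noteq> 0"
proof (cases "5 dvd (\<tau> - k)")
  case True
  then have "sn (\<tau> - k) = 0" by (simp add: sn_eq_0_iff)
  then have "\<bar>ht k cs\<bar> = 1" using sn_at_\<tau>[OF True] by (simp add: ht_cs abs_mult abs_\<beta>)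
  then show ?thesis by auto
next
  case False
  have "phi ^ 1 < phi ^ Suc n" using phi_gt_1 n2 by (intro power_strict_increasing) auto
  then show ?thesis using \<alpha>_large[OF False] \<beta>_small[of "\<tau> + \<eta> - k"] unfolding ht_cs by auto
qed

lemma cs_n2: "n = 2 \<Longrightarrow> ht (\<tau> - \<eta>) cs \<noteq> ht (\<tau> - \<eta>) (c 1)"
proof
  assume n: "n = 2" and eq: "ht (\<tau> - \<eta>) cs = ht (\<tau> - \<eta>) (c 1)"
  define e where "e = \<tau> - \<theta> 0"
  define d where "d = \<theta> 1 - \<theta> 0"
  define d' where "d' = \<theta> 2 - \<theta> 1"
  have th: "\<theta> 0 - \<tau> = - e" "\<theta> n - \<tau> - \<eta> = d + d' - e - \<eta>" "\<theta> 1 - (\<tau> - \<eta>) = d - e + \<eta>"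
    using n by (simp_all add: e_def d_def d'_def)
  have mem: "d \<in> {1,-1,2,-2}" "d' \<in> {1,-1,2,-2}" using step[of 0] step[of 1] n by (simp_all add: d_def d'_def numeral_2_eq_2)
  have nd: "\<not> 5 dvd (d + d')" using step2[of 0] n by (simp add: d_def d'_def numeral_2_eq_2)
  have e: "e \<in> {1,-1}" using near by (auto simp: e_def)
  have far': "\<bar>sn (d + d' - e - \<eta>)\<bar> = phi" using far unfolding th .
  have s2: "real_of_int \<eta> * sn (2 * \<eta>) = phi" using eta by (auto simp: sn_2 sn_minus)
  have "ht (\<tau> - \<eta>) cs = \<alpha> * sn \<eta> + \<beta> * sn (2 * \<eta>)" by (simp add: ht_cs)
  also have "\<dots> = (real_of_int \<eta> * sn (2 * \<eta>)) * sn (- e) - (real_of_int \<eta> * sn \<eta>) * (phi ^ n * sn (d + d' - e - \<eta>))"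
    unfolding \<alpha>_def \<beta>_def th by (simp add: algebra_simps)
  also have "\<dots> = phi * sn (- e) - phi ^ 2 * sn (d + d' - e - \<eta>)" using n by (simp add: s2 eta_real(2))
  finally have 1: "ht (\<tau> - \<eta>) cs = phi * sn (- e) - phi ^ 2 * sn (d + d' - e - \<eta>)" .
  have "ht (\<tau> - \<eta>) (c 1) = phi ^ 1 * sn (d - e + \<eta>)" unfolding th(3)[symmetric] by (rule ht_c)
  then show False using two_steps[OF mem nd e eta far'] eq 1 by (simp only: power_one_right)
qed

text \<open>In slope \<tau> the cap has height of size 1, too small for c i. In another slope the
  \<alpha> part is at least phi^(n+1) = phi^n + phi^(n-1), while \<beta> and c i contribute at most
  phi and phi^n; this decides n > 2. For n = 2 the bounds are tight, and equality forces the extreme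
  sizes, which occur together only in slope \<tau> - \<eta>; that slope is
  \<open>cs_n2\<close>.\<close>

lemma pair:
  assumes "0 < i" "i < n"
  shows "ht k cs \<noteq> ht k (c i)"
proof
  assume eq: "ht k cs = ht k (c i)"
  show False
  proof (cases "5 dvd (\<tau> - k)")
    case True
    then have "sn (\<tau> - k) = 0" by (simp add: sn_eq_0_iff)
    then have 1: "\<bar>ht k cs\<bar> = 1" using sn_at_\<tau>[OF True] by (simp add: ht_cs abs_mult abs_\<beta>)
    have "\<not> 5 dvd (\<theta> i - k)"
    proof
      assume "5 dvd (\<theta> i - k)"
      then have "ht k (c i) = 0" by (simp add: c_eq_0_iff)
      then show False using 1 eq by simp
    qed
    then have "phi ^ i \<le> \<bar>ht k (c i)\<bar>" by (rule ht_c_size(2))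
    moreover have "phi ^ 1 \<le> phi ^ i" by (rule phi_pow_mono) (use assms in simp)
    ultimately show False using 1 eq phi_gt_1 by simp
  next
    case nd: False
    have *: "\<bar>\<alpha> * sn (\<tau> - k)\<bar> \<le> \<bar>\<beta> * sn (\<tau> + \<eta> - k)\<bar> + \<bar>ht k (c i)\<bar>" using eq unfolding ht_cs by linarith
    note big = \<alpha>_large[OF nd] and small = \<beta>_small[of "\<tau> + \<eta> - k"] and ci = ht_c_le[of k i]
    obtain m where m: "n = Suc m" using n2 by (cases n) auto
    have p: "phi ^ Suc n = phi ^ n + phi ^ m" unfolding m by (rule phi_add)
    have mn: "phi ^ Suc i \<le> phi ^ n" by (rule phi_pow_mono) (use assms in simp)
    show False
    proof (cases "n = 2")
      case False
      then have "phi ^ Suc 1 \<le> phi ^ m" using n2 m by (intro phi_pow_mono) simp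
      then have "phi < phi ^ m" using phi_gt_1 phi_sq by simp
      then show False using * big small ci p mn by linarith
    next
      case True
      then have i: "i = 1" using assms by simp
      have m1: "m = 1" using True m by simp
      have "\<not> \<bar>sn (\<tau> - k)\<bar> \<ge> phi"
      proof
        assume "\<bar>sn (\<tau> - k)\<bar> \<ge> phi"
        then have "phi ^ Suc n * phi \<le> \<bar>\<alpha> * sn (\<tau> - k)\<bar>" unfolding abs_mult abs_\<alpha>
          using phi_pos by (intro mult_left_mono) auto
        moreover have "phi ^ Suc n * 1 < phi ^ Suc n * phi" using phi_gt_1 phi_pos by (intro mult_strict_left_mono) auto
        ultimately show False using * small ci p mn unfolding m1 by simp
      qed
      then have a: "(\<tau> - k) mod 5 = 1 \<or> (\<tau> - k) mod 5 = 4" using abs_sn[of "\<tau> - k"] nd by (auto split: if_splits)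
      have "\<not> \<bar>sn (\<tau> + \<eta> - k)\<bar> \<le> 1"
      proof
        assume "\<bar>sn (\<tau> + \<eta> - k)\<bar> \<le> 1"
        then have "\<bar>\<beta> * sn (\<tau> + \<eta> - k)\<bar> \<le> 1" by (simp add: abs_mult abs_\<beta>)
        then show False using * big ci p mn phi_gt_1 unfolding m1 by simp
      qed
      then have b: "\<not> 5 dvd (\<tau> + \<eta> - k)" "(\<tau> + \<eta> - k) mod 5 \<noteq> 1" "(\<tau> + \<eta> - k) mod 5 \<noteq> 4"
        using abs_sn[of "\<tau> + \<eta> - k"] by (auto split: if_splits)
      have eta': "\<eta> = 1 \<or> \<eta> = - 1" using eta by simp
      have "5 dvd (k - (\<tau> - \<eta>))" using eta'
      proof
        assume \<eta>: "\<eta> = 1"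
        have "(\<tau> - k) mod 5 \<noteq> 4" using b(1) unfolding \<eta> by presburger
        then have "(\<tau> - k) mod 5 = 1" using a by simp
        then show ?thesis unfolding \<eta> by presburger
      next
        assume \<eta>: "\<eta> = - 1"
        have "(\<tau> - k) mod 5 \<noteq> 1" using b(1) unfolding \<eta> by presburger
        then have "(\<tau> - k) mod 5 = 4" using a by simp
        then show ?thesis unfolding \<eta> by presburger
      qed
      then have "ht (\<tau> - \<eta>) cs = ht (\<tau> - \<eta>) (c i)" using ht_cong_eq[of k "\<tau> - \<eta>" cs "c i"] eq by blast
      then show False using cs_n2[OF True] i by simp
    qed
  qed
qed

lemma cs_ne_c: "cs \<noteq> c i" using nonbasic[of "\<theta> i"] c_eq_0_iff[of "\<theta> i" i] by auto

lemma pair_first: "ht k cs = ht k (c 0) \<Longrightarrow> 5 dvd (k - \<tau>)"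
  using ht_inj[of k \<tau> cs "c 0"] cs_first cs_ne_c by blast
lemma pair_last: "ht k cs = ht k (c n) \<Longrightarrow> 5 dvd (k - (\<tau> + \<eta>))"
  using ht_inj[of k "\<tau> + \<eta>" cs "c n"] cs_last cs_ne_c by blast

text \<open>The inequality says that cs, c i and c j are not collinear. If \<theta> j is not \<tau>
  mod 5, the product of \<alpha> with c j dominates, except for the smallest indices, which are left
  to \<open>four_steps\<close>. If it is, the product of \<alpha> with c i takes this role, and if
  that vanishes too, the \<beta> parts have different powers of phi.\<close>

lemma triple_step:
  assumes ij: "0 < i" "i + 2 \<le> j" "j < n"
  shows "\<alpha> * (phi ^ j * sn (\<theta> j - \<tau>)) + \<beta> * (phi ^ j * sn (\<theta> j - (\<tau> + \<eta>))) \<noteq>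
    phi ^ (i + j) * sn (\<theta> j - \<theta> i) + \<alpha> * (phi ^ i * sn (\<theta> i - \<tau>)) + \<beta> * (phi ^ i * sn (\<theta> i - (\<tau> + \<eta>)))"
proof
  assume eq: "\<alpha> * (phi ^ j * sn (\<theta> j - \<tau>)) + \<beta> * (phi ^ j * sn (\<theta> j - (\<tau> + \<eta>))) =
    phi ^ (i + j) * sn (\<theta> j - \<theta> i) + \<alpha> * (phi ^ i * sn (\<theta> i - \<tau>)) + \<beta> * (phi ^ i * sn (\<theta> i - (\<tau> + \<eta>)))"
  have tri: "\<bar>u\<bar> \<le> \<bar>x\<bar> + \<bar>y\<bar> + \<bar>z\<bar> + \<bar>w\<bar>" if "x + y = z + u + w" for x y z u w :: real
    using that by linarith
  have tri': "\<bar>x\<bar> \<le> \<bar>y\<bar> + \<bar>z\<bar> + \<bar>u\<bar> + \<bar>w\<bar>" if "x + y = z + u + w" for x y z u w :: real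
    using that by linarith
  have ub: "phi ^ l * \<bar>sn k\<bar> \<le> phi ^ Suc l" for l k
    using mult_left_mono[OF abs_sn_le_phi[of k], of "phi ^ l"] phi_pos by (simp add: mult.commute)
  have lb: "phi ^ l \<le> phi ^ l * \<bar>sn k\<bar>" if "sn k \<noteq> 0" for l k
    using mult_left_mono[OF abs_sn_ge_1[of k], of "phi ^ l"] phi_pos that by (simp add: sn_eq_0_iff)
  have A: "\<bar>\<alpha> * (phi ^ l * sn k)\<bar> = phi ^ (Suc n + l) * \<bar>sn k\<bar>" for l k
    using phi_pos by (simp add: abs_mult abs_\<alpha> power_add)
  have B: "\<bar>\<beta> * (phi ^ l * sn k)\<bar> = phi ^ l * \<bar>sn k\<bar>" for l k
    using phi_pos by (simp add: abs_mult abs_\<beta>)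
  have M: "\<bar>phi ^ l * sn k\<bar> = phi ^ l * \<bar>sn k\<bar>" for l k using phi_pos by (simp add: abs_mult)
  show False
  proof (cases "sn (\<theta> j - \<tau>) = 0")
    case True
    then have d: "5 dvd (\<theta> j - \<tau>)" by (simp add: sn_eq_0_iff)
    have "5 dvd (\<tau> - \<theta> j)" using d by presburger
    then have b1: "\<bar>sn (\<theta> j - (\<tau> + \<eta>))\<bar> = 1"
      using sn_at_\<tau>[of "\<theta> j"] sn_minus[of "\<theta> j - (\<tau> + \<eta>)"] by simp
    obtain e where e: "e \<in> {1, -1}" "\<And>k. sn (\<theta> j - k) = e * sn (\<tau> - k)" by (rule sn_sign[OF d]) blast
    have x: "\<bar>sn (\<theta> j - \<theta> i)\<bar> = \<bar>sn (\<theta> i - \<tau>)\<bar>"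
      using e(1) e(2)[of "\<theta> i"] sn_minus[of "\<theta> i - \<tau>"] by (auto simp: abs_mult)
    show False
    proof (cases "sn (\<theta> i - \<tau>) = 0")
      case True2: True
      then have "5 dvd (\<tau> - \<theta> i)" unfolding sn_eq_0_iff by presburger
      then have b2: "\<bar>sn (\<theta> i - (\<tau> + \<eta>))\<bar> = 1"
        using sn_at_\<tau>[of "\<theta> i"] sn_minus[of "\<theta> i - (\<tau> + \<eta>)"] by simp
      have "\<beta> * (phi ^ j * sn (\<theta> j - (\<tau> + \<eta>))) = \<beta> * (phi ^ i * sn (\<theta> i - (\<tau> + \<eta>)))"
        using eq True True2 x by simp
      then have "\<bar>\<beta> * (phi ^ j * sn (\<theta> j - (\<tau> + \<eta>)))\<bar> = \<bar>\<beta> * (phi ^ i * sn (\<theta> i - (\<tau> + \<eta>)))\<bar>"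
        by (rule arg_cong)
      then have "phi ^ j = phi ^ i" unfolding B b1 b2 by simp
      moreover have "phi ^ i < phi ^ j" using ij phi_gt_1 by (intro power_strict_increasing) auto
      ultimately show False by simp
    next
      case nz: False
      define Y where "Y = \<bar>sn (\<theta> i - \<tau>)\<bar>"
      have Y: "1 \<le> Y" using lb[of "\<theta> i - \<tau>" 0] nz by (simp add: Y_def)
      obtain m where m: "n = Suc (Suc m)" using n2 by (metis add_2_eq_Suc le_Suc_ex)
      have "phi ^ (Suc n + i) * Y \<le> phi ^ (i + j) * Y + phi ^ j + phi ^ Suc i"
        using tri[OF eq, unfolded A M B] True b1 x ub[of i "\<theta> i - (\<tau> + \<eta>)"] by (simp add: Y_def)
      moreover have "phi ^ (i + j) * Y \<le> phi ^ (Suc m + i) * Y"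
        
        by (rule mult_right_mono[OF phi_pow_mono]) (use Y ij m in linarith)+
      moreover have "phi ^ (Suc n + i) * Y = phi ^ (n + i) * Y + phi ^ (Suc m + i) * Y"
        using phi_add[of "Suc m + i"] by (simp add: m algebra_simps)
      moreover have "phi ^ (n + i) * 1 \<le> phi ^ (n + i) * Y" using Y phi_pos by (intro mult_left_mono) auto
      moreover have "phi ^ j + phi ^ Suc i \<le> phi ^ n"
      proof -
        have "phi ^ j \<le> phi ^ Suc m" "phi ^ Suc i \<le> phi ^ m" 
          by (rule phi_pow_mono, use ij m in linarith)+
        then show ?thesis using phi_add[of m] unfolding m by linarith
      qed
      moreover have "phi ^ n < phi ^ (n + i)" using ij phi_gt_1 by (intro power_strict_increasing) auto
      ultimately show False by linarith
    qed
  next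
    case nz: False
    have main: "phi ^ (Suc n + j) * \<bar>sn (\<theta> j - \<tau>)\<bar> \<le> phi ^ Suc j + phi ^ Suc (i + j) + phi ^ Suc (Suc n + i) + phi ^ Suc i"
      using tri'[OF eq, unfolded A M B] ub[of j "\<theta> j - (\<tau> + \<eta>)"] ub[of i "\<theta> i - (\<tau> + \<eta>)"]
        ub[of "i + j" "\<theta> j - \<theta> i"] ub[of "Suc n + i" "\<theta> i - \<tau>"]
      by linarith
    define m where "m = n - 4"
    have m: "n = m + 4" using ij by (simp add: m_def)
    show False
    proof (cases "m = 0")
      case False
      have "phi ^ (Suc n + j) \<le> phi ^ Suc j + phi ^ Suc (i + j) + phi ^ Suc (Suc n + i) + phi ^ Suc i"
        using main lb[OF nz, of "Suc n + j"] by linarith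
      moreover have "phi ^ Suc (i + j) \<le> phi ^ (j + m + 2)" "phi ^ Suc (Suc n + i) \<le> phi ^ (j + n)" "phi ^ Suc i \<le> phi ^ j"
        
          by (rule phi_pow_mono, use ij m in linarith)+
      moreover have "phi ^ (Suc n + j) = phi ^ (j + n) + phi ^ (j + m + 3)"
        by (rule phi_add') (simp_all add: m)
      moreover have "phi ^ (j + m + 3) = phi ^ (j + m + 2) + phi ^ (j + m + 1)"
        by (rule phi_add') simp_all
      moreover have "phi ^ Suc (Suc j) \<le> phi ^ (j + m + 1)" using False by (intro phi_pow_mono) simp
      ultimately have "phi ^ Suc (Suc j) \<le> phi ^ Suc j + phi ^ Suc i"
        by linarith
      moreover have "phi ^ Suc i < phi ^ j" using ij phi_gt_1 by (intro power_strict_increasing) auto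
      ultimately show False using phi_add[of j] by linarith
    next
      case True
      then have n4: "n = 4" and i1: "i = 1" and j3: "j = 3" using m ij by simp_all
      \<comment> \<open>Reduction mod 5 loses the signs s1 and s3. Multiplying the equation by s1
        and s3 leaves three independent signs, the p, q, w of \<open>four_steps\<close>.\<close>
      define a b where "a = (\<theta> i - \<tau>) mod 5" and "b = (\<theta> j - \<tau>) mod 5"
      have da: "5 dvd (\<theta> i - (\<tau> + a))" and db: "5 dvd (\<theta> j - (\<tau> + b))" unfolding a_def b_def by presburger+
      obtain s1 where s1: "s1 \<in> {1, -1}" "\<And>k. sn (\<theta> i - k) = s1 * sn (\<tau> + a - k)" by (rule sn_sign[OF da]) blast
      obtain s3 where s3: "s3 \<in> {1, -1}" "\<And>k. sn (\<theta> j - k) = s3 * sn (\<tau> + b - k)" by (rule sn_sign[OF db]) blast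
      have ab: "a \<in> {0,1,2,3,4}" unfolding a_def using pos_mod_bound[of 5 "\<theta> i - \<tau>"] pos_mod_sign[of 5 "\<theta> i - \<tau>"] by auto
      have "b \<noteq> 0" using nz s3(2)[of \<tau>] by (auto simp: sn_0)
      then have bb: "b \<in> {1,2,3,4}" unfolding b_def using pos_mod_bound[of 5 "\<theta> j - \<tau>"] pos_mod_sign[of 5 "\<theta> j - \<tau>"] by auto
      have "\<not> 5 dvd (\<theta> j - \<theta> i)" using step2[of 1] n4 i1 j3 by (simp add: numeral_3_eq_3)
      then have nab: "a \<noteq> b" using da db by presburger
      have ab0: "sn (\<theta> j - \<theta> i) = s1 * s3 * sn (b - a)"
      proof -
        have 1: "sn (\<theta> j - \<theta> i) = s3 * sn (\<tau> + b - \<theta> i)" by (rule s3(2))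
        have 2: "sn (\<theta> i - (\<tau> + b)) = s1 * sn (a - b)" using s1(2)[of "\<tau> + b"] by simp
        have 3: "sn (\<tau> + b - \<theta> i) = - sn (\<theta> i - (\<tau> + b))"
          using sn_minus[of "\<theta> i - (\<tau> + b)"] by (simp only: minus_diff_eq)
        have 4: "sn (a - b) = - sn (b - a)" using sn_minus[of "b - a"] by (simp only: minus_diff_eq)
        show ?thesis unfolding 1 3 2 4 by simp
      qed
      have n5: "Suc n = 5" using n4 by simp
      have \<alpha>5: "\<bar>\<alpha>\<bar> = phi ^ 5" using abs_\<alpha> unfolding n5 .
      define sa :: real where "sa = (if \<alpha> < 0 then - 1 else 1)"
      have "\<alpha> = sa * \<bar>\<alpha>\<bar>" by (simp add: sa_def)
      then have sa: "sa \<in> {1, -1}" "\<alpha> = sa * phi ^ 5" unfolding \<alpha>5 by (simp_all add: sa_def)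
      have sb: "\<beta> \<in> {1, -1}" using abs_\<beta> by (auto simp: abs_if split: if_splits)
      have sq: "s1 * s1 = 1" "s3 * s3 = 1" using s1(1) s3(1) by auto
      have v: "sn (\<theta> j - \<tau>) = s3 * sn b" "sn (\<theta> j - (\<tau> + \<eta>)) = s3 * sn (b - \<eta>)"
        "sn (\<theta> i - \<tau>) = s1 * sn a" "sn (\<theta> i - (\<tau> + \<eta>)) = s1 * sn (a - \<eta>)"
        using s1(2) s3(2) by simp_all
      have pw: "phi ^ 8 = phi ^ 5 * phi ^ 3" "phi ^ 6 = phi ^ 5 * phi ^ 1" "phi ^ 4 = phi ^ (1 + 3)"
        by (simp_all only: power_add[symmetric]) simp_all
      have "phi ^ 8 * ((sa * s1) * sn b) + phi ^ 3 * ((\<beta> * s1) * sn (b - \<eta>)) =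
        phi ^ 4 * sn (b - a) + phi ^ 6 * (((sa * s1) * (s1 * s3)) * sn a) + phi * (((\<beta> * s1) * (s1 * s3)) * sn (a - \<eta>))"
        using s1(1) s3(1) eq[unfolded v ab0 sa(2), unfolded i1 j3] unfolding pw
        by (elim insertE emptyE; hypsubst; simp add: algebra_simps)
      moreover have "sa * s1 \<in> {1,-1}" "\<beta> * s1 \<in> {1,-1}" "s1 * s3 \<in> {1,-1}" using sa(1) s1(1) s3(1) sb by auto
      ultimately show False using four_steps[OF ab bb nab eta] by blast
    qed
  qed
qed

text \<open>An end of the path shares a height with the cap, and consecutive vertices share the
  height of their edge; in these cases collinearity would give a coincidence excluded by
  \<open>pair\<close> or \<open>pair_last\<close>. All other index pairs fall under
  \<open>triple_step\<close>.\<close>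

lemma triple:
  assumes "i < j" "j \<le> n"
  shows "cr (c i - cs) (c j - cs) \<noteq> 0"
proof
  assume 0: "cr (c i - cs) (c j - cs) = 0"
  have z: "ht k (c j - cs) = 0" if "ht k (c i - cs) = 0" for k
    using ht_parallel[OF that _ 0] cs_ne_c[of i] by auto
  have z': "ht k (c i - cs) = 0" if "ht k (c j - cs) = 0" for k
  proof -
    have "cr (c j - cs) (c i - cs) = 0" using 0 cr_commute[of "c j - cs"] by simp
    then show ?thesis using ht_parallel[OF that, of "c i - cs"] cs_ne_c[of j] by auto
  qed
  show False
  proof (cases "i = 0")
    case True
    then have t0: "ht \<tau> cs = ht \<tau> (c j)" using z[of \<tau>] cs_first by (simp add: ht_diff)
    show False
    proof (cases "j = n")
      case True
      then have "5 dvd (\<tau> - (\<tau> + \<eta>))" using pair_last t0 by blast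
      then show False using slopes_differ by blast
    next
      case False
      then show False using pair[of j \<tau>] t0 assms by simp
    qed
  next
    case i0: False
    show False
    proof (cases "j = n")
      case True
      then have "ht (\<tau> + \<eta>) cs = ht (\<tau> + \<eta>) (c i)" using z'[of "\<tau> + \<eta>"] cs_last by (simp add: ht_diff)
      then show False using pair[of i "\<tau> + \<eta>"] i0 assms True by simp
    next
      case jn: False
      show False
      proof (cases "j = Suc i")
        case True
        then have i: "i < n" using assms by simp
        have "ht (t i) (c j - c i) = 0" using ht_t_c[OF i] True by (simp add: ht_diff)
        moreover have "c j \<noteq> c i" using c_ne[OF i] True by auto
        moreover have "cr (c j - c i) (cs - c i) = 0" using 0 cr_rotate[of "c i" cs "c j"] by simp
        ultimately have "ht (t i) (cs - c i) = 0" using ht_parallel[of "t i" "c j - c i" "cs - c i"] by auto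
        then show False using pair[of i "t i"] i0 i by (simp add: ht_diff)
      next
        case False
        have "cr (c i - cs) (c j - cs) = cr (c i) (c j) + cr cs (c i) - cr cs (c j)"
          by (simp add: cr_linear cr_commute[of "c i" cs])
        moreover have "cr cs (c k) = sin (pi/5) * (\<alpha> * (phi ^ k * sn (\<theta> k - \<tau>)) + \<beta> * (phi ^ k * sn (\<theta> k - (\<tau> + \<eta>))))" for k
          unfolding cs_def by (simp only: cr_linear cr_dir ht_c) (simp add: algebra_simps)
        ultimately have "0 = sin (pi/5) * (phi ^ (i + j) * sn (\<theta> j - \<theta> i)
           + (\<alpha> * (phi ^ i * sn (\<theta> i - \<tau>)) + \<beta> * (phi ^ i * sn (\<theta> i - (\<tau> + \<eta>))))
           - (\<alpha> * (phi ^ j * sn (\<theta> j - \<tau>)) + \<beta> * (phi ^ j * sn (\<theta> j - (\<tau> + \<eta>)))))"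
          using 0 by (simp only: cr_c_c) (simp add: algebra_simps)
        then have "phi ^ (i + j) * sn (\<theta> j - \<theta> i)
           + (\<alpha> * (phi ^ i * sn (\<theta> i - \<tau>)) + \<beta> * (phi ^ i * sn (\<theta> i - (\<tau> + \<eta>))))
           - (\<alpha> * (phi ^ j * sn (\<theta> j - \<tau>)) + \<beta> * (phi ^ j * sn (\<theta> j - (\<tau> + \<eta>)))) = 0"
          using sin_pi5_pos by simp
        then show False using triple_step[of i j] i0 jn False assms by simp
      qed
    qed
  qed
qed

end

text \<open>What is needed to add w as a new vertex with exactly the neighbours a and b, in the
  slopes \<tau> and \<tau>'. Here w is only a point of the plane, so the same notion serves for
  adding a vertex and for gluing.\<close>

definition capped :: "'a set \<Rightarrow> ('a \<Rightarrow> complex) \<Rightarrow> 'a \<Rightarrow> 'a \<Rightarrow> int \<Rightarrow> int \<Rightarrow> complex \<Rightarrow> bool" where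
  "capped W D a b \<tau> \<tau>' w \<longleftrightarrow> ht \<tau> w = ht \<tau> (D a) \<and> ht \<tau>' w = ht \<tau>' (D b) \<and>
     (\<forall>x\<in>W. \<forall>k. ht k w = ht k (D x) \<longrightarrow> x = a \<and> 5 dvd (k - \<tau>) \<or> x = b \<and> 5 dvd (k - \<tau>')) \<and>
     (\<forall>x\<in>W. \<forall>y\<in>W. x \<noteq> y \<longrightarrow> cr (D x - w) (D y - w) \<noteq> 0)"

context path_cap
begin

definition cap_base :: complex where
  "cap_base = (SOME z. ht \<tau> z = ht \<tau> (base 0) \<and> ht (\<tau> + \<eta>) z = ht (\<tau> + \<eta>) (base n))"
definition cap :: "real \<Rightarrow> complex" where "cap X = cap_base + of_real X * cs"

lemma cap_base: "ht \<tau> cap_base = ht \<tau> (base 0)" "ht (\<tau> + \<eta>) cap_base = ht (\<tau> + \<eta>) (base n)"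
proof -
  obtain z where "ht \<tau> z = ht \<tau> (base 0)" "ht (\<tau> + \<eta>) z = ht (\<tau> + \<eta>) (base n)"
    by (rule ht_surj[OF slopes_differ])
  then have "\<exists>z. ht \<tau> z = ht \<tau> (base 0) \<and> ht (\<tau> + \<eta>) z = ht (\<tau> + \<eta>) (base n)" by blast
  note s = someI_ex[where P="\<lambda>z. ht \<tau> z = ht \<tau> (base 0) \<and> ht (\<tau> + \<eta>) z = ht (\<tau> + \<eta>) (base n)", OF this]
  show "ht \<tau> cap_base = ht \<tau> (base 0)" "ht (\<tau> + \<eta>) cap_base = ht (\<tau> + \<eta>) (base n)"
    using s unfolding cap_base_def by simp_all
qed

lemma cap_ends: "ht \<tau> (cap X) = ht \<tau> (pos X (v 0))" "ht (\<tau> + \<eta>) (cap X) = ht (\<tau> + \<eta>) (pos X (v n))"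
  by (simp_all only: cap_def pos_v[OF le0] pos_v[OF order_refl] ht_add ht_scale cap_base cs_first cs_last)

lemma cap_off_V:
  "generic (\<lambda>X. \<forall>x\<in>V'. \<forall>k\<in>{0..<5}. ht k (cap X) \<noteq> ht k (D' x))"
proof (intro generic_ball countable_finite fin finite_atLeastLessThan_int)
  fix x k
  have "generic (\<lambda>X. ht k (cap X) - ht k (D' x) \<noteq> 0)"
    by (rule affine_generic[of _ "ht k cap_base - ht k (D' x)" "ht k cs"])
      (use nonbasic in \<open>simp_all add: cap_def ht_linear algebra_simps\<close>)
  then show "generic (\<lambda>X. ht k (cap X) \<noteq> ht k (D' x))" by simp
qed

lemma cap_off_v:
  "generic (\<lambda>X. \<forall>i\<in>{..n}. \<forall>k\<in>{0..<5}. ht k cs \<noteq> ht k (c i) \<longrightarrow> ht k (cap X) \<noteq> ht k (pos X (v i)))"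
proof (intro generic_ball countable_finite finite_atMost finite_atLeastLessThan_int generic_imp)
  fix i k assume i: "i \<in> {..n}" and ne: "ht k cs \<noteq> ht k (c i)"
  have "generic (\<lambda>X. ht k (cap X) - ht k (pos X (v i)) \<noteq> 0)"
    by (rule affine_generic[of _ "ht k cap_base - ht k (base i)" "ht k cs - ht k (c i)"])
      (use ne i in \<open>simp_all add: cap_def pos_v ht_linear algebra_simps\<close>)
  then show "generic (\<lambda>X. ht k (cap X) \<noteq> ht k (pos X (v i)))" by simp
qed

lemma cr_c_cs: "cr (c i) cs \<noteq> 0"
  using nonbasic[of "\<theta> i"] phi_pos sin_pi5_pos unfolding c_def cr_linear cr_dir by simp

lemma cap_v_V:
  "generic (\<lambda>X. \<forall>i\<in>{..n}. \<forall>x\<in>V'. cr (pos X (v i) - cap X) (D' x - cap X) \<noteq> 0)"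
proof (intro generic_ball countable_finite finite_atMost fin)
  fix i x assume i: "i \<in> {..n}"
  define P Q where "P = base i - cap_base" and "Q = D' x - cap_base"
  have e: "pos X (v i) - cap X = P + of_real X * (c i - cs)" "D' x - cap X = Q - of_real X * cs" for X
    using i by (simp_all add: P_def Q_def cap_def pos_v algebra_simps)
  show "generic (\<lambda>X. cr (pos X (v i) - cap X) (D' x - cap X) \<noteq> 0)" unfolding e
  proof (rule quadratic_generic)
    show "cr (P + of_real X * (c i - cs)) (Q - of_real X * cs) =
      cr P Q + (cr (c i - cs) Q - cr P cs) * X + (- cr (c i) cs) * X\<^sup>2" for X
      by (simp only: cr_linear) (simp add: algebra_simps power2_eq_square)
  qed (use cr_c_cs[of i] in simp)
qed

lemma cap_v_v:
  "generic (\<lambda>X. \<forall>i\<in>{..n}. \<forall>j\<in>{..n}. i < j \<longrightarrow> cr (pos X (v i) - cap X) (pos X (v j) - cap X) \<noteq> 0)"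
proof (intro generic_ball countable_finite finite_atMost generic_imp)
  fix i j assume i: "i \<in> {..n}" and j: "j \<in> {..n}" and ij: "i < j"
  define P Q where "P = base i - cap_base" and "Q = base j - cap_base"
  define a b where "a = c i - cs" and "b = c j - cs"
  have e: "pos X (v i) - cap X = P + of_real X * a" "pos X (v j) - cap X = Q + of_real X * b" for X
    using i j by (simp_all add: P_def Q_def a_def b_def cap_def pos_v algebra_simps)
  have nz: "cr a b \<noteq> 0" unfolding a_def b_def by (rule triple) (use ij j in auto)
  show "generic (\<lambda>X. cr (pos X (v i) - cap X) (pos X (v j) - cap X) \<noteq> 0)" unfolding e
  proof (rule quadratic_generic)
    show "cr (P + of_real X * a) (Q + of_real X * b) = cr P Q + (cr a Q + cr P b) * X + cr a b * X\<^sup>2" for X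
      by (simp only: cr_linear) (simp add: algebra_simps power2_eq_square)
  qed (use nz in simp)
qed

text \<open>The determinant is affine in X with slope the determinant of cs and D' x - D' y. For an
  edge x y the difference is a basic direction and cs is not. For nonadjacent x and y the
  determinant with cs is, up to a factor, a functional over \<open>Zphi\<close>, to which
  \<open>nr\<close> applies.\<close>

lemma cap_V_V:
  assumes nr: "\<And>p q d. p \<in> V' \<Longrightarrow> q \<in> V' \<Longrightarrow> p \<noteq> q \<Longrightarrow> \<not> E p q \<Longrightarrow> d \<in> Zphi \<times> Zphi \<Longrightarrow> d \<noteq> 0 \<Longrightarrow>
      lin d (D' p) \<noteq> lin d (D' q)"
  shows "generic (\<lambda>X. \<forall>x\<in>V'. \<forall>y\<in>V'. x \<noteq> y \<longrightarrow> cr (D' x - cap X) (D' y - cap X) \<noteq> 0)"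
proof (intro generic_ball countable_finite fin generic_imp)
  fix x y assume x: "x \<in> V'" and y: "y \<in> V'" and xy: "x \<noteq> y"
  define P Q where "P = D' x - cap_base" and "Q = D' y - cap_base"
  have e: "D' x - cap X = P - of_real X * cs" "D' y - cap X = Q - of_real X * cs" for X
    by (simp_all add: P_def Q_def cap_def)
  define d where "d = \<alpha> *\<^sub>R htc \<tau> + \<beta> *\<^sub>R htc (\<tau> + \<eta>)"
  have cd: "cr cs z = sin (pi/5) * lin d z" for z
    unfolding cs_def d_def cr_linear cr_dir lin_coeff lin_htc by (simp add: algebra_simps)
  have dZ: "d \<in> Zphi \<times> Zphi"
  proof -
    have "fst (htc k) \<in> Zphi" "snd (htc k) \<in> Zphi" for k using htc_Zphi[of k] by (simp_all add: mem_Times_iff)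
    then have "fst d \<in> Zphi" "snd d \<in> Zphi"
      unfolding d_def fst_add snd_add fst_scaleR snd_scaleR real_scaleR_def
      by (intro Zphi_add Zphi_mult coeff_Zphi; blast)+
    then show ?thesis by (simp add: mem_Times_iff)
  qed
  have "cr cs (D' x - D' y) \<noteq> 0"
  proof (cases "E x y")
    case True
    then obtain s where s: "ht s (D' x) = ht s (D' y)" using faithfulD(2)[OF faithful' x y xy] by blast
    have ne: "D' x - D' y \<noteq> 0" using faithfulD(1)[OF faithful' x y xy] by simp
    show ?thesis
    proof
      assume 0: "cr cs (D' x - D' y) = 0"
      have "cr (D' x - D' y) cs = 0" using 0 cr_commute[of "D' x - D' y" cs] by linarith
      moreover have "ht s (D' x - D' y) = 0" using s by (simp add: ht_diff)
      ultimately have "ht s cs = 0" using ht_parallel[OF _ ne] by blast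
      then show False using nonbasic by blast
    qed
  next
    case False
    have "d \<noteq> 0"
    proof
      assume "d = 0"
      then have "cr cs (c 0) = 0" using cd by (simp add: lin_coeff)
      then show False using cr_c_cs[of 0] cr_commute[of "c 0" cs] by linarith
    qed
    then have "lin d (D' x) \<noteq> lin d (D' y)" by (rule nr[OF x y xy False dZ])
    then show ?thesis using sin_pi5_pos by (simp add: cd lin_linear)
  qed
  moreover have "cr cs (D' x - D' y) = cr cs P - cr cs Q" by (simp add: P_def Q_def cr_linear)
  ultimately have nz: "cr cs P - cr cs Q \<noteq> 0" by simp
  show "generic (\<lambda>X. cr (D' x - cap X) (D' y - cap X) \<noteq> 0)" unfolding e
  proof (rule affine_generic)
    show "cr (P - of_real X * cs) (Q - of_real X * cs) = cr P Q + (cr cs P - cr cs Q) * X" for X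
      by (simp only: cr_linear cr_commute[of P cs]) (simp add: algebra_simps)
  qed (use nz in simp)
qed

lemma cap_exists:
  assumes nr: "\<And>p q d. p \<in> V' \<Longrightarrow> q \<in> V' \<Longrightarrow> p \<noteq> q \<Longrightarrow> \<not> E p q \<Longrightarrow> d \<in> Zphi \<times> Zphi \<Longrightarrow> d \<noteq> 0 \<Longrightarrow>
      lin d (D' p) \<noteq> lin d (D' q)"
  shows "\<exists>X w. placed X \<and> capped points (pos X) (v 0) (v n) \<tau> (\<tau> + \<eta>) w"
proof -
  obtain X where X: "placed X"
    and g1: "\<forall>x\<in>V'. \<forall>k\<in>{0..<5}. ht k (cap X) \<noteq> ht k (D' x)"
    and g2: "\<forall>i\<in>{..n}. \<forall>k\<in>{0..<5}. ht k cs \<noteq> ht k (c i) \<longrightarrow> ht k (cap X) \<noteq> ht k (pos X (v i))"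
    and g3: "\<forall>i\<in>{..n}. \<forall>x\<in>V'. cr (pos X (v i) - cap X) (D' x - cap X) \<noteq> 0"
    and g4: "\<forall>i\<in>{..n}. \<forall>j\<in>{..n}. i < j \<longrightarrow> cr (pos X (v i) - cap X) (pos X (v j) - cap X) \<noteq> 0"
    and g5: "\<forall>x\<in>V'. \<forall>y\<in>V'. x \<noteq> y \<longrightarrow> cr (D' x - cap X) (D' y - cap X) \<noteq> 0"
  proof -
    have "generic (\<lambda>X. placed X \<and> (\<forall>x\<in>V'. \<forall>k\<in>{0..<5}. ht k (cap X) \<noteq> ht k (D' x)) \<and>
      (\<forall>i\<in>{..n}. \<forall>k\<in>{0..<5}. ht k cs \<noteq> ht k (c i) \<longrightarrow> ht k (cap X) \<noteq> ht k (pos X (v i))) \<and>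
      (\<forall>i\<in>{..n}. \<forall>x\<in>V'. cr (pos X (v i) - cap X) (D' x - cap X) \<noteq> 0) \<and>
      (\<forall>i\<in>{..n}. \<forall>j\<in>{..n}. i < j \<longrightarrow> cr (pos X (v i) - cap X) (pos X (v j) - cap X) \<noteq> 0) \<and>
      (\<forall>x\<in>V'. \<forall>y\<in>V'. x \<noteq> y \<longrightarrow> cr (D' x - cap X) (D' y - cap X) \<noteq> 0))"
      by (intro generic_conj generic_placed cap_off_V cap_off_v cap_v_V cap_v_v cap_V_V) (rule nr)
    from generic_ex[OF this] show thesis by (elim exE conjE) (rule that)
  qed
  have slope: "x = v 0 \<and> 5 dvd (k - \<tau>) \<or> x = v n \<and> 5 dvd (k - (\<tau> + \<eta>))"
    if x: "x \<in> points" and eq: "ht k (cap X) = ht k (pos X x)" for x k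
  proof -
    define s where "s = k mod 5"
    have s: "s \<in> {0..<5}" "5 dvd (k - s)" unfolding s_def by (simp, presburger)
    have eqs: "ht s (cap X) = ht s (pos X x)" using ht_cong_eq[OF s(2)] eq by blast
    show ?thesis
    proof (cases rule: points_cases[OF x])
      case 1 then show ?thesis using g1 s eqs by (simp add: pos_V)
    next
      case (2 i)
      have i: "i \<in> {..n}" using 2 by simp
      have same: "ht s cs = ht s (c i)"
        using bspec[OF bspec[OF g2 i] s(1)] eqs unfolding 2(2) by blast
      have "\<not> (0 < i \<and> i < n)" using pair[of i s] same by blast
      then consider "i = 0" | "i = n" using 2(1) by linarith
      then show ?thesis
      proof cases
        case 1
        then have "5 dvd (s - \<tau>)" using pair_first same by blast
        then have "5 dvd (k - \<tau>)" using s(2) by presburger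
        then show ?thesis using 1 2 by simp
      next
        case b: 2
        then have "5 dvd (s - (\<tau> + \<eta>))" using pair_last same by blast
        then have "5 dvd (k - (\<tau> + \<eta>))" using s(2) by presburger
        then show ?thesis using b 2 by simp
      qed
    qed
  qed
  have flip: "cr a b \<noteq> 0 \<Longrightarrow> cr b a \<noteq> 0" for a b using cr_commute[of a b] by auto
  have cross: "cr (pos X x - cap X) (pos X y - cap X) \<noteq> 0" if x: "x \<in> points" and y: "y \<in> points" and xy: "x \<noteq> y" for x y
  proof (cases rule: points_cases[OF x])
    case xV: 1
    show ?thesis
    proof (cases rule: points_cases[OF y])
      case 1 then show ?thesis using g5 xV xy by (simp add: pos_V)
    next
      case (2 j)
      have "cr (pos X (v j) - cap X) (D' x - cap X) \<noteq> 0" using g3 2 xV by auto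
      then show ?thesis unfolding 2 pos_V[OF xV] by (rule flip)
    qed
  next
    case xi: (2 i)
    show ?thesis
    proof (cases rule: points_cases[OF y])
      case 1 then show ?thesis using g3 xi by (simp add: pos_V)
    next
      case (2 j)
      then have "i \<noteq> j" using xi xy by auto
      then consider "i < j" | "j < i" by linarith
      then show ?thesis
      proof cases
        case 1 then show ?thesis using g4 xi 2 by simp
      next
        case b: 2
        then have "cr (pos X (v j) - cap X) (pos X (v i) - cap X) \<noteq> 0" using g4 xi 2 by simp
        then show ?thesis unfolding 2 xi by (rule flip)
      qed
    qed
  qed
  have "capped points (pos X) (v 0) (v n) \<tau> (\<tau> + \<eta>) (cap X)"
    unfolding capped_def by (intro conjI ballI allI impI cap_ends) (use slope cross in blast)+
  then show ?thesis using X by blast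
qed

end

section \<open>Paths in the graph\<close>

text \<open>A greedy choice: edges at u k and earlier choices at the same vertex exclude at most two
  slopes, the last two path vertices exclude at most two more, and there are five.\<close>

lemma choose_slopes:
  fixes F :: "'b \<Rightarrow> int \<Rightarrow> bool" and n :: nat and u :: "nat \<Rightarrow> 'b"
  assumes "\<And>k. k \<le> n \<Longrightarrow> card {s \<in> {0..<5}. \<not> F (u k) s} + card {j. j \<le> n \<and> u j = u k} \<le> 3"
  shows "\<exists>s. \<forall>k\<le>n. s k \<in> {0..<5} \<and> F (u k) (s k) \<and> (\<forall>j<k. u j = u k \<or> k \<le> j + 2 \<longrightarrow> s j \<noteq> s k)"
proof -
  have "\<exists>s. \<forall>k<m. s k \<in> {0..<5} \<and> F (u k) (s k) \<and> (\<forall>j<k. u j = u k \<or> k \<le> j + 2 \<longrightarrow> s j \<noteq> s k)"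
    if "m \<le> Suc n" for m
    using that
  proof (induction m)
    case (Suc m)
    then have m: "m \<le> n" by simp
    obtain s where s: "\<And>k. k < m \<Longrightarrow> s k \<in> {0..<5} \<and> F (u k) (s k) \<and> (\<forall>j<k. u j = u k \<or> k \<le> j + 2 \<longrightarrow> s j \<noteq> s k)"
      using Suc by auto
    define N where "N = {x \<in> {0..<5}. \<not> F (u m) x}"
    define J where "J = {j. j < m \<and> u j = u m}"
    \<comment> \<open>For m < 2 truncated subtraction yields some other value of s; this only
      enlarges B within the same bound.\<close>
    define B where "B = N \<union> (s ` J \<union> {s (m - 1), s (m - 2)})"
    have fJ: "finite J" by (simp add: J_def)
    have "card (insert m J) \<le> card {j. j \<le> n \<and> u j = u m}"
      by (rule card_mono) (use m in \<open>auto simp: J_def\<close>)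
    then have "card J + 1 \<le> card {j. j \<le> n \<and> u j = u m}" using fJ by (simp add: J_def)
    moreover have "card B \<le> card N + (card J + 2)"
    proof -
      have "card (s ` J) \<le> card J" by (rule card_image_le[OF fJ])
      moreover have "card {s (m - 1), s (m - 2)} \<le> 2" by (simp add: card_insert_if)
      ultimately show ?thesis
        unfolding B_def using card_Un_le[of N "s ` J \<union> {s (m - 1), s (m - 2)}"] card_Un_le[of "s ` J" "{s (m - 1), s (m - 2)}"]
        by linarith
    qed
    ultimately have "card B < 5" using assms[OF m] unfolding N_def by linarith
    then have "card B < card {0..<5::int}" by simp
    moreover have "finite N" unfolding N_def by (rule finite_subset[of _ "{0..<5}"]) auto
    then have "finite B" by (simp add: B_def fJ)
    ultimately have "\<not> {0..<5} \<subseteq> B" by (meson card_mono leD)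
    then obtain x where x: "x \<in> {0..<5}" "x \<notin> B" by blast
    define s' where "s' = s(m := x)"
    show ?case
    proof (intro exI[of _ s'] allI impI conjI)
      fix k assume k: "k < Suc m"
      show "s' k \<in> {0..<5}" "F (u k) (s' k)"
        using k s[of k] x by (auto simp: s'_def B_def N_def less_Suc_eq)
      fix j assume j: "j < k" and uk: "u j = u k \<or> k \<le> j + 2"
      show "s' j \<noteq> s' k"
      proof (cases "k = m")
        case True
        have "s j \<in> B"
        proof (cases "u j = u m")
          case True2: True then show ?thesis using j True by (auto simp: B_def J_def)
        next
          case False
          then have "j = m - 1 \<or> j = m - 2" using uk j True by auto
          then show ?thesis by (auto simp: B_def)
        qed
        then show ?thesis using x j True by (auto simp: s'_def)
      next
        case False
        then show ?thesis using s[of k] k j uk by (auto simp: s'_def)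
      qed
    qed
  qed simp
  from this[of "Suc n"] show ?thesis by (simp add: less_Suc_eq_le)
qed

text \<open>The letter i stands for induced: the path has n edges and no chord.\<close>

definition ipath :: "'a set \<Rightarrow> ('a \<Rightarrow> 'a \<Rightarrow> bool) \<Rightarrow> nat \<Rightarrow> (nat \<Rightarrow> 'a) \<Rightarrow> bool" where
  "ipath V E n v \<longleftrightarrow> inj_on v {..n} \<and> v ` {..n} \<subseteq> V \<and> (\<forall>i j. i < j \<longrightarrow> j \<le> n \<longrightarrow> (E (v i) (v j) \<longleftrightarrow> j = Suc i))"

lemma ipath_rev:
  assumes "ipath V E n v" and sym: "\<And>x y. E x y \<Longrightarrow> E y x"
  shows "ipath V E n (\<lambda>k. v (n - k))"
  unfolding ipath_def
proof (intro conjI allI impI)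
  have inj: "inj_on v {..n}" and im: "v ` {..n} \<subseteq> V"
    and adj: "\<And>i j. i < j \<Longrightarrow> j \<le> n \<Longrightarrow> E (v i) (v j) \<longleftrightarrow> j = Suc i"
    using assms(1) unfolding ipath_def by blast+
  show "inj_on (\<lambda>k. v (n - k)) {..n}"
    by (rule inj_onI) (metis atMost_iff diff_diff_cancel diff_le_self inj inj_onD)
  show "(\<lambda>k. v (n - k)) ` {..n} \<subseteq> V" using im by auto
  fix i j assume ij: "i < j" "j \<le> n"
  then have "E (v (n - j)) (v (n - i)) \<longleftrightarrow> n - i = Suc (n - j)" by (intro adj) auto
  moreover have "n - i = Suc (n - j) \<longleftrightarrow> j = Suc i" using ij by auto
  ultimately show "E (v (n - i)) (v (n - j)) \<longleftrightarrow> j = Suc i" using sym by blast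
qed

text \<open>A shortest walk between distinct vertices of S has no repeated vertex and no chord,
  since either gives a shortcut. An inner vertex in S would cut off a shorter walk: the initial
  part, or the final part if it equals the first vertex.\<close>

lemma shortest_path:
  assumes sym: "\<And>x y. E x y \<Longrightarrow> E y x" and irr: "\<And>x. \<not> E x x"
    and conn: "\<And>Y. closed_in V E Y \<Longrightarrow> Y = {} \<or> Y = V"
    and ab: "a \<in> V" "b \<in> V" "a \<noteq> b" "a \<in> S" "b \<in> S"
  obtains n v where "ipath V E n v" "n \<noteq> 0" "v 0 \<in> S" "v n \<in> S" "v 0 \<noteq> v n"
    "\<And>k. 0 < k \<Longrightarrow> k < n \<Longrightarrow> v k \<notin> S"
proof -
  define W where "W n v \<longleftrightarrow> v 0 \<in> S \<and> v n \<in> S \<and> v 0 \<noteq> v n \<and> (\<forall>k\<le>n. v k \<in> V) \<and> (\<forall>k<n. E (v k) (v (Suc k)))" for n v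
  let ?r = "\<lambda>x y. E x y \<and> y \<in> V"
  have "closed_in V E {x \<in> V. ?r\<^sup>*\<^sup>* a x}"
    unfolding closed_in_def by (auto intro: rtranclp.rtrancl_into_rtrancl)
  moreover have "a \<in> {x \<in> V. ?r\<^sup>*\<^sup>* a x}" using ab by simp
  ultimately have "{x \<in> V. ?r\<^sup>*\<^sup>* a x} = V" using conn by blast
  then have "?r\<^sup>*\<^sup>* a b" using ab by blast
  then obtain n where "(?r ^^ n) a b" using rtranclp_imp_relpowp by metis
  then obtain f where f: "f 0 = a" "f n = b" "\<And>i. i < n \<Longrightarrow> E (f i) (f (Suc i)) \<and> f (Suc i) \<in> V"
    unfolding relpowp_fun_conv by blast
  have "f k \<in> V" if "k \<le> n" for k using f ab that by (cases k) auto
  then have "W n f" using f ab by (simp add: W_def)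
  then have ex: "\<exists>n. \<exists>v. W n v" by blast
  define n0 where "n0 = (LEAST n. \<exists>v. W n v)"
  obtain v where v: "W n0 v" using LeastI_ex[OF ex] unfolding n0_def by blast
  have min: "n0 \<le> m" if "W m w" for m w unfolding n0_def by (rule Least_le) (use that in blast)
  have vS: "v 0 \<in> S" "v n0 \<in> S" "v 0 \<noteq> v n0" and vV: "\<And>k. k \<le> n0 \<Longrightarrow> v k \<in> V"
    and vE: "\<And>k. k < n0 \<Longrightarrow> E (v k) (v (Suc k))" using v unfolding W_def by blast+
  \<comment> \<open>d steps after position i are skipped: d = j - i if v i = v j, and d = j - i - 1
    if a chord joins v i to v j.\<close>
  have cut: False if ij: "i < j" "j \<le> n0" and d: "0 < d" "i + d \<le> j" and e: "i + d = j \<and> v i = v j \<or> Suc (i + d) = j \<and> E (v i) (v j)" for i j d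
  proof -
    define w where "w k = (if k \<le> i then v k else v (k + d))" for k
    have "W (n0 - d) w" unfolding W_def
    proof (intro conjI allI impI)
      have w0: "w 0 = v 0" by (simp add: w_def)
      have wn: "w (n0 - d) = v n0"
      proof (cases "n0 - d \<le> i")
        case True
        then have "n0 - d = i" "j = n0" "v i = v j" using ij d e by auto
        then show ?thesis by (simp add: w_def)
      next
        case False then show ?thesis using ij d by (simp add: w_def)
      qed
      show "w 0 \<in> S" "w (n0 - d) \<in> S" "w 0 \<noteq> w (n0 - d)" unfolding w0 wn by (rule vS)+
      show "w k \<in> V" if "k \<le> n0 - d" for k using that d ij by (auto simp: w_def intro!: vV)
      show "E (w k) (w (Suc k))" if k: "k < n0 - d" for k
      proof -
        consider "Suc k \<le> i" | "k = i" | "i < k" by linarith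
        then show ?thesis
        proof cases
          case 1 then show ?thesis using ij vE[of k] by (simp add: w_def)
        next
          case 2
          have "E (v i) (v (Suc (i + d)))" using e
          proof
            assume h: "i + d = j \<and> v i = v j"
            then have "j < n0" using k 2 by linarith
            then show ?thesis using vE[of j] h by simp
          next
            assume "Suc (i + d) = j \<and> E (v i) (v j)"
            then show ?thesis by simp
          qed
          then show ?thesis using 2 by (simp add: w_def)
        next
          case 3 then show ?thesis using vE[of "k + d"] k by (simp add: w_def)
        qed
      qed
    qed
    then have "n0 \<le> n0 - d" by (rule min)
    then show False using d ij by linarith
  qed
  show thesis
  proof (rule that[of n0 v])
    show "n0 \<noteq> 0" using vS by (cases n0) auto
    show "ipath V E n0 v" unfolding ipath_def
    proof (intro conjI allI impI)
      show "inj_on v {..n0}"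
      proof (rule inj_onI, rule ccontr)
        fix i j assume "i \<in> {..n0}" "j \<in> {..n0}" and e: "v i = v j" and "i \<noteq> j"
        then consider "i < j" "j \<le> n0" | "j < i" "i \<le> n0" by force
        then show False
        proof cases
          case 1 then show ?thesis using cut[OF 1, of "j - i"] e by simp
        next
          case 2 then show ?thesis using cut[OF 2, of "i - j"] e by simp
        qed
      qed
      show "v ` {..n0} \<subseteq> V" using vV by auto
      fix i j assume ij: "i < j" "j \<le> n0"
      show "E (v i) (v j) \<longleftrightarrow> j = Suc i"
      proof
        assume E: "E (v i) (v j)"
        show "j = Suc i"
        proof (rule ccontr)
          assume "j \<noteq> Suc i"
          then show False using cut[OF ij, of "j - Suc i"] E ij by simp
        qed
      qed (use vE ij in simp)
    qed
    fix k assume k: "0 < k" "k < n0"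
    show "v k \<notin> S"
    proof
      assume S: "v k \<in> S"
      show False
      proof (cases "v k = v 0")
        case True
        have nk: "n0 - k + k = n0" using k by simp
        have "W (n0 - k) (\<lambda>i. v (i + k))" unfolding W_def nk
        proof (intro conjI allI impI vS(2))
          show "v (0 + k) \<in> S" "v (0 + k) \<noteq> v n0" using S True vS(3) by (simp, metis add_0)
          show "v (i + k) \<in> V" if "i \<le> n0 - k" for i by (rule vV) (use that k in linarith)
          show "E (v (i + k)) (v (Suc i + k))" if "i < n0 - k" for i
            using vE[of "i + k"] that k by simp
        qed
        then have "n0 \<le> n0 - k" by (rule min)
        then show False using k by linarith
      next
        case False
        have "W k v" unfolding W_def
        proof (intro conjI allI impI vS(1) S)
          show "v 0 \<noteq> v k" using False by metis
          show "v i \<in> V" if "i \<le> k" for i by (rule vV) (use that k in linarith)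
          show "E (v i) (v (Suc i))" if "i < k" for i by (rule vE) (use that k in linarith)
        qed
        then have "n0 \<le> k" by (rule min)
        then show False using k by linarith
      qed
    qed
  qed (rule vS)+
qed

text \<open>Closed sets are the unions of components, so asking for a deficient vertex in each
  nonempty one is the same as asking for it in each component.\<close>

definition subcubic_on :: "'a set \<Rightarrow> ('a \<Rightarrow> 'a \<Rightarrow> bool) \<Rightarrow> bool" where
  "subcubic_on V E \<longleftrightarrow> finite V \<and> (\<forall>x\<in>V. deg V E x \<le> 3) \<and>
     (\<forall>Y. closed_in V E Y \<longrightarrow> Y \<noteq> {} \<longrightarrow> (\<exists>x\<in>Y. deg V E x < 3))"

text \<open>The rest is subcubic because V is connected, so each of its components lost an edge to
  the path. The order R1 lists the u k along the path. A u k of degree two in the rest had degree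
  three in V and occurs for one k only; hence R1 is antisymmetric on such vertices, and it does not
  clash with R2, which concerns only vertices already deficient in V.\<close>

lemma path_base:
  fixes V :: "'a set"
  assumes sym: "\<And>x y. E x y \<Longrightarrow> E y x" and fin: "finite V" and d3: "\<And>x. x \<in> V \<Longrightarrow> deg V E x \<le> 3"
    and irr: "\<And>x. \<not> E x x"
    and conn: "\<And>Y. closed_in V E Y \<Longrightarrow> Y = {} \<or> Y = V"
    and path: "ipath V E n v" and n: "n \<noteq> 0"
    and ends: "deg V E (v 0) = 2" "deg V E (v n) = 2" and inner: "\<And>k. 0 < k \<Longrightarrow> k < n \<Longrightarrow> deg V E (v k) = 3"
    and orient: "oriented V E R"
    and IH: "\<And>W R. W \<subset> V \<Longrightarrow> subcubic_on W E \<Longrightarrow> oriented W E R \<Longrightarrow> \<exists>D. good W E R D"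
  obtains u \<theta> D' R' where "path_core (V - v ` {..n}) E D' R' n v u \<theta>" "good (V - v ` {..n}) E R' D'"
    "R \<inter> {(p, q). p \<in> V - v ` {..n} \<and> q \<in> V - v ` {..n} \<and> deg V E p < 3 \<and> deg V E q < 3} \<subseteq> R'"
proof -
  define V' where "V' = V - v ` {..n}"
  have inj: "inj_on v {..n}" and im: "v ` {..n} \<subseteq> V"
    and adj: "\<And>i j. i < j \<Longrightarrow> j \<le> n \<Longrightarrow> E (v i) (v j) \<longleftrightarrow> j = Suc i"
    using path unfolding ipath_def by blast+
  have vV: "v k \<in> V" if "k \<le> n" for k using im that by auto
  have fin': "finite V'" using fin by (simp add: V'_def)
  have vadj: "E (v k) (v j) \<longleftrightarrow> j = Suc k \<or> k = Suc j" if "k \<le> n" "j \<le> n" for k j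
  proof -
    consider "k < j" | "j < k" | "j = k" by linarith
    then show ?thesis
    proof cases
      case 1 then show ?thesis using adj[of k j] that by auto
    next
      case 2
      have "E (v k) (v j) \<longleftrightarrow> E (v j) (v k)" using sym by blast
      then show ?thesis using adj[of j k] 2 that by auto
    next
      case 3 then show ?thesis using irr by simp
    qed
  qed
  have single: "card {w \<in> V'. E (v k) w} = 1" if k: "k \<le> n" for k
  proof -
    define J where "J = {j. j \<le> n \<and> (j = Suc k \<or> k = Suc j)}"
    have eq: "{w \<in> V. E (v k) w} = {w \<in> V'. E (v k) w} \<union> v ` J"
      using vadj[OF k] vV by (auto simp: V'_def J_def)
    have "card (v ` J) = card J" by (rule card_image) (rule inj_on_subset[OF inj], auto simp: J_def)
    moreover have "card ({w \<in> V'. E (v k) w} \<union> v ` J) = card {w \<in> V'. E (v k) w} + card (v ` J)"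
      by (rule card_Un_disjoint) (use fin' in \<open>auto simp: J_def V'_def\<close>)
    moreover have "card J + 1 = deg V E (v k)"
    proof -
      consider "k = 0" | "k = n" "k \<noteq> 0" | "0 < k" "k < n" using k by linarith
      then show ?thesis
      proof cases
        case 1
        then have "J = {1}" using n by (auto simp: J_def)
        then show ?thesis using ends 1 by simp
      next
        case 2
        then have "J = {n - 1}" by (auto simp: J_def)
        then show ?thesis using ends 2 by simp
      next
        case 3
        then have "J = {k - 1, Suc k}" by (auto simp: J_def)
        then show ?thesis using inner[OF 3] by simp
      qed
    qed
    ultimately show ?thesis unfolding deg_def eq by linarith
  qed
  define u where "u k = the_elem {w \<in> V'. E (v k) w}" for k
  have u: "{w \<in> V'. E (v k) w} = {u k}" if k: "k \<le> n" for k
  proof -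
    obtain w where "{w \<in> V'. E (v k) w} = {w}" using single[OF k] by (rule card_1_singletonE)
    then show ?thesis by (simp add: u_def)
  qed
  have uV: "u k \<in> V'" if "k \<le> n" for k using u[OF that] by blast
  have ext: "E (v k) w \<longleftrightarrow> w = u k" if "k \<le> n" "w \<in> V'" for k w using u[OF that(1)] that(2) by blast
  have degV: "deg V E x = deg V' E x + card {k. k \<le> n \<and> u k = x}" if x: "x \<in> V'" for x
  proof -
    have "{w \<in> V. E x w} = {w \<in> V'. E x w} \<union> v ` {k. k \<le> n \<and> u k = x}"
    proof (intro equalityI subsetI)
      fix w assume w: "w \<in> {w \<in> V. E x w}"
      show "w \<in> {w \<in> V'. E x w} \<union> v ` {k. k \<le> n \<and> u k = x}"
      proof (cases "w \<in> V'")
        case False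
        then obtain k where k: "k \<le> n" "w = v k" using w by (auto simp: V'_def)
        then have "x = u k" using ext[OF k(1) x] w sym by blast
        then show ?thesis using k by auto
      qed (use w in simp)
    next
      fix w assume "w \<in> {w \<in> V'. E x w} \<union> v ` {k. k \<le> n \<and> u k = x}"
      then consider "w \<in> V'" "E x w" | k where "k \<le> n" "u k = x" "w = v k" by auto
      then show "w \<in> {w \<in> V. E x w}"
      proof cases
        case 1 then show ?thesis by (simp add: V'_def)
      next
        case (2 k)
        then have "E (v k) x" using ext[OF 2(1) x] by simp
        then show ?thesis using 2 sym vV by simp
      qed
    qed
    moreover have "card ({w \<in> V'. E x w} \<union> v ` {k. k \<le> n \<and> u k = x}) =
        card {w \<in> V'. E x w} + card (v ` {k. k \<le> n \<and> u k = x})"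
      by (rule card_Un_disjoint) (use fin' in \<open>auto simp: V'_def\<close>)
    moreover have "card (v ` {k. k \<le> n \<and> u k = x}) = card {k. k \<le> n \<and> u k = x}"
      by (rule card_image) (rule inj_on_subset[OF inj], auto)
    ultimately show ?thesis unfolding deg_def by simp
  qed
  have V'V: "x \<in> V" if "x \<in> V'" for x using that by (simp add: V'_def)
  have cnt: "1 \<le> card {k. k \<le> n \<and> u k = u i}" if "i \<le> n" for i
  proof -
    have "card {i} \<le> card {k. k \<le> n \<and> u k = u i}" by (rule card_mono) (use that in auto)
    then show ?thesis by simp
  qed
  have sub: "V' \<subset> V" using vV[of 0] by (auto simp: V'_def)
  have sc: "subcubic_on V' E" unfolding subcubic_on_def
  proof (intro conjI ballI allI impI fin')
    show "deg V' E x \<le> 3" if "x \<in> V'" for x using degV[OF that] d3[OF V'V[OF that]] by simp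
    fix Y assume Y: "closed_in V' E Y" and ne: "Y \<noteq> {}"
    have YV: "x \<in> V'" if "x \<in> Y" for x using Y that by (auto simp: closed_in_def)
    have "\<not> closed_in V E Y" using conn[of Y] ne YV vV[of 0] by (auto simp: V'_def)
    then obtain x w where xw: "x \<in> Y" "w \<in> V" "E x w" "w \<notin> Y" using YV V'V unfolding closed_in_def by blast
    have "w \<notin> V'" using Y xw by (auto simp: closed_in_def)
    then obtain k where k: "k \<le> n" "w = v k" using xw by (auto simp: V'_def)
    then have "x = u k" using ext[OF k(1) YV[OF xw(1)]] sym xw by blast
    then have "deg V' E x < 3" using degV[OF YV[OF xw(1)]] d3[OF V'V[OF YV[OF xw(1)]]] cnt[OF k(1)] by simp
    then show "\<exists>x\<in>Y. deg V' E x < 3" using xw by blast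
  qed
  define R1 where "R1 = {(u i, u j) | i j. i < j \<and> j \<le> n}"
  define R2 where "R2 = R \<inter> {(p, q). p \<in> V' \<and> q \<in> V' \<and> deg V E p < 3 \<and> deg V E q < 3}"
  have uniq: "deg V E (u i) = 3 \<and> (\<forall>k\<le>n. u k = u i \<longrightarrow> k = i)" if "i \<le> n" "deg V' E (u i) = 2" for i
  proof -
    have 1: "deg V E (u i) = 3" "card {k. k \<le> n \<and> u k = u i} = 1"
      using degV[OF uV[OF that(1)]] d3[OF V'V[OF uV[OF that(1)]]] cnt[OF that(1)] that(2) by linarith+
    obtain x where x: "{k. k \<le> n \<and> u k = u i} = {x}" by (rule card_1_singletonE[OF 1(2)])
    have m: "k = x" if "k \<le> n" "u k = u i" for k
    proof -
      have "k \<in> {k. k \<le> n \<and> u k = u i}" using that by simp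
      then show ?thesis unfolding x by simp
    qed
    show ?thesis using 1(1) m m[OF that(1) refl] by simp
  qed
  have or: "oriented V' E (R1 \<union> R2)" unfolding oriented_def
  proof (intro ballI impI notI)
    fix p q assume p: "p \<in> V'" and q: "q \<in> V'" and dp: "deg V' E p = 2" and dq: "deg V' E q = 2"
      and pq: "(p, q) \<in> R1 \<union> R2" and qp: "(q, p) \<in> R1 \<union> R2"
    show False
    proof (cases "(p, q) \<in> R1")
      case True
      then obtain i j where ij: "i < j" "j \<le> n" "p = u i" "q = u j" by (auto simp: R1_def)
      have ui: "deg V E p = 3" "\<And>k. k \<le> n \<Longrightarrow> u k = p \<Longrightarrow> k = i" using uniq[of i] ij dp by auto
      have uj: "\<And>k. k \<le> n \<Longrightarrow> u k = q \<Longrightarrow> k = j" using uniq[of j] ij dq by auto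
      have "(q, p) \<notin> R2" using ui by (simp add: R2_def)
      then obtain i' j' where "i' < j'" "j' \<le> n" "q = u i'" "p = u j'" using qp by (auto simp: R1_def)
      then have "i' = j" "j' = i" using ui(2)[of j'] uj[of i'] by auto
      then show False using ij \<open>i' < j'\<close> by simp
    next
      case False
      then have 2: "(p, q) \<in> R" "deg V E p < 3" "deg V E q < 3" using pq by (auto simp: R2_def)
      have "(q, p) \<notin> R1"
      proof
        assume "(q, p) \<in> R1"
        then obtain i j where "i < j" "j \<le> n" "q = u i" by (auto simp: R1_def)
        then show False using uniq[of i] dq 2 by simp
      qed
      then have "(q, p) \<in> R" using qp by (auto simp: R2_def)
      moreover have "deg V E p = 2" "deg V E q = 2" using degV[OF p] degV[OF q] dp dq 2 by simp_all
      ultimately show False using orient 2(1) V'V[OF p] V'V[OF q] unfolding oriented_def by blast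
    qed
  qed
  obtain D' where D': "good V' E (R1 \<union> R2) D'" using IH[OF sub sc or] by blast
  then have fa: "faithful V' E D'" and se: "separated V' E (R1 \<union> R2) D'" by (simp_all add: good_def)
  have "card {s \<in> {0..<5}. \<not> free V' D' (u k) s} + card {j. j \<le> n \<and> u j = u k} \<le> 3" if "k \<le> n" for k
    using card_not_free[OF fin' fa uV[OF that]] degV[OF uV[OF that]] d3[OF V'V[OF uV[OF that]]] by linarith
  note slopes = choose_slopes[of n "free V' D'" u, OF this]
  obtain s where S: "\<forall>k\<le>n. s k \<in> {0..<5} \<and> free V' D' (u k) (s k) \<and> (\<forall>j<k. u j = u k \<or> k \<le> j + 2 \<longrightarrow> s j \<noteq> s k)"
    by (rule exE[OF slopes])
  have s: "s k \<in> {0..<5}" "free V' D' (u k) (s k)" "\<And>j. j < k \<Longrightarrow> u j = u k \<or> k \<le> j + 2 \<Longrightarrow> s j \<noteq> s k" if "k \<le> n" for k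
    using mp[OF spec[OF S] that] by auto
  \<comment> \<open>Each difference of residues is represented in -2, ..., 2, and the sums lift the
    slopes to integers with the small steps that \<open>path_core\<close> requires.\<close>
  define \<theta> where "\<theta> k = s 0 + (\<Sum>i<k. (s (Suc i) - s i + 2) mod 5 - 2)" for k
  have th: "\<theta> (Suc k) - \<theta> k = (s (Suc k) - s k + 2) mod 5 - 2" for k by (simp add: \<theta>_def)
  have cong: "5 dvd (\<theta> k - s k)" for k
  proof (induction k)
    case 0 show ?case by (simp add: \<theta>_def)
  next
    case (Suc k) then show ?case using th[of k] by presburger
  qed
  have nd: "\<not> 5 dvd (\<theta> j - \<theta> i)" if "j < i" "i \<le> n" "u j = u i \<or> i \<le> j + 2" for i j
  proof -
    have "\<not> 5 dvd (s j - s i)" by (rule not_dvd_slopes) (use s(1)[of i] s(1)[of j] s(3)[of i j] that in auto)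
    then show ?thesis using cong[of i] cong[of j] by presburger
  qed
  have "path_core V' E D' (R1 \<union> R2) n v u \<theta>"
  proof
    show "finite V'" by (rule fin')
    show "E x y \<Longrightarrow> E y x" for x y by (rule sym)
    show "faithful V' E D'" by (rule fa)
    show "separated V' E (R1 \<union> R2) D'" by (rule se)
    show "v k \<notin> V'" if "k \<le> n" for k using that by (simp add: V'_def)
    show "inj_on v {..n}" by (rule inj)
    show "u k \<in> V'" if "k \<le> n" for k by (rule uV[OF that])
    show "E (v k) w \<longleftrightarrow> w = u k" if "k \<le> n" "w \<in> V'" for k w by (rule ext[OF that])
    show "E (v i) (v j) \<longleftrightarrow> j = Suc i" if "i < j" "j \<le> n" for i j by (rule adj[OF that])
    show "\<theta> (Suc k) - \<theta> k \<in> {1, - 1, 2, - 2}" if k: "k < n" for k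
    proof -
      define m where "m = (s (Suc k) - s k + 2) mod 5"
      have "m \<noteq> 2"
      proof
        assume "m = 2"
        then have "\<theta> k - \<theta> (Suc k) = 0" using th[of k] by (simp add: m_def)
        then show False using nd[of k "Suc k"] k by simp
      qed
      moreover have "0 \<le> m" "m < 5" by (simp_all add: m_def)
      ultimately show ?thesis using th[of k] unfolding m_def[symmetric] by auto
    qed
    show "\<not> 5 dvd (\<theta> (Suc (Suc k)) - \<theta> k)" if "Suc k < n" for k
    proof -
      have "\<not> 5 dvd (\<theta> k - \<theta> (Suc (Suc k)))" by (rule nd) (use that in auto)
      then show ?thesis by presburger
    qed
    show "free V' D' (u k) (\<theta> k)" if "k \<le> n" for k
      using s(2)[OF that] ht_cong_eq[OF cong[of k]] unfolding free_def by blast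
    show "\<not> 5 dvd (\<theta> i - \<theta> j)" if "i < j" "j \<le> n" "u i = u j" for i j using nd[of i j] that by simp
    show "(u i, u j) \<in> R1 \<union> R2" if "i < j" "j \<le> n" for i j using that by (auto simp: R1_def)
    show "deg V' E (u k) < 3" if "k \<le> n" for k
      using degV[OF uV[OF that]] d3[OF V'V[OF uV[OF that]]] cnt[OF that] by linarith
  qed
  moreover have "R \<inter> {(p, q). p \<in> V' \<and> q \<in> V' \<and> deg V E p < 3 \<and> deg V E q < 3} \<subseteq> R1 \<union> R2"
    unfolding R2_def by blast
  ultimately show thesis using that[of D' "R1 \<union> R2" u \<theta>] D' unfolding V'_def by blast
qed

text \<open>The extra conclusion, that the two edges at v n in question have neighbouring slopes,
  comes from \<open>t_theta\<close>. It is needed when v n stands for a contracted part, whose cap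
  also has neighbouring slopes.\<close>

lemma path_step:
  fixes V :: "'a set"
  assumes sym: "\<And>x y. E x y \<Longrightarrow> E y x" and fin: "finite V" and d3: "\<And>x. x \<in> V \<Longrightarrow> deg V E x \<le> 3"
    and irr: "\<And>x. \<not> E x x"
    and conn: "\<And>Y. closed_in V E Y \<Longrightarrow> Y = {} \<or> Y = V"
    and path: "ipath V E n v" and n: "n \<noteq> 0"
    and ends: "deg V E (v 0) = 2" "deg V E (v n) = 2" and inner: "\<And>k. 0 < k \<Longrightarrow> k < n \<Longrightarrow> deg V E (v k) = 3"
    and orient: "oriented V E R" and vR: "(v 0, v n) \<notin> R"
    and IH: "\<And>W R. W \<subset> V \<Longrightarrow> subcubic_on W E \<Longrightarrow> oriented W E R \<Longrightarrow> \<exists>D. good W E R D"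
  shows "\<exists>D. good V E R D \<and> (\<exists>x\<in>V. \<exists>y\<in>V. \<exists>s s'. x \<noteq> y \<and> E (v n) x \<and> E (v n) y \<and>
    ht s (D (v n)) = ht s (D x) \<and> ht s' (D (v n)) = ht s' (D y) \<and> \<bar>sn (s' - s)\<bar> = 1)"
proof -
  obtain u \<theta> D' R' where core: "path_core (V - v ` {..n}) E D' R' n v u \<theta>" and good': "good (V - v ` {..n}) E R' D'"
    and RR: "R \<inter> {(p, q). p \<in> V - v ` {..n} \<and> q \<in> V - v ` {..n} \<and> deg V E p < 3 \<and> deg V E q < 3} \<subseteq> R'"
    by (rule path_base[OF sym fin d3 irr conn path n ends inner orient IH]) blast+
  interpret C: path_core "V - v ` {..n}" E D' R' n v u \<theta> by (rule core)
  have pts: "C.points = V" using path unfolding C.points_def ipath_def by blast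
  have "indep (V - v ` {..n}) E D'" "nonrigid (V - v ` {..n}) E D'" using good' by (simp_all add: good_def)
  from C.good_placed[OF this n vR, unfolded pts, OF d3 RR]
  obtain X where X: "C.placed X" "good V E R (C.pos X)" by auto
  have e: "Suc (n - 1) = n" "n - 1 < n" using n by simp_all
  have vV: "v (n - 1) \<in> V" using C.v_points[of "n - 1"] pts by simp
  have uV: "u n \<in> V" using C.u_in[of n] by simp
  have 1: "v (n - 1) \<noteq> u n" using C.v_ne_u(1)[of "n - 1" n] by simp
  have 2: "E (v n) (v (n - 1))" using C.path_adj(2)[OF e(2)] unfolding e(1) .
  have 3: "E (v n) (u n)" by (rule C.v_u_adj[OF order_refl])
  have 4: "ht (C.t (n - 1)) (C.pos X (v n)) = ht (C.t (n - 1)) (C.pos X (v (n - 1)))"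
    using C.ht_edge[OF X(1) e(2)] unfolding e(1) .
  have 5: "ht (\<theta> n) (C.pos X (v n)) = ht (\<theta> n) (C.pos X (u n))" by (rule C.ht_ext[OF X(1) order_refl])
  have 6: "\<bar>sn (\<theta> n - C.t (n - 1))\<bar> = 1" using C.t_theta(5)[OF e(2)] unfolding e(1) .
  show ?thesis using X(2) vV uV 1 2 3 4 5 6 by blast
qed

lemma abs_sn_phi: "k mod 5 = 2 \<or> k mod 5 = 3 \<Longrightarrow> \<bar>sn k\<bar> = phi"
  using abs_sn[of k] by (auto simp: dvd_eq_mod_eq_0)

text \<open>The residue of y - x mod 5 decides: three of the four sign combinations of x - \<tau>
  and \<eta> cover all five residues.\<close>

lemma choose_cap:
  fixes x y :: int
  obtains \<tau> \<eta> where "\<eta> \<in> {1, -1}" "x - \<tau> \<in> {1, -1}" "\<bar>sn (y - \<tau> - \<eta>)\<bar> = phi"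
proof -
  have "(y - x) mod 5 = 0 \<or> (y - x) mod 5 = 1 \<or> (y - x) mod 5 = 2 \<or> (y - x) mod 5 = 3 \<or> (y - x) mod 5 = 4"
    by presburger
  then consider "(y - x) mod 5 = 2 \<or> (y - x) mod 5 = 3" | "(y - x) mod 5 = 0 \<or> (y - x) mod 5 = 4" | "(y - x) mod 5 = 1"
    by blast
  then show thesis
  proof cases
    case 1
    then have "\<bar>sn (y - (x + 1) - (- 1))\<bar> = phi" by (intro abs_sn_phi) simp
    then show ?thesis by (intro that[of "- 1" "x + 1"]) simp_all
  next
    case 2
    then have "(y - (x + 1) - 1) mod 5 = 2 \<or> (y - (x + 1) - 1) mod 5 = 3" by presburger
    then show ?thesis by (intro that[of 1 "x + 1"] abs_sn_phi) simp_all
  next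
    case 3
    then have "(y - (x - 1) - (- 1)) mod 5 = 2 \<or> (y - (x - 1) - (- 1)) mod 5 = 3" by presburger
    then show ?thesis by (intro that[of "- 1" "x - 1"] abs_sn_phi) simp_all
  qed
qed

lemma capped_swap: "capped W D a b \<tau> \<tau>' w \<Longrightarrow> capped W D b a \<tau>' \<tau> w"
  unfolding capped_def by blast

lemma deg_closed: "closed_in V E Y \<Longrightarrow> x \<in> Y \<Longrightarrow> deg Y E x = deg V E x"
  unfolding deg_def closed_in_def by (rule arg_cong[where f=card]) blast

text \<open>Every use of \<open>cuts\<close> finds a proper nonempty set of defect at most two: if a
  and b were adjacent, V - {a, b} would be one; a proper union of components is one; and a relation
  over \<open>Zphi\<close> between nonadjacent vertices off the path would yield one through
  \<open>nonrigid\<close>. So a and b are the ends of a path with an inner vertex, and nothing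
  obstructs the cap.\<close>

lemma cap_step:
  fixes V :: "'a set"
  assumes sym: "\<And>x y. E x y \<Longrightarrow> E y x" and fin: "finite V" and irr: "\<And>x. \<not> E x x"
    and ab: "a \<in> V" "b \<in> V" "a \<noteq> b" and d2: "deg V E a = 2" "deg V E b = 2"
    and d3: "\<And>x. x \<in> V \<Longrightarrow> x \<noteq> a \<Longrightarrow> x \<noteq> b \<Longrightarrow> deg V E x = 3"
    and cuts: "\<And>Z. Z \<subset> V \<Longrightarrow> Z \<noteq> {} \<Longrightarrow> 3 \<le> defect E Z"
    and IH: "\<And>W R. W \<subset> V \<Longrightarrow> subcubic_on W E \<Longrightarrow> oriented W E R \<Longrightarrow> \<exists>D. good W E R D"
  shows "\<exists>D \<tau> \<eta> w. faithful V E D \<and> \<eta> \<in> {1, -1} \<and> capped V D a b \<tau> (\<tau> + \<eta>) w"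
proof -
  have nE: "\<not> E a b"
  proof
    assume E: "E a b"
    define Z where "Z = V - {a, b}"
    have finZ: "finite Z" using fin by (simp add: Z_def)
    have na: "{w \<in> V. E a w} = insert b {w \<in> Z. E a w}" "{w \<in> V. E b w} = insert a {w \<in> Z. E b w}"
      using E sym[OF E] irr ab by (auto simp: Z_def)
    have c1: "card {w \<in> Z. E a w} = 1" "card {w \<in> Z. E b w} = 1"
      using d2 finZ unfolding deg_def na by (simp_all add: Z_def)
    then have "Z \<noteq> {}" by auto
    then have "3 \<le> defect E Z" using ab by (intro cuts) (auto simp: Z_def)
    moreover have "defect E Z = (\<Sum>x\<in>Z. (if E a x then 1 else 0) + (if E b x then 1 else 0))"
      unfolding defect_def
    proof (rule sum.cong[OF refl])
      fix x assume x: "x \<in> Z"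
      have A: "{w \<in> V. E x w} = {w \<in> Z. E x w} \<union> {w \<in> {a, b}. E x w}" using ab by (auto simp: Z_def)
      have B: "card ({w \<in> Z. E x w} \<union> {w \<in> {a, b}. E x w}) = card {w \<in> Z. E x w} + card {w \<in> {a, b}. E x w}"
        by (rule card_Un_disjoint) (use finZ in \<open>auto simp: Z_def\<close>)
      have "{w \<in> {a, b}. E x w} = (if E a x then {a} else {}) \<union> (if E b x then {b} else {})"
        using sym by auto
      then have C: "card {w \<in> {a, b}. E x w} = (if E a x then 1 else 0) + (if E b x then 1 else 0)" using ab by simp
      have "deg V E x = 3" using d3 x by (simp add: Z_def)
      then have "card {w \<in> Z. E x w} + ((if E a x then 1 else 0) + (if E b x then 1 else 0)) = 3"
        unfolding deg_def A B C .
      then show "3 - deg Z E x = (if E a x then 1 else 0) + (if E b x then 1 else 0)"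
        unfolding deg_def by (metis add_diff_cancel_left')
    qed
    moreover have "(\<Sum>x\<in>Z. (if E a x then 1 else 0) + (if E b x then 1 else 0 :: nat)) = 2"
      using c1 finZ by (simp add: sum.distrib sum.If_cases Int_def conj_commute)
    ultimately show False by simp
  qed
  have d23: "deg V E x \<le> 3" if "x \<in> V" for x using d2 d3[OF that] by (cases "x = a \<or> x = b") auto
  have conn: "Y = {} \<or> Y = V" if Y: "closed_in V E Y" for Y
  proof (rule ccontr)
    assume ne: "\<not> (Y = {} \<or> Y = V)"
    have YV: "Y \<subseteq> V" using Y by (simp add: closed_in_def)
    have finY: "finite Y" using YV fin finite_subset by blast
    have "3 \<le> defect E Y" using ne YV by (intro cuts) auto
    also have "defect E Y \<le> (\<Sum>x\<in>Y. (if x = a then 1 else 0) + (if x = b then 1 else 0))"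
      unfolding defect_def
    proof (rule sum_mono)
      fix x assume x: "x \<in> Y"
      then have "x \<in> V" using YV by blast
      then show "3 - deg Y E x \<le> (if x = a then 1 else 0) + (if x = b then 1 else 0)"
        unfolding deg_closed[OF Y x] using d2 d3[of x] ab(3) by auto
    qed
    also have "\<dots> \<le> 2" using finY by (simp add: sum.distrib)
    finally show False by simp
  qed
  obtain n v where path: "ipath V E n v" and n: "n \<noteq> 0" and v: "v 0 \<in> {a, b}" "v n \<in> {a, b}" "v 0 \<noteq> v n"
    and inn: "\<And>k. 0 < k \<Longrightarrow> k < n \<Longrightarrow> v k \<notin> {a, b}"
    by (rule shortest_path[where V=V and E=E and S="{a, b}", OF sym irr conn ab insertI1 insertI2[OF insertI1]]) blast+
  have adj: "\<And>i j. i < j \<Longrightarrow> j \<le> n \<Longrightarrow> E (v i) (v j) \<longleftrightarrow> j = Suc i" and im: "v ` {..n} \<subseteq> V"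
    using path unfolding ipath_def by blast+
  have n2: "2 \<le> n"
  proof (rule ccontr)
    assume "\<not> 2 \<le> n"
    then have "n = 1" using n by simp
    then have "E (v 0) (v n)" using adj[of 0 1] by simp
    then show False using v nE sym by auto
  qed
  have ends: "deg V E (v 0) = 2" "deg V E (v n) = 2" using v d2 by auto
  have inner: "deg V E (v k) = 3" if "0 < k" "k < n" for k
    using inn[OF that] im that by (intro d3) auto
  have or: "oriented V E {}" by (simp add: oriented_def)
  obtain u \<theta> D' R' where core: "path_core (V - v ` {..n}) E D' R' n v u \<theta>" and good': "good (V - v ` {..n}) E R' D'"
    by (rule path_base[OF sym fin d23 irr conn path n ends inner or IH]) blast+
  obtain \<tau> \<eta> where te: "\<eta> \<in> {1, -1}" "\<theta> 0 - \<tau> \<in> {1, -1}" "\<bar>sn (\<theta> n - \<tau> - \<eta>)\<bar> = phi" by (rule choose_cap)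
  interpret C: path_cap "V - v ` {..n}" E D' R' n v u \<theta> \<tau> \<eta>
    by (intro path_cap.intro path_cap_axioms.intro core te n2)
  have pts: "C.points = V" using im unfolding C.points_def by blast
  have nr: "lin d (D' p) \<noteq> lin d (D' q)"
    if pq: "p \<in> V - v ` {..n}" "q \<in> V - v ` {..n}" "p \<noteq> q" "\<not> E p q" "d \<in> Zphi \<times> Zphi" "d \<noteq> 0" for p q d
  proof
    assume eq: "lin d (D' p) = lin d (D' q)"
    have nr1: "nonrigid (V - v ` {..n}) E D'" using good' by (simp add: good_def)
    obtain Z where Z: "Z \<subseteq> V - v ` {..n}" "p \<in> Z" "defect E Z \<le> 2"
      by (rule nonrigidD[OF nr1 pq(1,2,5,3,4,6) eq]) blast+
    have "v 0 \<in> V" using im by auto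
    then have "Z \<subset> V" using Z(1) by auto
    then have "3 \<le> defect E Z" using Z(2) by (intro cuts) auto
    then show False using Z(3) by simp
  qed
  obtain X w where X: "C.placed X" "capped V (C.pos X) (v 0) (v n) \<tau> (\<tau> + \<eta>) w"
    using C.cap_exists[OF nr] unfolding pts by blast
  have f: "faithful V E (C.pos X)" using C.faithful_placed[OF X(1)] unfolding pts .
  show ?thesis
  proof (cases "v 0 = a")
    case True
    then have "v n = b" using v by auto
    then show ?thesis using f te(1) X(2) True by blast
  next
    case False
    then have "v 0 = b" "v n = a" using v by auto
    then have "capped V (C.pos X) a b (\<tau> + \<eta>) ((\<tau> + \<eta>) + (- \<eta>)) w" using capped_swap[OF X(2)] by simp
    moreover have "- \<eta> \<in> {1, -1}" using te(1) by auto
    ultimately show ?thesis using f by blast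
  qed
qed

section \<open>Sets with two outgoing edges: drawing them and putting them together\<close>

lemma closed_inD: "closed_in V E Y \<Longrightarrow> x \<in> Y \<Longrightarrow> y \<in> V \<Longrightarrow> E x y \<Longrightarrow> y \<in> Y"
  and closed_in_subset: "closed_in V E Y \<Longrightarrow> Y \<subseteq> V"
  unfolding closed_in_def by blast+

lemma cappedD:
  assumes "capped W D a b \<tau> \<tau>' w"
  shows "ht \<tau> w = ht \<tau> (D a)" "ht \<tau>' w = ht \<tau>' (D b)"
    "\<And>x k. x \<in> W \<Longrightarrow> ht k w = ht k (D x) \<Longrightarrow> x = a \<and> 5 dvd (k - \<tau>) \<or> x = b \<and> 5 dvd (k - \<tau>')"
    "\<And>x y. x \<in> W \<Longrightarrow> y \<in> W \<Longrightarrow> x \<noteq> y \<Longrightarrow> cr (D x - w) (D y - w) \<noteq> 0"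
  using assms unfolding capped_def by auto

lemma cappedI:
  assumes "ht \<tau> w = ht \<tau> (D a)" "ht \<tau>' w = ht \<tau>' (D b)"
    "\<And>x k. x \<in> W \<Longrightarrow> ht k w = ht k (D x) \<Longrightarrow> x = a \<and> 5 dvd (k - \<tau>) \<or> x = b \<and> 5 dvd (k - \<tau>')"
    "\<And>x y. x \<in> W \<Longrightarrow> y \<in> W \<Longrightarrow> x \<noteq> y \<Longrightarrow> cr (D x - w) (D y - w) \<noteq> 0"
  shows "capped W D a b \<tau> \<tau>' w"
  unfolding capped_def by (intro conjI ballI allI impI assms)

lemma cr_perm:
  assumes "cr (q - p) (r - p) \<noteq> 0"
  shows "cr (p - q) (r - q) \<noteq> 0" "cr (r - p) (q - p) \<noteq> 0" "cr (q - r) (p - r) \<noteq> 0" "cr (p - r) (q - r) \<noteq> 0"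
    "cr (r - q) (p - q) \<noteq> 0"
proof -
  have e: "cr (p - q) (r - q) = - cr (q - p) (r - p)" "cr (r - p) (q - p) = - cr (q - p) (r - p)"
    "cr (q - r) (p - r) = - cr (q - p) (r - p)" "cr (p - r) (q - r) = cr (q - p) (r - p)" "cr (r - q) (p - q) = cr (q - p) (r - p)"
    by (simp_all add: cr_def algebra_simps)
  show "cr (p - q) (r - q) \<noteq> 0" "cr (r - p) (q - p) \<noteq> 0" "cr (q - r) (p - r) \<noteq> 0" "cr (p - r) (q - r) \<noteq> 0"
    "cr (r - q) (p - q) \<noteq> 0" using assms unfolding e by simp_all
qed

lemma other_slope:
  fixes s s' :: int
  obtains k where "\<not> 5 dvd (k - s)" "\<not> 5 dvd (k - s')"
proof (cases "5 dvd (s + 1 - s')")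
  case True
  have "\<not> 5 dvd (s + 2 - s)" by simp
  moreover have "\<not> 5 dvd (s + 2 - s')" using True by presburger
  ultimately show thesis by (rule that)
next
  case False
  have "\<not> 5 dvd (s + 1 - s)" by simp
  then show thesis using False by (rule that)
qed

lemma faithfulI:
  assumes "\<And>p q. p \<in> V \<Longrightarrow> q \<in> V \<Longrightarrow> p \<noteq> q \<Longrightarrow> D p \<noteq> D q"
    and "\<And>p q. p \<in> V \<Longrightarrow> q \<in> V \<Longrightarrow> p \<noteq> q \<Longrightarrow> E p q \<longleftrightarrow> (\<exists>s. ht s (D p) = ht s (D q))"
    and "\<And>p q r. p \<in> V \<Longrightarrow> q \<in> V \<Longrightarrow> r \<in> V \<Longrightarrow> p \<noteq> q \<Longrightarrow> p \<noteq> r \<Longrightarrow> q \<noteq> r \<Longrightarrow> cr (D q - D p) (D r - D p) \<noteq> 0"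
  shows "faithful V E D"
  unfolding faithful_def using assms by blast

lemma faithful_cong:
  assumes "faithful V E D" "W \<subseteq> V" "\<And>x y. x \<in> W \<Longrightarrow> y \<in> W \<Longrightarrow> E x y = E' x y"
  shows "faithful W E' D"
proof (rule faithfulI)
  fix p q assume pq: "p \<in> W" "q \<in> W" "p \<noteq> q"
  then have V: "p \<in> V" "q \<in> V" using assms(2) by blast+
  show "D p \<noteq> D q" by (rule faithfulD(1)[OF assms(1) V pq(3)])
  show "E' p q \<longleftrightarrow> (\<exists>s. ht s (D p) = ht s (D q))"
    using faithfulD(2)[OF assms(1) V pq(3)] assms(3)[OF pq(1,2)] by simp
  fix r assume r: "r \<in> W" "p \<noteq> r" "q \<noteq> r"
  then have "r \<in> V" using assms(2) by blast
  then show "cr (D q - D p) (D r - D p) \<noteq> 0" by (rule faithfulD(3)[OF assms(1) V pq(3) _ r(2,3)])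
qed

lemma faithful_insert:
  assumes f: "faithful X E D" and cap: "capped X D a b \<tau> \<tau>' w" and z: "z \<notin> X" and ab: "a \<in> X" "b \<in> X"
    and E: "\<And>x. x \<in> X \<Longrightarrow> E z x \<longleftrightarrow> x = a \<or> x = b" and sym: "\<And>x y. E x y \<Longrightarrow> E y x"
    and nd: "\<not> 5 dvd (\<tau> - \<tau>')"
  shows "faithful (insert z X) E (D(z := w))"
proof -
  let ?D = "D(z := w)"
  have D: "?D x = D x" if "x \<in> X" for x using that z by auto
  have s: "x = a \<and> 5 dvd (k - \<tau>) \<or> x = b \<and> 5 dvd (k - \<tau>')" if "x \<in> X" "ht k w = ht k (D x)" for x k
    by (rule cappedD(3)[OF cap that])
  have c: "cr (D x - w) (D y - w) \<noteq> 0" if "x \<in> X" "y \<in> X" "x \<noteq> y" for x y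
    by (rule cappedD(4)[OF cap that])
  have ne: "w \<noteq> D x" if x: "x \<in> X" for x
  proof
    assume "w = D x"
    then have all: "5 dvd (k - \<tau>) \<or> 5 dvd (k - \<tau>')" for k using s[OF x, of k] by auto
    obtain k where "\<not> 5 dvd (k - \<tau>)" "\<not> 5 dvd (k - \<tau>')" by (rule other_slope)
    then show False using all[of k] by blast
  qed
  have Ez: "E z x \<longleftrightarrow> (\<exists>k. ht k w = ht k (D x))" if x: "x \<in> X" for x
  proof
    assume "E z x"
    then have "x = a \<or> x = b" using E[OF x] by blast
    then show "\<exists>k. ht k w = ht k (D x)" using cappedD(1,2)[OF cap] by auto
  next
    assume "\<exists>k. ht k w = ht k (D x)"
    then obtain k where "ht k w = ht k (D x)" by (elim exE)
    from s[OF x this] show "E z x" unfolding E[OF x] by blast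
  qed
  show ?thesis
  proof (rule faithfulI)
    fix p q assume p: "p \<in> insert z X" and q: "q \<in> insert z X" and pq: "p \<noteq> q"
    consider "p = z" "q \<in> X" | "q = z" "p \<in> X" | "p \<in> X" "q \<in> X" using p q pq by blast
    then have "?D p \<noteq> ?D q \<and> (E p q \<longleftrightarrow> (\<exists>s. ht s (?D p) = ht s (?D q)))"
    proof cases
      case 1
      then show ?thesis using ne[OF 1(2)] D[OF 1(2)] Ez[OF 1(2)] by simp
    next
      case 2
      have "E p q \<longleftrightarrow> E z p" using 2 sym by blast
      moreover have "(\<exists>s. ht s (?D p) = ht s (?D q)) \<longleftrightarrow> (\<exists>s. ht s w = ht s (D p))"
        by (simp only: D[OF 2(2)] 2(1) fun_upd_same) metis
      moreover have "?D p \<noteq> ?D q" using ne[OF 2(2)] D[OF 2(2)] 2 by simp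
      ultimately show ?thesis using Ez[OF 2(2)] by simp
    next
      case 3
      then show ?thesis using faithfulD(1,2)[OF f 3 pq] D[OF 3(1)] D[OF 3(2)] by simp
    qed
    then show "?D p \<noteq> ?D q" "E p q \<longleftrightarrow> (\<exists>s. ht s (?D p) = ht s (?D q))" by blast+
  next
    fix p q r assume p: "p \<in> insert z X" and q: "q \<in> insert z X" and r: "r \<in> insert z X"
      and ne': "p \<noteq> q" "p \<noteq> r" "q \<noteq> r"
    consider "p = z" "q \<in> X" "r \<in> X" | "q = z" "p \<in> X" "r \<in> X" | "r = z" "p \<in> X" "q \<in> X" | "p \<in> X" "q \<in> X" "r \<in> X"
      using p q r ne' by blast
    then show "cr (?D q - ?D p) (?D r - ?D p) \<noteq> 0"
    proof cases
      case 1 then show ?thesis using c[of q r] ne' D by simp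
    next
      case 2
      have "cr (D r - w) (D p - w) \<noteq> 0" using c[of r p] ne' 2 by simp
      from cr_perm(4)[OF this] show ?thesis using D 2 by simp
    next
      case 3
      have "cr (D p - w) (D q - w) \<noteq> 0" using c[of p q] ne' 3 by simp
      from cr_perm(5)[OF this] show ?thesis using D 3 by simp
    next
      case 4
      then show ?thesis using faithfulD(3)[OF f 4(1,2) ne'(1) 4(3) ne'(2,3)] D by simp
    qed
  qed
qed

text \<open>Meant for rotations by multiples of \<pi>/5 and for reflections; g is the action on
  slope indices and h a right inverse of it.\<close>

lemma faithful_transform:
  assumes f: "faithful V E D" and diff: "\<And>z w. T z - T w = T (z - w)" and T0: "\<And>z. T z = 0 \<longleftrightarrow> z = 0"
    and ht: "\<And>k z. ht k (T z) = 0 \<longleftrightarrow> ht (g k) z = 0" and g: "\<And>k. g (h k) = k"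
    and cr: "\<And>z w. cr (T z) (T w) = 0 \<longleftrightarrow> cr z w = 0"
  shows "faithful V E (\<lambda>x. T (D x))"
proof (rule faithfulI)
  have eq: "ht k (T z) = ht k (T w) \<longleftrightarrow> ht (g k) z = ht (g k) w" for k z w
    using ht[of k "z - w"] by (simp add: diff[symmetric] ht_diff)
  fix p q assume pq: "p \<in> V" "q \<in> V" "p \<noteq> q"
  show "T (D p) \<noteq> T (D q)"
    using faithfulD(1)[OF f pq] T0[of "D p - D q"] by (simp add: diff[symmetric])
  have "(\<exists>s. ht (g s) (D p) = ht (g s) (D q)) \<longleftrightarrow> (\<exists>s. ht s (D p) = ht s (D q))" using g by metis
  then show "E p q \<longleftrightarrow> (\<exists>s. ht s (T (D p)) = ht s (T (D q)))" using faithfulD(2)[OF f pq] unfolding eq by simp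
  fix r assume r: "r \<in> V" "p \<noteq> r" "q \<noteq> r"
  show "cr (T (D q) - T (D p)) (T (D r) - T (D p)) \<noteq> 0"
    using faithfulD(3)[OF f pq r] unfolding diff cr .
qed

lemma capped_transform:
  assumes c: "capped W D a b \<tau> \<tau>' w" and diff: "\<And>z w. T z - T w = T (z - w)"
    and ht: "\<And>k z. ht k (T z) = 0 \<longleftrightarrow> ht (g k) z = 0"
    and cr: "\<And>z w. cr (T z) (T w) = 0 \<longleftrightarrow> cr z w = 0"
    and s: "\<And>k. 5 dvd (g k - \<tau>) \<longleftrightarrow> 5 dvd (k - s)" "\<And>k. 5 dvd (g k - \<tau>') \<longleftrightarrow> 5 dvd (k - s')"
  shows "capped W (\<lambda>x. T (D x)) a b s s' (T w)"
proof -
  have eq: "ht k (T z) = ht k (T w) \<longleftrightarrow> ht (g k) z = ht (g k) w" for k z w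
    using ht[of k "z - w"] by (simp add: diff[symmetric] ht_diff)
  have "5 dvd (g s - \<tau>)" "5 dvd (g s' - \<tau>')" using s by simp_all
  then have e: "ht (g s) w = ht (g s) (D a)" "ht (g s') w = ht (g s') (D b)"
    using ht_cong_eq[of "g s" \<tau> w "D a"] ht_cong_eq[of "g s'" \<tau>' w "D b"] cappedD(1,2)[OF c] by simp_all
  show ?thesis
  proof (rule cappedI)
    show "ht s (T w) = ht s (T (D a))" "ht s' (T w) = ht s' (T (D b))" using e unfolding eq .
    fix x assume x: "x \<in> W"
    show "x = a \<and> 5 dvd (k - s) \<or> x = b \<and> 5 dvd (k - s')" if "ht k (T w) = ht k (T (D x))" for k
      using cappedD(3)[OF c x] that unfolding eq s[symmetric] by blast
    show "cr (T (D x) - T w) (T (D y) - T w) \<noteq> 0" if "y \<in> W" "x \<noteq> y" for y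
      using cappedD(4)[OF c x that] unfolding diff cr .
  qed
qed

lemma dvd_shift: "5 dvd (a - b) \<Longrightarrow> 5 dvd a \<longleftrightarrow> 5 dvd b" for a b :: int
  by presburger

text \<open>\<tau>, \<tau> + \<eta> and s, s' are both pairs of neighbours mod 5. A rotation carries
  one to the other, preceded by complex conjugation if the pairs run in opposite directions.\<close>

lemma match_slopes:
  assumes f: "faithful V E D" and c: "capped V D a b \<tau> (\<tau> + \<eta>) w" and \<eta>: "\<eta> \<in> {1, -1}" and s: "\<bar>sn (s' - s)\<bar> = 1"
  shows "\<exists>D w. faithful V E D \<and> capped V D a b s s' w"
proof -
  define d where "d = s' - s"
  have d5: "(s' - s) mod 5 = 1 \<or> (s' - s) mod 5 = 4" using s abs_sn[of "s' - s"] phi_gt_1 by (auto split: if_splits)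
  have "5 dvd (d - 1) \<or> 5 dvd (d + 1)" using d5 unfolding d_def[symmetric] by presburger
  then have cases: "5 dvd (s' - s - \<eta>) \<or> 5 dvd (s' - s + \<eta>)" using \<eta> unfolding d_def by auto
  have ht_rot: "ht k (cis (real_of_int m * pi / 5) * z) = ht (k - m) z" for k m z
  proof -
    have "cis (real_of_int m * pi / 5) * z * cis (- (real_of_int k * pi / 5)) =
        z * cis (real_of_int m * pi / 5 + - (real_of_int k * pi / 5))"
      by (simp only: cis_mult[symmetric] mult_ac)
    also have "real_of_int m * pi / 5 + - (real_of_int k * pi / 5) = - (real_of_int (k - m) * pi / 5)"
      by (simp add: field_simps)
    finally show ?thesis by (simp only: ht_def)
  qed
  have cr_rot: "cr (cis t * z) (cis t * y) = cr z y" for t z y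
  proof -
    have "cnj (cis t * z) * (cis t * y) = (cnj (cis t) * cis t) * (cnj z * y)" by (simp add: algebra_simps)
    also have "cnj (cis t) * cis t = 1" by (simp only: cis_cnj cis_mult) simp
    finally show ?thesis by (simp only: cr_def mult_1_left)
  qed
  have ht_cnj: "ht k (cnj z) = - ht (- k) z" for k z
  proof -
    have e: "cnj z * cis (- (real_of_int k * pi / 5)) = cnj (z * cis (- (real_of_int (- k) * pi / 5)))"
      by (simp only: complex_cnj_mult cis_cnj) simp
    show ?thesis unfolding ht_def e by (simp only: cnj.simps minus_divide_left)
  qed
  have cr_cnj: "cr (cnj z) (cnj y) = - cr z y" for z y by (simp add: cr_def algebra_simps)
  show ?thesis using cases
  proof
    assume e: "5 dvd (s' - s - \<eta>)"
    define T where "T z = cis (real_of_int (s - \<tau>) * pi / 5) * z" for z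
    have 1: "T z - T y = T (z - y)" for z y by (simp add: T_def algebra_simps)
    have 2: "ht k (T z) = 0 \<longleftrightarrow> ht (k - (s - \<tau>)) z = 0" for k z unfolding T_def ht_rot by simp
    have 3: "cr (T z) (T y) = 0 \<longleftrightarrow> cr z y = 0" for z y unfolding T_def cr_rot by simp
    have 0: "T z = 0 \<longleftrightarrow> z = 0" for z by (simp add: T_def)
    have "faithful V E (\<lambda>x. T (D x))"
      by (rule faithful_transform[where T=T and g="\<lambda>k. k - (s - \<tau>)" and h="\<lambda>k. k + (s - \<tau>)", OF f 1 0 2 _ 3]) simp
    moreover have "capped V (\<lambda>x. T (D x)) a b s s' (T w)"
    proof (rule capped_transform[OF c 1 2 3])
      show "5 dvd (k - (s - \<tau>) - \<tau>) \<longleftrightarrow> 5 dvd (k - s)" for k by (simp add: algebra_simps)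
      show "5 dvd (k - (s - \<tau>) - (\<tau> + \<eta>)) \<longleftrightarrow> 5 dvd (k - s')" for k
      proof (rule dvd_shift)
        have k: "k - (s - \<tau>) - (\<tau> + \<eta>) - (k - s') = s' - s - \<eta>" by simp
        show "5 dvd (k - (s - \<tau>) - (\<tau> + \<eta>) - (k - s'))" unfolding k by (rule e)
      qed
    qed
    ultimately show ?thesis by blast
  next
    assume e: "5 dvd (s' - s + \<eta>)"
    define T where "T z = cis (real_of_int (s + \<tau>) * pi / 5) * cnj z" for z
    have 1: "T z - T y = T (z - y)" for z y by (simp add: T_def algebra_simps)
    have 2: "ht k (T z) = 0 \<longleftrightarrow> ht (- (k - (s + \<tau>))) z = 0" for k z unfolding T_def ht_rot ht_cnj by simp
    have 3: "cr (T z) (T y) = 0 \<longleftrightarrow> cr z y = 0" for z y unfolding T_def cr_rot cr_cnj by simp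
    have 0: "T z = 0 \<longleftrightarrow> z = 0" for z by (simp add: T_def)
    have "faithful V E (\<lambda>x. T (D x))"
      by (rule faithful_transform[where T=T and g="\<lambda>k. - (k - (s + \<tau>))" and h="\<lambda>k. (s + \<tau>) - k", OF f 1 0 2 _ 3]) simp
    moreover have "capped V (\<lambda>x. T (D x)) a b s s' (T w)"
    proof (rule capped_transform[OF c 1 2 3])
      have "- (k - (s + \<tau>)) - \<tau> = - (k - s)" for k by simp
      then show "5 dvd (- (k - (s + \<tau>)) - \<tau>) \<longleftrightarrow> 5 dvd (k - s)" for k by (simp only: dvd_minus_iff)
      have 1: "- (k - (s + \<tau>)) - (\<tau> + \<eta>) = - (k - s + \<eta>)" for k by simp
      have "5 dvd (k - s + \<eta>) \<longleftrightarrow> 5 dvd (k - s')" for k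
      proof (rule dvd_shift)
        have k: "k - s + \<eta> - (k - s') = s' - s + \<eta>" by simp
        show "5 dvd (k - s + \<eta> - (k - s'))" unfolding k by (rule e)
      qed
      then show "5 dvd (- (k - (s + \<tau>)) - (\<tau> + \<eta>)) \<longleftrightarrow> 5 dvd (k - s')" for k
        unfolding 1 dvd_minus_iff .
    qed
    ultimately show ?thesis by blast
  qed
qed

text \<open>Both caps are moved to 0. Then p and p' lie on the line of slope s through 0, and q and
  q' on the line of slope s', so both crossing edges are drawn and remain so when A is scaled by l.
  Any other equality of heights across the parts involves a nonzero height and holds for at most one
  l.\<close>

lemma glue_caps:
  assumes fin: "finite A" "finite B" and disj: "A \<inter> B = {}" and sym: "\<And>x y. E x y \<Longrightarrow> E y x"
    and fA: "faithful A E DA" and fB: "faithful B E DB"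
    and cA: "capped A DA p q s s' a" and cB: "capped B DB p' q' s s' b"
    and mem: "p \<in> A" "q \<in> A" "p' \<in> B" "q' \<in> B" "p \<noteq> q" "p' \<noteq> q'"
    and cross: "\<And>x y. x \<in> A \<Longrightarrow> y \<in> B \<Longrightarrow> E x y \<longleftrightarrow> x = p \<and> y = p' \<or> x = q \<and> y = q'"
    and nd: "\<not> 5 dvd (s - s')"
  shows "\<exists>D. faithful (A \<union> B) E D"
proof -
  define f where "f x = DA x - a" for x
  define g where "g y = DB y - b" for y
  have f0: "x = p \<and> 5 dvd (k - s) \<or> x = q \<and> 5 dvd (k - s')" if "x \<in> A" "ht k (f x) = 0" for x k
    using cappedD(3)[OF cA that(1), of k] that(2) by (simp add: f_def ht_diff)
  have g0: "y = p' \<and> 5 dvd (k - s) \<or> y = q' \<and> 5 dvd (k - s')" if "y \<in> B" "ht k (g y) = 0" for y k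
    using cappedD(3)[OF cB that(1), of k] that(2) by (simp add: g_def ht_diff)
  have edge: "ht s (f p) = 0" "ht s' (f q) = 0" "ht s (g p') = 0" "ht s' (g q') = 0"
    using cappedD(1,2)[OF cA] cappedD(1,2)[OF cB] by (simp_all add: f_def g_def ht_diff)
  have fc: "cr (f x) (f y) \<noteq> 0" if "x \<in> A" "y \<in> A" "x \<noteq> y" for x y
    unfolding f_def by (rule cappedD(4)[OF cA that])
  have gc: "cr (g x) (g y) \<noteq> 0" if "x \<in> B" "y \<in> B" "x \<noteq> y" for x y
    unfolding g_def by (rule cappedD(4)[OF cB that])
  have G1: "generic (\<lambda>l. \<forall>x\<in>A. \<forall>y\<in>B. \<forall>k\<in>{0..<5}. ht k (f x) \<noteq> 0 \<or> ht k (g y) \<noteq> 0 \<longrightarrow>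
      ht k (of_real l * f x) \<noteq> ht k (g y))"
  proof (intro generic_ball countable_finite fin finite_atLeastLessThan_int generic_imp)
    fix x y k assume "ht k (f x) \<noteq> 0 \<or> ht k (g y) \<noteq> 0"
    then have "generic (\<lambda>l. ht k (of_real l * f x) - ht k (g y) \<noteq> 0)"
      by (intro affine_generic[of _ "- ht k (g y)" "ht k (f x)"]) (auto simp: ht_scale)
    then show "generic (\<lambda>l. ht k (of_real l * f x) \<noteq> ht k (g y))" by simp
  qed
  have G2: "generic (\<lambda>l. \<forall>x\<in>A. \<forall>x'\<in>A. \<forall>y\<in>B. x \<noteq> x' \<longrightarrow>
      cr (of_real l * f x' - of_real l * f x) (g y - of_real l * f x) \<noteq> 0)"
  proof (intro generic_ball countable_finite fin generic_imp)
    fix x x' y assume x: "x \<in> A" "x' \<in> A" "x \<noteq> x'"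
    show "generic (\<lambda>l. cr (of_real l * f x' - of_real l * f x) (g y - of_real l * f x) \<noteq> 0)"
    proof (rule quadratic_generic)
      show "cr (of_real l * f x' - of_real l * f x) (g y - of_real l * f x) =
        0 + cr (f x' - f x) (g y) * l + (- cr (f x') (f x)) * l\<^sup>2" for l
        by (simp only: cr_linear) (simp add: algebra_simps power2_eq_square)
    qed (use fc[OF x(2,1)] x(3) in auto)
  qed
  have G3: "generic (\<lambda>l. \<forall>x\<in>A. \<forall>y\<in>B. \<forall>y'\<in>B. y \<noteq> y' \<longrightarrow> cr (g y' - g y) (of_real l * f x - g y) \<noteq> 0)"
  proof (intro generic_ball countable_finite fin generic_imp)
    fix x y y' assume y: "y \<in> B" "y' \<in> B" "y \<noteq> y'"
    show "generic (\<lambda>l. cr (g y' - g y) (of_real l * f x - g y) \<noteq> 0)"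
    proof (rule affine_generic)
      show "cr (g y' - g y) (of_real l * f x - g y) = - cr (g y') (g y) + cr (g y' - g y) (f x) * l" for l
        by (simp only: cr_linear) (simp add: algebra_simps)
    qed (use gc[OF y(2,1)] y(3) in auto)
  qed
  have G4: "generic (\<lambda>l. l \<noteq> 0)" by (rule affine_generic[of _ 0 1]) simp_all
  obtain l where l1: "\<forall>x\<in>A. \<forall>y\<in>B. \<forall>k\<in>{0..<5}. ht k (f x) \<noteq> 0 \<or> ht k (g y) \<noteq> 0 \<longrightarrow>
      ht k (of_real l * f x) \<noteq> ht k (g y)"
    and l2: "\<forall>x\<in>A. \<forall>x'\<in>A. \<forall>y\<in>B. x \<noteq> x' \<longrightarrow> cr (of_real l * f x' - of_real l * f x) (g y - of_real l * f x) \<noteq> 0"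
    and l3: "\<forall>x\<in>A. \<forall>y\<in>B. \<forall>y'\<in>B. y \<noteq> y' \<longrightarrow> cr (g y' - g y) (of_real l * f x - g y) \<noteq> 0"
    and l4: "l \<noteq> 0"
    using generic_ex[OF generic_conj[OF G1 generic_conj[OF G2 generic_conj[OF G3 G4]]]]
    by (elim exE conjE) (rule that)
  define D where "D x = (if x \<in> A then of_real l * f x else g x)" for x
  have DA: "D x = of_real l * f x" if "x \<in> A" for x using that by (simp add: D_def)
  have DB: "D y = g y" if "y \<in> B" for y using that disj by (auto simp: D_def)
  have h: "ht k (f x) = 0 \<and> ht k (g y) = 0" if xy: "x \<in> A" "y \<in> B" and eq: "ht k (D x) = ht k (D y)" for x y k
  proof -
    define m where "m = k mod 5"
    have m: "m \<in> {0..<5}" "5 dvd (k - m)" unfolding m_def by (simp, presburger)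
    have "ht m (D x) = ht m (D y)" using ht_cong_eq[OF m(2)] eq by blast
    then have "ht m (of_real l * f x) = ht m (g y)" unfolding DA[OF xy(1)] DB[OF xy(2)] .
    then have "ht m (f x) = 0 \<and> ht m (g y) = 0"
      using bspec[OF bspec[OF bspec[OF l1 xy(1)] xy(2)] m(1)] by blast
    then show ?thesis using ht_cong_eq[OF m(2), of "f x" 0] ht_cong_eq[OF m(2), of "g y" 0] by (simp add: ht_0)
  qed
  have AB: "D x \<noteq> D y \<and> (E x y \<longleftrightarrow> (\<exists>k. ht k (D x) = ht k (D y)))" if xy: "x \<in> A" "y \<in> B" for x y
  proof
    show "D x \<noteq> D y"
    proof
      assume "D x = D y"
      then have all: "5 dvd (k - s) \<or> 5 dvd (k - s')" for k
        using h[OF xy, of k] f0[OF xy(1), of k] by (auto simp: \<open>D x = D y\<close>)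
      obtain k where "\<not> 5 dvd (k - s)" "\<not> 5 dvd (k - s')" by (rule other_slope)
      then show False using all[of k] by blast
    qed
    show "E x y \<longleftrightarrow> (\<exists>k. ht k (D x) = ht k (D y))"
    proof
      assume "E x y"
      then have "x = p \<and> y = p' \<or> x = q \<and> y = q'" using cross[OF xy] by blast
      then show "\<exists>k. ht k (D x) = ht k (D y)"
      proof
        assume "x = p \<and> y = p'"
        then have "ht s (D x) = ht s (D y)" using edge xy by (simp add: DA DB ht_scale)
        then show ?thesis by blast
      next
        assume "x = q \<and> y = q'"
        then have "ht s' (D x) = ht s' (D y)" using edge xy by (simp add: DA DB ht_scale)
        then show ?thesis by blast
      qed
    next
      assume "\<exists>k. ht k (D x) = ht k (D y)"
      then obtain k where "ht k (f x) = 0" "ht k (g y) = 0" using h[OF xy] by blast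
      then have "x = p \<and> 5 dvd (k - s) \<or> x = q \<and> 5 dvd (k - s')" "y = p' \<and> 5 dvd (k - s) \<or> y = q' \<and> 5 dvd (k - s')"
        by (auto dest: f0[OF xy(1)] g0[OF xy(2)])
      moreover have "\<not> (5 dvd (k - s) \<and> 5 dvd (k - s'))" using nd by presburger
      ultimately show "E x y" using cross[OF xy] by blast
    qed
  qed
  have BA: "D y \<noteq> D x \<and> (E y x \<longleftrightarrow> (\<exists>k. ht k (D y) = ht k (D x)))" if "x \<in> A" "y \<in> B" for x y
  proof -
    have 1: "D y \<noteq> D x" by (rule conjunct1[THEN not_sym, OF AB[OF that]])
    have 2: "(\<exists>k. ht k (D y) = ht k (D x)) = (\<exists>k. ht k (D x) = ht k (D y))"
      by (rule iff_exI) (rule eq_commute)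
    have 3: "E y x = E x y" using sym by blast
    show ?thesis unfolding 2 3 by (rule conjI[OF 1 conjunct2[OF AB[OF that]]])
  qed
  have AA: "D x - D y = of_real l * (DA x - DA y)" if "x \<in> A" "y \<in> A" for x y
    unfolding DA[OF that(1)] DA[OF that(2)] f_def by (simp add: algebra_simps)
  have BB: "D x - D y = DB x - DB y" if "x \<in> B" "y \<in> B" for x y
    unfolding DB[OF that(1)] DB[OF that(2)] g_def by simp
  have eqA: "ht k (D x) = ht k (D y) \<longleftrightarrow> ht k (DA x) = ht k (DA y)" if "x \<in> A" "y \<in> A" for x y k
  proof -
    have "ht k (D x - D y) = l * (ht k (DA x) - ht k (DA y))" unfolding AA[OF that] by (simp only: ht_scale ht_diff)
    then have "ht k (D x - D y) = 0 \<longleftrightarrow> ht k (DA x) - ht k (DA y) = 0" using l4 by simp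
    then show ?thesis unfolding ht_diff by simp
  qed
  have eqB: "ht k (D x) = ht k (D y) \<longleftrightarrow> ht k (DB x) = ht k (DB y)" if "x \<in> B" "y \<in> B" for x y k
  proof -
    have "ht k (D x - D y) = ht k (DB x - DB y)" unfolding BB[OF that] ..
    then show ?thesis unfolding ht_diff by (metis eq_iff_diff_eq_0)
  qed
  have "faithful (A \<union> B) E D"
  proof (rule faithfulI)
    fix x y assume x: "x \<in> A \<union> B" and y: "y \<in> A \<union> B" and xy: "x \<noteq> y"
    consider "x \<in> A" "y \<in> A" | "x \<in> A" "y \<in> B" | "y \<in> A" "x \<in> B" | "x \<in> B" "y \<in> B" using x y by blast
    then have "D x \<noteq> D y \<and> (E x y \<longleftrightarrow> (\<exists>k. ht k (D x) = ht k (D y)))"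
    proof cases
      case 1
      have "D x - D y \<noteq> 0" unfolding AA[OF 1] using faithfulD(1)[OF fA 1 xy] l4 by simp
      then show ?thesis using faithfulD(2)[OF fA 1 xy] eqA[OF 1] by simp
    next
      case 2 then show ?thesis by (rule AB)
    next
      case 3 then show ?thesis by (rule BA)
    next
      case 4
      have "D x - D y \<noteq> 0" unfolding BB[OF 4] using faithfulD(1)[OF fB 4 xy] by simp
      then show ?thesis using faithfulD(2)[OF fB 4 xy] eqB[OF 4] by simp
    qed
    then show "D x \<noteq> D y" "E x y \<longleftrightarrow> (\<exists>k. ht k (D x) = ht k (D y))" by blast+
  next
    fix x y z assume x: "x \<in> A \<union> B" and y: "y \<in> A \<union> B" and z: "z \<in> A \<union> B" and ne: "x \<noteq> y" "x \<noteq> z" "y \<noteq> z"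
    have AAB: "cr (D x' - D x) (D y - D x) \<noteq> 0" if "x \<in> A" "x' \<in> A" "y \<in> B" "x \<noteq> x'" for x x' y
      using l2 that DA DB by simp
    have BBA: "cr (D y' - D y) (D x - D y) \<noteq> 0" if "y \<in> B" "y' \<in> B" "x \<in> A" "y \<noteq> y'" for x y y'
      using l3 that DA DB by simp
    consider "x \<in> A" "y \<in> A" "z \<in> A" | "x \<in> A" "y \<in> A" "z \<in> B" | "x \<in> A" "z \<in> A" "y \<in> B" | "y \<in> A" "z \<in> A" "x \<in> B"
      | "x \<in> B" "y \<in> B" "z \<in> B" | "x \<in> B" "y \<in> B" "z \<in> A" | "x \<in> B" "z \<in> B" "y \<in> A" | "y \<in> B" "z \<in> B" "x \<in> A"
      using x y z by blast
    then show "cr (D y - D x) (D z - D x) \<noteq> 0"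
    proof cases
      case 1
      have "cr (D y - D x) (D z - D x) = l * (l * cr (DA y - DA x) (DA z - DA x))"
        unfolding AA[OF 1(2,1)] AA[OF 1(3,1)] by (simp only: cr_linear(5,6))
      then show ?thesis using faithfulD(3)[OF fA 1(1,2) ne(1) 1(3) ne(2,3)] l4 by simp
    next
      case 2 then show ?thesis using AAB ne by blast
    next
      case 3
      from cr_perm(2)[OF AAB[OF 3 ne(2)]] show ?thesis .
    next
      case 4
      from cr_perm(4)[OF AAB[OF 4 ne(3)]] show ?thesis .
    next
      case 5
      show ?thesis unfolding BB[OF 5(2,1)] BB[OF 5(3,1)] by (rule faithfulD(3)[OF fB 5(1,2) ne(1) 5(3) ne(2,3)])
    next
      case 6 then show ?thesis using BBA ne by blast
    next
      case 7
      from cr_perm(2)[OF BBA[OF 7 ne(2)]] show ?thesis .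
    next
      case 8
      from cr_perm(4)[OF BBA[OF 8 ne(3)]] show ?thesis .
    qed
  qed
  then show ?thesis by blast
qed

text \<open>\<open>tight\<close> forbids proper nonempty sets with at most one outgoing edge. A
  smallest set X off z of defect at most two is therefore left by exactly two edges. These have
  different ends in X: a common end would have one neighbour in X, and X without it would have one
  outgoing edge. The ends outside differ for the same reason, unless both are z; then z has no
  further neighbour and is all that remains, so it goes to the cap of X.\<close>

lemma single_deficient:
  fixes V :: "'a set"
  assumes sym: "\<And>x y. E x y \<Longrightarrow> E y x" and irr: "\<And>x. \<not> E x x" and fin: "finite V"
    and z: "z \<in> V" "deg V E z = 2" and d3: "\<And>x. x \<in> V \<Longrightarrow> x \<noteq> z \<Longrightarrow> deg V E x = 3"
    and tight: "\<And>A a b. A \<subseteq> V \<Longrightarrow> A \<noteq> {} \<Longrightarrow> A \<noteq> V \<Longrightarrow> \<exists>x\<in>A. \<exists>y\<in>V - A. E x y \<and> \<not> (x = a \<and> y = b)"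
    and IH: "\<And>(W :: 'a set) E R. card W < card V \<Longrightarrow> (\<And>x y. E x y \<Longrightarrow> E y x) \<Longrightarrow> (\<And>x. \<not> E x x) \<Longrightarrow> subcubic_on W E \<Longrightarrow>
      oriented W E R \<Longrightarrow> \<exists>D. good W E R D"
  shows "\<exists>D. faithful V E D"
proof -
  define cross where "cross X = (SIGMA x:X. {y \<in> V - X. E x y})" for X
  have split: "deg V E x = deg X E x + card {y \<in> V - X. E x y}" if "X \<subseteq> V" for X x
  proof -
    have "{w \<in> V. E x w} = {w \<in> X. E x w} \<union> {y \<in> V - X. E x y}" using that by blast
    moreover have "card ({w \<in> X. E x w} \<union> {y \<in> V - X. E x y}) = card {w \<in> X. E x w} + card {y \<in> V - X. E x y}"
      by (rule card_Un_disjoint) (use fin finite_subset[OF that] in auto)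
    ultimately show ?thesis by (simp add: deg_def)
  qed
  have defect: "defect E X = card (cross X)" if X: "X \<subseteq> V - {z}" for X
  proof -
    have XV: "X \<subseteq> V" using X by blast
    have "card (cross X) = (\<Sum>x\<in>X. card {y \<in> V - X. E x y})"
      unfolding cross_def by (rule card_SigmaI) (use fin finite_subset[OF XV] in auto)
    also have "\<dots> = defect E X" unfolding defect_def
    proof (rule sum.cong[OF refl])
      fix x assume "x \<in> X"
      then have "deg V E x = 3" using d3 X by blast
      then show "card {y \<in> V - X. E x y} = 3 - deg X E x" using split[OF XV, of x] by simp
    qed
    finally show ?thesis by simp
  qed
  define P where "P X \<longleftrightarrow> X \<subseteq> V - {z} \<and> X \<noteq> {} \<and> defect E X \<le> 2" for X
  have nz: "{w \<in> V. E z w} \<noteq> {}" using z(2) unfolding deg_def by force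
  have "P (V - {z})" unfolding P_def
  proof (intro conjI)
    show "V - {z} \<noteq> {}" using nz irr by auto
    have "cross (V - {z}) = (\<lambda>x. (x, z)) ` {w \<in> V. E z w}"
      using z(1) irr sym unfolding cross_def by auto
    then have "card (cross (V - {z})) \<le> 2" using card_image_le[of "{w \<in> V. E z w}"] fin z(2) unfolding deg_def by simp
    then show "defect E (V - {z}) \<le> 2" using defect[of "V - {z}"] by simp
  qed simp
  then obtain X where X: "P X" and min: "\<And>Y. P Y \<Longrightarrow> card X \<le> card Y"
    using ex_has_least_nat[of P "V - {z}" card] by blast
  have Xz: "X \<subseteq> V - {z}" and Xne: "X \<noteq> {}" and Xd: "defect E X \<le> 2" using X by (simp_all add: P_def)
  have XV: "X \<subseteq> V" and zX: "z \<notin> X" using Xz by auto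
  have finX: "finite X" using XV fin finite_subset by blast
  have cuts: "3 \<le> defect E Z" if Z: "Z \<subset> X" "Z \<noteq> {}" for Z
  proof (rule ccontr)
    assume "\<not> 3 \<le> defect E Z"
    then have "P Z" using Z Xz by (auto simp: P_def)
    then show False using min[of Z] psubset_card_mono[OF finX Z(1)] by simp
  qed
  have fc: "finite (cross X)" unfolding cross_def using finX fin by auto
  have "\<not> card (cross X) \<le> Suc 0"
  proof
    assume c: "card (cross X) \<le> Suc 0"
    obtain x0 y0 where 0: "(x0, y0) \<in> cross X"
      using tight[OF XV Xne, of undefined undefined] zX z(1) unfolding cross_def by blast
    obtain x y where xy: "x \<in> X" "y \<in> V - X" "E x y" "\<not> (x = x0 \<and> y = y0)"
      using tight[OF XV Xne, of x0 y0] zX z(1) by blast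
    have "(x, y) \<in> cross X" using xy by (simp add: cross_def)
    then have "(x, y) = (x0, y0)" using c 0 unfolding card_le_Suc0_iff_eq[OF fc] by blast
    then show False using xy(4) by simp
  qed
  then have "card (cross X) = 2" using Xd defect[OF Xz] by simp
  then obtain e1 e2 where e12: "cross X = {e1, e2}" "e1 \<noteq> e2" unfolding card_2_iff by blast
  define p p' q q' where "p = fst e1" and "p' = snd e1" and "q = fst e2" and "q' = snd e2"
  have cr: "cross X = {(p, p'), (q, q')}" and pqne: "(p, p') \<noteq> (q, q')"
    using e12 by (simp_all add: p_def p'_def q_def q'_def)
  have edges: "E x y \<longleftrightarrow> x = p \<and> y = p' \<or> x = q \<and> y = q'" if "x \<in> X" "y \<in> V - X" for x y
  proof -
    have "(x, y) \<in> cross X \<longleftrightarrow> E x y" using that by (simp add: cross_def)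
    then show ?thesis unfolding cr by auto
  qed
  have "(p, p') \<in> cross X" "(q, q') \<in> cross X" unfolding cr by simp_all
  then have mem: "p \<in> X" "q \<in> X" "p' \<in> V - X" "q' \<in> V - X" and Epq: "E p p'" "E q q'"
    unfolding cross_def by simp_all
  have out: "{y \<in> V - X. E x y} = (if x = p then {p'} else {}) \<union> (if x = q then {q'} else {})" if "x \<in> X" for x
    using edges[OF that] mem by auto
  have dX3: "deg V E x = 3" if "x \<in> X" for x using d3 that Xz by blast
  have pq: "p \<noteq> q"
  proof
    assume e: "p = q"
    then have ne: "p' \<noteq> q'" using pqne by simp
    have "card {y \<in> V - X. E p y} = 2" using out[OF mem(1)] e ne by simp
    then have "card {w \<in> X. E p w} = 1" using split[OF XV, of p] dX3[OF mem(1)] by (simp add: deg_def)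
    then obtain r where r: "{w \<in> X. E p w} = {r}" by (rule card_1_singletonE)
    have "X - {p} \<noteq> {}" using r irr by blast
    moreover have "X - {p} \<noteq> V" "X - {p} \<subseteq> V" using zX z(1) XV by blast+
    ultimately obtain x y where xy: "x \<in> X - {p}" "y \<in> V - (X - {p})" "E x y" "\<not> (x = r \<and> y = p)"
      using tight[of "X - {p}" r p] by blast
    show False
    proof (cases "y = p")
      case True
      then have "x \<in> {w \<in> X. E p w}" using xy sym by blast
      then show False using r xy(4) True by blast
    next
      case False
      then show False using edges[of x y] xy e by blast
    qed
  qed
  have dX: "deg X E p = 2" "deg X E q = 2"
    using split[OF XV, of p] split[OF XV, of q] out[OF mem(1)] out[OF mem(2)] dX3[OF mem(1)] dX3[OF mem(2)] pq by simp_all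
  have dXx: "deg X E x = 3" if "x \<in> X" "x \<noteq> p" "x \<noteq> q" for x
  proof -
    have "card {y \<in> V - X. E x y} = 0" unfolding out[OF that(1)] using that(2,3) by simp
    then show ?thesis using split[OF XV, of x] dX3[OF that(1)] by linarith
  qed
  have IHX: "\<exists>D. good W E R D" if "W \<subset> X" "subcubic_on W E" "oriented W E R" for W R
  proof (rule IH[where W=W and E=E and R=R])
    show "E y x" if "E x y" for x y by (rule sym[OF that])
    show "\<not> E x x" for x by (rule irr)
    show "subcubic_on W E" "oriented W E R" by (rule that)+
    show "card W < card V" by (rule psubset_card_mono[OF fin]) (use that(1) XV in blast)
  qed
  have "\<exists>D \<tau> \<eta> w. faithful X E D \<and> \<eta> \<in> {1, -1} \<and> capped X D p q \<tau> (\<tau> + \<eta>) w"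
    by (rule cap_step[OF sym finX irr mem(1,2) pq dX dXx cuts IHX])
  then obtain D0 \<tau> \<eta> w where D0: "faithful X E D0" "\<eta> \<in> {1, -1}" "capped X D0 p q \<tau> (\<tau> + \<eta>) w"
    by (elim exE conjE) (rule that)
  have nd: "\<not> 5 dvd (\<tau> - (\<tau> + \<eta>))" using D0(2) by auto
  define Y where "Y = V - X"
  have zY: "z \<in> Y" using zX z(1) by (simp add: Y_def)
  have inX: "{x \<in> X. E y x} = (if y = p' then {p} else {}) \<union> (if y = q' then {q} else {})" if "y \<in> Y" for y
  proof -
    have "E y x \<longleftrightarrow> x = p \<and> y = p' \<or> x = q \<and> y = q'" if "x \<in> X" for x
      using edges[OF that, of y] \<open>y \<in> Y\<close> sym unfolding Y_def by blast
    then show ?thesis using mem by auto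
  qed
  have splitY: "deg V E y = deg Y E y + card {x \<in> X. E y x}" for y
  proof -
    have "V - Y = X" using XV by (auto simp: Y_def)
    then show ?thesis using split[of Y y] by (simp add: Y_def)
  qed
  show ?thesis
  proof (cases "p' = q'")
    case True
    have p'z: "p' = z"
    proof (rule ccontr)
      assume ne: "p' \<noteq> z"
      have "card {x \<in> X. E p' x} = 2" using inX[of p'] mem True pq by (simp add: Y_def)
      then have "card {w \<in> Y. E p' w} = 1" using splitY[of p'] d3[of p'] ne mem by (simp add: deg_def)
      then obtain r where r: "{w \<in> Y. E p' w} = {r}" by (rule card_1_singletonE)
      have "Y - {p'} \<subseteq> V" "Y - {p'} \<noteq> {}" "Y - {p'} \<noteq> V" using zY ne mem by (auto simp: Y_def)
      then obtain x y where xy: "x \<in> Y - {p'}" "y \<in> V - (Y - {p'})" "E x y" "\<not> (x = r \<and> y = p')"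
        using tight[of "Y - {p'}" r p'] by blast
      show False
      proof (cases "y = p'")
        case y: True
        then have "x \<in> {w \<in> Y. E p' w}" using xy sym by blast
        then show False using r xy(4) y by blast
      next
        case False
        then have "y \<in> X" "E y x" using xy sym by (auto simp: Y_def)
        then show False using edges[of y x] xy(1) True by (auto simp: Y_def)
      qed
    qed
    have "{x \<in> X. E z x} = {p, q}" using inX[OF zY] True p'z by auto
    moreover have "card {p, q} = 2" using pq by simp
    ultimately have "card {w \<in> Y. E z w} = 0" using splitY[of z] z(2) by (simp add: deg_def)
    then have zE: "\<not> E z w" if "w \<in> Y" for w using that fin by (auto simp: Y_def)
    have Yz: "Y = {z}"
    proof (rule ccontr)
      assume "Y \<noteq> {z}"
      then have "Y - {z} \<subseteq> V" "Y - {z} \<noteq> {}" "Y - {z} \<noteq> V" using zY by (auto simp: Y_def)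
      then obtain x y where xy: "x \<in> Y - {z}" "y \<in> V - (Y - {z})" "E x y"
        using tight[of "Y - {z}" undefined undefined] by blast
      show False
      proof (cases "y = z")
        case True then show False using zE[of x] xy sym by blast
      next
        case False
        then have "y \<in> X" "E y x" using xy sym by (auto simp: Y_def)
        then show False using edges[of y x] xy(1) \<open>p' = q'\<close> p'z by (auto simp: Y_def)
      qed
    qed
    have Vz: "V = insert z X" using Yz XV by (auto simp: Y_def)
    have Ez: "E z x \<longleftrightarrow> x = p \<or> x = q" if "x \<in> X" for x
      using edges[OF that, of z] zX z(1) True p'z sym by blast
    have "faithful (insert z X) E (D0(z := w))"
      by (rule faithful_insert[OF D0(1,3) zX mem(1,2) Ez sym nd])
    then show ?thesis unfolding Vz by blast
  next
    case ne': False
    \<comment> \<open>X is contracted to a vertex, for which the name p is reused. The contracted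
      graph has exactly two vertices of degree two, z and p, so the path step applies to it.\<close>
    define V2 where "V2 = insert p Y"
    define E' where "E' x y \<longleftrightarrow> x \<in> Y \<and> y \<in> Y \<and> E x y \<or> x = p \<and> (y = p' \<or> y = q') \<or> y = p \<and> (x = p' \<or> x = q')" for x y
    have pY: "p \<notin> Y" and p'Y: "p' \<in> Y" "q' \<in> Y" using mem by (simp_all add: Y_def)
    have finY: "finite Y" using fin by (simp add: Y_def)
    have fin2: "finite V2" using finY by (simp add: V2_def)
    have sym': "E' x y \<Longrightarrow> E' y x" for x y using sym unfolding E'_def by blast
    have irr': "\<not> E' x x" for x using irr pY p'Y unfolding E'_def by blast
    have E'p: "E' p y \<longleftrightarrow> y = p' \<or> y = q'" for y using pY p'Y unfolding E'_def by blast
    have E'Y: "E' x y \<longleftrightarrow> E x y" if "x \<in> Y" "y \<in> Y" for x y using that pY unfolding E'_def by blast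
    have dp: "deg V2 E' p = 2"
    proof -
      have "{w \<in> V2. E' p w} = {p', q'}" using E'p p'Y by (auto simp: V2_def)
      then show ?thesis using ne' by (simp add: deg_def)
    qed
    have dY: "deg V2 E' y = deg V E y" if y: "y \<in> Y" for y
    proof -
      have yp: "y \<noteq> p" using y pY by blast
      have "{w \<in> V2. E' y w} = {w \<in> Y. E y w} \<union> (if y = p' \<or> y = q' then {p} else {})"
        using E'Y[OF y] yp pY unfolding V2_def by (auto simp: E'_def)
      moreover have "card ({w \<in> Y. E y w} \<union> (if y = p' \<or> y = q' then {p} else {})) =
          card {w \<in> Y. E y w} + card (if y = p' \<or> y = q' then {p} else {})"
        by (rule card_Un_disjoint) (use finY pY in auto)
      moreover have "card {x \<in> X. E y x} = card (if y = p' \<or> y = q' then {p} else {})"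
        unfolding inX[OF y] using ne' by auto
      ultimately show ?thesis using splitY[of y] by (simp add: deg_def)
    qed
    have conn: "Z = {} \<or> Z = V2" if Z: "closed_in V2 E' Z" for Z
    proof -
      have empty: "Z = {}" if Z: "closed_in V2 E' Z" and pZ: "p \<notin> Z" for Z
      proof (rule ccontr)
        assume Zne: "Z \<noteq> {}"
        have ZY: "Z \<subseteq> Y" using closed_in_subset[OF Z] pZ unfolding V2_def by blast
        have cl: "y \<in> Z" if "x \<in> Z" "y \<in> V2" "E' x y" for x y
          by (rule closed_inD[OF Z that])
        have "p \<in> V2" by (simp add: V2_def)
        then have pq': "p' \<notin> Z" "q' \<notin> Z" using pZ cl[of p' p] cl[of q' p] sym'[of p p'] sym'[of p q'] E'p by auto
        have ZV: "Z \<subseteq> V" "Z \<noteq> V" using ZY mem XV by (auto simp: Y_def)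
        obtain x y where xy: "x \<in> Z" "y \<in> V - Z" "E x y"
          using tight[OF ZV(1) Zne ZV(2), of undefined undefined] by blast
        have xY: "x \<in> Y" using xy(1) ZY by blast
        show False
        proof (cases "y \<in> Y")
          case True
          then have "E' x y" "y \<in> V2" using E'Y[OF xY] xy by (simp_all add: V2_def)
          then show False using cl[OF xy(1)] xy(2) by blast
        next
          case False
          then have "y \<in> X" "E y x" using xy sym by (auto simp: Y_def)
          then show False using edges[of y x] xY xy(1) pq' by (auto simp: Y_def)
        qed
      qed
      show ?thesis
      proof (cases "p \<in> Z")
        case False then show ?thesis using empty[OF Z] by blast
      next
        case True
        have "closed_in V2 E' (V2 - Z)" unfolding closed_in_def
        proof (intro conjI ballI impI)
          fix x y assume x: "x \<in> V2 - Z" and y: "y \<in> V2" and xy: "E' x y"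
          have "y \<notin> Z"
          proof
            assume "y \<in> Z"
            then have "x \<in> Z" by (rule closed_inD[OF Z _ _ sym'[OF xy]]) (use x in simp)
            then show False using x by simp
          qed
          then show "y \<in> V2 - Z" using y by simp
        qed simp
        then have "V2 - Z = {}" by (rule empty) (use True in simp)
        then show ?thesis using closed_in_subset[OF Z] by blast
      qed
    qed
    have zV2: "z \<in> V2" and pV2: "p \<in> V2" and zp: "z \<noteq> p" using zY pY by (auto simp: V2_def)
    obtain n v0 where path0: "ipath V2 E' n v0" and n: "n \<noteq> 0" and ends0: "v0 0 \<in> {z, p}" "v0 n \<in> {z, p}" "v0 0 \<noteq> v0 n"
      and inn0: "\<And>k. 0 < k \<Longrightarrow> k < n \<Longrightarrow> v0 k \<notin> {z, p}"
      by (rule shortest_path[where V=V2 and E=E' and S="{z, p}", OF sym' irr' conn zV2 pV2 zp insertI1 insertI2[OF insertI1]]) blast+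
    \<comment> \<open>The path is directed so that it ends in p, because the path step controls the
      slopes at its last vertex.\<close>
    obtain v where path: "ipath V2 E' n v" and ends: "v 0 = z" "v n = p" and inn: "\<And>k. 0 < k \<Longrightarrow> k < n \<Longrightarrow> v k \<notin> {z, p}"
    proof (cases "v0 n = p")
      case True
      then have "v0 0 = z" using ends0 by auto
      then show ?thesis using that[OF path0 _ True inn0] by blast
    next
      case False
      then have e: "v0 n = z" "v0 0 = p" using ends0 by auto
      show ?thesis
      proof (rule that[OF ipath_rev[OF path0 sym']])
        show "v0 (n - k) \<notin> {z, p}" if "0 < k" "k < n" for k by (rule inn0) (use that in simp_all)
      qed (use e in simp_all)
    qed
    have vV2: "v k \<in> V2" if "k \<le> n" for k using path that unfolding ipath_def by blast
    have inner: "deg V2 E' (v k) = 3" if "0 < k" "k < n" for k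
    proof -
      have "v k \<noteq> z" "v k \<noteq> p" using inn[OF that] by simp_all
      then have "v k \<in> Y" using vV2[of k] that by (auto simp: V2_def)
      then show ?thesis using dY d3[of "v k"] \<open>v k \<noteq> z\<close> by (simp add: Y_def)
    qed
    have d23: "deg V2 E' x \<le> 3" if "x \<in> V2" for x
    proof (cases "x = p")
      case True then show ?thesis using dp by simp
    next
      case False
      then have "x \<in> Y" using that by (simp add: V2_def)
      then show ?thesis using dY[of x] d3[of x] z(2) by (cases "x = z") (simp_all add: Y_def)
    qed
    have e0: "deg V2 E' (v 0) = 2" unfolding ends using dY[OF zY] z(2) by simp
    have en: "deg V2 E' (v n) = 2" unfolding ends by (rule dp)
    have cV2: "card V2 < card V"
    proof -
      have "card V2 = Suc (card Y)" using pY finY by (simp add: V2_def)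
      moreover have "card V = card X + card Y" using card_Un_disjoint[of X Y] finX finY XV
        by (simp add: Y_def Un_absorb1)
      moreover have "card {p, q} \<le> card X" by (rule card_mono) (use finX mem in auto)
      ultimately show ?thesis using pq by simp
    qed
    have IH2: "\<exists>D. good W E' R D" if "W \<subset> V2" "subcubic_on W E'" "oriented W E' R" for W R
    proof (rule IH[where W=W and E=E' and R=R])
      show "E' y x" if "E' x y" for x y by (rule sym'[OF that])
      show "\<not> E' x x" for x by (rule irr')
      show "subcubic_on W E'" "oriented W E' R" by (rule that)+
      show "card W < card V" using psubset_card_mono[OF fin2 that(1)] cV2 by simp
    qed
    have or: "oriented V2 E' {}" by (simp add: oriented_def)
    have "\<exists>D. good V2 E' {} D \<and> (\<exists>x\<in>V2. \<exists>y\<in>V2. \<exists>s s'. x \<noteq> y \<and> E' (v n) x \<and> E' (v n) y \<and>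
        ht s (D (v n)) = ht s (D x) \<and> ht s' (D (v n)) = ht s' (D y) \<and> \<bar>sn (s' - s)\<bar> = 1)"
      by (rule path_step[OF sym' fin2 d23 irr' conn path n e0 en inner or _ IH2]) simp_all
    then obtain DB x y s0 s1 where DB: "good V2 E' {} DB" and xy: "x \<noteq> y" "E' p x" "E' p y"
      and h: "ht s0 (DB p) = ht s0 (DB x)" "ht s1 (DB p) = ht s1 (DB y)" and s01: "\<bar>sn (s1 - s0)\<bar> = 1"
      unfolding ends by (elim exE conjE bexE) (rule that)
    obtain s s' where hs: "ht s (DB p) = ht s (DB p')" "ht s' (DB p) = ht s' (DB q')" and ss: "\<bar>sn (s' - s)\<bar> = 1"
    proof (cases "x = p'")
      case True
      have "y = p' \<or> y = q'" using xy(3) unfolding E'p .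
      then have "y = q'" using xy(1) True by auto
      then show ?thesis using that[of s0 s1] h s01 True by simp
    next
      case False
      have "x = p' \<or> x = q'" "y = p' \<or> y = q'" using xy(2,3) unfolding E'p .
      then have "x = q'" "y = p'" using xy(1) False by auto
      moreover have "\<bar>sn (s0 - s1)\<bar> = 1" using s01 sn_minus[of "s1 - s0"] by simp
      ultimately show ?thesis using that[of s1 s0] h by simp
    qed
    have fB2: "faithful V2 E' DB" using DB by (simp add: good_def)
    have YV2: "y \<in> V2" "p \<noteq> y" if "y \<in> Y" for y using that pY by (auto simp: V2_def)
    have fB: "faithful Y E DB"
      by (rule faithful_cong[OF fB2]) (use E'Y in \<open>auto simp: V2_def\<close>)
    \<comment> \<open>In the drawing of the contracted graph, the point of p is itself a cap for the
      rest Y; the vertex p is now dropped and X takes its place.\<close>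
    have cB: "capped Y DB p' q' s s' (DB p)"
    proof (rule cappedI)
      show "ht s (DB p) = ht s (DB p')" "ht s' (DB p) = ht s' (DB q')" by (rule hs)+
      fix y k assume y: "y \<in> Y" and eq: "ht k (DB p) = ht k (DB y)"
      have ne: "DB p \<noteq> DB y" by (rule faithfulD(1)[OF fB2 pV2 YV2[OF y]])
      have "E' p y" using faithfulD(2)[OF fB2 pV2 YV2[OF y]] eq by blast
      then have "y = p' \<or> y = q'" unfolding E'p .
      then consider "y = p'" | "y = q'" by blast
      then show "y = p' \<and> 5 dvd (k - s) \<or> y = q' \<and> 5 dvd (k - s')"
      proof cases
        case 1 then show ?thesis using ht_inj[of k s "DB p" "DB y"] eq hs ne by blast
      next
        case 2 then show ?thesis using ht_inj[of k s' "DB p" "DB y"] eq hs ne by blast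
      qed
    next
      fix x y assume x: "x \<in> Y" and y: "y \<in> Y" and "x \<noteq> y"
      then show "cr (DB x - DB p) (DB y - DB p) \<noteq> 0"
        using faithfulD(3)[OF fB2 pV2 YV2[OF x] YV2[OF y]] by blast
    qed
    obtain DA wA where DA: "faithful X E DA" "capped X DA p q s s' wA"
      using match_slopes[OF D0(1,3,2) ss] by blast
    have nds: "\<not> 5 dvd (s - s')"
    proof
      assume "5 dvd (s - s')"
      then have "5 dvd (s' - s)" by presburger
      then have "sn (s' - s) = 0" by (simp add: sn_eq_0_iff)
      then show False using ss by simp
    qed
    have "\<exists>D. faithful (X \<union> Y) E D"
      by (rule glue_caps[OF finX finY _ sym DA(1) fB DA(2) cB mem(1,2) p'Y pq ne' _ nds])
        (use edges in \<open>auto simp: Y_def\<close>)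
    moreover have "X \<union> Y = V" using XV by (auto simp: Y_def)
    ultimately show ?thesis by simp
  qed
qed

lemma orientedD:
  "oriented V E R \<Longrightarrow> p \<in> V \<Longrightarrow> q \<in> V \<Longrightarrow> deg V E p = 2 \<Longrightarrow> deg V E q = 2 \<Longrightarrow> (p, q) \<in> R \<Longrightarrow> (q, p) \<notin> R"
  unfolding oriented_def by blast

text \<open>The induction runs over all edge relations and all R, since contraction changes the
  former and each removed path the latter. If no proper set is left by at most one edge, the graph
  is connected, and apart from a single vertex all degrees are two or three.\<close>

theorem good_exists:
  fixes V :: "'a set"
  assumes "\<And>x y. E x y \<Longrightarrow> E y x" "\<And>x. \<not> E x x" "subcubic_on V E" "oriented V E R"
  shows "\<exists>D. good V E R D"
  using assms
proof (induction "card V" arbitrary: V E R rule: less_induct)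
  case less
  note sym = less.prems(1) and irr = less.prems(2) and sc = less.prems(3) and or = less.prems(4)
  have fin: "finite V" and d3: "\<And>x. x \<in> V \<Longrightarrow> deg V E x \<le> 3"
    and low: "\<And>Y. closed_in V E Y \<Longrightarrow> Y \<noteq> {} \<Longrightarrow> \<exists>x\<in>Y. deg V E x < 3"
    using sc unfolding subcubic_on_def by blast+
  have part: "\<exists>D. good W E (R \<inter> {(p, q). deg V E p < 3 \<and> deg V E q < 3}) D" if W: "W \<subset> V" for W
  proof (rule less.hyps)
    have WV: "W \<subseteq> V" using W by blast
    have le: "deg W E x \<le> deg V E x" for x unfolding deg_def by (rule card_mono) (use fin WV in auto)
    show "card W < card V" by (rule psubset_card_mono[OF fin W])
    show "E y x" if "E x y" for x y by (rule sym[OF that])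
    show "\<not> E x x" for x by (rule irr)
    show "subcubic_on W E" unfolding subcubic_on_def
    proof (intro conjI ballI allI impI)
      show "finite W" using fin WV finite_subset by blast
      show "deg W E x \<le> 3" if "x \<in> W" for x using le[of x] d3[of x] that WV by force
      fix Y assume Y: "closed_in W E Y" and ne: "Y \<noteq> {}"
      have YW: "Y \<subseteq> W" using Y by (simp add: closed_in_def)
      show "\<exists>x\<in>Y. deg W E x < 3"
      proof (cases "closed_in V E Y")
        case True
        then obtain x where "x \<in> Y" "deg V E x < 3" using low ne by blast
        then show ?thesis using le[of x] by (intro bexI[of _ x]) auto
      next
        case False
        then obtain x y where xy: "x \<in> Y" "y \<in> V" "E x y" "y \<notin> Y"
          using YW WV unfolding closed_in_def by blast
        have "y \<notin> W" using Y xy unfolding closed_in_def by blast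
        then have "deg W E x < deg V E x" using deg_less[where E=E and u=x, OF fin WV xy(2)] xy(3) by blast
        moreover have "x \<in> V" using xy(1) YW WV by blast
        then have "deg V E x \<le> 3" by (rule d3)
        ultimately show ?thesis using xy(1) by (intro bexI[of _ x]) auto
      qed
    qed
    show "oriented W E (R \<inter> {(p, q). deg V E p < 3 \<and> deg V E q < 3})" unfolding oriented_def
    proof (intro ballI impI notI)
      fix p q assume p: "p \<in> W" and q: "q \<in> W" and d: "deg W E p = 2" "deg W E q = 2"
        and pq: "(p, q) \<in> R \<inter> {(p, q). deg V E p < 3 \<and> deg V E q < 3}"
        and qp: "(q, p) \<in> R \<inter> {(p, q). deg V E p < 3 \<and> deg V E q < 3}"
      have "deg V E p = 2" "deg V E q = 2" using le[of p] le[of q] d pq by auto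
      moreover have "p \<in> V" "q \<in> V" using p q WV by blast+
      moreover have "(p, q) \<in> R" "(q, p) \<in> R" using pq qp by blast+
      ultimately show False using orientedD[OF or] by blast
    qed
  qed
  have IH: "\<exists>D. good W E' R' D" if "card W < card V" "\<And>x y. E' x y \<Longrightarrow> E' y x" "\<And>x. \<not> E' x x" "subcubic_on W E'" "oriented W E' R'"
    for W :: "'a set" and E' R'
  proof (rule less.hyps)
    show "E' y x" if "E' x y" for x y by (rule \<open>\<And>x y. E' x y \<Longrightarrow> E' y x\<close>[OF that])
    show "\<not> E' x x" for x by fact
  qed fact+
  have IHs: "\<exists>D. good W E R' D" if "W \<subset> V" "subcubic_on W E" "oriented W E R'" for W R'
  proof (rule IH)
    show "card W < card V" by (rule psubset_card_mono[OF fin that(1)])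
    show "E y x" if "E x y" for x y by (rule sym[OF that])
    show "\<not> E x x" for x by (rule irr)
  qed (rule that)+
  show ?case
  proof (cases "\<forall>A a b. A \<subseteq> V \<longrightarrow> A \<noteq> {} \<longrightarrow> A \<noteq> V \<longrightarrow> (\<exists>x\<in>A. \<exists>y\<in>V - A. E x y \<and> \<not> (x = a \<and> y = b))")
    case False
    then obtain A a b where A: "A \<subseteq> V" "A \<noteq> {}" "A \<noteq> V"
      and "\<not> (\<exists>x\<in>A. \<exists>y\<in>V - A. E x y \<and> \<not> (x = a \<and> y = b))" by auto
    then have one: "x = a \<and> y = b" if "x \<in> A" "y \<in> V - A" "E x y" for x y using that by blast
    \<comment> \<open>If a and b do not lie on the two sides of the cut, then no edge crosses it and
      any such pair will do.\<close>
    obtain a0 b0 where ab: "a0 \<in> A" "b0 \<in> V - A"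
      and cross: "\<And>x y. x \<in> A \<Longrightarrow> y \<in> V - A \<Longrightarrow> E x y \<Longrightarrow> x = a0 \<and> y = b0"
    proof (cases "a \<in> A \<and> b \<in> V - A")
      case True then show ?thesis using that one by blast
    next
      case False
      obtain a1 b1 where ab1: "a1 \<in> A" "b1 \<in> V - A" using A by blast
      show ?thesis
      proof (rule that[OF ab1])
        fix x y assume xy: "x \<in> A" "y \<in> V - A" "E x y"
        then show "x = a1 \<and> y = b1" using one[OF xy] False by blast
      qed
    qed
    have u: "A \<union> (V - A) = V" using A by blast
    have sub: "A \<subset> V" "V - A \<subset> V" using A by blast+
    obtain DA where DA: "good A E (R \<inter> {(p, q). deg V E p < 3 \<and> deg V E q < 3}) DA"
      using part[OF sub(1)] by (elim exE)
    obtain DB where DB: "good (V - A) E (R \<inter> {(p, q). deg V E p < 3 \<and> deg V E q < 3}) DB"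
      using part[OF sub(2)] by (elim exE)
    show ?thesis
    proof (rule good_glue[where A=A and B="V - A" and a=a0 and b=b0 and DA=DA and DB=DB and E=E and R=R, unfolded u])
      show "finite A" "finite (V - A)" using fin A(1) finite_subset by blast+
      show "E y x" if "E x y" for x y by (rule sym[OF that])
      show "x = a0 \<and> y = b0" if "x \<in> A" "y \<in> V - A" "E x y" for x y by (rule cross[OF that])
      show "deg V E x \<le> 3" if "x \<in> V" for x by (rule d3[OF that])
    qed (use ab DA DB in blast)+
  next
    case True
    then have tight: "\<exists>x\<in>A. \<exists>y\<in>V - A. E x y \<and> \<not> (x = a \<and> y = b)" if "A \<subseteq> V" "A \<noteq> {}" "A \<noteq> V" for A a b
      using that by blast
    have conn: "Y = {} \<or> Y = V" if Y: "closed_in V E Y" for Y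
    proof (rule ccontr)
      assume ne: "\<not> (Y = {} \<or> Y = V)"
      have YV: "Y \<subseteq> V" using Y by (simp add: closed_in_def)
      obtain x y where "x \<in> Y" "y \<in> V - Y" "E x y" using tight[OF YV, of undefined undefined] ne by blast
      then show False using Y unfolding closed_in_def by blast
    qed
    have triv: ?thesis if "V = {}"
      using that by (auto simp: good_def faithful_def separated_def indep_def nonrigid_def closed_in_def)
    show ?thesis
    proof (cases "\<exists>u. V \<subseteq> {u}")
      case True
      then consider "V = {}" | u where "V = {u}" by blast
      then show ?thesis
      proof cases
        case 1 then show ?thesis by (rule triv)
      next
        case (2 u) then show ?thesis using good_single[of E u R] irr by simp
      qed
    next
      case big: False
      have d2: "2 \<le> deg V E x" if x: "x \<in> V" for x
      proof (rule ccontr)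
        assume "\<not> 2 \<le> deg V E x"
        then have c: "card {w \<in> V. E x w} \<le> Suc 0" unfolding deg_def by simp
        have xs: "{x} \<subseteq> V" "{x} \<noteq> {}" "{x} \<noteq> V" using x big by blast+
        obtain y where y: "y \<in> V" "E x y" using tight[OF xs, of undefined undefined] by blast
        obtain y' where y': "y' \<in> V" "E x y'" "y' \<noteq> y" using tight[OF xs, of x y] by blast
        have "finite {w \<in> V. E x w}" using fin by simp
        then show False using c y y' by (auto simp: card_le_Suc0_iff_eq)
      qed
      define S where "S = {x \<in> V. deg V E x < 3}"
      have S2: "x \<in> V" "deg V E x = 2" if "x \<in> S" for x using that d2[of x] by (auto simp: S_def)
      have S3: "deg V E x = 3" if "x \<in> V" "x \<notin> S" for x using that d3[of x] by (auto simp: S_def)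
      have "closed_in V E V" by (simp add: closed_in_def)
      then obtain z where z: "z \<in> S" using low[of V] big unfolding S_def by blast
      show ?thesis
      proof (cases "\<exists>z'\<in>S. z' \<noteq> z")
        case True
        then obtain z' where z': "z' \<in> S" "z \<noteq> z'" by blast
        obtain n v0 where path0: "ipath V E n v0" and n: "n \<noteq> 0" and ends0: "v0 0 \<in> S" "v0 n \<in> S" "v0 0 \<noteq> v0 n"
          and inn0: "\<And>k. 0 < k \<Longrightarrow> k < n \<Longrightarrow> v0 k \<notin> S"
          by (rule shortest_path[where V=V and E=E and S=S, OF sym irr conn S2(1)[OF z] S2(1)[OF z'(1)] z'(2) z z'(1)]) blast+
        obtain v where path: "ipath V E n v" and ends: "v 0 \<in> S" "v n \<in> S" and vR: "(v 0, v n) \<notin> R"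
          and inn: "\<And>k. 0 < k \<Longrightarrow> k < n \<Longrightarrow> v k \<notin> S"
        proof (cases "(v0 0, v0 n) \<in> R")
          case False then show ?thesis using that[OF path0 ends0(1,2) _ inn0] by blast
        next
          case True
          have "(v0 n, v0 0) \<notin> R" 
            by (rule orientedD[OF or S2(1)[OF ends0(1)] S2(1)[OF ends0(2)] S2(2)[OF ends0(1)] S2(2)[OF ends0(2)] True])
          show ?thesis
          proof (rule that[OF ipath_rev[OF path0 sym]])
            show "v0 (n - k) \<notin> S" if "0 < k" "k < n" for k by (rule inn0) (use that in simp_all)
          qed (use ends0 \<open>(v0 n, v0 0) \<notin> R\<close> in simp_all)
        qed
        have "v k \<in> V" if "k \<le> n" for k using path that unfolding ipath_def by blast
        then have inner: "deg V E (v k) = 3" if "0 < k" "k < n" for k using S3 inn[OF that] that by simp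
        have "\<exists>D. good V E R D \<and> (\<exists>x\<in>V. \<exists>y\<in>V. \<exists>s s'. x \<noteq> y \<and> E (v n) x \<and> E (v n) y \<and>
            ht s (D (v n)) = ht s (D x) \<and> ht s' (D (v n)) = ht s' (D y) \<and> \<bar>sn (s' - s)\<bar> = 1)"
          by (rule path_step[OF sym fin d3 irr conn path n S2(2)[OF ends(1)] S2(2)[OF ends(2)] inner or vR IHs])
        then show ?thesis by (elim exE conjE) (rule exI)
      next
        case False
        have rest: "deg V E x = 3" if "x \<in> V" "x \<noteq> z" for x using S3 False that by blast
        \<comment> \<open>With a single deficient vertex z faithfulness implies the rest: there is
          no pair for \<open>separated\<close>, V itself has defect at most one, and the only slot
          is the one at z, which fills V completely when it is used.\<close>
        have "\<exists>D. faithful V E D"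
        proof (rule single_deficient[where E=E and z=z])
          show "E y x" if "E x y" for x y by (rule sym[OF that])
          show "\<not> E x x" for x by (rule irr)
          show "z \<in> V" "deg V E z = 2" by (rule S2[OF z])+
          show "deg V E x = 3" if "x \<in> V" "x \<noteq> z" for x by (rule rest[OF that])
          show "\<exists>x\<in>A. \<exists>y\<in>V - A. E x y \<and> \<not> (x = a \<and> y = b)" if "A \<subseteq> V" "A \<noteq> {}" "A \<noteq> V" for A a b
            by (rule tight[OF that])
          show "\<exists>D. good W E' R' D" if "card W < card V" "\<And>x y. E' x y \<Longrightarrow> E' y x" "\<And>x. \<not> E' x x"
            "subcubic_on W E'" "oriented W E' R'" for W :: "'a set" and E' R'
            using that by (rule IH)
        qed (rule fin)
        then obtain D where D: "faithful V E D" by (elim exE)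
        have "separated V E R D" unfolding separated_def using rest by (metis less_irrefl)
        moreover have "nonrigid V E D" unfolding nonrigid_def
        proof (intro ballI impI)
          fix p q assume "p \<in> V" "q \<in> V"
          have "defect E V \<le> (\<Sum>x\<in>V. if x = z then 1 else 0)" unfolding defect_def
            by (rule sum_mono) (use rest S2[OF z] in auto)
          also have "\<dots> \<le> 2" using fin by simp
          finally show "\<exists>X\<subseteq>V. p \<in> X \<and> q \<in> X \<and> defect E X \<le> 2" using \<open>p \<in> V\<close> \<open>q \<in> V\<close> by blast
        qed
        moreover have "indep V E D" unfolding indep_def
        proof (intro allI impI)
          fix \<kappa> assume "slots V E D \<kappa>"
          then have sl: "card (supp \<kappa> x) + deg V E x \<le> 3" if "x \<in> V" for x using that unfolding slots_def by blast
          have e: "supp \<kappa> x = {}" if "x \<in> V" "x \<noteq> z" for x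
          proof -
            have "card (supp \<kappa> x) = 0" using sl[OF that(1)] rest[OF that] by simp
            then show ?thesis using finite_supp[of \<kappa> x] by simp
          qed
          show "\<exists>Y. closed_in V E Y \<and> (\<forall>x\<in>Y. card (supp \<kappa> x) + deg V E x = 3) \<and> (\<forall>x\<in>V - Y. supp \<kappa> x = {})"
          proof (cases "supp \<kappa> z = {}")
            case True
            then have "\<forall>x\<in>V - {}. supp \<kappa> x = {}" using e by blast
            then show ?thesis by (intro exI[of _ "{}"]) (simp add: closed_in_def)
          next
            case False
            then have "card (supp \<kappa> z) \<noteq> 0" using finite_supp[of \<kappa> z] by simp
            then have "card (supp \<kappa> z) + deg V E z = 3" using sl[OF S2(1)[OF z]] S2(2)[OF z] by linarith
            then have "\<forall>x\<in>V. card (supp \<kappa> x) + deg V E x = 3" using e rest by (metis add_0 card.empty)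
            then show ?thesis by (intro exI[of _ V]) (simp add: closed_in_def)
          qed
        qed
        ultimately have "good V E R D" using D by (simp add: good_def)
        then show ?thesis by blast
      qed
    qed
  qed
qed

section \<open>Slopes of lines\<close>

lemma parallel_iff:
  assumes "p \<noteq> q"
  shows "affine_parallel ((\<lambda>z. cis t * z) ` \<real>) (affine hull {p, q}) \<longleftrightarrow> (\<exists>r. q - p = of_real r * cis t)"
proof
  assume "affine_parallel ((\<lambda>z. cis t * z) ` \<real>) (affine hull {p, q})"
  then obtain a where a: "affine hull {p, q} = (\<lambda>x. a + x) ` (\<lambda>z. cis t * z) ` \<real>"
    unfolding affine_parallel_def by blast
  have "p \<in> affine hull {p, q}" "q \<in> affine hull {p, q}" by (simp_all add: hull_inc)
  then obtain r r' where "p = a + cis t * of_real r" "q = a + cis t * of_real r'"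
    unfolding a by (auto elim!: Reals_cases)
  then have "q - p = of_real (r' - r) * cis t" by (simp add: algebra_simps)
  then show "\<exists>r. q - p = of_real r * cis t" by blast
next
  assume "\<exists>r. q - p = of_real r * cis t"
  then obtain r where r: "q - p = of_real r * cis t" by blast
  then have r0: "r \<noteq> 0" using assms by auto
  have q: "q = p + of_real r * cis t" using r by (simp add: algebra_simps)
  have "affine hull {p, q} = (\<lambda>x. p + x) ` (\<lambda>z. cis t * z) ` \<real>"
  proof (intro equalityI subsetI)
    fix x assume "x \<in> affine hull {p, q}"
    then obtain u v where x: "x = u *\<^sub>R p + v *\<^sub>R q" "u + v = 1" unfolding affine_hull_2 by blast
    have "u *\<^sub>R p + v *\<^sub>R q = (u + v) *\<^sub>R p + cis t * of_real (v * r)"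
      unfolding q by (simp add: algebra_simps scaleR_conv_of_real)
    then have e: "x = p + cis t * of_real (v * r)" using x by simp
    have "cis t * of_real (v * r) \<in> (\<lambda>z. cis t * z) ` \<real>" by (rule imageI) (rule Reals_of_real)
    then show "x \<in> (\<lambda>x. p + x) ` (\<lambda>z. cis t * z) ` \<real>" unfolding e by (rule imageI)
  next
    fix x assume "x \<in> (\<lambda>x. p + x) ` (\<lambda>z. cis t * z) ` \<real>"
    then obtain w where w: "x = p + cis t * of_real w" by (auto elim!: Reals_cases)
    have "x = (1 - w / r) *\<^sub>R p + (w / r) *\<^sub>R q"
      unfolding w q using r0 by (simp add: algebra_simps scaleR_conv_of_real)
    then show "x \<in> affine hull {p, q}" unfolding affine_hull_2
      by (intro CollectI exI[of _ "1 - w / r"] exI[of _ "w / r"]) simp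
  qed
  then show "affine_parallel ((\<lambda>z. cis t * z) ` \<real>) (affine hull {p, q})" unfolding affine_parallel_def by blast
qed

text \<open>The definite description in \<open>slope\<close> is meaningful: parallel directions with
  angles in [0, \<pi>) have a difference of sine 0 and size below \<pi>. An angle exists because the
  argument can be shifted by \<pi> if it is negative and replaced by 0 if it is \<pi>.\<close>

lemma slope_eq_iff:
  assumes "p \<noteq> q"
  shows "slope (affine hull {p, q}) = t \<longleftrightarrow> t \<in> {0..<pi} \<and> (\<exists>r. q - p = of_real r * cis t)"
proof -
  define Q where "Q t \<longleftrightarrow> t \<in> {0..<pi} \<and> (\<exists>r. q - p = of_real r * cis t)" for t
  have uniq: "t = t'" if t: "Q t" and t': "Q t'" for t t'
  proof -
    obtain r r' where r: "q - p = of_real r * cis t" and r': "q - p = of_real r' * cis t'"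
      using t t' unfolding Q_def by blast
    have "r \<noteq> 0" using r assms by auto
    have "of_real r * cis t * cis (- t') = of_real r' * cis t' * cis (- t')" using r r' by simp
    then have "of_real r * cis (t - t') = (of_real r' :: complex)" by (simp add: mult.assoc cis_mult)
    then have "Im (of_real r * cis (t - t')) = 0" by simp
    then have "sin (t - t') = 0" using \<open>r \<noteq> 0\<close> by simp
    moreover have "- pi < t - t'" "t - t' < pi" using t t' unfolding Q_def by auto
    ultimately have "t - t' = 0" using sin_eq_0_pi by blast
    then show ?thesis by simp
  qed
  define a where "a = Arg (q - p)"
  define m where "m = norm (q - p)"
  have qp: "q - p = of_real m * cis a" 
    using assms by (simp add: m_def a_def cis_Arg sgn_eq)
  have "\<exists>t. Q t"
  proof -
    have a: "- pi < a" "a \<le> pi" unfolding a_def using Arg_bounded by auto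
    consider "0 \<le> a" "a < pi" | "a < 0" | "a = pi" using a by linarith
    then show ?thesis
    proof cases
      case 1 then show ?thesis using qp unfolding Q_def by auto
    next
      case 2
      have e: "q - p = of_real (- m) * cis (a + pi)" unfolding qp by (simp add: cis_mult[symmetric])
      have "a + pi \<in> {0..<pi}" using a 2 by simp
      then have "Q (a + pi)" unfolding Q_def by (rule conjI[OF _ exI[of _ "- m"]]) (rule e)
      then show ?thesis by (rule exI)
    next
      case 3
      have e: "q - p = of_real (- m) * cis 0" unfolding qp 3 by simp
      have "0 \<in> {0..<pi}" by simp
      then have "Q 0" unfolding Q_def by (rule conjI[OF _ exI[of _ "- m"]]) (rule e)
      then show ?thesis by (rule exI)
    qed
  qed
  then obtain t0 where t0: "Q t0" by blast
  have "slope (affine hull {p, q}) = (THE t. Q t)"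
    unfolding slope_def Q_def parallel_iff[OF assms] ..
  also have "\<dots> = t0"
  proof (rule the_equality)
    show "Q t0" by (rule t0)
    show "t = t0" if "Q t" for t by (rule uniq[OF that t0])
  qed
  finally have s: "slope (affine hull {p, q}) = t0" .
  show ?thesis
  proof
    assume "slope (affine hull {p, q}) = t"
    then have "t = t0" using s by simp
    then show "t \<in> {0..<pi} \<and> (\<exists>r. q - p = of_real r * cis t)" using t0 unfolding Q_def by simp
  next
    assume "t \<in> {0..<pi} \<and> (\<exists>r. q - p = of_real r * cis t)"
    then have "Q t" unfolding Q_def .
    from uniq[OF t0 this] show "slope (affine hull {p, q}) = t" using s by simp
  qed
qed

text \<open>The bridge from heights to slopes: an arbitrary integer index is reduced mod 5, and
  height 0 of the difference means being a real multiple of the basic direction.\<close>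

lemma basic_slope_iff:
  assumes "p \<noteq> q"
  shows "slope (affine hull {p, q}) \<in> {real i * pi / 5 | i. i \<le> 4} \<longleftrightarrow> (\<exists>s. ht s p = ht s q)"
proof -
  have dir: "(\<exists>r. z = of_real r * cis (real i * pi / 5)) \<longleftrightarrow> ht (int i) z = 0" for z i
  proof
    assume "\<exists>r. z = of_real r * cis (real i * pi / 5)"
    then obtain r where "z = of_real r * dir (int i)" by (auto simp: dir_def)
    then show "ht (int i) z = 0" by (simp only: ht_scale ht_dir) (simp add: sn_0)
  next
    assume 0: "ht (int i) z = 0"
    have "z = of_real (- ht (int i + 1) z) * dir (int i)"
      by (rule ht_inj[of "int i" "int i + 1"]) (use 0 in \<open>simp_all only: ht_scale ht_dir\<close>, simp_all add: sn_0 sn_minus sn_1)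
    then have "z = of_real (- ht (int i + 1) z) * cis (real i * pi / 5)"
      by (simp only: dir_def of_int_of_nat_eq)
    then show "\<exists>r. z = of_real r * cis (real i * pi / 5)" by (rule exI)
  qed
  show ?thesis
  proof
    assume "slope (affine hull {p, q}) \<in> {real i * pi / 5 | i. i \<le> 4}"
    then obtain i where "slope (affine hull {p, q}) = real i * pi / 5" by blast
    then have "ht (int i) (q - p) = 0" unfolding slope_eq_iff[OF assms] dir by blast
    then have "ht (int i) p = ht (int i) q" by (simp add: ht_diff)
    then show "\<exists>s. ht s p = ht s q" by blast
  next
    assume "\<exists>s. ht s p = ht s q"
    then obtain s where s: "ht s p = ht s q" by blast
    define i where "i = nat (s mod 5)"
    have i: "int i = s mod 5" by (simp add: i_def)
    have i4: "i \<le> 4" using i pos_mod_bound[of 5 s] by linarith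
    have "5 dvd (s - int i)" unfolding i by presburger
    then have "ht (int i) p = ht (int i) q" using ht_cong_eq[of s "int i" p q] s by blast
    then have "\<exists>r. q - p = of_real r * cis (real i * pi / 5)" unfolding dir by (simp add: ht_diff)
    moreover have "real i * pi / 5 \<in> {0..<pi}"
    proof -
      have "real i * pi \<le> 4 * pi" using i4 by (intro mult_right_mono) auto
      moreover have "4 * pi / 5 < pi" by simp
      ultimately show ?thesis by simp
    qed
    ultimately have "slope (affine hull {p, q}) = real i * pi / 5" using slope_eq_iff[OF assms] by blast
    then show "slope (affine hull {p, q}) \<in> {real i * pi / 5 | i. i \<le> 4}" using i4 by blast
  qed
qed

lemma not_collinear:
  assumes "cr (q - p) (r - p) \<noteq> 0"
  shows "\<not> collinear {p, q, r}"
proof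
  assume "collinear {p, q, r}"
  then obtain u where u: "\<forall>x\<in>{p, q, r}. \<forall>y\<in>{p, q, r}. \<exists>c. x - y = c *\<^sub>R u" unfolding collinear_def by blast
  obtain c d where "q - p = of_real c * u" "r - p = of_real d * u"
    using bspec[OF bspec[OF u, of q], of p] bspec[OF bspec[OF u, of r], of p] by (auto simp: scaleR_conv_of_real)
  then have "cr (q - p) (r - p) = 0" by (simp only: cr_linear)
  then show False using assms by simp
qed

text \<open>Arcs are pairs of vertices, so an arc leaving v is determined by its head.\<close>

lemma deg_out_degree:
  assumes "pair_wf_digraph G"
  shows "deg (pverts G) (\<lambda>x y. (x, y) \<in> parcs G) v = out_degree (with_proj G) v"
proof -
  have "out_arcs (with_proj G) v = Pair v ` {w \<in> pverts G. (v, w) \<in> parcs G}"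
    using pair_wf_digraph.in_arcsD2[OF assms] by (auto simp: out_arcs_def)
  moreover have "card (Pair v ` {w \<in> pverts G. (v, w) \<in> parcs G}) = card {w \<in> pverts G. (v, w) \<in> parcs G}"
    by (rule card_image) (simp add: inj_on_def)
  ultimately show ?thesis by (simp add: deg_def out_degree_def)
qed

text \<open>A closed set contains everything reachable from its elements, hence the strong component
  of each of them, and with it a deficient vertex.\<close>

lemma subcubic_imp_subcubic_on:
  assumes "subcubic G"
  shows "subcubic_on (pverts G) (\<lambda>x y. (x, y) \<in> parcs G)"
proof -
  have pg: "pair_graph G" and d: "\<And>v. v \<in> pverts G \<Longrightarrow> out_degree (with_proj G) v \<le> 3"
    and scc: "\<And>C. C \<in> pre_digraph.sccs (with_proj G) \<Longrightarrow> \<exists>v\<in>verts C. out_degree (with_proj G) v < 3"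
    using assms by (auto simp: subcubic_def cubic_def)
  interpret P: pair_graph G by (rule pg)
  have wf: "pair_wf_digraph G" by unfold_locales
  show ?thesis unfolding subcubic_on_def
  proof (intro conjI ballI allI impI)
    show "finite (pverts G)" by (rule P.pair_finite_verts)
    show "deg (pverts G) (\<lambda>x y. (x, y) \<in> parcs G) x \<le> 3" if "x \<in> pverts G" for x
      unfolding deg_out_degree[OF wf] by (rule d[OF that])
    fix Y assume Y: "closed_in (pverts G) (\<lambda>x y. (x, y) \<in> parcs G) Y" and "Y \<noteq> {}"
    then obtain y where y: "y \<in> Y" by blast
    then have yV: "y \<in> pverts G" using Y unfolding closed_in_def by blast
    have "P.scc_of y \<in> P.sccs_verts" by (rule P.scc_of_in_sccs_verts[OF yV])
    then obtain C where C: "C \<in> pre_digraph.sccs (with_proj G)" "verts C = P.scc_of y"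
      unfolding P.sccs_verts_conv by auto
    then obtain v where v: "v \<in> P.scc_of y" "out_degree (with_proj G) v < 3" using scc by metis
    have "y \<rightarrow>\<^sup>*\<^bsub>with_proj G\<^esub> v" using v(1) by (simp add: P.scc_of_def)
    then have "v \<in> Y"
    proof (induction rule: P.reachable_induct)
      case base show ?case by (rule y)
    next
      case (step x z)
      then have xz: "(x, z) \<in> parcs G" by simp
      show ?case by (rule closed_inD[OF Y step.IH pair_wf_digraph.in_arcsD2[OF wf xz] xz])
    qed
    then show "\<exists>x\<in>Y. deg (pverts G) (\<lambda>x y. (x, y) \<in> parcs G) x < 3"
      using v(2) deg_out_degree[OF wf] by auto
  qed
qed

lemma faithful_iso:
  assumes wf: "pair_wf_digraph G" and loop: "\<And>x. (x, x) \<notin> parcs G"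
    and f: "faithful (pverts G) (\<lambda>x y. (x, y) \<in> parcs G) D"
  shows "digraph_iso (with_proj G) (with_proj (slope_graph (D ` pverts G) {real i * pi / 5 | i. i \<le> 4}))"
proof -
  have inj: "inj_on D (pverts G)" by (rule inj_onI) (use faithfulD(1)[OF f] in blast)
  have arc: "x \<in> pverts G" "y \<in> pverts G" if "(x, y) \<in> parcs G" for x y
    using pair_wf_digraph.in_arcsD1[OF wf that] pair_wf_digraph.in_arcsD2[OF wf that] .
  define h where "h = \<lparr>iso_verts = D, iso_arcs = map_prod D D, iso_head = snd, iso_tail = fst\<rparr>"
  have "pre_digraph.digraph_isomorphism (with_proj G) h"
    unfolding pre_digraph.digraph_isomorphism_def
  proof (intro conjI)
    show "wf_digraph (with_proj G)" using wf by (simp add: wf_digraph_wp_iff)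
    show "inj_on (iso_verts h) (verts (with_proj G))" using inj by (simp add: h_def)
    have "inj_on (map_prod D D) (pverts G \<times> pverts G)" by (rule map_prod_inj_on[OF inj inj])
    moreover have "parcs G \<subseteq> pverts G \<times> pverts G" using arc by auto
    ultimately have "inj_on (map_prod D D) (parcs G)" by (rule inj_on_subset)
    then show "inj_on (iso_arcs h) (arcs (with_proj G))" by (simp add: h_def)
  qed (simp add: h_def)
  moreover have "with_proj (slope_graph (D ` pverts G) {real i * pi / 5 | i. i \<le> 4}) = app_iso h (with_proj G)"
  proof -
    have "parcs (slope_graph (D ` pverts G) {real i * pi / 5 | i. i \<le> 4}) = map_prod D D ` parcs G"
    proof (intro equalityI subrelI)
      fix a b assume "(a, b) \<in> parcs (slope_graph (D ` pverts G) {real i * pi / 5 | i. i \<le> 4})"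
      then obtain x y where xy: "x \<in> pverts G" "y \<in> pverts G" "a = D x" "b = D y" "D x \<noteq> D y"
        and sl: "slope (affine hull {D x, D y}) \<in> {real i * pi / 5 | i. i \<le> 4}"
        unfolding slope_graph_def by auto
      have "x \<noteq> y" using xy by blast
      then have "(x, y) \<in> parcs G" using faithfulD(2)[OF f xy(1,2)] sl unfolding basic_slope_iff[OF xy(5)] by blast
      then show "(a, b) \<in> map_prod D D ` parcs G" using xy by force
    next
      fix a b assume "(a, b) \<in> map_prod D D ` parcs G"
      then obtain x y where xy: "(x, y) \<in> parcs G" "a = D x" "b = D y" by auto
      have "x \<noteq> y" using xy(1) loop by blast
      note ne = faithfulD(1)[OF f arc[OF xy(1)] this] and E = faithfulD(2)[OF f arc[OF xy(1)] this]
      have "slope (affine hull {D x, D y}) \<in> {real i * pi / 5 | i. i \<le> 4}"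
        unfolding basic_slope_iff[OF ne] using E xy(1) by blast
      then show "(a, b) \<in> parcs (slope_graph (D ` pverts G) {real i * pi / 5 | i. i \<le> 4})"
        using ne arc[OF xy(1)] xy unfolding slope_graph_def by simp
    qed
    moreover have "pverts (slope_graph (D ` pverts G) {real i * pi / 5 | i. i \<le> 4}) = D ` pverts G"
      by (simp add: slope_graph_def)
    ultimately show ?thesis by (simp only: with_proj_def app_iso_def h_def) simp
  qed
  ultimately show ?thesis unfolding digraph_iso_def by blast
qed

theorem theorem7p2:
  fixes G :: "'a pair_pre_digraph"
  assumes "subcubic G"
  shows "slope_parameter G \<le> 5 \<and>
    (\<exists>P. no_three_collinear P \<and>
         digraph_iso G (slope_graph P {real i * pi / 5 | i. i \<le> 4}))"
proof -
  have pg: "pair_graph G" using assms by (simp add: subcubic_def cubic_def)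
  interpret P: pair_graph G by (rule pg)
  have wf: "pair_wf_digraph G" by unfold_locales
  define E where "E = (\<lambda>x y. (x, y) \<in> parcs G)"
  define S where "S = {real i * pi / 5 | i. i \<le> 4}"
  have loop: "(x, x) \<notin> parcs G" for x using P.pair_no_loops[of "(x, x)"] by auto
  \<comment> \<open>No separation is asked of the final drawing, so the induction starts with an
    empty set of ordered pairs.\<close>
  have "\<exists>D. good (pverts G) E {} D"
  proof (rule good_exists)
    show "E y x" if "E x y" for x y using P.arcs_symmetric that unfolding E_def by blast
    show "\<not> E x x" for x using loop by (simp add: E_def)
    show "subcubic_on (pverts G) E" unfolding E_def by (rule subcubic_imp_subcubic_on[OF assms])
    show "oriented (pverts G) E {}" by (simp add: oriented_def)
  qed
  then obtain D where f: "faithful (pverts G) E D" by (auto simp: good_def)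
  have iso: "digraph_iso (with_proj G) (with_proj (slope_graph (D ` pverts G) S))"
    unfolding S_def by (rule faithful_iso[OF wf loop f[unfolded E_def]])
  have "no_three_collinear (D ` pverts G)" unfolding no_three_collinear_def
  proof (intro ballI impI)
    fix p q r assume "p \<in> D ` pverts G" "q \<in> D ` pverts G" "r \<in> D ` pverts G" and d: "distinct [p, q, r]"
    then obtain x y z where xyz: "x \<in> pverts G" "y \<in> pverts G" "z \<in> pverts G" and e: "p = D x" "q = D y" "r = D z" by blast
    have "x \<noteq> y" "x \<noteq> z" "y \<noteq> z" using d e by auto
    then show "\<not> collinear {p, q, r}" unfolding e by (intro not_collinear faithfulD(3)[OF f] xyz)
  qed
  moreover have "slope_parameter G \<le> 5"
  proof -
    have S: "S = (\<lambda>i. real i * pi / 5) ` {..4}" by (auto simp: S_def)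
    have "card S \<le> 5" unfolding S using card_image_le[of "{..4::nat}"] by force
    have "real i * pi / 5 \<in> {0..<pi}" if "i \<le> 4" for i
    proof -
      have "real i * pi \<le> 4 * pi" using that by (intro mult_right_mono) auto
      moreover have "4 * pi / 5 < pi" by simp
      ultimately show ?thesis by simp
    qed
    then have "finite S" "S \<subseteq> {0..<pi}" unfolding S by auto
    then have "slope_parameter G \<le> enat (card S)"
      unfolding slope_parameter_def using iso by (intro Inf_lower) blast
    also have "\<dots> \<le> 5" using \<open>card S \<le> 5\<close> by (simp add: numeral_eq_enat)
    finally show ?thesis .
  qed
  ultimately show ?thesis using iso unfolding S_def by blast
qed

end
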